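(* Let $\mu$ be a probability Borel measure on the unit circle $\mathbb{T}$ that is symmetric with respect to complex conjugation, absolutely continuous with respect to the arclength measure, and whose Radon-Nikodym derivative $\mu'(\xi)$ with respect to arclength extends to a holomorphic non-vanishing function in some neighborhood of the unit circle. Let $\{\varphi_i\}_{i\ge 0}$ be the orthonormal polynomials with respect to $\mu$ (which have real coefficients), let $\eta_0,\eta_1,\ldots$ be i.i.d. standard real Gaussian random variables, and let $$P_n(z)=\eta_0\varphi_0(z)+\eta_1\varphi_1(z)+\cdots+\eta_n\varphi_n(z).$$ Let $\mathbb{E}_n(\mu)$ be the expected number of real zeros of $P_n$. Then there exist constants $A_p^\mu$, $p\ge 1$, depending on $\mu$ (but not on $n$ or $N$), such that for any integer $N$ and all $n$ large $$\mathbb{E}_n(\mu)=\frac{2}{\pi}\log(n+1)+A_0+\sum_{p=1}^{N-1}A_p^\mu (n+1)^{-p}+\mathcal{O}_N\left((n+1)^{-N}\right),$$ where the implied constant in $\mathcal{O}_N(\cdot)$ depends on $N$ but is independent of $n$, $$A_0=\frac{2}{\pi}\left(\log 2+\int_0^1 t^{-1}f(t)\,dt+\int_1^\infty t^{-1}(f(t)-1)\,dt\right),$$ and $f(t):=\sqrt{1-t^2\,\mathrm{csch}^2 t}$.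
   Context: Orthonormality means that $\varphi_i$ is a polynomial of degree exactly $i$ and $\int_{\mathbb{T}}\varphi_i(\xi)\overline{\varphi_j(\xi)}\,d\mu(\xi)=\delta_{ij}$; by the conjugate symmetry of $\mu$ the polynomials are taken with real coefficients. Here $\mathrm{csch}\,t=1/\sinh t$. Empty sums are zero. *)

theory Defs
  imports "HOL-Probability.Probability" "HOL-Complex_Analysis.Complex_Analysis"
begin

definition borel_circle :: "complex measure" where
  "borel_circle = restrict_space borel (sphere 0 1)"

(* Arclength is not normalized: the total mass is 2 * pi. *)
definition arclength :: "complex measure" where
  "arclength = distr (restrict_space lborel {0..<2 * pi}) borel_circle cis"

definition conj_symmetric :: "complex measure \<Rightarrow> bool" where
  "conj_symmetric \<mu> \<longleftrightarrow> distr \<mu> \<mu> cnj = \<mu>"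

(* The Radon-Nikodym derivative is determined only up to null sets, so an extension
   has to agree with it almost everywhere on the circle. *)
definition has_nonvanishing_holomorphic_density :: "complex measure \<Rightarrow> bool" where
  "has_nonvanishing_holomorphic_density \<mu> \<longleftrightarrow>
     (\<exists>U w. open U \<and> sphere 0 1 \<subseteq> U \<and> w holomorphic_on U \<and> (\<forall>z\<in>U. w z \<noteq> 0) \<and>
        (AE \<xi> in arclength. w \<xi> = complex_of_real (enn2real (RN_deriv arclength \<mu> \<xi>))))"

(* No sign is imposed on the leading coefficients. *)
definition orthonormal_polys :: "complex measure \<Rightarrow> (nat \<Rightarrow> real poly) \<Rightarrow> bool" where
  "orthonormal_polys \<mu> \<phi> \<longleftrightarrow>
     (\<forall>i. degree (\<phi> i) = i) \<and>
     (\<forall>i j. (\<integral>\<xi>. poly (map_poly complex_of_real (\<phi> i)) \<xi> *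
                  cnj (poly (map_poly complex_of_real (\<phi> j)) \<xi>) \<partial>\<mu>) = (if i = j then 1 else 0))"

definition iid_std_normal :: "'a measure \<Rightarrow> (nat \<Rightarrow> 'a \<Rightarrow> real) \<Rightarrow> bool" where
  "iid_std_normal M \<eta> \<longleftrightarrow>
     prob_space M \<and>
     prob_space.indep_vars M (\<lambda>_. borel) \<eta> UNIV \<and>
     (\<forall>i. distributed M lborel (\<eta> i) (\<lambda>x. ennreal (std_normal_density x)))"

definition random_poly :: "(nat \<Rightarrow> real poly) \<Rightarrow> (nat \<Rightarrow> 'a \<Rightarrow> real) \<Rightarrow> nat \<Rightarrow> 'a \<Rightarrow> real poly" where
  "random_poly \<phi> \<eta> n \<omega> = (\<Sum>i\<le>n. smult (\<eta> i \<omega>) (\<phi> i))"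

(* Zeros are counted without multiplicity. If the random polynomial is zero, which happens
   with probability 0, the set of zeros is infinite and card returns 0. *)
definition expected_real_zeros ::
    "'a measure \<Rightarrow> (nat \<Rightarrow> real poly) \<Rightarrow> (nat \<Rightarrow> 'a \<Rightarrow> real) \<Rightarrow> nat \<Rightarrow> real" where
  "expected_real_zeros M \<phi> \<eta> n =
     (\<integral>\<omega>. real (card {x::real. poly (random_poly \<phi> \<eta> n \<omega>) x = 0}) \<partial>M)"

definition csch :: "real \<Rightarrow> real" where
  "csch t = 1 / sinh t"

definition kac_f :: "real \<Rightarrow> real" where
  "kac_f t = sqrt (1 - t\<^sup>2 * (csch t)\<^sup>2)"

definition kac_A0 :: real where
  "kac_A0 = 2 / pi * (ln 2 + (LBINT t:{0..1}. kac_f t / t) + (LBINT t:{1..}. (kac_f t - 1) / t))"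

end

theory Submission
  imports Defs
begin

text \<open>
  Write \<open>m = n + 1\<close>, let \<open>Q = \<phi> m\<close> and let \<open>P\<close> be the reversed polynomial of \<open>Q\<close>. The proof turns the
  expectation into an integral that depends on \<open>\<mu>\<close> only through the quotient \<open>Q / P\<close>, and then
  uses that this quotient is, up to an exponentially small error, an explicit function of \<open>m\<close>.

  \<^emph>\<open>Exact formula.\<close> The Kac-Rice formula (\<open>kac_rice\<close>) expresses the expectation through the sums
  \<open>K, K\<^sub>1, K\<^sub>2\<close> of \<open>(\<phi> i)\<^sup>2\<close>, \<open>\<phi> i \<cdot> (\<phi> i)'\<close> and \<open>((\<phi> i)')\<^sup>2\<close>. By Christoffel and Darboux these sums are
  functions of \<open>P\<close>, \<open>Q\<close> and their derivatives alone. The quotient \<open>Q / P\<close> is a finite Blaschke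
  product; after the substitution \<open>x = \<plusminus> exp (- s)\<close> the density of the real zeros becomes
  \<open>sqrt (csch\<^sup>2 s - v\<^sup>2) / pi\<close> on \<open>s > 0\<close> (\<open>expected_real_zeros_hyperbolic\<close>), where \<open>csch s\<close> and \<open>v\<close> are
  the hyperbolic speeds of \<open>x\<close> and of \<open>(Q / P) x\<close>: the density measures how far the Blaschke product
  is from being a hyperbolic isometry. The zeros outside \<open>[-1, 1]\<close> are accounted for by the
  symmetry \<open>x \<mapsto> 1 / x\<close>.

  \<^emph>\<open>Asymptotics of the orthonormal polynomials.\<close> The density of \<open>\<mu>\<close> factors on the circle as
  \<open>D z * D (1 / z)\<close> with \<open>D\<close> holomorphic and zero-free in a disc of radius larger than 1. A multiple of
  \<open>P\<close> differs from \<open>T = 1 / D\<close> by \<open>O (q ^ m)\<close> with \<open>q < 1\<close>, on a disc that still contains the closed unit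
  disc (\<open>szego_asymptotics\<close>). Away from the endpoints \<open>x = \<plusminus> 1\<close> the speed \<open>v\<close> is therefore exponentially small.
  Near an endpoint, \<open>v = (m - g' s) / sinh (m s - g s)\<close> up to sign, where \<open>g\<close> is holomorphic and odd and is
  within \<open>O (q ^ m)\<close> of a function that depends on \<open>\<mu>\<close> only.

  \<^emph>\<open>Expansion.\<close> Put \<open>\<epsilon> = 1 / m\<close> and \<open>s = \<epsilon> t\<close>. After subtraction of \<open>csch s\<close> for \<open>s > \<epsilon>\<close> the integrand is
  holomorphic in \<open>\<epsilon>\<close> and decays like \<open>exp (- t)\<close>, on discs in \<open>\<epsilon>\<close> whose radius shrinks only like
  \<open>1 / (1 + t)\<close> (\<open>rescaled_integrand_bound\<close>); expanding under the integral sign gives an asymptotic expansion in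
  powers of \<open>\<epsilon>\<close> to every order (\<open>integral_asymptotic_expansion\<close>). At \<open>\<epsilon> = 0\<close> the integrand is
  \<open>(kac_f t - 1) / t\<close> for \<open>t > 1\<close> and \<open>kac_f t / t\<close> for \<open>t < 1\<close>, which yields the integrals in the constant term. The
  subtracted part integrates to \<open>- ln (tanh (\<epsilon> / 2))\<close>, which is \<open>ln m + ln 2\<close> plus a convergent power
  series in \<open>\<epsilon>\<close>. Each of the two endpoints contributes once, whence the factor \<open>2 / pi\<close>.
\<close>

section \<open>Change of variables and the area formula for polynomials\<close>

text \<open>
  A bridge between the extended nonnegative integral and the gauge integral, for which the change of
  variables theorem is stated. The value \<open>\<infinity>\<close> in the second case makes the bridge usable
  before integrability is known.
\<close>

lemma nn_integral_lborel_eq_integral_on: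
  fixes u :: "real \<Rightarrow> real"
  assumes S: "S \<in> sets borel" and u: "u \<in> borel_measurable borel" and nn: "\<And>x. x \<in> S \<Longrightarrow> 0 \<le> u x"
  shows "(\<integral>\<^sup>+x. ennreal (u x) * indicator S x \<partial>lborel) =
         (if u absolutely_integrable_on S then ennreal (integral S u) else \<infinity>)"
proof -
  have meas: "(\<lambda>x. indicator S x * u x) \<in> borel_measurable borel"
    using S u by measurable
  have eq: "(\<integral>\<^sup>+x. ennreal (u x) * indicator S x \<partial>lborel) = (\<integral>\<^sup>+x. ennreal (indicator S x * u x) \<partial>lborel)"
    by (intro nn_integral_cong) (auto simp: indicator_def)
  have ai: "u absolutely_integrable_on S \<longleftrightarrow> integrable lborel (\<lambda>x. indicator S x * u x)"
    unfolding set_integrable_def using integrable_completion[of "\<lambda>x. indicator S x * u x" lborel] meas by simp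
  show ?thesis
  proof (cases "u absolutely_integrable_on S")
    case True
    have "(\<integral>\<^sup>+x. ennreal (indicator S x * u x) \<partial>lborel) = ennreal (\<integral>x. indicator S x * u x \<partial>lborel)"
      using True ai nn by (intro nn_integral_eq_integral) (auto simp: indicator_def)
    also have "(\<integral>x. indicator S x * u x \<partial>lborel) = (\<integral>x. indicator S x * u x \<partial>lebesgue)"
      using integral_completion[of "\<lambda>x. indicator S x * u x" lborel] meas by simp
    also have "\<dots> = integral S u"
      using set_lebesgue_integral_eq_integral(2)[OF True] by (simp add: set_lebesgue_integral_def)
    finally show ?thesis using eq True by simp
  next
    case False
    have "\<not> (\<integral>\<^sup>+x. ennreal (indicator S x * u x) \<partial>lborel) < \<infinity>"
    proof
      assume "(\<integral>\<^sup>+x. ennreal (indicator S x * u x) \<partial>lborel) < \<infinity>"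
      then have "integrable lborel (\<lambda>x. indicator S x * u x)"
        using meas nn by (intro integrableI_nonneg) (auto simp: indicator_def)
      with ai False show False by simp
    qed
    then have "(\<integral>\<^sup>+x. ennreal (indicator S x * u x) \<partial>lborel) = \<infinity>"
      by (metis infinity_ennreal_def less_top)
    then show ?thesis using eq False by simp
  qed
qed

lemma nn_integral_change_of_variables_real:
  fixes f g h :: "real \<Rightarrow> real"
  assumes S: "S \<in> sets borel" "g ` S \<in> sets borel"
    and g: "\<And>x. x \<in> S \<Longrightarrow> (g has_field_derivative h x) (at x within S)" "inj_on g S"
    and meas: "f \<in> borel_measurable borel" "g \<in> borel_measurable borel" "h \<in> borel_measurable borel"
    and nn: "\<And>y. 0 \<le> f y"
  shows "(\<integral>\<^sup>+x. ennreal (\<bar>h x\<bar> * f (g x)) * indicator S x \<partial>lborel) =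
         (\<integral>\<^sup>+y. ennreal (f y) * indicator (g ` S) y \<partial>lborel)"
proof -
  have SL: "S \<in> sets lebesgue" using S by auto
  note cv = has_absolute_integral_change_of_variables_real[OF SL g, of f, unfolded real_scaleR_def]
  have m: "(\<lambda>x. \<bar>h x\<bar> * f (g x)) \<in> borel_measurable borel" using meas by measurable
  have iff: "(\<lambda>x. \<bar>h x\<bar> * f (g x)) absolutely_integrable_on S \<longleftrightarrow> f absolutely_integrable_on g ` S"
    using cv by blast
  have eq: "integral S (\<lambda>x. \<bar>h x\<bar> * f (g x)) = integral (g ` S) f" if "f absolutely_integrable_on g ` S"
    by (rule conjunct2[OF iffD2[OF cv conjI[OF that refl]]])
  show ?thesis
  proof (cases "f absolutely_integrable_on g ` S")
    case True
    with iff have "(\<lambda>x. \<bar>h x\<bar> * f (g x)) absolutely_integrable_on S" by blast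
    then show ?thesis
      unfolding nn_integral_lborel_eq_integral_on[OF S(2) meas(1) nn]
        nn_integral_lborel_eq_integral_on[OF S(1) m mult_nonneg_nonneg[OF abs_ge_zero nn]]
      using True eq[OF True] by (simp only: if_True simp_thms)
  next
    case False
    with iff have "\<not> (\<lambda>x. \<bar>h x\<bar> * f (g x)) absolutely_integrable_on S" by blast
    then show ?thesis
      unfolding nn_integral_lborel_eq_integral_on[OF S(2) meas(1) nn]
        nn_integral_lborel_eq_integral_on[OF S(1) m mult_nonneg_nonneg[OF abs_ge_zero nn]]
      using False by (simp only: if_False simp_thms)
  qed
qed

lemma is_interval_borel_real: "is_interval (S::real set) \<Longrightarrow> S \<in> sets borel"
  by (simp add: is_interval_convex_1 real_interval_borel_measurable is_interval_connected_1)

text \<open>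
  The critical points cut the line into finitely many intervals on which \<open>G\<close> is injective. On each of
  them the substitution \<open>u = G t\<close> applies, and summing over the intervals counts how often a value \<open>u\<close> is attained.
  For constant \<open>G\<close> the only fibre that is not empty is infinite and has \<open>card\<close> 0, in agreement with the
  vanishing right-hand side.
\<close>

lemma poly_area_formula:
  fixes G :: "real poly" and w :: "real \<Rightarrow> real"
  assumes w: "w \<in> borel_measurable borel" "\<And>u. 0 \<le> w u"
  shows "(\<integral>\<^sup>+u. of_nat (card {t. poly G t = u}) * ennreal (w u) \<partial>lborel) =
         (\<integral>\<^sup>+t. ennreal (\<bar>poly (pderiv G) t\<bar> * w (poly G t)) \<partial>lborel)"
proof (cases "pderiv G = 0")
  case True
  then obtain c where c: "G = [:c:]"
    using degree_eq_zeroE[of G] pderiv_eq_0_iff[of G] by auto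
  have "card {t. poly G t = u} = 0" for u
  proof (cases "c = u")
    case True
    then have "{t. poly G t = u} = (UNIV::real set)" by (auto simp: c)
    then show ?thesis by (simp add: infinite_UNIV_char_0)
  qed (auto simp: c)
  then show ?thesis using True by simp
next
  case False
  define Cr where "Cr = {t. poly (pderiv G) t = 0}"
  have fin: "finite Cr" unfolding Cr_def using False by (rule poly_roots_finite)
  \<comment> \<open>The number of critical points to the left of \<open>t\<close> labels the monotonicity interval that contains
    \<open>t\<close>.\<close>
  define r where "r t = card {c\<in>Cr. c < t}" for t
  define S where "S k = {t. t \<notin> Cr \<and> r t = k}" for k
  let ?n = "card Cr"
  have r_le: "r t \<le> ?n" for t unfolding r_def by (rule card_mono) (use fin in auto)
  have r_mono: "r s \<le> r t" if "s \<le> t" for s t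
    unfolding r_def by (rule card_mono) (use fin that in auto)
  have crit_between: "r s < r t" if "s \<le> c" "c < t" "c \<in> Cr" for s c t
  proof -
    have "{c\<in>Cr. c < s} \<subseteq> {c\<in>Cr. c < t}" "c \<in> {c\<in>Cr. c < t}" "c \<notin> {c\<in>Cr. c < s}"
      using that by auto
    then have "{c\<in>Cr. c < s} \<subset> {c\<in>Cr. c < t}" by blast
    then show ?thesis unfolding r_def using fin by (intro psubset_card_mono) auto
  qed
  have int: "is_interval (S k)" for k
    unfolding is_interval_1
  proof (intro ballI allI impI)
    fix a b x assume ab: "a \<in> S k" "b \<in> S k" and xx: "a \<le> x \<and> x \<le> b"
    then have x: "a \<le> x" "x \<le> b" by auto
    have "r x = k" using ab r_mono[OF x(1)] r_mono[OF x(2)] by (auto simp: S_def)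
    moreover have "x \<notin> Cr"
    proof
      assume "x \<in> Cr"
      then have "x < b" using ab x by (cases "x = b") (auto simp: S_def)
      then have "r a < r b" using crit_between[OF x(1) _ \<open>x \<in> Cr\<close>] by auto
      then show False using ab by (auto simp: S_def)
    qed
    ultimately show "x \<in> S k" by (simp add: S_def)
  qed
  have Sb: "S k \<in> sets borel" for k by (rule is_interval_borel_real[OF int])
  have der: "(poly G has_field_derivative poly (pderiv G) x) (at x within A)" for x A
    by (rule has_field_derivative_at_within[OF poly_DERIV])
  have inj: "inj_on (poly G) (S k)" for k
  proof -
    have False if st: "s \<in> S k" "t \<in> S k" "s < t" "poly G s = poly G t" for s t
    proof -
      obtain z where z: "s < z" "z < t" "poly (pderiv G) z = 0"
      proof -
        from poly_MVT[OF st(3), of G] obtain z where z: "s < z" "z < t"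
          "poly G t - poly G s = (t - s) * poly (pderiv G) z" by blast
        then have "poly (pderiv G) z = 0" using st by simp
        with z that show ?thesis by blast
      qed
      then have "r s < r t" using crit_between[of s z t] by (simp add: Cr_def)
      then show False using st by (simp add: S_def)
    qed
    then show ?thesis unfolding inj_on_def by (metis linorder_neqE_linordered_idom)
  qed
  have "is_interval (poly G ` S k)" for k
    using int[of k] unfolding is_interval_connected_1
    by (intro connected_continuous_image) (auto intro: continuous_intros)
  then have Gb: "poly G ` S k \<in> sets borel" for k by (rule is_interval_borel_real)
  have piece: "(\<integral>\<^sup>+t. ennreal (\<bar>poly (pderiv G) t\<bar> * w (poly G t)) * indicator (S k) t \<partial>lborel)
     = (\<integral>\<^sup>+u. ennreal (w u) * indicator (poly G ` S k) u \<partial>lborel)" for k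
    by (rule nn_integral_change_of_variables_real[OF Sb Gb der inj w(1) _ _ w(2)])
       (auto intro!: borel_measurable_continuous_onI continuous_intros)
  have [measurable]: "poly p \<in> borel_measurable borel" for p :: "real poly"
    by (auto intro!: borel_measurable_continuous_onI continuous_intros)
  note w(1)[measurable] Sb[measurable] Gb[measurable]
  have "(\<integral>\<^sup>+t. ennreal (\<bar>poly (pderiv G) t\<bar> * w (poly G t)) \<partial>lborel)
      = (\<integral>\<^sup>+t. (\<Sum>k\<le>?n. ennreal (\<bar>poly (pderiv G) t\<bar> * w (poly G t)) * indicator (S k) t) \<partial>lborel)"
  proof (rule nn_integral_cong)
    fix t :: real
    have "(\<Sum>k\<le>?n. indicator (S k) t :: ennreal) = (if t \<in> Cr then 0 else 1)"
    proof -
      have "(\<Sum>k\<le>?n. indicator (S k) t :: ennreal) = (\<Sum>k\<le>?n. if k = r t then (if t \<in> Cr then 0 else 1) else 0)"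
        by (intro sum.cong) (auto simp: S_def)
      then show ?thesis using r_le[of t] by (simp add: sum.delta')
    qed
    then show "ennreal (\<bar>poly (pderiv G) t\<bar> * w (poly G t)) =
      (\<Sum>k\<le>?n. ennreal (\<bar>poly (pderiv G) t\<bar> * w (poly G t)) * indicator (S k) t)"
      by (auto simp flip: sum_distrib_left simp: Cr_def)
  qed
  also have "\<dots> = (\<Sum>k\<le>?n. \<integral>\<^sup>+t. ennreal (\<bar>poly (pderiv G) t\<bar> * w (poly G t)) * indicator (S k) t \<partial>lborel)"
    by (intro nn_integral_sum) measurable
  also have "\<dots> = (\<Sum>k\<le>?n. \<integral>\<^sup>+u. ennreal (w u) * indicator (poly G ` S k) u \<partial>lborel)"
    by (simp add: piece)
  also have "\<dots> = (\<integral>\<^sup>+u. (\<Sum>k\<le>?n. ennreal (w u) * indicator (poly G ` S k) u) \<partial>lborel)"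
    by (intro nn_integral_sum[symmetric]) measurable
  also have "\<dots> = (\<integral>\<^sup>+u. of_nat (card {t. poly G t = u}) * ennreal (w u) \<partial>lborel)"
  proof (rule nn_integral_cong_AE)
    \<comment> \<open>Critical values are excluded: there a fibre may contain critical points, which lie in no \<open>S
      k\<close>.\<close>
    have "AE u in lborel. u \<notin> poly G ` Cr"
      using fin by (intro AE_not_in) (simp add: finite_imp_null_set_lborel)
    then show "AE u in lborel. (\<Sum>k\<le>?n. ennreal (w u) * indicator (poly G ` S k) u) =
               of_nat (card {t. poly G t = u}) * ennreal (w u)"
    proof eventually_elim
      case (elim u)
      let ?Z = "{t. poly G t = u}"
      have Gu: "G - [:u:] \<noteq> 0"
      proof
        assume "G - [:u:] = 0"
        then have "G = [:u:]" by simp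
        then show False using False by (simp add: pderiv_pCons)
      qed
      have "?Z = {t. poly (G - [:u:]) t = 0}" by auto
      then have finZ: "finite ?Z" using poly_roots_finite[OF Gu] by simp
      have part: "?Z = (\<Union>k\<le>?n. ?Z \<inter> S k)"
        using elim r_le by (auto simp: S_def)
      have "card ?Z = card (\<Union>k\<in>{..?n}. ?Z \<inter> S k)" using part by simp
      also have "\<dots> = (\<Sum>k\<le>?n. card (?Z \<inter> S k))"
        by (rule card_UN_disjoint) (use finZ in \<open>auto simp: S_def\<close>)
      finally have c1: "card ?Z = (\<Sum>k\<le>?n. card (?Z \<inter> S k))" .
      have c2: "of_nat (card (?Z \<inter> S k)) = (indicator (poly G ` S k) u :: ennreal)" for k
      proof (cases "u \<in> poly G ` S k")
        case True
        then obtain t where t: "t \<in> S k" "poly G t = u" by auto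
        have "?Z \<inter> S k = {t}" using t inj[of k] by (auto simp: inj_on_def)
        then show ?thesis using True by simp
      next
        case False
        then have "?Z \<inter> S k = {}" by auto
        then show ?thesis using False by simp
      qed
      show ?case unfolding c1
        by (simp add: sum_distrib_left sum_distrib_right c2 mult.commute flip: c2)
    qed
  qed
  finally show ?thesis by simp
qed

section \<open>Measurability of the number of zeros\<close>

text \<open>
  By compactness, a continuous function has a zero in \<open>{a..b}\<close> iff its absolute value gets below every
  \<open>1 / (k + 1)\<close> at the points of a countable dense set. Clamping rational numbers to the
  interval provides such a set also when \<open>a = b\<close>.
\<close>

lemma sets_exists_zero_in_interval:
  fixes f :: "'a \<Rightarrow> real \<Rightarrow> real" and a b :: real
  assumes m: "\<And>x. (\<lambda>\<omega>. f \<omega> x) \<in> borel_measurable M" and c: "\<And>\<omega>. continuous_on UNIV (f \<omega>)"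
  shows "{\<omega> \<in> space M. \<exists>x\<in>{a..b}. f \<omega> x = 0} \<in> sets M"
proof (cases "a \<le> b")
  case False
  then show ?thesis by simp
next
  case True
  define cl where "cl y = max a (min b y)" for y
  have cl: "cl y \<in> {a..b}" for y using True by (auto simp: cl_def)
  have clid: "cl y = y" if "y \<in> {a..b}" for y using that by (auto simp: cl_def)
  have contcl: "continuous_on UNIV (\<lambda>y. f \<omega> (cl y))" for \<omega>
    unfolding cl_def
    by (rule continuous_on_compose2[OF c[of \<omega>]]) (auto intro!: continuous_intros)
  have "(\<exists>x\<in>{a..b}. f \<omega> x = 0) \<longleftrightarrow> (\<forall>k::nat. \<exists>r::rat. \<bar>f \<omega> (cl (of_rat r))\<bar> < 1 / real (Suc k))" for \<omega>
  proof
    assume "\<exists>x\<in>{a..b}. f \<omega> x = 0"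
    then obtain x where x: "x \<in> {a..b}" "f \<omega> x = 0" by auto
    show "\<forall>k::nat. \<exists>r::rat. \<bar>f \<omega> (cl (of_rat r))\<bar> < 1 / real (Suc k)"
    proof
      fix k :: nat
      have "open {y. \<bar>f \<omega> (cl y)\<bar> < 1 / real (Suc k)}"
        by (rule open_Collect_less) (use contcl in \<open>auto intro!: continuous_intros\<close>)
      moreover have "x \<in> {y. \<bar>f \<omega> (cl y)\<bar> < 1 / real (Suc k)}" using x clid by simp
      ultimately obtain e where e: "e > 0" "ball x e \<subseteq> {y. \<bar>f \<omega> (cl y)\<bar> < 1 / real (Suc k)}"
        using open_contains_ball by blast
      obtain r where r: "x < of_rat r" "of_rat r < x + e" using of_rat_dense[of x "x + e"] e by auto
      then have "of_rat r \<in> ball x e" by (auto simp: dist_real_def)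
      then show "\<exists>r::rat. \<bar>f \<omega> (cl (of_rat r))\<bar> < 1 / real (Suc k)" using e by auto
    qed
  next
    assume *: "\<forall>k::nat. \<exists>r::rat. \<bar>f \<omega> (cl (of_rat r))\<bar> < 1 / real (Suc k)"
    have "continuous_on {a..b} (\<lambda>y. \<bar>f \<omega> y\<bar>)"
      by (intro continuous_intros continuous_on_subset[OF c]) auto
    then obtain x where x: "x \<in> {a..b}" "\<And>y. y \<in> {a..b} \<Longrightarrow> \<bar>f \<omega> x\<bar> \<le> \<bar>f \<omega> y\<bar>"
      using continuous_attains_inf[of "{a..b}" "\<lambda>y. \<bar>f \<omega> y\<bar>"] True by auto
    have "\<bar>f \<omega> x\<bar> < 1 / real (Suc k)" for k
      using * x(2)[OF cl] by (meson order_le_less_trans)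
    then have "\<bar>f \<omega> x\<bar> \<le> 0"
      by (metis abs_ge_zero nat_approx_posE not_less order_less_asym linorder_not_le)
    then show "\<exists>x\<in>{a..b}. f \<omega> x = 0" using x(1) by auto
  qed
  then have eq: "{\<omega> \<in> space M. \<exists>x\<in>{a..b}. f \<omega> x = 0} =
     {\<omega> \<in> space M. \<forall>k::nat. \<exists>r::rat. \<bar>f \<omega> (cl (of_rat r))\<bar> < 1 / real (Suc k)}" by simp
  note m[measurable]
  show ?thesis unfolding eq by measurable
qed

text \<open>
  There are at least \<open>k\<close> zeros iff some \<open>k\<close> pairwise disjoint intervals with rational endpoints each
  contain a zero, which is a countable combination of measurable events.
\<close>

lemma card_zeros_measurable:
  fixes f :: "'a \<Rightarrow> real \<Rightarrow> real"
  assumes m: "\<And>x. (\<lambda>\<omega>. f \<omega> x) \<in> borel_measurable M" and c: "\<And>\<omega>. continuous_on UNIV (f \<omega>)"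
  shows "(\<lambda>\<omega>. card {x. f \<omega> x = 0}) \<in> measurable M (count_space UNIV)"
proof -
  define Z where "Z \<omega> = {x. f \<omega> x = 0}" for \<omega>
  define I where "I p = {real_of_rat (fst p)..real_of_rat (snd p)}" for p
  define dj where "dj l \<longleftrightarrow> (\<forall>i<length l. \<forall>j<length l. i \<noteq> j \<longrightarrow> I (l!i) \<inter> I (l!j) = {})" for l
  define E where "E k \<omega> \<longleftrightarrow> (\<exists>l. length l = k \<and> dj l \<and> (\<forall>p\<in>set l. \<exists>x\<in>I p. f \<omega> x = 0))" for k \<omega>
  have E1: "\<exists>Y\<subseteq>Z \<omega>. finite Y \<and> card Y = k" if "E k \<omega>" for k \<omega>
  proof -
    from that obtain l where l: "length l = k" "dj l" "\<forall>p\<in>set l. \<exists>x\<in>I p. f \<omega> x = 0"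
      by (auto simp: E_def)
    then have "\<forall>i<k. \<exists>x. x \<in> I (l!i) \<and> f \<omega> x = 0" by (metis nth_mem)
    then obtain x where x: "\<forall>i<k. x i \<in> I (l!i) \<and> f \<omega> (x i) = 0" by metis
    have "inj_on x {..<k}" unfolding inj_on_def
    proof (intro ballI impI, rule ccontr)
      fix i j assume ij: "i \<in> {..<k}" "j \<in> {..<k}" "x i = x j" "i \<noteq> j"
      then have "I (l!i) \<inter> I (l!j) = {}" using l by (auto simp: dj_def)
      then show False using x ij by (metis IntI emptyE lessThan_iff)
    qed
    then have "card (x ` {..<k}) = k" by (simp add: card_image)
    then show ?thesis using x by (intro exI[of _ "x ` {..<k}"]) (auto simp: Z_def)
  qed
  have E2: "E k \<omega>" if Y: "Y \<subseteq> Z \<omega>" "finite Y" "card Y = k" for Y k \<omega>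
  proof -
    define D where "D = insert 1 ((\<lambda>(y,z). \<bar>y - z\<bar>) ` {p\<in>Y \<times> Y. fst p \<noteq> snd p})"
    have finD: "finite D" using Y by (auto simp: D_def)
    define e where "e = Min D"
    have e: "e > 0" unfolding e_def using finD by (subst Min_gr_iff) (auto simp: D_def)
    have sep: "e \<le> \<bar>y - z\<bar>" if "y \<in> Y" "z \<in> Y" "y \<noteq> z" for y z
      unfolding e_def using finD that by (intro Min_le) (auto simp: D_def image_iff intro!: bexI[of _ "(y,z)"])
    have "\<exists>p. y \<in> I p \<and> of_rat (snd p) - of_rat (fst p) < e / 2" for y
    proof -
      obtain a where a: "y - e/4 < of_rat a" "of_rat a < y" using of_rat_dense[of "y - e/4" y] e by auto
      obtain b where b: "y < of_rat b" "of_rat b < y + e/4" using of_rat_dense[of y "y + e/4"] e by auto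
      show ?thesis using a b by (intro exI[of _ "(a,b)"]) (auto simp: I_def)
    qed
    then obtain p where p: "\<And>y. y \<in> I (p y)" "\<And>y. of_rat (snd (p y)) - of_rat (fst (p y)) < e / 2" by metis
    obtain ys where ys: "set ys = Y" "distinct ys" using finite_distinct_list[OF Y(2)] by auto
    have "I (p y) \<inter> I (p z) = {}" if yz: "y \<in> Y" "z \<in> Y" "y \<noteq> z" for y z
      using sep[OF yz] p(1)[of y] p(1)[of z] p(2)[of y] p(2)[of z] by (auto simp: I_def)
    then have "dj (map p ys)" using ys unfolding dj_def
      by (metis length_map nth_eq_iff_index_eq nth_map nth_mem)
    moreover have "length (map p ys) = k" using ys Y distinct_card by fastforce
    ultimately show ?thesis unfolding E_def using ys p(1) Y
      by (intro exI[of _ "map p ys"]) (auto simp: Z_def)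
  qed
  have Eiff: "E k \<omega> \<longleftrightarrow> infinite (Z \<omega>) \<or> k \<le> card (Z \<omega>)" for k \<omega>
  proof
    assume "E k \<omega>"
    then show "infinite (Z \<omega>) \<or> k \<le> card (Z \<omega>)" using E1[of k \<omega>] card_mono by metis
  next
    assume "infinite (Z \<omega>) \<or> k \<le> card (Z \<omega>)"
    then obtain Y where "Y \<subseteq> Z \<omega>" "finite Y" "card Y = k"
      by (metis infinite_arbitrarily_large obtain_subset_with_card_n)
    then show "E k \<omega>" using E2 by blast
  qed
  have [measurable]: "{\<omega> \<in> space M. \<exists>x\<in>I p. f \<omega> x = 0} \<in> sets M" for p
    unfolding I_def by (rule sets_exists_zero_in_interval[OF m c])
  have [measurable]: "Measurable.pred M (\<lambda>\<omega>. E k \<omega>)" for k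
    unfolding E_def by measurable (auto simp: pred_def)
  \<comment> \<open>The first branch is the convention that infinite sets have \<open>card\<close> 0.\<close>
  have eq: "card (Z \<omega>) = (if \<forall>k. E k \<omega> then 0 else (LEAST k. \<not> E (Suc k) \<omega>))" for \<omega>
  proof (cases "\<forall>k. E k \<omega>")
    case True
    then have "infinite (Z \<omega>)" using Eiff[of "Suc (card (Z \<omega>))" \<omega>] by auto
    then show ?thesis using True by simp
  next
    case False
    then have f: "finite (Z \<omega>)" using Eiff by blast
    have "(LEAST k. \<not> E (Suc k) \<omega>) = card (Z \<omega>)"
      by (rule Least_equality) (use f Eiff in \<open>auto simp: not_less_eq_eq\<close>)
    then show ?thesis using False by auto
  qed
  show ?thesis unfolding Z_def[symmetric] eq by measurable
qed

section \<open>Gaussian integrals\<close>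

abbreviation std_normal :: "real measure" where
  "std_normal \<equiv> density lborel (\<lambda>x. ennreal (std_normal_density x))"

lemma prob_space_std_normal: "prob_space std_normal"
  by (rule prob_space_normal_density) simp

lemma nn_integral_std_normal:
  assumes [measurable]: "f \<in> borel_measurable borel"
  shows "(\<integral>\<^sup>+x. f x \<partial>std_normal) = (\<integral>\<^sup>+x. ennreal (std_normal_density x) * f x \<partial>lborel)"
  by (rule nn_integral_density) measurable

lemma emeasure_std_normal_UNIV: "emeasure std_normal UNIV = 1"
  using prob_space.emeasure_space_1[OF prob_space_std_normal] by simp

lemma nn_integral_std_normal_pair:
  assumes [measurable]: "case_prod F \<in> borel_measurable (borel \<Otimes>\<^sub>M borel)"
  shows "(\<integral>\<^sup>+x. \<integral>\<^sup>+y. F x y \<partial>std_normal \<partial>std_normal) =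
    (\<integral>\<^sup>+x. \<integral>\<^sup>+y. ennreal (std_normal_density x * std_normal_density y) * F x y \<partial>lborel \<partial>lborel)"
proof -
  interpret prob_space std_normal by (rule prob_space_std_normal)
  have "(\<integral>\<^sup>+x. \<integral>\<^sup>+y. F x y \<partial>std_normal \<partial>std_normal) =
    (\<integral>\<^sup>+x. ennreal (std_normal_density x) * (\<integral>\<^sup>+y. F x y \<partial>std_normal) \<partial>lborel)"
    by (rule nn_integral_std_normal) measurable
  also have "\<dots> = (\<integral>\<^sup>+x. \<integral>\<^sup>+y. ennreal (std_normal_density x * std_normal_density y) * F x y \<partial>lborel \<partial>lborel)"
    by (intro nn_integral_cong, subst nn_integral_std_normal, measurable)
       (simp add: nn_integral_cmult[symmetric] ennreal_mult' mult.assoc)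
  finally show ?thesis .
qed

lemma std_normal_product_rotation:
  fixes c s u v :: real
  assumes "c\<^sup>2 + s\<^sup>2 = 1"
  shows "std_normal_density (c * u - s * v) * std_normal_density (s * u + c * v) =
         std_normal_density u * std_normal_density v"
proof -
  have "(c * u - s * v)\<^sup>2 + (s * u + c * v)\<^sup>2 = (c\<^sup>2 + s\<^sup>2) * (u\<^sup>2 + v\<^sup>2)"
    by (simp add: power2_eq_square algebra_simps)
  then have "(c * u - s * v)\<^sup>2 + (s * u + c * v)\<^sup>2 = u\<^sup>2 + v\<^sup>2" using assms by simp
  then have "exp (- (c * u - s * v)\<^sup>2 / 2) * exp (- (s * u + c * v)\<^sup>2 / 2) = exp (- u\<^sup>2 / 2) * exp (- v\<^sup>2 / 2)"
    unfolding exp_add[symmetric] by (simp add: field_simps)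
  then show ?thesis by (simp add: std_normal_density_def)
qed

lemma std_normal_swap:
  assumes [measurable]: "case_prod F \<in> borel_measurable (borel \<Otimes>\<^sub>M borel)"
  shows "(\<integral>\<^sup>+x. \<integral>\<^sup>+y. F x y \<partial>std_normal \<partial>std_normal) = (\<integral>\<^sup>+y. \<integral>\<^sup>+x. F x y \<partial>std_normal \<partial>std_normal)"
proof -
  interpret p: prob_space std_normal by (rule prob_space_std_normal)
  interpret pair_sigma_finite std_normal std_normal ..
  show ?thesis by (rule Fubini'[symmetric]) measurable
qed

lemma std_normal_negate:
  assumes [measurable]: "f \<in> borel_measurable borel"
  shows "(\<integral>\<^sup>+x. f (- x) \<partial>std_normal) = (\<integral>\<^sup>+x. f x \<partial>std_normal)"
proof -
  have e: "std_normal_density (- x) = std_normal_density x" for x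
    by (simp add: std_normal_density_def)
  have "(\<integral>\<^sup>+x. f (- x) \<partial>std_normal) = (\<integral>\<^sup>+x. ennreal (std_normal_density x) * f (- x) \<partial>lborel)"
    by (rule nn_integral_std_normal) measurable
  also have "\<dots> = (\<integral>\<^sup>+x. ennreal (std_normal_density x) * f x \<partial>lborel)"
    using nn_integral_real_affine[of "\<lambda>x. ennreal (std_normal_density x) * f x" "-1" 0] by (simp add: e)
  also have "\<dots> = (\<integral>\<^sup>+x. f x \<partial>std_normal)"
    by (rule nn_integral_std_normal[symmetric]) measurable
  finally show ?thesis .
qed

text \<open>
  Two independent standard Gaussians have a rotation invariant joint law. For \<open>c \<noteq> 0\<close> the rotation is a
  composition of two shears with scaling, so one-dimensional substitutions and Tonelli's theorem suffice;
  for \<open>c = 0\<close> it exchanges the coordinates up to sign.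
\<close>

lemma std_normal_rotation:
  fixes F :: "real \<Rightarrow> real \<Rightarrow> ennreal"
  assumes F[measurable]: "case_prod F \<in> borel_measurable (borel \<Otimes>\<^sub>M borel)" and cs: "c\<^sup>2 + s\<^sup>2 = 1"
  shows "(\<integral>\<^sup>+x. \<integral>\<^sup>+y. F (c * x + s * y) (c * y - s * x) \<partial>std_normal \<partial>std_normal) =
         (\<integral>\<^sup>+x. \<integral>\<^sup>+y. F x y \<partial>std_normal \<partial>std_normal)"
proof (cases "c = 0")
  case True
  interpret prob_space std_normal by (rule prob_space_std_normal)
  have s: "s = 1 \<or> s = -1" using cs True by (simp add: power2_eq_1_iff)
  have "(\<integral>\<^sup>+x. \<integral>\<^sup>+y. F (s * y) (- s * x) \<partial>std_normal \<partial>std_normal) = (\<integral>\<^sup>+y. \<integral>\<^sup>+x. F (s * y) (- s * x) \<partial>std_normal \<partial>std_normal)"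
    by (rule std_normal_swap[of "\<lambda>x y. F (s * y) (- s * x)"]) measurable
  also have "\<dots> = (\<integral>\<^sup>+y. \<integral>\<^sup>+x. F (s * y) x \<partial>std_normal \<partial>std_normal)"
  proof (rule nn_integral_cong)
    fix y :: real
    have "(\<integral>\<^sup>+x. F (s * y) (- x) \<partial>std_normal) = (\<integral>\<^sup>+x. F (s * y) x \<partial>std_normal)"
      by (rule std_normal_negate) measurable
    then show "(\<integral>\<^sup>+x. F (s * y) (- s * x) \<partial>std_normal) = (\<integral>\<^sup>+x. F (s * y) x \<partial>std_normal)"
      using s by auto
  qed
  also have "\<dots> = (\<integral>\<^sup>+y. \<integral>\<^sup>+x. F y x \<partial>std_normal \<partial>std_normal)"
  proof -
    have "(\<integral>\<^sup>+y. \<integral>\<^sup>+x. F (- y) x \<partial>std_normal \<partial>std_normal) = (\<integral>\<^sup>+y. \<integral>\<^sup>+x. F y x \<partial>std_normal \<partial>std_normal)"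
      by (rule std_normal_negate) measurable
    then show ?thesis using s by auto
  qed
  finally show ?thesis using True by simp
next
  case False
  let ?g = std_normal_density
  have c2: "c * c + s * s = 1" using cs by (simp add: power2_eq_square)
  have "(\<integral>\<^sup>+x. \<integral>\<^sup>+y. F (c * x + s * y) (c * y - s * x) \<partial>std_normal \<partial>std_normal) =
    (\<integral>\<^sup>+x. \<integral>\<^sup>+y. ennreal (?g x * ?g y) * F (c * x + s * y) (c * y - s * x) \<partial>lborel \<partial>lborel)"
    by (rule nn_integral_std_normal_pair[of "\<lambda>x y. F (c * x + s * y) (c * y - s * x)"]) measurable
  also have "\<dots> = (\<integral>\<^sup>+y. \<integral>\<^sup>+x. ennreal (?g x * ?g y) * F (c * x + s * y) (c * y - s * x) \<partial>lborel \<partial>lborel)"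
    by (rule lborel_pair.Fubini') measurable
  \<comment> \<open>Substitute \<open>u = c x + s y\<close> for \<open>x\<close>; below, \<open>y = s u + c v\<close>, so that
    \<open>v = c y - s x\<close>.\<close>
  also have "\<dots> = (\<integral>\<^sup>+y. ennreal \<bar>1/c\<bar> * (\<integral>\<^sup>+u. ennreal (?g (- s * y / c + 1/c * u) * ?g y) *
        F (c * (- s * y / c + 1/c * u) + s * y) (c * y - s * (- s * y / c + 1/c * u)) \<partial>lborel) \<partial>lborel)"
    using False by (intro nn_integral_cong nn_integral_real_affine) auto
  also have "\<dots> = (\<integral>\<^sup>+y. \<integral>\<^sup>+u. ennreal \<bar>1/c\<bar> * (ennreal (?g (- s * y / c + 1/c * u) * ?g y) *
        F u (c * y - s * (- s * y / c + 1/c * u))) \<partial>lborel \<partial>lborel)"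
    using False by (subst nn_integral_cmult[symmetric]) (measurable, simp add: field_simps)
  also have "\<dots> = (\<integral>\<^sup>+u. \<integral>\<^sup>+y. ennreal \<bar>1/c\<bar> * (ennreal (?g (- s * y / c + 1/c * u) * ?g y) *
        F u (c * y - s * (- s * y / c + 1/c * u))) \<partial>lborel \<partial>lborel)"
    by (rule lborel_pair.Fubini') measurable
  also have "\<dots> = (\<integral>\<^sup>+u. ennreal \<bar>c\<bar> * (\<integral>\<^sup>+v. ennreal \<bar>1/c\<bar> * (ennreal (?g (- s * (s * u + c * v) / c + 1/c * u) * ?g (s * u + c * v)) *
        F u (c * (s * u + c * v) - s * (- s * (s * u + c * v) / c + 1/c * u))) \<partial>lborel) \<partial>lborel)"
    using False by (intro nn_integral_cong nn_integral_real_affine) auto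
  also have "\<dots> = (\<integral>\<^sup>+u. \<integral>\<^sup>+v. ennreal (?g u * ?g v) * F u v \<partial>lborel \<partial>lborel)"
  proof (rule nn_integral_cong)
    fix u :: real
    have e1: "- s * (s * u + c * v) / c + 1/c * u = c * u - s * v" for v
    proof -
      have "- s * (s * u + c * v) + u = c * (c * u - s * v)" using c2 by algebra
      then show ?thesis using False by (simp add: field_simps)
    qed
    have e2: "c * (s * u + c * v) - s * (c * u - s * v) = v" for v using c2 by algebra
    have cc: "ennreal \<bar>c\<bar> * (ennreal \<bar>1/c\<bar> * z) = z" for z
      using False by (simp add: mult.assoc[symmetric] ennreal_mult'[symmetric])
    show "ennreal \<bar>c\<bar> * (\<integral>\<^sup>+v. ennreal \<bar>1/c\<bar> * (ennreal (?g (- s * (s * u + c * v) / c + 1/c * u) * ?g (s * u + c * v)) *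
        F u (c * (s * u + c * v) - s * (- s * (s * u + c * v) / c + 1/c * u))) \<partial>lborel) =
       (\<integral>\<^sup>+v. ennreal (?g u * ?g v) * F u v \<partial>lborel)"
      unfolding e1 e2 std_normal_product_rotation[OF cs]
      by (subst nn_integral_cmult, measurable, rule cc)
  qed
  also have "\<dots> = (\<integral>\<^sup>+x. \<integral>\<^sup>+y. F x y \<partial>std_normal \<partial>std_normal)"
    by (rule nn_integral_std_normal_pair[symmetric]) measurable
  finally show ?thesis .
qed

lemma unit_direction: "\<exists>c s r. c\<^sup>2 + s\<^sup>2 = 1 \<and> r\<^sup>2 = a\<^sup>2 + b\<^sup>2 \<and> a = r * c \<and> b = r * (s::real)"
proof (cases "a = 0 \<and> b = 0")
  case True
  then show ?thesis by (intro exI[of _ 1] exI[of _ 0]) auto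
next
  case False
  define r where "r = sqrt (a\<^sup>2 + b\<^sup>2)"
  have "a\<^sup>2 + b\<^sup>2 > 0" using False sum_power2_gt_zero_iff by blast
  then have "r > 0" "r\<^sup>2 = a\<^sup>2 + b\<^sup>2" by (auto simp: r_def)
  then show ?thesis
    by (intro exI[of _ "a/r"] exI[of _ "b/r"] exI[of _ r]) (auto simp: power_divide simp flip: add_divide_distrib)
qed

lemma std_normal_pair_combine:
  fixes f :: "real \<Rightarrow> ennreal"
  assumes f[measurable]: "f \<in> borel_measurable borel" and r: "r\<^sup>2 = a\<^sup>2 + b\<^sup>2"
    and cs: "c\<^sup>2 + s\<^sup>2 = 1" "a = r * c" "b = r * s"
  shows "(\<integral>\<^sup>+x. \<integral>\<^sup>+y. f (a * x + b * y) \<partial>std_normal \<partial>std_normal) = (\<integral>\<^sup>+x. f (r * x) \<partial>std_normal)"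
proof -
  interpret prob_space std_normal by (rule prob_space_std_normal)
  have "(\<integral>\<^sup>+x. \<integral>\<^sup>+y. f (a * x + b * y) \<partial>std_normal \<partial>std_normal) = (\<integral>\<^sup>+x. \<integral>\<^sup>+y. f (r * (c * x + s * y)) \<partial>std_normal \<partial>std_normal)"
    by (simp add: cs(2,3) algebra_simps)
  also have "\<dots> = (\<integral>\<^sup>+x. \<integral>\<^sup>+y. f (r * x) \<partial>std_normal \<partial>std_normal)"
    by (rule std_normal_rotation[of "\<lambda>x y. f (r * x)", OF _ cs(1)]) measurable
  also have "\<dots> = (\<integral>\<^sup>+x. f (r * x) \<partial>std_normal)" by (simp add: emeasure_std_normal_UNIV)
  finally show ?thesis .
qed

text \<open>
  Two linear forms in independent Gaussians have the joint law of \<open>\<alpha> x\<close> and \<open>\<beta> x + \<gamma> y\<close> with the same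
  covariance matrix. The numbers \<open>\<alpha>, \<beta>, \<gamma>\<close> are its Cholesky factor, updated one variable at a time by
  rotations; no covariance matrix has to be inverted, so degenerate pairs are included.
\<close>

lemma gaussian_pair_reduction:
  fixes a b :: "'i \<Rightarrow> real"
  assumes "finite I"
  shows "\<exists>\<alpha> \<beta> \<gamma>. \<alpha>\<^sup>2 = (\<Sum>i\<in>I. (a i)\<^sup>2) \<and> \<alpha> * \<beta> = (\<Sum>i\<in>I. a i * b i) \<and> \<beta>\<^sup>2 + \<gamma>\<^sup>2 = (\<Sum>i\<in>I. (b i)\<^sup>2) \<and>
    (\<forall>F \<in> borel_measurable (borel \<Otimes>\<^sub>M borel).
      (\<integral>\<^sup>+\<omega>. F (\<Sum>i\<in>I. a i * \<omega> i, \<Sum>i\<in>I. b i * \<omega> i) \<partial>Pi\<^sub>M I (\<lambda>_. std_normal)) =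
      (\<integral>\<^sup>+x. \<integral>\<^sup>+y. F (\<alpha> * x, \<beta> * x + \<gamma> * y) \<partial>std_normal \<partial>std_normal :: ennreal))"
  using assms
proof (induction I rule: finite_induct)
  case empty
  interpret prob_space std_normal by (rule prob_space_std_normal)
  show ?case
    by (intro exI[of _ 0]) (auto simp: PiM_empty nn_integral_count_space_finite emeasure_std_normal_UNIV)
next
  case (insert j I)
  interpret ps: prob_space std_normal by (rule prob_space_std_normal)
  interpret product_sigma_finite "\<lambda>_::'i. std_normal" ..
  from insert.IH obtain \<alpha> \<beta> \<gamma> where h: "\<alpha>\<^sup>2 = (\<Sum>i\<in>I. (a i)\<^sup>2)" "\<alpha> * \<beta> = (\<Sum>i\<in>I. a i * b i)"
    "\<beta>\<^sup>2 + \<gamma>\<^sup>2 = (\<Sum>i\<in>I. (b i)\<^sup>2)"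
    and IH: "\<And>F::real \<times> real \<Rightarrow> ennreal. F \<in> borel_measurable (borel \<Otimes>\<^sub>M borel) \<Longrightarrow>
      (\<integral>\<^sup>+\<omega>. F (\<Sum>i\<in>I. a i * \<omega> i, \<Sum>i\<in>I. b i * \<omega> i) \<partial>Pi\<^sub>M I (\<lambda>_. std_normal)) =
      (\<integral>\<^sup>+x. \<integral>\<^sup>+y. F (\<alpha> * x, \<beta> * x + \<gamma> * y) \<partial>std_normal \<partial>std_normal)" by blast
  \<comment> \<open>This rotation moves the new variable out of the first form; it leaves the coefficient \<open>\<delta>\<close>
    in the second form.\<close>
  obtain c s \<alpha>' where d: "c\<^sup>2 + s\<^sup>2 = 1" "\<alpha>'\<^sup>2 = \<alpha>\<^sup>2 + (a j)\<^sup>2" "\<alpha> = \<alpha>' * c" "a j = \<alpha>' * s"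
    using unit_direction by metis
  define \<beta>' where "\<beta>' = \<beta> * c + b j * s"
  define \<delta> where "\<delta> = b j * c - \<beta> * s"
  \<comment> \<open>The second rotation merges \<open>\<delta>\<close> and \<open>\<gamma>\<close> into one coefficient.\<close>
  obtain c' s' \<gamma>' where d': "c'\<^sup>2 + s'\<^sup>2 = 1" "\<gamma>'\<^sup>2 = \<delta>\<^sup>2 + \<gamma>\<^sup>2" "\<delta> = \<gamma>' * c'" "\<gamma> = \<gamma>' * s'"
    using unit_direction by metis
  have "\<beta>'\<^sup>2 + \<delta>\<^sup>2 = (c\<^sup>2 + s\<^sup>2) * (\<beta>\<^sup>2 + (b j)\<^sup>2)"
    unfolding \<beta>'_def \<delta>_def by (simp add: power2_eq_square algebra_simps)
  then have e3: "\<beta>'\<^sup>2 + \<gamma>'\<^sup>2 = (\<Sum>i\<in>insert j I. (b i)\<^sup>2)"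
    using insert.hyps h d d' by simp
  have "\<alpha>' * \<beta>' = \<alpha> * \<beta> + a j * b j" using d by (simp add: \<beta>'_def algebra_simps)
  then have e2: "\<alpha>' * \<beta>' = (\<Sum>i\<in>insert j I. a i * b i)" using insert.hyps h by simp
  have e1: "\<alpha>'\<^sup>2 = (\<Sum>i\<in>insert j I. (a i)\<^sup>2)" using insert.hyps h d by simp
  have "(\<integral>\<^sup>+\<omega>. F (\<Sum>i\<in>insert j I. a i * \<omega> i, \<Sum>i\<in>insert j I. b i * \<omega> i) \<partial>Pi\<^sub>M (insert j I) (\<lambda>_. std_normal)) =
      (\<integral>\<^sup>+x. \<integral>\<^sup>+y. F (\<alpha>' * x, \<beta>' * x + \<gamma>' * y) \<partial>std_normal \<partial>std_normal)"
    if F[measurable]: "F \<in> borel_measurable (borel \<Otimes>\<^sub>M borel)" for F :: "real \<times> real \<Rightarrow> ennreal"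
  proof -
    have upd: "(\<Sum>i\<in>insert j I. g i * fun_upd \<omega> j z i) = (\<Sum>i\<in>I. g i * \<omega> i) + g j * z" for g \<omega> z
      using insert.hyps by (simp add: add.commute) (intro arg_cong2[where f="(+)"] sum.cong; auto)
    have "(\<integral>\<^sup>+\<omega>. F (\<Sum>i\<in>insert j I. a i * \<omega> i, \<Sum>i\<in>insert j I. b i * \<omega> i) \<partial>Pi\<^sub>M (insert j I) (\<lambda>_. std_normal)) =
      (\<integral>\<^sup>+z. \<integral>\<^sup>+\<omega>. F ((\<Sum>i\<in>I. a i * \<omega> i) + a j * z, (\<Sum>i\<in>I. b i * \<omega> i) + b j * z) \<partial>Pi\<^sub>M I (\<lambda>_. std_normal) \<partial>std_normal)"
      unfolding upd[symmetric]
      by (rule product_nn_integral_insert_rev[OF insert.hyps]) measurable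
    also have "\<dots> = (\<integral>\<^sup>+z. \<integral>\<^sup>+x. \<integral>\<^sup>+y. F (\<alpha> * x + a j * z, \<beta> * x + \<gamma> * y + b j * z) \<partial>std_normal \<partial>std_normal \<partial>std_normal)"
      by (intro nn_integral_cong, rule IH[of "\<lambda>p. F (fst p + a j * z, snd p + b j * z)" for z, unfolded fst_conv snd_conv]) measurable
    also have "\<dots> = (\<integral>\<^sup>+x. \<integral>\<^sup>+z. \<integral>\<^sup>+y. F (\<alpha> * x + a j * z, \<beta> * x + \<gamma> * y + b j * z) \<partial>std_normal \<partial>std_normal \<partial>std_normal)"
      by (rule std_normal_swap[symmetric, of "\<lambda>x z. \<integral>\<^sup>+y. F (\<alpha> * x + a j * z, \<beta> * x + \<gamma> * y + b j * z) \<partial>std_normal"]) measurable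
    also have "\<dots> = (\<integral>\<^sup>+x. \<integral>\<^sup>+z. \<integral>\<^sup>+y. F (\<alpha>' * (c * x + s * z), \<beta>' * (c * x + s * z) + \<delta> * (c * z - s * x) + \<gamma> * y) \<partial>std_normal \<partial>std_normal \<partial>std_normal)"
    proof -
      have "\<beta>' * (c * x + s * z) + \<delta> * (c * z - s * x) = (c\<^sup>2 + s\<^sup>2) * (\<beta> * x + b j * z)" for x z
        unfolding \<beta>'_def \<delta>_def by (simp add: power2_eq_square algebra_simps)
      then have "\<beta>' * (c * x + s * z) + \<delta> * (c * z - s * x) = \<beta> * x + b j * z" for x z using d by simp
      then show ?thesis by (simp add: d(3,4) algebra_simps)
    qed
    also have "\<dots> = (\<integral>\<^sup>+x. \<integral>\<^sup>+z. \<integral>\<^sup>+y. F (\<alpha>' * x, \<beta>' * x + \<delta> * z + \<gamma> * y) \<partial>std_normal \<partial>std_normal \<partial>std_normal)"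
      by (rule std_normal_rotation[of "\<lambda>x z. \<integral>\<^sup>+y. F (\<alpha>' * x, \<beta>' * x + \<delta> * z + \<gamma> * y) \<partial>std_normal", OF _ d(1)]) measurable
    also have "\<dots> = (\<integral>\<^sup>+x. \<integral>\<^sup>+y. F (\<alpha>' * x, \<beta>' * x + \<gamma>' * y) \<partial>std_normal \<partial>std_normal)"
      using std_normal_pair_combine[of "\<lambda>y. F (\<alpha>' * x, \<beta>' * x + y)" for x, OF _ d'(2,1,3,4)]
      by (simp add: add.assoc)
    finally show ?thesis .
  qed
  then show ?case using e1 e2 e3 by blast
qed

lemma nn_integral_abs_std_normal:
  "(\<integral>\<^sup>+x. ennreal \<bar>r * x\<bar> \<partial>std_normal) = ennreal (\<bar>r\<bar> * sqrt (2 / pi))"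
proof -
  have hb: "has_bochner_integral lborel (\<lambda>x. std_normal_density x * \<bar>x\<bar>) (sqrt (2/pi))"
    using std_normal_moment_abs_odd[of 0] by simp
  have "(\<integral>\<^sup>+x. ennreal \<bar>r * x\<bar> \<partial>std_normal) = (\<integral>\<^sup>+x. ennreal (\<bar>r\<bar> * (std_normal_density x * \<bar>x\<bar>)) \<partial>lborel)"
    by (subst nn_integral_std_normal, measurable)
       (intro nn_integral_cong, simp add: ennreal_mult'[symmetric] abs_mult mult_ac)
  also have "\<dots> = ennreal (\<integral>x. \<bar>r\<bar> * (std_normal_density x * \<bar>x\<bar>) \<partial>lborel)"
    using hb by (intro nn_integral_eq_integral integrable_mult_right) (auto simp: has_bochner_integral_iff)
  also have "\<dots> = ennreal (\<bar>r\<bar> * sqrt (2 / pi))"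
    using hb by (simp add: has_bochner_integral_iff)
  finally show ?thesis .
qed

text \<open>
  The local density of zeros of a Gaussian pair (value, slope). Absorbing the additional factor
  \<open>std_normal_density (\<alpha> x)\<close> rescales \<open>x\<close> by \<open>k = sqrt (1 + \<alpha>\<^sup>2)\<close>, after which only the first absolute
  moment of one Gaussian variable is left.
\<close>

lemma gaussian_zero_density_integral:
  fixes \<alpha> \<beta> \<gamma> :: real
  shows "(\<integral>\<^sup>+x. \<integral>\<^sup>+y. ennreal (\<bar>\<beta> * x + \<gamma> * y\<bar> * std_normal_density (\<alpha> * x)) \<partial>std_normal \<partial>std_normal) =
    ennreal (sqrt (\<beta>\<^sup>2 + \<gamma>\<^sup>2 * (1 + \<alpha>\<^sup>2)) / (pi * (1 + \<alpha>\<^sup>2)))"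
proof -
  interpret prob_space std_normal by (rule prob_space_std_normal)
  define k where "k = sqrt (1 + \<alpha>\<^sup>2)"
  have k: "k > 0" "k\<^sup>2 = 1 + \<alpha>\<^sup>2" by (auto simp: k_def add_pos_nonneg)
  have dens: "std_normal_density (x / k) * std_normal_density (\<alpha> * (x / k)) = std_normal_density x / sqrt (2 * pi)" for x
  proof -
    have "(x/k)\<^sup>2 + (\<alpha> * (x / k))\<^sup>2 = x\<^sup>2 * (1 + \<alpha>\<^sup>2) / k\<^sup>2" using k(1) by (simp add: field_simps power2_eq_square)
    also have "\<dots> = x\<^sup>2" using k by (simp add: k(2)[symmetric])
    finally have "exp (- (x/k)\<^sup>2 / 2) * exp (- (\<alpha> * (x/k))\<^sup>2 / 2) = exp (- x\<^sup>2 / 2)"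
      unfolding exp_add[symmetric] by (simp add: field_simps)
    then show ?thesis by (simp add: std_normal_density_def)
  qed
  obtain c s r where r: "c\<^sup>2 + s\<^sup>2 = 1" "r\<^sup>2 = (\<beta>/k)\<^sup>2 + \<gamma>\<^sup>2" "\<beta>/k = r * c" "\<gamma> = r * s"
    using unit_direction by metis
  have "(\<integral>\<^sup>+x. \<integral>\<^sup>+y. ennreal (\<bar>\<beta> * x + \<gamma> * y\<bar> * std_normal_density (\<alpha> * x)) \<partial>std_normal \<partial>std_normal) =
    (\<integral>\<^sup>+x. ennreal (std_normal_density x) * (\<integral>\<^sup>+y. ennreal (\<bar>\<beta> * x + \<gamma> * y\<bar> * std_normal_density (\<alpha> * x)) \<partial>std_normal) \<partial>lborel)"
    by (rule nn_integral_std_normal) measurable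
  also have "\<dots> = (\<integral>\<^sup>+x. ennreal (std_normal_density x * std_normal_density (\<alpha> * x)) * (\<integral>\<^sup>+y. ennreal \<bar>\<beta> * x + \<gamma> * y\<bar> \<partial>std_normal) \<partial>lborel)"
  proof (rule nn_integral_cong)
    fix x :: real
    have "(\<integral>\<^sup>+y. ennreal (\<bar>\<beta> * x + \<gamma> * y\<bar> * std_normal_density (\<alpha> * x)) \<partial>std_normal) =
       (\<integral>\<^sup>+y. ennreal (std_normal_density (\<alpha> * x)) * ennreal \<bar>\<beta> * x + \<gamma> * y\<bar> \<partial>std_normal)"
      by (intro nn_integral_cong) (simp only: ennreal_mult' normal_density_nonneg mult.commute)
    also have "\<dots> = ennreal (std_normal_density (\<alpha> * x)) * (\<integral>\<^sup>+y. ennreal \<bar>\<beta> * x + \<gamma> * y\<bar> \<partial>std_normal)"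
      by (rule nn_integral_cmult) measurable
    finally show "ennreal (std_normal_density x) * (\<integral>\<^sup>+y. ennreal (\<bar>\<beta> * x + \<gamma> * y\<bar> * std_normal_density (\<alpha> * x)) \<partial>std_normal) =
      ennreal (std_normal_density x * std_normal_density (\<alpha> * x)) * (\<integral>\<^sup>+y. ennreal \<bar>\<beta> * x + \<gamma> * y\<bar> \<partial>std_normal)"
      by (simp only: ennreal_mult' normal_density_nonneg mult.assoc)
  qed
  also have "\<dots> = ennreal \<bar>1/k\<bar> * (\<integral>\<^sup>+x. ennreal (std_normal_density (0 + 1/k * x) * std_normal_density (\<alpha> * (0 + 1/k*x))) *
      (\<integral>\<^sup>+y. ennreal \<bar>\<beta> * (0 + 1/k * x) + \<gamma> * y\<bar> \<partial>std_normal) \<partial>lborel)"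
    by (rule nn_integral_real_affine, measurable) (use k in auto)
  also have "\<dots> = ennreal (1/k) * (\<integral>\<^sup>+x. ennreal (1 / sqrt (2 * pi)) * (ennreal (std_normal_density x) *
      (\<integral>\<^sup>+y. ennreal \<bar>\<beta> / k * x + \<gamma> * y\<bar> \<partial>std_normal)) \<partial>lborel)"
    using k dens by (simp add: ennreal_mult'[symmetric] mult.assoc[symmetric])
  also have "\<dots> = ennreal (1/k) * (ennreal (1 / sqrt (2 * pi)) * (\<integral>\<^sup>+x. \<integral>\<^sup>+y. ennreal \<bar>\<beta> / k * x + \<gamma> * y\<bar> \<partial>std_normal \<partial>std_normal))"
  proof -
    have "(\<integral>\<^sup>+x. \<integral>\<^sup>+y. ennreal \<bar>\<beta> / k * x + \<gamma> * y\<bar> \<partial>std_normal \<partial>std_normal) =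
      (\<integral>\<^sup>+x. ennreal (std_normal_density x) * (\<integral>\<^sup>+y. ennreal \<bar>\<beta> / k * x + \<gamma> * y\<bar> \<partial>std_normal) \<partial>lborel)"
      by (rule nn_integral_std_normal) measurable
    note eq = this
    show ?thesis unfolding eq by (subst nn_integral_cmult) measurable
  qed
  also have "(\<integral>\<^sup>+x. \<integral>\<^sup>+y. ennreal \<bar>\<beta> / k * x + \<gamma> * y\<bar> \<partial>std_normal \<partial>std_normal) = (\<integral>\<^sup>+x. ennreal \<bar>r * x\<bar> \<partial>std_normal)"
    by (rule std_normal_pair_combine[OF _ r(2,1,3,4)]) measurable
  also have "\<dots> = ennreal (\<bar>r\<bar> * sqrt (2 / pi))" by (rule nn_integral_abs_std_normal)
  also have "ennreal (1/k) * (ennreal (1 / sqrt (2 * pi)) * ennreal (\<bar>r\<bar> * sqrt (2 / pi))) =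
     ennreal (1/k * (1 / sqrt (2 * pi) * (\<bar>r\<bar> * sqrt (2 / pi))))"
    using k by (simp add: ennreal_mult'[symmetric])
  also have "1/k * (1 / sqrt (2 * pi) * (\<bar>r\<bar> * sqrt (2 / pi))) = sqrt (\<beta>\<^sup>2 + \<gamma>\<^sup>2 * (1 + \<alpha>\<^sup>2)) / (pi * (1 + \<alpha>\<^sup>2))"
  proof -
    have "\<bar>r\<bar> = sqrt (r\<^sup>2)" by simp
    also have "r\<^sup>2 = (\<beta>\<^sup>2 + \<gamma>\<^sup>2 * (1 + \<alpha>\<^sup>2)) / k\<^sup>2"
    proof -
      have nz: "1 + \<alpha>\<^sup>2 \<noteq> 0" using k by auto
      show ?thesis unfolding r(2) power_divide k(2) using nz by (simp add: divide_simps)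
    qed
    also have "sqrt \<dots> = sqrt (\<beta>\<^sup>2 + \<gamma>\<^sup>2 * (1 + \<alpha>\<^sup>2)) / k" using k(1) by (simp add: real_sqrt_divide)
    finally have rr: "\<bar>r\<bar> = sqrt (\<beta>\<^sup>2 + \<gamma>\<^sup>2 * (1 + \<alpha>\<^sup>2)) / k" .
    have "sqrt (2/pi) / sqrt (2 * pi) = sqrt ((2/pi) / (2*pi))" by (simp only: real_sqrt_divide)
    also have "(2/pi) / (2*pi) = (1/pi)\<^sup>2" by (simp add: power2_eq_square)
    also have "sqrt ((1/pi)\<^sup>2) = 1/pi" by simp
    finally have pp: "sqrt (2/pi) / sqrt (2 * pi) = 1/pi" .
    have "1/k * (1 / sqrt (2 * pi) * (\<bar>r\<bar> * sqrt (2 / pi))) = \<bar>r\<bar> / k * (sqrt (2/pi) / sqrt (2 * pi))" by simp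
    also have "\<dots> = sqrt (\<beta>\<^sup>2 + \<gamma>\<^sup>2 * (1 + \<alpha>\<^sup>2)) / (k\<^sup>2 * pi)" unfolding pp rr by (simp add: power2_eq_square)
    finally show ?thesis by (simp add: k(2) mult.commute)
  qed
  finally show ?thesis .
qed

section \<open>The Kac-Rice formula\<close>

text \<open>
  The reproducing kernel \<open>\<Sum>i\<le>n. \<phi> i x * \<phi> i y\<close>, its first derivative in \<open>y\<close> and its mixed second
  derivative, on the diagonal.
\<close>

definition kernel0 :: "(nat \<Rightarrow> real poly) \<Rightarrow> nat \<Rightarrow> real \<Rightarrow> real" where
  "kernel0 \<phi> n x = (\<Sum>i\<le>n. (poly (\<phi> i) x)\<^sup>2)"
definition kernel1 :: "(nat \<Rightarrow> real poly) \<Rightarrow> nat \<Rightarrow> real \<Rightarrow> real" where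
  "kernel1 \<phi> n x = (\<Sum>i\<le>n. poly (\<phi> i) x * poly (pderiv (\<phi> i)) x)"
definition kernel2 :: "(nat \<Rightarrow> real poly) \<Rightarrow> nat \<Rightarrow> real \<Rightarrow> real" where
  "kernel2 \<phi> n x = (\<Sum>i\<le>n. (poly (pderiv (\<phi> i)) x)\<^sup>2)"

text \<open>
  The coefficient of \<open>\<phi> 0\<close> has been integrated out already: its Gaussian density, at the value that makes
  \<open>t\<close> a zero, is the factor \<open>std_normal_density\<close>, and the slope is the Jacobian.
\<close>

lemma kac_rice_pointwise:
  fixes \<phi> :: "nat \<Rightarrow> real poly"
  assumes k0: "\<phi> 0 = [:k0:]" "k0 \<noteq> 0"
  shows "(\<integral>\<^sup>+c. ennreal (\<bar>\<Sum>i=1..n. (- poly (pderiv (\<phi> i)) t / k0) * c i\<bar> *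
             std_normal_density (\<Sum>i=1..n. (- poly (\<phi> i) t / k0) * c i)) \<partial>Pi\<^sub>M {1..n} (\<lambda>_. std_normal)) =
         ennreal (sqrt (kernel0 \<phi> n t * kernel2 \<phi> n t - (kernel1 \<phi> n t)\<^sup>2) / (pi * kernel0 \<phi> n t))"
proof -
  let ?I = "{1..n}"
  define a where "a i = - poly (\<phi> i) t / k0" for i
  define b where "b i = - poly (pderiv (\<phi> i)) t / k0" for i
  have "(\<lambda>(x,z). ennreal (\<bar>z\<bar> * std_normal_density x)) \<in> borel_measurable (borel \<Otimes>\<^sub>M (borel :: real measure))"
    by measurable
  then obtain \<alpha> \<beta> \<gamma> where h: "\<alpha>\<^sup>2 = (\<Sum>i\<in>?I. (a i)\<^sup>2)" "\<alpha> * \<beta> = (\<Sum>i\<in>?I. a i * b i)"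
    "\<beta>\<^sup>2 + \<gamma>\<^sup>2 = (\<Sum>i\<in>?I. (b i)\<^sup>2)"
    and red: "(\<integral>\<^sup>+\<omega>. (\<lambda>(x,z). ennreal (\<bar>z\<bar> * std_normal_density x)) (\<Sum>i\<in>?I. a i * \<omega> i, \<Sum>i\<in>?I. b i * \<omega> i) \<partial>Pi\<^sub>M ?I (\<lambda>_. std_normal)) =
      (\<integral>\<^sup>+x. \<integral>\<^sup>+y. (\<lambda>(x,z). ennreal (\<bar>z\<bar> * std_normal_density x)) (\<alpha> * x, \<beta> * x + \<gamma> * y) \<partial>std_normal \<partial>std_normal)"
    using gaussian_pair_reduction[of ?I a b] by blast
  have split: "(\<Sum>i\<le>n. g i) = g 0 + (\<Sum>i=1..n. g i)" for g :: "nat \<Rightarrow> real"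
    by (simp add: sum.atMost_shift atMost_atLeast0 sum.atLeast_Suc_atMost)
  have d0: "pderiv (\<phi> 0) = 0" using k0 by (simp add: pderiv_pCons)
  have e0: "kernel0 \<phi> n t = k0\<^sup>2 * (1 + \<alpha>\<^sup>2)"
    unfolding kernel0_def split h a_def using k0 by (simp add: power_divide sum_divide_distrib[symmetric] field_simps)
  have e1: "kernel1 \<phi> n t = k0\<^sup>2 * (\<alpha> * \<beta>)"
    unfolding kernel1_def split h a_def b_def using k0 d0
    by (simp add: power2_eq_square sum_distrib_left)
  have e2: "kernel2 \<phi> n t = k0\<^sup>2 * (\<beta>\<^sup>2 + \<gamma>\<^sup>2)"
    unfolding kernel2_def split h b_def using k0 d0 by (simp add: power_divide sum_divide_distrib[symmetric])
  have "kernel0 \<phi> n t * kernel2 \<phi> n t - (kernel1 \<phi> n t)\<^sup>2 = (k0\<^sup>2)\<^sup>2 * (\<beta>\<^sup>2 + \<gamma>\<^sup>2 * (1 + \<alpha>\<^sup>2))"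
    unfolding e0 e1 e2 by (simp add: power2_eq_square algebra_simps)
  then have "sqrt (kernel0 \<phi> n t * kernel2 \<phi> n t - (kernel1 \<phi> n t)\<^sup>2) = k0\<^sup>2 * sqrt (\<beta>\<^sup>2 + \<gamma>\<^sup>2 * (1 + \<alpha>\<^sup>2))"
    by (simp only: real_sqrt_mult real_sqrt_abs) simp
  then have "sqrt (kernel0 \<phi> n t * kernel2 \<phi> n t - (kernel1 \<phi> n t)\<^sup>2) / (pi * kernel0 \<phi> n t) =
     sqrt (\<beta>\<^sup>2 + \<gamma>\<^sup>2 * (1 + \<alpha>\<^sup>2)) / (pi * (1 + \<alpha>\<^sup>2))"
    unfolding e0 using k0 by simp
  then show ?thesis
    using red gaussian_zero_density_integral[of \<beta> \<gamma> \<alpha>] unfolding a_def b_def by simp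
qed

text \<open>
  Since \<open>\<phi> 0\<close> is a constant \<open>k0\<close>, the random polynomial vanishes at \<open>t\<close> iff the first coefficient \<open>u\<close> equals
  \<open>G t\<close>, where \<open>G\<close> is a polynomial in the other coefficients. So for fixed other coefficients the zeros
  form a fibre of \<open>G\<close>, and the area formula integrates their number over \<open>u\<close> exactly. This avoids the usual
  limit of smoothed counting functions.
\<close>

theorem kac_rice:
  fixes \<phi> :: "nat \<Rightarrow> real poly"
  assumes iid: "iid_std_normal M \<eta>" and k0: "\<phi> 0 = [:k0:]" "k0 \<noteq> 0"
  shows "ennreal (expected_real_zeros M \<phi> \<eta> n) =
     (\<integral>\<^sup>+x. ennreal (sqrt (kernel0 \<phi> n x * kernel2 \<phi> n x - (kernel1 \<phi> n x)\<^sup>2) / (pi * kernel0 \<phi> n x)) \<partial>lborel)"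
proof -
  interpret M: prob_space M using iid by (simp add: iid_std_normal_def)
  interpret N: prob_space std_normal by (rule prob_space_std_normal)
  interpret product_sigma_finite "\<lambda>_::nat. std_normal" ..
  have dist: "distributed M lborel (\<eta> i) (\<lambda>x. ennreal (std_normal_density x))" for i
    using iid by (simp add: iid_std_normal_def)
  have rv[measurable]: "\<eta> i \<in> borel_measurable M" for i
    using distributed_measurable[OF dist] by simp
  have "distr M lborel (\<eta> i) = std_normal" for i
    by (rule distributed_distr_eq_density[OF dist])
  then have dN: "distr M borel (\<eta> i) = std_normal" for i
    by (metis distr_cong sets_lborel)
  let ?I = "{..n}"
  have "M.indep_vars (\<lambda>_. borel) \<eta> ?I"
    using iid M.indep_vars_subset unfolding iid_std_normal_def by blast
  then have PI: "distr M (Pi\<^sub>M ?I (\<lambda>_. borel)) (\<lambda>\<omega>. \<lambda>i\<in>?I. \<eta> i \<omega>) = Pi\<^sub>M ?I (\<lambda>_. std_normal)"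
    by (subst (asm) M.indep_vars_iff_distr_eq_PiM) (auto simp: dN)
  define P where "P c = (\<Sum>i\<le>n. smult (c i) (\<phi> i))" for c :: "nat \<Rightarrow> real"
  define Z where "Z c = card {x. poly (P c) x = 0}" for c
  have polyP: "poly (P c) x = (\<Sum>i\<le>n. c i * poly (\<phi> i) x)" for c x
    by (simp add: P_def poly_sum)
  have Zm[measurable]: "Z \<in> measurable (Pi\<^sub>M ?I (\<lambda>_. borel)) (count_space UNIV)"
    unfolding Z_def by (rule card_zeros_measurable) (auto intro!: continuous_intros simp: polyP)
  have Zext: "random_poly \<phi> \<eta> n \<omega> = P (\<lambda>i\<in>?I. \<eta> i \<omega>)" for \<omega>
    unfolding random_poly_def P_def by (intro sum.cong) auto
  have Zm': "(\<lambda>\<omega>. Z (\<lambda>i\<in>?I. \<eta> i \<omega>)) \<in> measurable M (count_space UNIV)"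
    by measurable
  have degP: "degree (P c) \<le> (\<Sum>i\<le>n. degree (\<phi> i))" for c
    unfolding P_def
  proof (rule degree_sum_le)
    fix i assume "i \<in> {..n}"
    then have "degree (\<phi> i) \<le> (\<Sum>i\<le>n. degree (\<phi> i))" by (intro member_le_sum) auto
    then show "degree (smult (c i) (\<phi> i)) \<le> (\<Sum>i\<le>n. degree (\<phi> i))"
      using degree_smult_le order_trans by blast
  qed simp
  have Zb: "Z c \<le> (\<Sum>i\<le>n. degree (\<phi> i))" for c
  proof (cases "P c = 0")
    case True
    then show ?thesis by (simp add: Z_def infinite_UNIV_char_0)
  next
    case False
    then show ?thesis using card_poly_roots_bound[OF False] degP[of c] by (auto simp: Z_def intro: order_trans)
  qed
  have int: "integrable M (\<lambda>\<omega>. real (Z (\<lambda>i\<in>?I. \<eta> i \<omega>)))"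
    by (rule M.integrable_const_bound[of _ "real (\<Sum>i\<le>n. degree (\<phi> i))"])
       (use Zb Zm' in \<open>auto simp del: of_nat_sum\<close>)
  have "ennreal (expected_real_zeros M \<phi> \<eta> n) = (\<integral>\<^sup>+\<omega>. ennreal (real (Z (\<lambda>i\<in>?I. \<eta> i \<omega>))) \<partial>M)"
    unfolding expected_real_zeros_def Zext Z_def[symmetric]
    by (rule nn_integral_eq_integral[symmetric]) (use int in auto)
  also have "\<dots> = (\<integral>\<^sup>+c. of_nat (Z c) \<partial>distr M (Pi\<^sub>M ?I (\<lambda>_. borel)) (\<lambda>\<omega>. \<lambda>i\<in>?I. \<eta> i \<omega>))"
    by (subst nn_integral_distr) (auto simp: ennreal_of_nat_eq_real_of_nat)
  also have "\<dots> = (\<integral>\<^sup>+c. of_nat (Z c) \<partial>Pi\<^sub>M (insert 0 {1..n}) (\<lambda>_. std_normal))"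
  proof -
    have "?I = insert 0 {1..n}" by auto
    then show ?thesis unfolding PI by simp
  qed
  also have "\<dots> = (\<integral>\<^sup>+c. \<integral>\<^sup>+u. of_nat (Z (c(0 := u))) \<partial>std_normal \<partial>Pi\<^sub>M {1..n} (\<lambda>_. std_normal))"
  proof (rule product_nn_integral_insert)
    have "insert 0 {1..n} = ?I" by auto
    moreover have "sets (Pi\<^sub>M ?I (\<lambda>_. std_normal)) = sets (Pi\<^sub>M ?I (\<lambda>_. borel :: real measure))"
      by (intro sets_PiM_cong) auto
    ultimately have sets: "sets (Pi\<^sub>M (insert 0 {1..n}) (\<lambda>_. std_normal)) = sets (Pi\<^sub>M ?I (\<lambda>_. borel :: real measure))"
      by (simp only:)
    have "(\<lambda>c. of_nat (Z c) :: ennreal) \<in> borel_measurable (Pi\<^sub>M ?I (\<lambda>_. borel))" by measurable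
    then show "(\<lambda>c. of_nat (Z c) :: ennreal) \<in> borel_measurable (Pi\<^sub>M (insert 0 {1..n}) (\<lambda>_. std_normal))"
      by (simp only: measurable_cong_sets[OF sets refl])
  qed auto
  also have "\<dots> = (\<integral>\<^sup>+c. \<integral>\<^sup>+t. ennreal (\<bar>\<Sum>i=1..n. (- poly (pderiv (\<phi> i)) t / k0) * c i\<bar> *
             std_normal_density (\<Sum>i=1..n. (- poly (\<phi> i) t / k0) * c i)) \<partial>lborel \<partial>Pi\<^sub>M {1..n} (\<lambda>_. std_normal))"
  proof (rule nn_integral_cong)
    fix c :: "nat \<Rightarrow> real"
    assume "c \<in> space (Pi\<^sub>M {1..n} (\<lambda>_. std_normal))"
    define G where "G = (\<Sum>i=1..n. smult (- c i / k0) (\<phi> i))"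
    have split: "(\<Sum>i\<le>n. g i) = g 0 + (\<Sum>i=1..n. g i)" for g :: "nat \<Rightarrow> real"
      by (simp add: sum.atMost_shift atMost_atLeast0 sum.atLeast_Suc_atMost)
    have G: "poly G t = (\<Sum>i=1..n. (- poly (\<phi> i) t / k0) * c i)" for t
      by (simp add: G_def poly_sum mult.commute)
    have G': "poly (pderiv G) t = (\<Sum>i=1..n. (- poly (pderiv (\<phi> i)) t / k0) * c i)" for t
      by (simp add: G_def poly_sum higher_pderiv_sum[of 1, simplified] pderiv_smult pderiv_minus mult.commute)
    have ZG: "Z (c(0 := u)) = card {t. poly G t = u}" for u
    proof -
      have "poly (P (c(0 := u))) t = k0 * (u - poly G t)" for t
      proof -
        have "(\<Sum>i=1..n. (c(0 := u)) i * poly (\<phi> i) t) = (\<Sum>i=1..n. c i * poly (\<phi> i) t)"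
          by (intro sum.cong) auto
        moreover have "k0 * poly G t = - (\<Sum>i=1..n. c i * poly (\<phi> i) t)"
          unfolding G sum_distrib_left sum_negf[symmetric] by (intro sum.cong refl) (use k0 in simp)
        ultimately show ?thesis unfolding polyP split right_diff_distrib using k0 by simp
      qed
      then have "{x. poly (P (c(0 := u))) x = 0} = {t. poly G t = u}" using k0 by auto
      then show ?thesis by (simp add: Z_def)
    qed
    have "(\<integral>\<^sup>+u. of_nat (Z (c(0 := u))) \<partial>std_normal) = (\<integral>\<^sup>+u. of_nat (card {t. poly G t = u}) * ennreal (std_normal_density u) \<partial>lborel)"
    proof -
      have "(\<lambda>u. card {t. poly G t - u = 0}) \<in> measurable borel (count_space UNIV)"
        by (rule card_zeros_measurable) (auto intro!: continuous_intros)
      then have [measurable]: "(\<lambda>u. card {t. poly G t = u}) \<in> measurable borel (count_space UNIV)" by simp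
      show ?thesis unfolding ZG
        by (subst nn_integral_std_normal) (auto simp: mult.commute)
    qed
    also have "\<dots> = (\<integral>\<^sup>+t. ennreal (\<bar>poly (pderiv G) t\<bar> * std_normal_density (poly G t)) \<partial>lborel)"
      by (rule poly_area_formula) auto
    finally show "(\<integral>\<^sup>+u. of_nat (Z (c(0 := u))) \<partial>std_normal) = (\<integral>\<^sup>+t. ennreal (\<bar>\<Sum>i=1..n. (- poly (pderiv (\<phi> i)) t / k0) * c i\<bar> *
             std_normal_density (\<Sum>i=1..n. (- poly (\<phi> i) t / k0) * c i)) \<partial>lborel)"
      unfolding G G' .
  qed
  also have "\<dots> = (\<integral>\<^sup>+t. \<integral>\<^sup>+c. ennreal (\<bar>\<Sum>i=1..n. (- poly (pderiv (\<phi> i)) t / k0) * c i\<bar> *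
             std_normal_density (\<Sum>i=1..n. (- poly (\<phi> i) t / k0) * c i)) \<partial>Pi\<^sub>M {1..n} (\<lambda>_. std_normal) \<partial>lborel)"
  proof -
    have fin: "finite {1..n}" by simp
    interpret PP: sigma_finite_measure "Pi\<^sub>M {1..n} (\<lambda>_. std_normal)" by (rule sigma_finite[OF fin])
    interpret pair_sigma_finite "Pi\<^sub>M {1..n} (\<lambda>_. std_normal)" lborel ..
    have [measurable]: "poly p \<in> borel_measurable borel" for p :: "real poly"
      by (auto intro!: borel_measurable_continuous_onI continuous_intros)
    have [measurable]: "(\<lambda>c. c i) \<in> borel_measurable (Pi\<^sub>M {1..n} (\<lambda>_. std_normal))" if "i \<in> {1..n}" for i
      using measurable_component_singleton[OF that, of "\<lambda>_. std_normal"] by simp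
    have "(\<lambda>(c, t). ennreal (\<bar>\<Sum>i=1..n. (- poly (pderiv (\<phi> i)) t / k0) * c i\<bar> *
             std_normal_density (\<Sum>i=1..n. (- poly (\<phi> i) t / k0) * c i)))
        \<in> borel_measurable (Pi\<^sub>M {1..n} (\<lambda>_. std_normal) \<Otimes>\<^sub>M lborel)"
      unfolding split_beta by measurable
    then show ?thesis by (rule Fubini'[symmetric])
  qed
  also have "\<dots> = (\<integral>\<^sup>+x. ennreal (sqrt (kernel0 \<phi> n x * kernel2 \<phi> n x - (kernel1 \<phi> n x)\<^sup>2) / (pi * kernel0 \<phi> n x)) \<partial>lborel)"
    by (intro nn_integral_cong kac_rice_pointwise k0)
  finally show ?thesis .
qed

section \<open>Szego recursion and the Christoffel-Darboux formula\<close>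

abbreviation complexify :: "real poly \<Rightarrow> complex poly" where
  "complexify \<equiv> map_poly complex_of_real"

text \<open>
  Reversal of the coefficients relative to a prescribed degree bound \<open>n\<close>, in contrast to \<open>reflect_poly\<close>, whose
  reference degree is that of the argument. This makes it linear on the polynomials of degree at most \<open>n\<close>.
\<close>

definition reflect_at :: "nat \<Rightarrow> real poly \<Rightarrow> real poly" where
  "reflect_at n p = Poly (map (\<lambda>i. coeff p (n - i)) [0..<Suc n])"

lemma coeff_reflect_at: "coeff (reflect_at n p) i = (if i \<le> n then coeff p (n - i) else 0)"
  by (auto simp: reflect_at_def coeff_Poly_eq nth_default_def simp del: upt_Suc)

lemma degree_reflect_at: "degree (reflect_at n p) \<le> n"
  by (rule degree_le) (simp add: coeff_reflect_at)

lemma reflect_at_reflect_at: "degree p \<le> n \<Longrightarrow> reflect_at n (reflect_at n p) = p"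
  by (rule poly_eqI) (auto simp: coeff_reflect_at coeff_eq_0)

lemma reflect_at_add: "reflect_at n (p + q) = reflect_at n p + reflect_at n q"
  by (rule poly_eqI) (auto simp: coeff_reflect_at)

lemma reflect_at_smult: "reflect_at n (smult c p) = smult c (reflect_at n p)"
  by (rule poly_eqI) (auto simp: coeff_reflect_at)

lemma reflect_at_Suc_pCons: "reflect_at (Suc n) (pCons 0 p) = reflect_at n p"
  by (rule poly_eqI) (auto simp: coeff_reflect_at coeff_pCons Suc_diff_le split: nat.splits)

lemma reflect_at_Suc_reflect_at: "degree p \<le> n \<Longrightarrow> reflect_at (Suc n) (reflect_at n p) = pCons 0 p"
  by (rule poly_eqI) (auto simp: coeff_reflect_at coeff_pCons coeff_eq_0 split: nat.splits)

lemma reflect_at_degree: "degree p = n \<Longrightarrow> reflect_at n p = reflect_poly p"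
  by (rule poly_eqI) (auto simp: coeff_reflect_at coeff_reflect_poly)

text \<open>
  What the recursion uses of the inner product of \<open>\<mu>\<close>: multiplication by the coordinate is an isometry,
  and, all coefficients being real, so is reversal.
\<close>

locale toeplitz_orthonormal =
  fixes L :: "real poly \<Rightarrow> real poly \<Rightarrow> real" and \<phi> :: "nat \<Rightarrow> real poly"
  assumes L_add: "L (p + q) r = L p r + L q r"
    and L_smult: "L (smult c p) r = c * L p r"
    and L_sym: "L p q = L q p"
    and L_shift: "L (pCons 0 p) (pCons 0 q) = L p q"
    and L_reflect: "degree p \<le> n \<Longrightarrow> degree q \<le> n \<Longrightarrow> L (reflect_at n p) (reflect_at n q) = L p q"
    and degree_\<phi>: "degree (\<phi> i) = i"
    and orthonormal: "L (\<phi> i) (\<phi> j) = (if i = j then 1 else 0)"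
begin

lemma L_0: "L 0 q = 0" using L_smult[of 0 0 q] by simp

lemma L_sum: "L (sum f A) q = (\<Sum>i\<in>A. L (f i) q)"
  by (induction A rule: infinite_finite_induct) (auto simp: L_0 L_add)

lemma L_add_right: "L r (p + q) = L r p + L r q" using L_add L_sym by metis
lemma L_smult_right: "L r (smult c p) = c * L r p" using L_smult L_sym by metis

lemma L_diff: "L (p - q) r = L p r - L q r"
  using L_add[of p "smult (-1) q" r] L_smult[of "-1" q r] by simp

lemma lead_\<phi>: "coeff (\<phi> n) n \<noteq> 0"
proof -
  have "\<phi> n \<noteq> 0" using orthonormal[of n n] L_0[of "\<phi> n"] by auto
  then show ?thesis using degree_\<phi>[of n] leading_coeff_0_iff by metis
qed

lemma span_exists: "degree p \<le> n \<Longrightarrow> \<exists>c. p = (\<Sum>i\<le>n. smult (c i) (\<phi> i))"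
proof (induction n arbitrary: p)
  case 0
  define c where "c = coeff p 0 / coeff (\<phi> 0) 0"
  have "p = smult c (\<phi> 0)"
  proof (rule poly_eqI)
    fix i show "coeff p i = coeff (smult c (\<phi> 0)) i"
      using 0 degree_\<phi>[of 0] lead_\<phi>[of 0] by (cases i) (auto simp: c_def coeff_eq_0)
  qed
  then show ?case by (intro exI[of _ "\<lambda>_. c"]) simp
next
  case (Suc n)
  define c where "c = coeff p (Suc n) / coeff (\<phi> (Suc n)) (Suc n)"
  have "degree (p - smult c (\<phi> (Suc n))) \<le> n"
  proof (rule degree_le, intro allI impI)
    fix i assume "n < i"
    then show "coeff (p - smult c (\<phi> (Suc n))) i = 0"
      using Suc.prems degree_\<phi>[of "Suc n"] lead_\<phi>[of "Suc n"]
      by (cases "i = Suc n") (auto simp: c_def coeff_eq_0)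
  qed
  then obtain d where d: "p - smult c (\<phi> (Suc n)) = (\<Sum>i\<le>n. smult (d i) (\<phi> i))"
    using Suc.IH by blast
  have "p = (\<Sum>i\<le>Suc n. smult ((d(Suc n := c)) i) (\<phi> i))"
    using d by (simp add: algebra_simps)
  then show ?case by blast
qed

lemma span: assumes "degree p \<le> n" shows "p = (\<Sum>i\<le>n. smult (L p (\<phi> i)) (\<phi> i))"
proof -
  obtain c where c: "p = (\<Sum>i\<le>n. smult (c i) (\<phi> i))" using span_exists[OF assms] by blast
  have "L p (\<phi> j) = c j" if "j \<le> n" for j
  proof -
    have "L p (\<phi> j) = (\<Sum>i\<le>n. c i * (if i = j then 1 else 0))"
      unfolding c by (simp only: L_sum L_smult orthonormal)
    also have "\<dots> = c j" using that by (simp add: if_distrib cong: if_cong)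
    finally show ?thesis .
  qed
  then have "(\<Sum>i\<le>n. smult (L p (\<phi> i)) (\<phi> i)) = (\<Sum>i\<le>n. smult (c i) (\<phi> i))"
    by (intro sum.cong) auto
  then show ?thesis using c by simp
qed

lemma orth_lower: assumes "degree p < n" shows "L p (\<phi> n) = 0"
proof -
  have "L p (\<phi> n) = L (\<Sum>i\<le>degree p. smult (L p (\<phi> i)) (\<phi> i)) (\<phi> n)"
    using span[of p "degree p"] by simp
  also have "\<dots> = (\<Sum>i\<le>degree p. L p (\<phi> i) * L (\<phi> i) (\<phi> n))" by (simp add: L_sum L_smult)
  also have "\<dots> = 0" using assms by (intro sum.neutral) (auto simp: orthonormal)
  finally show ?thesis .
qed

text \<open>
  Let \<open>d\<close> be the difference of \<open>\<phi> (n + 1)\<close> and the multiple of \<open>z * \<phi> n\<close> with the same leading coefficient. Its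
  reversal is orthogonal to \<open>\<phi> j\<close> for \<open>j < n\<close>, hence a multiple of \<open>\<phi> n\<close>. Comparing norms gives
  \<open>c\<^sup>2 = 1 + a\<^sup>2\<close>.
\<close>

lemma szego_recursion:
  "\<exists>c a. \<phi> (Suc n) = smult c (pCons 0 (\<phi> n)) + smult a (reflect_at n (\<phi> n)) \<and> c\<^sup>2 - a\<^sup>2 = 1"
proof -
  define c where "c = coeff (\<phi> (Suc n)) (Suc n) / coeff (\<phi> n) n"
  define d where "d = \<phi> (Suc n) - smult c (pCons 0 (\<phi> n))"
  have degd: "degree d \<le> n"
  proof (rule degree_le, intro allI impI)
    fix i assume "n < i"
    then show "coeff d i = 0"
      using degree_\<phi>[of "Suc n"] degree_\<phi>[of n] lead_\<phi>[of n]
      by (cases "i = Suc n") (auto simp: c_def d_def coeff_eq_0 coeff_pCons split: nat.splits)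
  qed
  have low: "L (reflect_at n d) (\<phi> j) = 0" if "j < n" for j
  proof -
    define u where "u = reflect_at (n - 1) (\<phi> j)"
    have degu: "degree u < n" using degree_reflect_at[of "n-1" "\<phi> j"] that by (simp add: u_def)
    have "reflect_at n (\<phi> j) = pCons 0 u"
      by (rule poly_eqI)
         (use that degree_\<phi>[of j] in \<open>auto simp: u_def coeff_reflect_at coeff_pCons coeff_eq_0 split: nat.splits\<close>)
    then have "L (reflect_at n d) (\<phi> j) = L d (pCons 0 u)"
      using L_reflect[of "reflect_at n d" n "\<phi> j"] degree_reflect_at degree_\<phi>[of j] that
      by (simp add: reflect_at_reflect_at[OF degd])
    also have "\<dots> = L (\<phi> (Suc n)) (pCons 0 u) - c * L (\<phi> n) u"
      by (simp add: d_def L_diff L_smult L_shift)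
    also have "L (\<phi> (Suc n)) (pCons 0 u) = 0"
      using orth_lower[of "pCons 0 u" "Suc n"] degu by (simp add: L_sym[of _ "pCons 0 u"] degree_pCons_eq_if)
    also have "L (\<phi> n) u = 0" using orth_lower[OF degu] by (simp add: L_sym[of _ u])
    finally show ?thesis by simp
  qed
  define a where "a = L (reflect_at n d) (\<phi> n)"
  have "reflect_at n d = (\<Sum>i\<le>n. smult (L (reflect_at n d) (\<phi> i)) (\<phi> i))"
    by (rule span[OF degree_reflect_at])
  also have "\<dots> = (\<Sum>i\<in>{n}. smult (L (reflect_at n d) (\<phi> i)) (\<phi> i))"
    by (rule sum.mono_neutral_right) (auto simp: low)
  finally have "reflect_at n d = smult a (\<phi> n)" by (simp add: a_def)
  then have da: "d = smult a (reflect_at n (\<phi> n))"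
    using reflect_at_reflect_at[OF degd] by (metis reflect_at_smult)
  then have rec: "\<phi> (Suc n) = smult c (pCons 0 (\<phi> n)) + smult a (reflect_at n (\<phi> n))"
    by (simp add: d_def algebra_simps)
  let ?s = "reflect_at n (\<phi> n)"
  have ss: "L ?s ?s = 1" using L_reflect[of "\<phi> n" n "\<phi> n"] degree_\<phi> orthonormal by simp
  have s0: "L ?s (\<phi> (Suc n)) = 0"
    using orth_lower[of ?s "Suc n"] degree_reflect_at[of n "\<phi> n"] by simp
  have eq: "smult c (pCons 0 (\<phi> n)) = \<phi> (Suc n) + smult (-a) ?s" using rec by (simp add: algebra_simps)
  have "c\<^sup>2 = L (smult c (pCons 0 (\<phi> n))) (smult c (pCons 0 (\<phi> n)))"
    by (simp add: L_smult L_smult_right L_shift orthonormal power2_eq_square)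
  also have "\<dots> = 1 + a\<^sup>2"
    unfolding eq L_add L_add_right L_smult L_smult_right ss s0 L_sym[of "\<phi> (Suc n)" ?s] orthonormal
    by (simp add: power2_eq_square)
  finally show ?thesis using rec by (intro exI[of _ c] exI[of _ a]) simp
qed

text \<open>
  The recursion acts on the pair \<open>(reflect_poly (\<phi> n), z * \<phi> n)\<close> by a matrix with rows \<open>(c, a)\<close> and \<open>(a, c)\<close>. As
  \<open>c\<^sup>2 - a\<^sup>2 = 1\<close>, it preserves the indefinite form of signature \<open>(1, -1)\<close>; this telescopes to
  the Christoffel-Darboux formula.
\<close>

lemma reflect_recursion_product:
  "poly (reflect_poly (\<phi> (Suc n))) x * poly (reflect_poly (\<phi> (Suc n))) y - poly (\<phi> (Suc n)) x * poly (\<phi> (Suc n)) y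
   = poly (reflect_poly (\<phi> n)) x * poly (reflect_poly (\<phi> n)) y - x * y * (poly (\<phi> n) x * poly (\<phi> n) y)"
proof -
  obtain c a where rec: "\<phi> (Suc n) = smult c (pCons 0 (\<phi> n)) + smult a (reflect_at n (\<phi> n))" and ca: "c\<^sup>2 - a\<^sup>2 = 1"
    using szego_recursion by blast
  have "reflect_poly (\<phi> (Suc n)) = reflect_at (Suc n) (\<phi> (Suc n))"
    using reflect_at_degree[OF degree_\<phi>] by simp
  also have "\<dots> = smult c (reflect_at n (\<phi> n)) + smult a (pCons 0 (\<phi> n))"
    unfolding rec by (simp add: reflect_at_add reflect_at_smult reflect_at_Suc_pCons reflect_at_Suc_reflect_at degree_\<phi>)
  finally have P: "reflect_poly (\<phi> (Suc n)) = smult c (reflect_poly (\<phi> n)) + smult a (pCons 0 (\<phi> n))"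
    by (simp add: reflect_at_degree degree_\<phi>)
  have Q: "\<phi> (Suc n) = smult c (pCons 0 (\<phi> n)) + smult a (reflect_poly (\<phi> n))"
    using rec by (simp add: reflect_at_degree degree_\<phi>)
  have alg: "(c * p + x * (a * q)) * (c * p' + y * (a * q')) - (x * (c * q) + a * p) * (y * (c * q') + a * p')
     = (c\<^sup>2 - a\<^sup>2) * (p * p' - x * y * (q * q'))" for p p' q q'
    by (simp add: power2_eq_square algebra_simps)
  show ?thesis unfolding P by (subst (1 2) Q) (simp add: alg ca)
qed

theorem christoffel_darboux:
  "(1 - x * y) * (\<Sum>i\<le>n. poly (\<phi> i) x * poly (\<phi> i) y) =
   poly (reflect_poly (\<phi> (Suc n))) x * poly (reflect_poly (\<phi> (Suc n))) y - poly (\<phi> (Suc n)) x * poly (\<phi> (Suc n)) y"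
proof (induction n)
  case 0
  obtain k where k: "\<phi> 0 = [:k:]" using degree_\<phi>[of 0] degree_eq_zeroE by blast
  show ?case unfolding reflect_recursion_product[of 0] by (simp add: k algebra_simps)
next
  case (Suc n)
  have "(1 - x * y) * (\<Sum>i\<le>Suc n. poly (\<phi> i) x * poly (\<phi> i) y) =
     (1 - x * y) * (\<Sum>i\<le>n. poly (\<phi> i) x * poly (\<phi> i) y) + (1 - x * y) * (poly (\<phi> (Suc n)) x * poly (\<phi> (Suc n)) y)"
    by (simp add: distrib_left)
  then show ?case unfolding Suc reflect_recursion_product[of "Suc n"] by (simp add: left_diff_distrib)
qed

end

text \<open>
  Differentiating the two-variable identity in \<open>y\<close>, then in \<open>x\<close>, and setting \<open>y = x\<close> gives linear equations
  for the three diagonal sums; they reduce the Gram determinant of the sums to the Wronskian of \<open>P\<close> and \<open>Q\<close>.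
\<close>

lemma christoffel_darboux_diagonal:
  fixes P Q :: "real poly"
  assumes cd: "\<And>x y. (1 - x * y) * (\<Sum>i\<le>n. poly (\<phi> i) x * poly (\<phi> i) y) = poly P x * poly P y - poly Q x * poly Q y"
  shows "(1 - x\<^sup>2) * (\<Sum>i\<le>n. (poly (\<phi> i) x)\<^sup>2) = (poly P x)\<^sup>2 - (poly Q x)\<^sup>2"
    and "(1 - x\<^sup>2)\<^sup>2 * ((\<Sum>i\<le>n. (poly (\<phi> i) x)\<^sup>2) * (\<Sum>i\<le>n. (poly (pderiv (\<phi> i)) x)\<^sup>2) - (\<Sum>i\<le>n. poly (\<phi> i) x * poly (pderiv (\<phi> i)) x)\<^sup>2)
       = (\<Sum>i\<le>n. (poly (\<phi> i) x)\<^sup>2)\<^sup>2 - (poly P x * poly (pderiv Q) x - poly (pderiv P) x * poly Q x)\<^sup>2"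
proof -
  define K where "K x y = (\<Sum>i\<le>n. poly (\<phi> i) x * poly (\<phi> i) y)" for x y
  define K1 where "K1 x y = (\<Sum>i\<le>n. poly (\<phi> i) x * poly (pderiv (\<phi> i)) y)" for x y
  define K2 where "K2 x y = (\<Sum>i\<le>n. poly (pderiv (\<phi> i)) x * poly (pderiv (\<phi> i)) y)" for x y
  have e0: "(1 - x * y) * K x y = poly P x * poly P y - poly Q x * poly Q y" for x y
    using cd by (simp add: K_def)
  have dK: "((\<lambda>y. K x y) has_real_derivative K1 x y) (at y)" for x y
    unfolding K_def K1_def by (auto intro!: derivative_eq_intros simp: mult.commute)
  have e1: "(1 - x * y) * K1 x y - x * K x y = poly P x * poly (pderiv P) y - poly Q x * poly (pderiv Q) y" for x y
  proof (rule DERIV_unique)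
    show "((\<lambda>y. (1 - x * y) * K x y) has_real_derivative (1 - x * y) * K1 x y - x * K x y) (at y)"
      by (auto intro!: derivative_eq_intros dK simp: algebra_simps)
    show "((\<lambda>y. (1 - x * y) * K x y) has_real_derivative poly P x * poly (pderiv P) y - poly Q x * poly (pderiv Q) y) (at y)"
      unfolding e0 by (auto intro!: derivative_eq_intros)
  qed
  have dK1: "((\<lambda>x. K1 x y) has_real_derivative K2 x y) (at x)" for x y
    unfolding K2_def K1_def by (auto intro!: derivative_eq_intros simp: mult.commute)
  have Ksym: "K x y = K y x" for x y by (simp add: K_def mult.commute)
  have dK': "((\<lambda>x. K x y) has_real_derivative K1 y x) (at x)" for x y
    using dK[of y x] by (simp add: Ksym[of _ y])
  have e2: "(1 - x * y) * K2 x y - y * K1 x y - K x y - x * K1 y x = poly (pderiv P) x * poly (pderiv P) y - poly (pderiv Q) x * poly (pderiv Q) y" for x y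
  proof (rule DERIV_unique)
    show "((\<lambda>x. (1 - x * y) * K1 x y - x * K x y) has_real_derivative (1 - x * y) * K2 x y - y * K1 x y - K x y - x * K1 y x) (at x)"
      by (auto intro!: derivative_eq_intros dK1 dK' simp: algebra_simps)
    show "((\<lambda>x. (1 - x * y) * K1 x y - x * K x y) has_real_derivative poly (pderiv P) x * poly (pderiv P) y - poly (pderiv Q) x * poly (pderiv Q) y) (at x)"
      unfolding e1 by (auto intro!: derivative_eq_intros)
  qed
  have K: "K x x = (\<Sum>i\<le>n. (poly (\<phi> i) x)\<^sup>2)" "K2 x x = (\<Sum>i\<le>n. (poly (pderiv (\<phi> i)) x)\<^sup>2)"
    "K1 x x = (\<Sum>i\<le>n. poly (\<phi> i) x * poly (pderiv (\<phi> i)) x)"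
    by (simp_all add: K_def K1_def K2_def power2_eq_square)
  show "(1 - x\<^sup>2) * (\<Sum>i\<le>n. (poly (\<phi> i) x)\<^sup>2) = (poly P x)\<^sup>2 - (poly Q x)\<^sup>2"
    using e0[of x x] unfolding K(1) by (simp add: power2_eq_square)
  define k k1 k2 p q p' q' where kd: "k = K x x" "k1 = K1 x x" "k2 = K2 x x" "p = poly P x" "q = poly Q x"
    "p' = poly (pderiv P) x" "q' = poly (pderiv Q) x"
  have f0: "(1 - x * x) * k = p * p - q * q" using e0[of x x] by (simp add: kd)
  have f1: "(1 - x * x) * k1 = p * p' - q * q' + x * k" using e1[of x x] by (simp add: kd)
  have f2: "(1 - x * x) * k2 = p' * p' - q' * q' + 2 * x * k1 + k" using e2[of x x] by (simp add: kd algebra_simps)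
  have "(1 - x * x) * (1 - x * x) * (k * k2 - k1 * k1) = k * k - (p * q' - p' * q) * (p * q' - p' * q)"
    using f0 f1 f2 by algebra
  then show "(1 - x\<^sup>2)\<^sup>2 * ((\<Sum>i\<le>n. (poly (\<phi> i) x)\<^sup>2) * (\<Sum>i\<le>n. (poly (pderiv (\<phi> i)) x)\<^sup>2) - (\<Sum>i\<le>n. poly (\<phi> i) x * poly (pderiv (\<phi> i)) x)\<^sup>2)
       = (\<Sum>i\<le>n. (poly (\<phi> i) x)\<^sup>2)\<^sup>2 - (poly P x * poly (pderiv Q) x - poly (pderiv P) x * poly Q x)\<^sup>2"
    unfolding K[symmetric] by (simp add: kd power2_eq_square)
qed

lemma complexify_add: "complexify (p + q) = complexify p + complexify q"
  by (rule poly_eqI) (simp add: coeff_map_poly)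

lemma complexify_smult: "complexify (smult c p) = smult (of_real c) (complexify p)"
  by (rule poly_eqI) (simp add: coeff_map_poly)

lemma poly_complexify_altdef:
  assumes "degree p \<le> n"
  shows "poly (complexify p) z = (\<Sum>i\<le>n. of_real (coeff p i) * z ^ i)"
proof -
  have "poly (complexify p) z = (\<Sum>i\<le>degree p. of_real (coeff p i) * z ^ i)"
    by (subst poly_altdef) (simp add: coeff_map_poly degree_map_poly)
  also have "\<dots> = (\<Sum>i\<le>n. of_real (coeff p i) * z ^ i)"
    by (rule sum.mono_neutral_left) (use assms in \<open>auto simp: coeff_eq_0\<close>)
  finally show ?thesis .
qed

lemma poly_reflect_at_circle:
  assumes "degree p \<le> n" "norm \<xi> = 1"
  shows "poly (complexify (reflect_at n p)) \<xi> = \<xi> ^ n * cnj (poly (complexify p) \<xi>)"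
proof -
  have inv: "\<xi> * cnj \<xi> = 1" using assms(2) by (simp add: complex_norm_square[symmetric])
  have pw: "\<xi> ^ n * cnj \<xi> ^ i = \<xi> ^ (n - i)" if "i \<le> n" for i
  proof -
    have "\<xi> ^ n * cnj \<xi> ^ i = \<xi> ^ (n - i) * (\<xi> * cnj \<xi>) ^ i"
      using that by (simp add: power_mult_distrib power_add[symmetric] mult.assoc[symmetric])
    then show ?thesis using inv by simp
  qed
  have "poly (complexify (reflect_at n p)) \<xi> = (\<Sum>i\<le>n. of_real (coeff p (n - i)) * \<xi> ^ i)"
    by (subst poly_complexify_altdef[OF degree_reflect_at]) (simp add: coeff_reflect_at)
  also have "\<dots> = (\<Sum>i\<le>n. of_real (coeff p i) * \<xi> ^ (n - i))"
    by (rule sum.reindex_bij_witness[of _ "\<lambda>i. n - i" "\<lambda>i. n - i"]) auto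
  also have "\<dots> = (\<Sum>i\<le>n. \<xi> ^ n * (of_real (coeff p i) * cnj \<xi> ^ i))"
    by (intro sum.cong refl) (simp add: pw[symmetric])
  also have "\<dots> = \<xi> ^ n * cnj (poly (complexify p) \<xi>)"
    by (simp add: poly_complexify_altdef[OF assms(1)] sum_distrib_left)
  finally show ?thesis .
qed

definition circle_form :: "complex measure \<Rightarrow> real poly \<Rightarrow> real poly \<Rightarrow> real" where
  "circle_form \<mu> p q = Re (\<integral>\<xi>. poly (complexify p) \<xi> * cnj (poly (complexify q) \<xi>) \<partial>\<mu>)"

lemma continuous_on_circle_integrable:
  fixes f :: "complex \<Rightarrow> complex"
  assumes "sets \<mu> = sets borel_circle" "prob_space \<mu>" "continuous_on (sphere 0 1) f"
  shows "integrable \<mu> f"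
proof -
  interpret prob_space \<mu> by fact
  have sp: "space \<mu> = sphere 0 1"
    using sets_eq_imp_space_eq[OF assms(1)] by (simp add: borel_circle_def space_restrict_space)
  have "f \<in> borel_measurable borel_circle"
    unfolding borel_circle_def using assms(3) by (intro borel_measurable_continuous_on_restrict)
  then have m: "f \<in> borel_measurable \<mu>" using assms(1) measurable_cong_sets by blast
  obtain B where "\<And>x. x \<in> sphere 0 1 \<Longrightarrow> norm (f x) \<le> B"
    using compact_imp_bounded[OF compact_continuous_image[OF assms(3) compact_sphere]]
    unfolding bounded_iff by blast
  then show ?thesis by (intro integrable_const_bound[of _ B] m AE_I2) (simp add: sp)
qed

lemma toeplitz_orthonormal_circle_form:
  assumes "sets \<mu> = sets borel_circle" "prob_space \<mu>" "orthonormal_polys \<mu> \<phi>"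
  shows "toeplitz_orthonormal (circle_form \<mu>) \<phi>"
proof
  interpret prob_space \<mu> by fact
  have sp: "space \<mu> = sphere 0 1"
    using sets_eq_imp_space_eq[OF assms(1)] by (simp add: borel_circle_def space_restrict_space)
  let ?e = "\<lambda>p. poly (complexify p)"
  have int: "integrable \<mu> (\<lambda>\<xi>. ?e p \<xi> * cnj (?e q \<xi>))" for p q
    by (rule continuous_on_circle_integrable[OF assms(1,2)]) (intro continuous_intros)
  fix p q r :: "real poly" and c :: real and n i j :: nat
  show "circle_form \<mu> (p + q) r = circle_form \<mu> p r + circle_form \<mu> q r"
    unfolding circle_form_def complexify_add poly_add distrib_right
    by (subst Bochner_Integration.integral_add[OF int int]) simp
  show "circle_form \<mu> (smult c p) r = c * circle_form \<mu> p r"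
    unfolding circle_form_def complexify_smult poly_smult mult.assoc by simp
  have cnj: "(\<integral>\<xi>. ?e q \<xi> * cnj (?e p \<xi>) \<partial>\<mu>) = cnj (\<integral>\<xi>. ?e p \<xi> * cnj (?e q \<xi>) \<partial>\<mu>)" for p q
  proof -
    have "(\<integral>\<xi>. ?e q \<xi> * cnj (?e p \<xi>) \<partial>\<mu>) = (\<integral>\<xi>. cnj (?e p \<xi> * cnj (?e q \<xi>)) \<partial>\<mu>)"
      by (simp add: mult.commute)
    also have "\<dots> = cnj (\<integral>\<xi>. ?e p \<xi> * cnj (?e q \<xi>) \<partial>\<mu>)" by (rule Bochner_Integration.integral_cnj)
    finally show ?thesis .
  qed
  show sym: "circle_form \<mu> p q = circle_form \<mu> q p" for p q
    unfolding circle_form_def by (subst cnj) simp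
  show "circle_form \<mu> (pCons 0 p) (pCons 0 q) = circle_form \<mu> p q"
    unfolding circle_form_def
  proof (rule arg_cong[where f=Re], rule Bochner_Integration.integral_cong[OF refl])
    fix \<xi> assume "\<xi> \<in> space \<mu>"
    then have "\<xi> * cnj \<xi> = 1" by (simp add: sp complex_norm_square[symmetric])
    then have "(\<xi> * a) * (cnj \<xi> * b) = a * b" for a b by (metis mult.assoc mult.commute mult_1)
    then show "?e (pCons 0 p) \<xi> * cnj (?e (pCons 0 q) \<xi>) = ?e p \<xi> * cnj (?e q \<xi>)"
      by (simp add: map_poly_pCons)
  qed
  show "circle_form \<mu> (reflect_at n p) (reflect_at n q) = circle_form \<mu> p q" if d: "degree p \<le> n" "degree q \<le> n"
  proof -
    have "circle_form \<mu> (reflect_at n p) (reflect_at n q) = circle_form \<mu> q p"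
      unfolding circle_form_def
    proof (rule arg_cong[where f=Re], rule Bochner_Integration.integral_cong[OF refl])
      fix \<xi> assume "\<xi> \<in> space \<mu>"
      then have n1: "norm \<xi> = 1" by (simp add: sp)
      then have "\<xi> * cnj \<xi> = 1" by (simp add: complex_norm_square[symmetric])
      then have i: "\<xi> ^ n * cnj \<xi> ^ n = 1" by (metis power_mult_distrib power_one)
      have "?e (reflect_at n p) \<xi> * cnj (?e (reflect_at n q) \<xi>) = (\<xi> ^ n * cnj \<xi> ^ n) * (?e q \<xi> * cnj (?e p \<xi>))"
        unfolding poly_reflect_at_circle[OF d(1) n1] poly_reflect_at_circle[OF d(2) n1] by simp
      then show "?e (reflect_at n p) \<xi> * cnj (?e (reflect_at n q) \<xi>) = ?e q \<xi> * cnj (?e p \<xi>)"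
        using i by simp
    qed
    then show ?thesis using sym by simp
  qed
  show "degree (\<phi> i) = i" using assms(3) by (simp add: orthonormal_polys_def)
  show "circle_form \<mu> (\<phi> i) (\<phi> j) = (if i = j then 1 else 0)"
    using assms(3) by (auto simp: orthonormal_polys_def circle_form_def)
qed

section \<open>The density as a symmetric weight on an annulus\<close>

definition annulus :: "real \<Rightarrow> complex set" where
  "annulus R = {z. 1 / R < norm z \<and> norm z < R}"

lemma open_annulus: "open (annulus R)"
  unfolding annulus_def by (intro open_Collect_conj open_Collect_less continuous_intros)

lemma annulus_inverse: "R > 1 \<Longrightarrow> z \<in> annulus R \<Longrightarrow> 1 / z \<in> annulus R"
proof -
  assume R: "R > 1" "z \<in> annulus R"
  then have "norm z > 0" "1 / R < norm z" "norm z < R"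
    by (auto simp: annulus_def intro: less_trans[of 0 "1/R"])
  then show "1 / z \<in> annulus R" using R(1) by (auto simp: annulus_def norm_divide field_simps)
qed

lemma annulus_nonzero: "R > 1 \<Longrightarrow> z \<in> annulus R \<Longrightarrow> z \<noteq> 0"
  by (auto simp: annulus_def field_simps)

lemma sphere_in_annulus: "R > 1 \<Longrightarrow> norm z = 1 \<Longrightarrow> z \<in> annulus R"
  by (auto simp: annulus_def field_simps)

lemma integral_reflect_2pi:
  fixes f :: "real \<Rightarrow> complex"
  shows "integral {0..2*pi} (\<lambda>\<theta>. f (2 * pi - \<theta>)) = integral {0..2*pi} f"
proof -
  have "(f has_integral i) {0..2*pi} \<Longrightarrow> ((\<lambda>\<theta>. f (2 * pi - \<theta>)) has_integral i) {0..2*pi}" for i and f :: "real \<Rightarrow> complex"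
    using has_integral_affinity[of f i 0 "2*pi" "-1" "2*pi"]
    by (simp add: image_affinity_atLeastAtMost_diff algebra_simps)
  from this[of f] this[of "\<lambda>\<theta>. f (2 * pi - \<theta>)"]
  have iff: "(f has_integral i) {0..2*pi} \<longleftrightarrow> ((\<lambda>\<theta>. f (2 * pi - \<theta>)) has_integral i) {0..2*pi}" for i
    by auto
  then show ?thesis unfolding integral_def integrable_on_def by simp
qed

lemma cis_measurable_circle: "cis \<in> measurable (restrict_space lborel {0..<2 * pi}) borel_circle"
  unfolding borel_circle_def
  by (intro measurable_restrict_space2 measurable_restrict_space1)
     (auto intro!: borel_measurable_continuous_onI continuous_intros)

lemma sets_arclength: "sets arclength = sets borel_circle"
  by (simp add: arclength_def)

lemma finite_measure_arclength: "finite_measure arclength"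
proof (rule finite_measureI)
  have "emeasure arclength (space arclength) \<le> emeasure (restrict_space lborel {0..<2 * pi}) (space (restrict_space lborel {0..<2 * pi}))"
    unfolding arclength_def by (subst emeasure_distr[OF cis_measurable_circle]) (use sets.top[of borel_circle] emeasure_space in \<open>auto simp only: space_distr\<close>)
  also have "\<dots> = ennreal (2 * pi)" by (simp add: space_restrict_space emeasure_restrict_space)
  finally show "emeasure arclength (space arclength) \<noteq> \<infinity>" by (auto simp: top_unique)
qed

lemma circle_measurable_continuous:
  fixes f :: "complex \<Rightarrow> 'b::topological_space"
  assumes "sets \<mu> = sets borel_circle" "continuous_on (sphere 0 1) f"
  shows "f \<in> borel_measurable \<mu>"
proof -
  have "f \<in> borel_measurable borel_circle"
    unfolding borel_circle_def using assms(2) by (intro borel_measurable_continuous_on_restrict)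
  then show ?thesis using assms(1) measurable_cong_sets by blast
qed

lemma integral_arclength:
  fixes g :: "complex \<Rightarrow> complex"
  assumes g: "continuous_on (sphere 0 1) g"
  shows "(\<integral>\<xi>. g \<xi> \<partial>arclength) = integral {0..2*pi} (\<lambda>\<theta>. g (cis \<theta>))"
proof -
  have cc: "continuous_on UNIV (\<lambda>\<theta>. g (cis \<theta>))"
    by (rule continuous_on_compose2[OF g]) (auto intro!: continuous_intros)
  have "(\<integral>\<xi>. g \<xi> \<partial>arclength) = (\<integral>\<theta>. g (cis \<theta>) \<partial>restrict_space lborel {0..<2 * pi})"
    unfolding arclength_def
    by (rule integral_distr[OF cis_measurable_circle]) (rule circle_measurable_continuous[OF refl g])
  also have "\<dots> = (LINT \<theta>:{0..<2*pi}|lborel. g (cis \<theta>))"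
    unfolding set_lebesgue_integral_def by (rule integral_restrict_space) simp
  also have "\<dots> = (LINT \<theta>:{0..2*pi}|lborel. g (cis \<theta>))"
    unfolding set_lebesgue_integral_def
    by (rule integral_discrete_difference[of "{2*pi}"]) (auto simp: indicator_def)
  also have "\<dots> = integral {0..2*pi} (\<lambda>\<theta>. g (cis \<theta>))"
    by (rule set_borel_integral_eq_integral(2)[OF borel_integrable_atLeastAtMost'])
       (rule continuous_on_subset[OF cc], simp)
  finally show ?thesis .
qed

text \<open>
  Every arc has positive length, so a closed condition on a continuous function that holds almost everywhere
  holds everywhere.
\<close>

lemma AE_closed_everywhere_circle:
  assumes h: "continuous_on (sphere 0 1) h" and C: "closed C"
    and ae: "AE \<xi> in arclength. (h \<xi> :: complex) \<in> C"
  shows "\<And>\<xi>. \<xi> \<in> sphere 0 1 \<Longrightarrow> h \<xi> \<in> C"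
proof -
  have "AE \<theta> in restrict_space lborel {0..<2*pi}. h (cis \<theta>) \<in> C"
    using AE_distrD[OF cis_measurable_circle] ae unfolding arclength_def by blast
  then have ae2: "AE \<theta> in lborel. \<theta> \<in> {0..<2*pi} \<longrightarrow> h (cis \<theta>) \<in> C"
    by (subst (asm) AE_restrict_space_iff) auto
  have cc: "continuous_on UNIV (\<lambda>\<theta>. h (cis \<theta>))"
    by (rule continuous_on_compose2[OF h]) (auto intro!: continuous_intros)
  define G where "G = {\<theta>. h (cis \<theta>) \<in> C}"
  have clG: "closed G" unfolding G_def
    using continuous_closed_vimage[OF C, of "\<lambda>\<theta>. h (cis \<theta>)"] cc
    by (simp add: vimage_def continuous_on_eq_continuous_at)
  have sub: "{0<..<2*pi} \<subseteq> G"
  proof (rule ccontr)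
    assume "\<not> {0<..<2*pi} \<subseteq> G"
    then obtain t where t: "t \<in> {0<..<2*pi} - G" by blast
    have op: "open ({0<..<2*pi} - G)" using clG by (intro open_Diff) auto
    then obtain e where e: "e > 0" "ball t e \<subseteq> {0<..<2*pi} - G" using t openE by blast
    from ae2 obtain N where N: "{\<theta>. \<not> (\<theta> \<in> {0..<2*pi} \<longrightarrow> h (cis \<theta>) \<in> C)} \<subseteq> N" "N \<in> null_sets lborel"
      by (auto simp: eventually_ae_filter)
    have "{t-e<..<t+e} \<subseteq> N"
    proof
      fix u assume "u \<in> {t-e<..<t+e}"
      then have "u \<in> ball t e" by (auto simp: dist_real_def)
      then have "u \<in> {0<..<2*pi} - G" using e by blast
      then show "u \<in> N" using N(1) by (auto simp: G_def)
    qed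
    then have "emeasure lborel {t-e<..<t+e} \<le> emeasure lborel N" using N(2) by (intro emeasure_mono) auto
    then show False using N(2) e(1) by (simp add: null_sets_def)
  qed
  have "closure {0<..<2*pi} \<subseteq> G" by (rule closure_minimal[OF sub clG])
  then have G: "{0..2*pi} \<subseteq> G" by simp
  fix \<xi> :: complex assume "\<xi> \<in> sphere 0 1"
  then have x: "\<xi> = cis (Arg2pi \<xi>)" using complex_norm_eq_1_exp[of \<xi>] Arg2pi_eq[of \<xi>]
    by (simp add: cis_conv_exp)
  have "Arg2pi \<xi> \<in> {0..2*pi}" using Arg2pi[of \<xi>] by auto
  then show "h \<xi> \<in> C" using G x unfolding G_def by (metis (mono_tags) mem_Collect_eq subsetD)
qed

text \<open>
  The extension \<open>w\<close> agrees with the density only almost everywhere. By continuity it is real and nonnegative on the whole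
  circle, and being zero-free it is positive there, so it may replace the density.
\<close>

lemma density_positive_on_circle:
  assumes sets: "sets \<mu> = sets borel_circle" and ps: "prob_space \<mu>"
    and ac: "absolutely_continuous arclength \<mu>"
    and w: "continuous_on (sphere 0 1) w" "\<And>z. z \<in> sphere 0 1 \<Longrightarrow> w z \<noteq> 0"
      "AE \<xi> in arclength. w \<xi> = complex_of_real (enn2real (RN_deriv arclength \<mu> \<xi>))"
  shows "\<And>z. z \<in> sphere 0 1 \<Longrightarrow> Im (w z) = 0 \<and> Re (w z) > 0"
    and "\<mu> = density arclength (\<lambda>\<xi>. ennreal (Re (w \<xi>)))"
proof -
  interpret P: prob_space \<mu> by fact
  interpret A: finite_measure arclength by (rule finite_measure_arclength)
  have ssets: "sets \<mu> = sets arclength" using sets sets_arclength by simp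
  let ?C = "{z. Im z = 0} \<inter> {z. Re z \<ge> 0}"
  have "closed ?C" by (intro closed_Int closed_Collect_eq closed_Collect_le continuous_intros)
  moreover have "AE \<xi> in arclength. w \<xi> \<in> ?C" using w(3) by eventually_elim auto
  ultimately have wC: "w z \<in> ?C" if "z \<in> sphere 0 1" for z
    using AE_closed_everywhere_circle[OF w(1)] that by blast
  show "Im (w z) = 0 \<and> Re (w z) > 0" if "z \<in> sphere 0 1" for z
    using wC[OF that] w(2)[OF that] by (auto simp: complex_eq_iff)
  have "\<mu> = density arclength (RN_deriv arclength \<mu>)"
    using A.density_RN_deriv[OF ac ssets] by simp
  also have "\<dots> = density arclength (\<lambda>\<xi>. ennreal (Re (w \<xi>)))"
  proof (rule density_cong)
    have "(\<lambda>\<xi>. Re (w \<xi>)) \<in> borel_measurable arclength"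
      by (rule circle_measurable_continuous[OF sets_arclength]) (intro continuous_intros w(1))
    then show "(\<lambda>\<xi>. ennreal (Re (w \<xi>))) \<in> borel_measurable arclength"
      by (rule measurable_compose[OF _ measurable_ennreal])
    have "AE x in arclength. RN_deriv arclength \<mu> x \<noteq> \<infinity>"
      by (rule A.RN_deriv_finite[OF P.sigma_finite_measure_axioms ac ssets])
    then show "AE x in arclength. RN_deriv arclength \<mu> x = ennreal (Re (w x))"
      using w(3) by eventually_elim (auto simp: less_top)
  qed auto
  finally show "\<mu> = density arclength (\<lambda>\<xi>. ennreal (Re (w \<xi>)))" .
qed

text \<open>
  Conjugation symmetry allows the weight to be replaced by the mean of \<open>w z\<close> and \<open>w (1 / z)\<close>, as conjugation is
  inversion on the circle. By compactness, the real part stays positive on an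
  annulus around the circle, so that a logarithm exists there.
\<close>

lemma symmetric_weight_on_annulus:
  assumes sets: "sets \<mu> = sets borel_circle" and ps: "prob_space \<mu>" and sym: "conj_symmetric \<mu>"
    and ac: "absolutely_continuous arclength \<mu>" and hd: "has_nonvanishing_holomorphic_density \<mu>"
  obtains R W where "R > 1" "W holomorphic_on annulus R"
    "\<And>z. z \<in> annulus R \<Longrightarrow> W (1 / z) = W z" "\<And>z. z \<in> annulus R \<Longrightarrow> Re (W z) > 0"
    "\<And>z. norm z = 1 \<Longrightarrow> Im (W z) = 0"
    "\<And>F. continuous_on (sphere 0 1) F \<Longrightarrow> (\<integral>\<xi>. F \<xi> \<partial>\<mu>) = integral {0..2*pi} (\<lambda>\<theta>. F (cis \<theta>) * W (cis \<theta>))"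
proof -
  from hd obtain U w where U: "open U" "sphere 0 1 \<subseteq> U" "w holomorphic_on U" "\<forall>z\<in>U. w z \<noteq> 0"
    and ae: "AE \<xi> in arclength. w \<xi> = complex_of_real (enn2real (RN_deriv arclength \<mu> \<xi>))"
    unfolding has_nonvanishing_holomorphic_density_def by blast
  have cw: "continuous_on U w" using U(3) by (rule holomorphic_on_imp_continuous_on)
  have cws: "continuous_on (sphere 0 1) w" using cw U(2) continuous_on_subset by blast
  have nz: "\<And>z. z \<in> sphere 0 1 \<Longrightarrow> w z \<noteq> 0" using U(2,4) by blast
  have dp: "Im (w z) = 0 \<and> Re (w z) > 0" if "z \<in> sphere 0 1" for z
    by (rule density_positive_on_circle(1)[OF sets ps ac cws _ ae that]) (rule nz)
  have wpos: "Im (w z) = 0" "Re (w z) > 0" if "z \<in> sphere 0 1" for z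
    using dp[OF that] by auto
  have \<mu>: "\<mu> = density arclength (\<lambda>\<xi>. ennreal (Re (w \<xi>)))"
    by (rule density_positive_on_circle(2)[OF sets ps ac cws _ ae]) (rule nz)
  define V where "V = {z \<in> U. Re (w z) > 0}"
  have opV: "open V"
  proof -
    have "openin (top_of_set U) (U \<inter> (\<lambda>z. Re (w z)) -` {0<..})"
      by (rule continuous_openin_preimage_gen) (use cw in \<open>auto intro!: continuous_intros\<close>)
    then have "open (U \<inter> (\<lambda>z. Re (w z)) -` {0<..})" using U(1) openin_open_trans by blast
    moreover have "U \<inter> (\<lambda>z. Re (w z)) -` {0<..} = V" by (auto simp: V_def)
    ultimately show ?thesis by simp
  qed
  have sV: "sphere 0 1 \<subseteq> V" using U(2) wpos by (auto simp: V_def)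
  obtain e where e: "e > 0" "(\<Union>x\<in>sphere 0 1. ball x e) \<subseteq> V"
    using compact_subset_open_imp_ball_epsilon_subset[OF compact_sphere opV sV] by blast
  define R where "R = 1 + e"
  have R: "R > 1" using e by (simp add: R_def)
  have annV: "z \<in> V" if "z \<in> annulus R" for z
  proof -
    have z0: "z \<noteq> 0" and nz: "1 / R < norm z" "norm z < R"
      using that annulus_nonzero[OF R] by (auto simp: annulus_def)
    have "1 - 1 / R \<le> e" using R e(1) by (simp add: R_def field_simps)
    then have ab: "\<bar>norm z - 1\<bar> < e" using nz by (auto simp: R_def abs_if)
    have "z / of_real (norm z) - z = of_real (1 - norm z) * (z / of_real (norm z))"
      using z0 by (simp add: field_simps)
    then have "dist (z / of_real (norm z)) z = \<bar>1 - norm z\<bar> * norm (z / of_real (norm z))"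
      by (simp only: dist_norm norm_mult norm_of_real)
    then have "dist (z / of_real (norm z)) z < e" using ab z0 by (simp add: norm_divide abs_minus_commute)
    then have "z \<in> ball (z / of_real (norm z)) e" by simp
    moreover have "z / of_real (norm z) \<in> sphere 0 1" using z0 by (simp add: norm_divide)
    ultimately show ?thesis using e(2) by blast
  qed
  define W where "W z = (w z + w (1 / z)) / 2" for z
  have hol: "W holomorphic_on annulus R"
  proof -
    have "w holomorphic_on annulus R" using U(3) annV holomorphic_on_subset by (fastforce simp: V_def)
    moreover have "(\<lambda>z. w (1 / z)) holomorphic_on annulus R"
    proof -
      have "(\<lambda>z. 1 / z) holomorphic_on annulus R"
        by (intro holomorphic_intros) (use annulus_nonzero[OF R] in auto)
      moreover have "(\<lambda>z. 1 / z) ` annulus R \<subseteq> U"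
        using annV annulus_inverse[OF R] by (force simp: V_def)
      ultimately show ?thesis
        using holomorphic_on_compose_gen[of "\<lambda>z. 1 / z" "annulus R" w U] U(3) by (simp add: o_def)
    qed
    ultimately show ?thesis unfolding W_def by (intro holomorphic_intros) auto
  qed
  have cnj_inv: "1 / z = cnj z" if "norm z = 1" for z
  proof -
    have "z * cnj z = 1" "z \<noteq> 0" using that by (auto simp: complex_norm_square[symmetric])
    then show ?thesis by (simp add: nonzero_divide_eq_eq mult.commute)
  qed
  have re: "complex_of_real (Re (w z)) = w z" if "norm z = 1" for z
    using wpos(1)[of z] that by (auto simp: complex_eq_iff)
  have base: "(\<integral>\<xi>. F \<xi> \<partial>\<mu>) = integral {0..2*pi} (\<lambda>\<theta>. F (cis \<theta>) * w (cis \<theta>))"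
    if F: "continuous_on (sphere 0 1) F" for F :: "complex \<Rightarrow> complex"
  proof -
    have "(\<integral>\<xi>. F \<xi> \<partial>\<mu>) = (\<integral>\<xi>. Re (w \<xi>) *\<^sub>R F \<xi> \<partial>arclength)"
    proof (subst \<mu>, rule integral_density)
      show "F \<in> borel_measurable arclength" by (rule circle_measurable_continuous[OF sets_arclength F])
      show "(\<lambda>\<xi>. Re (w \<xi>)) \<in> borel_measurable arclength"
        by (rule circle_measurable_continuous[OF sets_arclength]) (intro continuous_intros cws)
      have "space arclength = sphere 0 1" by (simp add: arclength_def borel_circle_def space_restrict_space)
      then show "AE \<xi> in arclength. 0 \<le> Re (w \<xi>)" using wpos by (auto intro!: AE_I2 less_imp_le)
    qed
    also have "\<dots> = integral {0..2*pi} (\<lambda>\<theta>. Re (w (cis \<theta>)) *\<^sub>R F (cis \<theta>))"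
      by (rule integral_arclength) (intro continuous_intros F cws)
    also have "\<dots> = integral {0..2*pi} (\<lambda>\<theta>. F (cis \<theta>) * w (cis \<theta>))"
      by (intro integral_cong) (simp add: scaleR_conv_of_real re)
    finally show ?thesis .
  qed
  have main: "(\<integral>\<xi>. F \<xi> \<partial>\<mu>) = integral {0..2*pi} (\<lambda>\<theta>. F (cis \<theta>) * W (cis \<theta>))"
    if F: "continuous_on (sphere 0 1) F" for F :: "complex \<Rightarrow> complex"
  proof -
    have mc: "cnj \<in> measurable \<mu> \<mu>"
    proof -
      have "cnj \<in> measurable borel_circle borel_circle"
        unfolding borel_circle_def
        by (intro measurable_restrict_space2 measurable_restrict_space1)
           (auto simp: space_restrict_space intro!: borel_measurable_continuous_onI continuous_intros)
      then show ?thesis using sets measurable_cong_sets by blast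
    qed
    have Fc: "continuous_on (sphere 0 1) (\<lambda>\<xi>. F (cnj \<xi>))"
      by (rule continuous_on_compose2[OF F]) (auto intro!: continuous_intros)
    have "(\<integral>\<xi>. F \<xi> \<partial>\<mu>) = (\<integral>\<xi>. F \<xi> \<partial>distr \<mu> \<mu> cnj)" using sym by (simp add: conj_symmetric_def)
    also have "\<dots> = (\<integral>\<xi>. F (cnj \<xi>) \<partial>\<mu>)"
      by (rule integral_distr[OF mc circle_measurable_continuous[OF sets F]])
    also have "\<dots> = integral {0..2*pi} (\<lambda>\<theta>. F (cnj (cis \<theta>)) * w (cis \<theta>))" by (rule base[OF Fc])
    also have "\<dots> = integral {0..2*pi} (\<lambda>\<theta>. F (cnj (cis (2 * pi - \<theta>))) * w (cis (2 * pi - \<theta>)))"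
      by (rule integral_reflect_2pi[symmetric])
    also have "\<dots> = integral {0..2*pi} (\<lambda>\<theta>. F (cis \<theta>) * w (1 / cis \<theta>))"
    proof (intro integral_cong)
      fix \<theta> :: real
      have "cis (2 * pi - \<theta>) = cnj (cis \<theta>)" by (simp add: complex_eq_iff cos_diff sin_diff)
      then show "F (cnj (cis (2 * pi - \<theta>))) * w (cis (2 * pi - \<theta>)) = F (cis \<theta>) * w (1 / cis \<theta>)"
        by (simp add: cnj_inv)
    qed
    finally have s: "(\<integral>\<xi>. F \<xi> \<partial>\<mu>) = integral {0..2*pi} (\<lambda>\<theta>. F (cis \<theta>) * w (1 / cis \<theta>))" .
    have c1: "continuous_on UNIV (\<lambda>\<theta>. F (cis \<theta>) * w (cis \<theta>))"
      by (intro continuous_intros continuous_on_compose2[OF F] continuous_on_compose2[OF cws]) auto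
    have c2: "continuous_on UNIV (\<lambda>\<theta>. F (cis \<theta>) * w (1 / cis \<theta>))"
      by (intro continuous_intros continuous_on_compose2[OF F] continuous_on_compose2[OF cws]) (auto simp: norm_divide)
    have i1: "(\<lambda>\<theta>. F (cis \<theta>) * w (cis \<theta>)) integrable_on {0..2*pi}" "(\<lambda>\<theta>. F (cis \<theta>) * w (1 / cis \<theta>)) integrable_on {0..2*pi}"
      using c1 c2 continuous_on_subset integrable_continuous_interval by (metis subset_UNIV)+
    have "(\<integral>\<xi>. F \<xi> \<partial>\<mu>) = (integral {0..2*pi} (\<lambda>\<theta>. F (cis \<theta>) * w (cis \<theta>)) + integral {0..2*pi} (\<lambda>\<theta>. F (cis \<theta>) * w (1 / cis \<theta>))) / 2"
      using base[OF F] s by simp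
    also have "\<dots> = integral {0..2*pi} (\<lambda>\<theta>. F (cis \<theta>) * w (cis \<theta>) + F (cis \<theta>) * w (1 / cis \<theta>)) / 2"
      using integral_add[OF i1] by simp
    also have "\<dots> = integral {0..2*pi} (\<lambda>\<theta>. (F (cis \<theta>) * w (cis \<theta>) + F (cis \<theta>) * w (1 / cis \<theta>)) / 2)"
      by simp
    also have "\<dots> = integral {0..2*pi} (\<lambda>\<theta>. F (cis \<theta>) * W (cis \<theta>))"
      by (simp add: W_def field_simps)
    finally show ?thesis .
  qed
  show thesis
  proof (rule that[OF R hol])
    show "W (1 / z) = W z" if "z \<in> annulus R" for z by (simp add: W_def add.commute)
    show "Re (W z) > 0" if "z \<in> annulus R" for z
      using annV[OF that] annV[OF annulus_inverse[OF R that]] by (simp add: W_def V_def)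
    show "Im (W z) = 0" if "norm z = 1" for z
      using wpos(1)[of z] wpos(1)[of "1/z"] that by (simp add: W_def norm_divide)
  qed (use main in blast)
qed

section \<open>The Szego function\<close>

lemma contour_integral_circle_eq:
  "contour_integral (circlepath 0 r) f = integral {0..2*pi} (\<lambda>t. f (r * cis t) * r * \<i> * cis t)"
  using contour_integral_part_circlepath_eq[of 0 "2*pi" 0 r f] by (simp add: circlepath_def)

lemma cis_reflect: "cis (2 * pi - \<theta>) = 1 / cis \<theta>"
  by (simp add: cis_divide[symmetric])

lemma homotopic_circles_annulus:
  assumes "R > 1" "1 / R < r" "r \<le> s" "s < R"
  shows "homotopic_loops (annulus R) (circlepath 0 s) (circlepath 0 r)"
proof (rule homotopic_loops_linear)
  fix t :: real assume "t \<in> {0..1}"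
  have r0: "r > 0" using assms(1,2) by (meson divide_pos_pos less_trans zero_less_one)
  show "closed_segment (circlepath 0 s t) (circlepath 0 r t) \<subseteq> annulus R"
  proof
    fix z assume "z \<in> closed_segment (circlepath 0 s t) (circlepath 0 r t)"
    then obtain u where u: "0 \<le> u" "u \<le> 1" "z = (1 - u) *\<^sub>R circlepath 0 s t + u *\<^sub>R circlepath 0 r t"
      by (auto simp: closed_segment_def)
    then have "z = of_real ((1 - u) * s + u * r) * exp (2 * of_real pi * \<i> * of_real t)"
      by (simp add: circlepath scaleR_conv_of_real algebra_simps)
    moreover have "norm (exp (2 * of_real pi * \<i> * of_real t)) = 1" by (simp add: norm_exp_eq_Re)
    ultimately have nz: "norm z = \<bar>(1 - u) * s + u * r\<bar>" by (simp only: norm_mult norm_of_real) simp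
    have "(1 - u) * r + u * r \<le> (1 - u) * s + u * r" "(1 - u) * s + u * r \<le> (1 - u) * s + u * s"
      using u assms by (auto intro!: mult_left_mono)
    then have "r \<le> (1 - u) * s + u * r" "(1 - u) * s + u * r \<le> s" by (auto simp: algebra_simps)
    then show "z \<in> annulus R" using nz r0 assms by (auto simp: annulus_def)
  qed
qed auto

lemma cauchy_transform_holomorphic:
  assumes "continuous_on (sphere 0 r) f" "r > 0"
  shows "(\<lambda>z. contour_integral (circlepath 0 r) (\<lambda>u. f u / (u - z))) holomorphic_on ball 0 r"
proof -
  have c: "continuous_on (path_image (circlepath 0 r)) f" using assms by simp
  have int: "((\<lambda>u. f u / (u - w) ^ 1) has_contour_integral contour_integral (circlepath 0 r) (\<lambda>u. f u / (u - w))) (circlepath 0 r)"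
    if "w \<in> ball 0 r" for w
  proof -
    have "(\<lambda>u. f u / (u - w)) contour_integrable_on circlepath 0 r"
      by (rule contour_integrable_continuous_circlepath)
         (use assms that in \<open>auto intro!: continuous_intros\<close>)
    then show ?thesis by (simp add: has_contour_integral_integral)
  qed
  show ?thesis
    unfolding holomorphic_on_open[OF open_ball]
  proof
    fix w assume w: "w \<in> ball (0::complex) r"
    show "\<exists>f'. ((\<lambda>z. contour_integral (circlepath 0 r) (\<lambda>u. f u / (u - z))) has_field_derivative f') (at w)"
      by (rule exI, rule Cauchy_next_derivative_circlepath(2)[OF c int _ w]) auto
  qed
qed

text \<open>
  Cauchy's formula on the annulus writes \<open>l\<close> as the difference of an integral \<open>I\<close> over the outer circle,
  which is holomorphic in the disc, and an integral \<open>J\<close> over the inner one. By symmetry, the substitution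
  \<open>u \<mapsto> 1 / u\<close> carries \<open>J\<close> to \<open>I\<close>; the constant term is counted twice and is subtracted once.
\<close>

lemma laurent_split_symmetric:
  assumes R: "R > 1" and hol: "l holomorphic_on annulus R" and sym: "\<And>z. z \<in> annulus R \<Longrightarrow> l (1 / z) = l z"
  obtains S d where "S > 1" "S < R" "d holomorphic_on ball 0 S" "\<And>z. norm z = 1 \<Longrightarrow> l z = d z + d (1 / z) - d 0"
proof -
  define S where "S = (1 + R) / 2"
  have S: "S > 1" "S < R" using R by (auto simp: S_def)
  have S0: "S > 0" using S by simp
  have iS: "1 / R < 1 / S" "1 / S < 1" using S by (auto simp: frac_less2)
  have sphS: "z \<in> annulus R" if "norm z = S" for z using that S iS R by (auto simp: annulus_def field_simps intro: less_trans)
  have sphS': "z \<in> annulus R" if "norm z = 1 / S" for z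
  proof -
    have "1 / S < R" using iS R by linarith
    then show ?thesis using that iS by (simp add: annulus_def)
  qed
  have cl: "continuous_on (annulus R) l" using hol by (rule holomorphic_on_imp_continuous_on)
  have clS: "continuous_on (sphere 0 S) l" by (rule continuous_on_subset[OF cl]) (auto intro: sphS)
  have clS': "continuous_on (sphere 0 (1/S)) l" by (rule continuous_on_subset[OF cl]) (auto intro: sphS')
  define I where "I z = contour_integral (circlepath 0 S) (\<lambda>u. l u / (u - z))" for z
  define J where "J z = contour_integral (circlepath 0 (1/S)) (\<lambda>u. l u / (u - z))" for z
  have Ihol: "I holomorphic_on ball 0 S" unfolding I_def by (rule cauchy_transform_holomorphic[OF clS S0])
  have main: "2 * of_real pi * \<i> * l z = I z - J z" if z: "norm z = 1" for z
  proof -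
    define h where "h = (\<lambda>u. if u = z then deriv l z else (l u - l z) / (u - z))"
    have hh: "h holomorphic_on annulus R" unfolding h_def by (rule pole_lemma_open[OF hol open_annulus])
    have eqh: "contour_integral (circlepath 0 S) h = contour_integral (circlepath 0 (1/S)) h"
      by (rule Cauchy_theorem_homotopic_loops[OF homotopic_circles_annulus open_annulus hh])
         (use R S iS in \<open>auto intro: order.trans[of _ 1]\<close>)
    have ne1: "u \<noteq> z" if "norm u = S" for u using that z S by auto
    have ne2: "u \<noteq> z" if "norm u = 1 / S" for u using that z iS by auto
    have i1: "(\<lambda>u. l u / (u - z)) contour_integrable_on circlepath 0 S"
      by (rule contour_integrable_continuous_circlepath) (use S ne1 in \<open>auto intro!: continuous_intros clS\<close>)
    have i2: "(\<lambda>u. l u / (u - z)) contour_integrable_on circlepath 0 (1/S)"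
      by (rule contour_integrable_continuous_circlepath) (use S ne2 clS' in \<open>auto intro!: continuous_intros\<close>)
    have j1: "((\<lambda>u. 1 / (u - z)) has_contour_integral 2 * of_real pi * \<i> * 1) (circlepath 0 S)"
      by (rule Cauchy_integral_circlepath_simple) (use z S in auto)
    have j2: "((\<lambda>u. 1 / (u - z)) has_contour_integral 0) (circlepath 0 (1/S))"
      by (rule Cauchy_theorem_disc_simple[where a=0 and e=1])
         (use z iS S in \<open>auto intro!: holomorphic_intros simp: path_image_circlepath\<close>)
    have "contour_integral (circlepath 0 S) h = contour_integral (circlepath 0 S) (\<lambda>u. l u / (u - z) - l z * (1 / (u - z)))"
      by (rule contour_integral_eq) (use S ne1 in \<open>auto simp: h_def diff_divide_distrib\<close>)
    also have "\<dots> = I z - l z * (2 * of_real pi * \<i>)"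
      unfolding I_def using has_contour_integral_diff[OF has_contour_integral_integral[OF i1] has_contour_integral_lmul[OF j1, of "l z"]]
      by (intro contour_integral_unique) simp
    finally have e1: "contour_integral (circlepath 0 S) h = I z - l z * (2 * of_real pi * \<i>)" .
    have "contour_integral (circlepath 0 (1/S)) h = contour_integral (circlepath 0 (1/S)) (\<lambda>u. l u / (u - z) - l z * (1 / (u - z)))"
      by (rule contour_integral_eq) (use S ne2 in \<open>auto simp: h_def diff_divide_distrib norm_divide\<close>)
    also have "\<dots> = J z"
      unfolding J_def using has_contour_integral_diff[OF has_contour_integral_integral[OF i2] has_contour_integral_lmul[OF j2, of "l z"]]
      by (intro contour_integral_unique) simp
    finally have e2: "contour_integral (circlepath 0 (1/S)) h = J z" .
    show ?thesis using eqh e1 e2 by (simp add: algebra_simps)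
  qed
  have J: "J z = I 0 - I (1 / z)" if z: "norm z = 1" for z
  proof -
    have z0: "z \<noteq> 0" using z by auto
    define \<zeta> where "\<zeta> t = complex_of_real S * cis t" for t
    have nzt: "norm (\<zeta> t) = S" for t using S0 by (simp add: \<zeta>_def norm_mult)
    have zt0: "\<zeta> t \<noteq> 0" for t using nzt[of t] S0 by auto
    have zz: "1 - \<zeta> t * z \<noteq> 0" for t
    proof
      assume "1 - \<zeta> t * z = 0"
      then have "norm (\<zeta> t * z) = 1" by (metis eq_iff_diff_eq_0 norm_one)
      then show False using z S nzt by (simp add: norm_mult)
    qed
    have cont: "continuous_on UNIV (\<lambda>t. l (\<zeta> t))"
      by (rule continuous_on_compose2[OF clS]) (auto simp: nzt, auto simp: \<zeta>_def intro!: continuous_intros)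
    have contz: "continuous_on UNIV \<zeta>" unfolding \<zeta>_def by (intro continuous_intros)
    have "J z = integral {0..2*pi} (\<lambda>t. l (of_real (1/S) * cis t) / (of_real (1/S) * cis t - z) * of_real (1/S) * \<i> * cis t)"
      unfolding J_def contour_integral_circle_eq ..
    also have "\<dots> = integral {0..2*pi} (\<lambda>t. l (of_real (1/S) * cis (2*pi - t)) / (of_real (1/S) * cis (2*pi-t) - z) * of_real (1/S) * \<i> * cis (2*pi-t))"
      by (rule integral_reflect_2pi[symmetric])
    also have "\<dots> = integral {0..2*pi} (\<lambda>t. \<i> * l (\<zeta> t) - \<i> * l (\<zeta> t) * (\<zeta> t / (\<zeta> t - 1 / z)))"
    proof (intro integral_cong)
      fix t :: real
      have e: "of_real (1/S) * cis (2*pi - t) = 1 / \<zeta> t" by (simp add: cis_reflect \<zeta>_def)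
      have gen: "x / y * a * \<i> * c = \<i> * x * ((a * c) / y)" for x y a c :: complex by simp
      have "l (1 / \<zeta> t) = l (\<zeta> t)" by (rule sym[OF sphS[OF nzt]])
      then have "l (of_real (1/S) * cis (2*pi - t)) / (of_real (1/S) * cis (2*pi-t) - z) * of_real (1/S) * \<i> * cis (2*pi-t)
        = \<i> * l (\<zeta> t) * ((1 / \<zeta> t) / (1 / \<zeta> t - z))"
        unfolding gen e by simp
      also have "(1 / \<zeta> t) / (1 / \<zeta> t - z) = 1 / (1 - \<zeta> t * z)"
      proof -
        have "1 / \<zeta> t - z = (1 - \<zeta> t * z) / \<zeta> t" using zt0 by (simp add: field_simps)
        then show ?thesis using zt0 by simp
      qed
      also have "1 / (1 - \<zeta> t * z) = 1 - \<zeta> t / (\<zeta> t - 1 / z)"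
      proof -
        define e where "e = 1 - \<zeta> t * z"
        have e0: "e \<noteq> 0" and ze: "\<zeta> t * z = 1 - e" using zz[of t] by (auto simp: e_def)
        have "\<zeta> t - 1 / z = - (e / z)" using z0 by (simp add: e_def field_simps)
        then have "\<zeta> t / (\<zeta> t - 1 / z) = - ((\<zeta> t * z) / e)" using z0 by simp
        also have "\<dots> = 1 - 1 / e" unfolding ze using e0 by (simp add: field_simps)
        finally show ?thesis by (simp add: e_def)
      qed
      finally show "l (of_real (1/S) * cis (2*pi - t)) / (of_real (1/S) * cis (2*pi-t) - z) * of_real (1/S) * \<i> * cis (2*pi-t)
        = \<i> * l (\<zeta> t) - \<i> * l (\<zeta> t) * (\<zeta> t / (\<zeta> t - 1 / z))" by (simp add: algebra_simps)
    qed
    also have "\<dots> = integral {0..2*pi} (\<lambda>t. \<i> * l (\<zeta> t)) - integral {0..2*pi} (\<lambda>t. \<i> * l (\<zeta> t) * (\<zeta> t / (\<zeta> t - 1 / z)))"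
    proof (rule integral_diff)
      show "(\<lambda>t. \<i> * l (\<zeta> t)) integrable_on {0..2*pi}"
        by (intro integrable_continuous_interval continuous_intros continuous_on_subset[OF cont]) auto
      have "\<zeta> t - 1 / z \<noteq> 0" for t
        using zz[of t] z0 by (auto simp: field_simps)
      then show "(\<lambda>t. \<i> * l (\<zeta> t) * (\<zeta> t / (\<zeta> t - 1 / z))) integrable_on {0..2*pi}"
        by (intro integrable_continuous_interval continuous_intros continuous_on_subset[OF cont] continuous_on_subset[OF contz]) auto
    qed
    also have "integral {0..2*pi} (\<lambda>t. \<i> * l (\<zeta> t)) = I 0"
      unfolding I_def contour_integral_circle_eq using zt0
      by (intro integral_cong) (simp add: \<zeta>_def)
    also have "integral {0..2*pi} (\<lambda>t. \<i> * l (\<zeta> t) * (\<zeta> t / (\<zeta> t - 1 / z))) = I (1 / z)"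
      unfolding I_def contour_integral_circle_eq \<zeta>_def
      by (intro integral_cong) (simp add: mult_ac)
    finally show ?thesis .
  qed
  define d where "d z = I z / (2 * of_real pi * \<i>)" for z
  show thesis
  proof (rule that[of S d])
    show "d holomorphic_on ball 0 S" unfolding d_def using Ihol by (intro holomorphic_intros) auto
    fix z :: complex assume z: "norm z = 1"
    have "2 * of_real pi * \<i> * l z = I z + I (1 / z) - I 0" using main[OF z] J[OF z] by simp
    then have "l z = (I z + I (1 / z) - I 0) / (2 * of_real pi * \<i>)" by (simp add: field_simps)
    then show "l z = d z + d (1 / z) - d 0" by (simp add: d_def add_divide_distrib diff_divide_distrib)
  qed (use S in auto)
qed

text \<open>
  Exponentiating the splitting of \<open>Ln W\<close>, with half of the constant term in each factor, gives a
  factorization of the weight into functions that are zero-free inside and outside the disc.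
\<close>

lemma szego_function_exists:
  assumes R: "R > 1" and hol: "W holomorphic_on annulus R" and sym: "\<And>z. z \<in> annulus R \<Longrightarrow> W (1 / z) = W z"
    and pos: "\<And>z. z \<in> annulus R \<Longrightarrow> Re (W z) > 0"
  obtains S D where "S > 1" "D holomorphic_on ball 0 S" "\<And>z. D z \<noteq> 0" "\<And>z. norm z = 1 \<Longrightarrow> D z * D (1 / z) = W z"
proof -
  have hl: "(\<lambda>z. Ln (W z)) holomorphic_on annulus R"
    using pos by (intro holomorphic_on_Ln' hol) (fastforce simp: complex_nonpos_Reals_iff)
  obtain S d where S: "S > 1" "S < R" "d holomorphic_on ball 0 S" "\<And>z. norm z = 1 \<Longrightarrow> Ln (W z) = d z + d (1 / z) - d 0"
    using laurent_split_symmetric[OF R hl] sym by metis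
  define D where "D z = exp (d z - d 0 / 2)" for z
  show thesis
  proof (rule that[of S D])
    show "D holomorphic_on ball 0 S" unfolding D_def by (intro holomorphic_intros S)
    fix z :: complex assume z: "norm z = 1"
    have "D z * D (1 / z) = exp (d z + d (1 / z) - d 0)"
      unfolding D_def exp_add[symmetric] by (simp add: algebra_simps)
    also have "\<dots> = W z" using S(4)[OF z] pos[OF sphere_in_annulus[OF R z]] by (metis exp_Ln less_irrefl zero_complex.sel(1))
    finally show "D z * D (1 / z) = W z" .
  qed (use S in \<open>auto simp: D_def\<close>)
qed

section \<open>Coefficient bounds and reflected polynomials\<close>

lemma integral_cis_int:
  "m \<noteq> 0 \<Longrightarrow> ((\<lambda>\<theta>. cis (of_int m * \<theta>)) has_integral 0) {0..2*pi}"
proof -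
  assume m: "m \<noteq> (0::int)"
  define F where "F \<theta> = cis (of_int m * \<theta>) / (\<i> * of_int m)" for \<theta> :: real
  have "((\<lambda>\<theta>. cis (of_int m * \<theta>)) has_integral (F (2*pi) - F 0)) {0..2*pi}"
  proof (rule fundamental_theorem_of_calculus)
    fix x :: real
    show "(F has_vector_derivative cis (of_int m * x)) (at x within {0..2*pi})"
    proof -
      define c where "c = \<i> * complex_of_int m"
      have "c \<noteq> 0" using m by (simp add: c_def)
      then have "((\<lambda>z. exp (c * z) / c) has_field_derivative exp (c * of_real x)) (at (of_real x))"
        by (auto intro!: derivative_eq_intros)
      from has_vector_derivative_real_field[OF this] show ?thesis
        unfolding F_def cis_conv_exp c_def by (simp add: mult.assoc)
    qed
  qed simp
  moreover have "F (2*pi) = F 0"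
    using cis_multiple_2pi[of "of_int m"] by (simp add: F_def mult.commute mult.left_commute)
  ultimately show ?thesis by simp
qed

lemma fourier_coefficient_poly:
  assumes "k \<le> n"
  shows "((\<lambda>\<theta>. (\<Sum>j\<le>n. g j * cis \<theta> ^ j) * cnj (cis \<theta> ^ k)) has_integral (2 * of_real pi * g k)) {0..2*pi}"
proof -
  have e: "cis \<theta> ^ j * cnj (cis \<theta> ^ k) = cis (of_int (int j - int k) * \<theta>)" for \<theta> j
    unfolding complex_cnj_power cis_cnj Complex.DeMoivre cis_mult
    by (rule arg_cong[where f=cis]) (simp add: algebra_simps)
  have "((\<lambda>\<theta>. \<Sum>j\<le>n. g j * cis (of_int (int j - int k) * \<theta>)) has_integral (\<Sum>j\<le>n. g j * (if j = k then 2 * of_real pi else 0))) {0..2*pi}"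
  proof (intro has_integral_sum has_integral_mult_right)
    fix j assume "j \<in> {..n}"
    show "((\<lambda>\<theta>. cis (of_int (int j - int k) * \<theta>)) has_integral (if j = k then 2 * of_real pi else 0)) {0..2*pi}"
    proof (cases "j = k")
      case True
      have "((\<lambda>\<theta>::real. 1::complex) has_integral (of_real (2 * pi))) {0..2*pi}"
        using has_integral_const_real[of "1::complex" 0 "2*pi"] by (simp add: scaleR_conv_of_real)
      then show ?thesis using True by simp
    next
      case False
      then show ?thesis using integral_cis_int[of "int j - int k"] by simp
    qed
  qed simp
  moreover have "(\<Sum>j\<le>n. g j * (if j = k then 2 * of_real pi else 0)) = 2 * of_real pi * g k"
    using assms by (simp add: if_distrib cong: if_cong)
  moreover have "(\<Sum>j\<le>n. g j * cis \<theta> ^ j) * cnj (cis \<theta> ^ k) = (\<Sum>j\<le>n. g j * cis (of_int (int j - int k) * \<theta>))" for \<theta>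
    by (simp only: sum_distrib_right mult.assoc e)
  ultimately show ?thesis by simp
qed

text \<open>
  The pointwise inequality \<open>\<bar>G\<bar> \<le> r / 2 + \<bar>G\<bar>\<^sup>2 / (2 r)\<close> takes the place of the Cauchy-Schwarz inequality for
  integrals.
\<close>

lemma poly_coefficient_bound_circle:
  assumes k: "k \<le> n" and r: "r > 0"
    and int: "integral {0..2*pi} (\<lambda>\<theta>. (norm (\<Sum>j\<le>n. g j * cis \<theta> ^ j))\<^sup>2) \<le> B * r\<^sup>2"
  shows "norm (g k) \<le> (1/2 + B / (4 * pi)) * r"
proof -
  let ?G = "\<lambda>\<theta>. (\<Sum>j\<le>n. g j * cis \<theta> ^ j)"
  have cG: "continuous_on A ?G" for A by (intro continuous_intros)
  have "norm (2 * of_real pi * g k) = norm (integral {0..2*pi} (\<lambda>\<theta>. ?G \<theta> * cnj (cis \<theta> ^ k)))"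
    using integral_unique[OF fourier_coefficient_poly[OF k, of g]] by simp
  also have "\<dots> \<le> integral {0..2*pi} (\<lambda>\<theta>. r / 2 + (1 / (2 * r)) * (norm (?G \<theta>))\<^sup>2)"
  proof (rule integral_norm_bound_integral)
    show "(\<lambda>\<theta>. ?G \<theta> * cnj (cis \<theta> ^ k)) integrable_on {0..2*pi}"
      using fourier_coefficient_poly[OF k, of g] by (rule has_integral_integrable)
    show "(\<lambda>\<theta>. r / 2 + (1 / (2 * r)) * (norm (?G \<theta>))\<^sup>2) integrable_on {0..2*pi}"
      by (intro integrable_continuous_interval continuous_intros cG)
    fix \<theta> :: real
    have "0 \<le> (r - norm (?G \<theta>))\<^sup>2" by simp
    then have "2 * r * norm (?G \<theta>) \<le> r\<^sup>2 + (norm (?G \<theta>))\<^sup>2" by (simp add: power2_diff)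
    then have "norm (?G \<theta>) \<le> r / 2 + (1 / (2 * r)) * (norm (?G \<theta>))\<^sup>2"
      using r by (simp add: field_simps power2_eq_square)
    then show "norm (?G \<theta> * cnj (cis \<theta> ^ k)) \<le> r / 2 + (1 / (2 * r)) * (norm (?G \<theta>))\<^sup>2"
      by (simp add: norm_mult norm_power)
  qed
  also have "\<dots> = r / 2 * (2 * pi) + (1 / (2 * r)) * integral {0..2*pi} (\<lambda>\<theta>. (norm (?G \<theta>))\<^sup>2)"
    using r by (subst integral_add) (auto intro!: integrable_continuous_interval continuous_intros cG)
  also have "\<dots> \<le> r / 2 * (2 * pi) + (1 / (2 * r)) * (B * r\<^sup>2)"
    using int r by (intro add_left_mono mult_left_mono) auto
  also have "\<dots> = 2 * pi * ((1/2 + B / (4 * pi)) * r)"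
    using r by (simp add: field_simps power2_eq_square)
  finally show ?thesis by (simp add: norm_mult)
qed

lemma power_series_tail_bound:
  assumes hol: "T holomorphic_on ball 0 S" and R: "0 < R2" "R2 < S"
  obtains \<tau> B where "B \<ge> 0" 
    "\<And>n z q. 0 \<le> q \<Longrightarrow> q < 1 \<Longrightarrow> norm z \<le> q * R2 \<Longrightarrow> norm (T z - (\<Sum>k\<le>n. \<tau> k * z ^ k)) \<le> B * q ^ Suc n / (1 - q)"
proof -
  define \<tau> where "\<tau> k = (deriv ^^ k) T 0 / fact k" for k
  have sub: "cball 0 R2 \<subseteq> ball (0::complex) S" using R by auto
  have cont: "continuous_on (cball 0 R2) T"
    using hol sub by (meson continuous_on_subset holomorphic_on_imp_continuous_on)
  obtain B where B: "\<And>z. z \<in> cball 0 R2 \<Longrightarrow> norm (T z) \<le> B"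
    using compact_imp_bounded[OF compact_continuous_image[OF cont compact_cball]] unfolding bounded_iff by blast
  have "norm (T 0) \<le> B" using B[of 0] R by simp
  then have B0: "B \<ge> 0" using norm_ge_zero[of "T 0"] by linarith
  have \<tau>b: "norm (\<tau> k) \<le> B / R2 ^ k" for k
  proof -
    have "norm ((deriv ^^ k) T 0) \<le> fact k * B / R2 ^ k"
    proof (rule Cauchy_inequality[of T 0 R2 B k])
      show "T holomorphic_on ball 0 R2" using hol sub holomorphic_on_subset ball_subset_cball by blast
    qed (use cont R B in auto)
    then have "norm ((deriv ^^ k) T 0) / fact k \<le> (fact k * B / R2 ^ k) / fact k" by (rule divide_right_mono) simp
    then show ?thesis by (simp add: \<tau>_def norm_divide)
  qed
  show thesis
  proof (rule that[OF B0])
    fix n :: nat and z :: complex and q :: real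
    assume q: "0 \<le> q" "q < 1" and z: "norm z \<le> q * R2"
    have "norm z < S" using z q R by (smt (verit) mult_le_cancel_right1)
    then have sums: "(\<lambda>k. \<tau> k * z ^ k) sums T z"
      using holomorphic_power_series[OF hol, of z] by (simp add: \<tau>_def)
    have tb: "norm (\<tau> k * z ^ k) \<le> B * q ^ k" for k
    proof -
      have "norm (\<tau> k * z ^ k) \<le> (B / R2 ^ k) * (q * R2) ^ k"
        unfolding norm_mult norm_power by (intro mult_mono \<tau>b power_mono z) (use R B0 in auto)
      then show ?thesis using R by (simp add: power_mult_distrib)
    qed
    have "(\<lambda>k. \<tau> (k + Suc n) * z ^ (k + Suc n)) sums (T z - (\<Sum>k<Suc n. \<tau> k * z ^ k))"
      by (rule sums_split_initial_segment[OF sums])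
    then have s2: "(\<lambda>k. \<tau> (k + Suc n) * z ^ (k + Suc n)) sums (T z - (\<Sum>k\<le>n. \<tau> k * z ^ k))"
      by (simp add: lessThan_Suc_atMost)
    have geo: "(\<lambda>k. B * q ^ Suc n * q ^ k) sums (B * q ^ Suc n * (1 / (1 - q)))"
      by (intro sums_mult geometric_sums) (use q in auto)
    have "norm (T z - (\<Sum>k\<le>n. \<tau> k * z ^ k)) \<le> B * q ^ Suc n * (1 / (1 - q))"
    proof (rule norm_sums_le[OF s2 geo])
      fix k show "norm (\<tau> (k + Suc n) * z ^ (k + Suc n)) \<le> B * q ^ Suc n * q ^ k"
        using tb[of "k + Suc n"] by (simp only: power_add[of q] mult_ac)
    qed
    then show "norm (T z - (\<Sum>k\<le>n. \<tau> k * z ^ k)) \<le> B * q ^ Suc n / (1 - q)" by simp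
  qed
qed

text \<open>
  On the circle, reversal is \<open>\<xi> ^ n\<close> times the conjugate. The reversed polynomial is therefore orthogonal to
  \<open>\<xi> ^ k\<close> for \<open>1 \<le> k \<le> n\<close>, and these conditions determine it up to a factor.
\<close>

lemma reflected_orthogonal:
  assumes sets: "sets \<mu> = sets borel_circle" and ps: "prob_space \<mu>" and on: "orthonormal_polys \<mu> \<phi>"
  shows "k < n \<Longrightarrow> (\<integral>\<xi>. \<xi> ^ k * cnj (poly (complexify (\<phi> n)) \<xi>) \<partial>\<mu>) = 0"
    and "1 \<le> k \<Longrightarrow> k \<le> n \<Longrightarrow> (\<integral>\<xi>. poly (complexify (reflect_poly (\<phi> n))) \<xi> * cnj (\<xi> ^ k) \<partial>\<mu>) = 0"
    and "(\<integral>\<xi>. poly (complexify (reflect_poly (\<phi> n))) \<xi> * cnj (poly (complexify (reflect_poly (\<phi> n))) \<xi>) \<partial>\<mu>) = 1"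
proof -
  interpret toeplitz_orthonormal "circle_form \<mu>" \<phi> by (rule toeplitz_orthonormal_circle_form[OF sets ps on])
  have sp: "space \<mu> = sphere 0 1"
    using sets_eq_imp_space_eq[OF sets] by (simp add: borel_circle_def space_restrict_space)
  let ?e = "\<lambda>p. poly (complexify p)"
  have int: "integrable \<mu> (\<lambda>\<xi>. ?e p \<xi> * cnj (?e q \<xi>))" for p q
    by (rule continuous_on_circle_integrable[OF sets ps]) (intro continuous_intros)
  have inv: "\<xi> * cnj \<xi> = 1" if "\<xi> \<in> space \<mu>" for \<xi> using that by (simp add: sp complex_norm_square[symmetric])
  have o: "(\<integral>\<xi>. ?e (\<phi> i) \<xi> * cnj (?e (\<phi> j) \<xi>) \<partial>\<mu>) = (if i = j then 1 else 0)" for i j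
    using on by (simp add: orthonormal_polys_def)
  show *: "(\<integral>\<xi>. \<xi> ^ k * cnj (?e (\<phi> n) \<xi>) \<partial>\<mu>) = 0" if k: "k < n" for k n
  proof -
    obtain c where c: "monom 1 k = (\<Sum>i\<le>k. smult (c i) (\<phi> i))"
      using span_exists[of "monom 1 k" k] by (auto simp: degree_monom_eq)
    have "\<xi> ^ k = (\<Sum>i\<le>k. of_real (c i) * ?e (\<phi> i) \<xi>)" for \<xi>
    proof -
      have "\<xi> ^ k = ?e (monom 1 k) \<xi>" by (simp add: map_poly_monom poly_monom)
      also have "\<dots> = ?e (\<Sum>i\<le>k. smult (c i) (\<phi> i)) \<xi>" using c by simp
      also have "\<dots> = (\<Sum>i\<le>k. of_real (c i) * ?e (\<phi> i) \<xi>)"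
      proof -
        have "complexify (\<Sum>i\<in>A. smult (c i) (\<phi> i)) = (\<Sum>i\<in>A. smult (of_real (c i)) (complexify (\<phi> i)))" for A
          by (induction A rule: infinite_finite_induct) (auto simp: complexify_add complexify_smult)
        then show ?thesis by (simp add: poly_sum)
      qed
      finally show ?thesis .
    qed
    then have "(\<integral>\<xi>. \<xi> ^ k * cnj (?e (\<phi> n) \<xi>) \<partial>\<mu>) = (\<integral>\<xi>. (\<Sum>i\<le>k. of_real (c i) * (?e (\<phi> i) \<xi> * cnj (?e (\<phi> n) \<xi>))) \<partial>\<mu>)"
      by (simp add: sum_distrib_right mult.assoc)
    also have "\<dots> = (\<Sum>i\<le>k. of_real (c i) * (\<integral>\<xi>. ?e (\<phi> i) \<xi> * cnj (?e (\<phi> n) \<xi>) \<partial>\<mu>))"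
      by (subst Bochner_Integration.integral_sum) (auto intro: int)
    also have "\<dots> = 0" using k by (intro sum.neutral) (auto simp: o)
    finally show ?thesis .
  qed
  have r: "?e (reflect_poly (\<phi> n)) \<xi> = \<xi> ^ n * cnj (?e (\<phi> n) \<xi>)" if "\<xi> \<in> space \<mu>" for \<xi>
    using poly_reflect_at_circle[of "\<phi> n" n \<xi>] that degree_\<phi> by (simp add: sp reflect_at_degree)
  show "(\<integral>\<xi>. ?e (reflect_poly (\<phi> n)) \<xi> * cnj (\<xi> ^ k) \<partial>\<mu>) = 0" if k: "1 \<le> k" "k \<le> n"
  proof -
    have "(\<integral>\<xi>. ?e (reflect_poly (\<phi> n)) \<xi> * cnj (\<xi> ^ k) \<partial>\<mu>) = (\<integral>\<xi>. \<xi> ^ (n - k) * cnj (?e (\<phi> n) \<xi>) \<partial>\<mu>)"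
    proof (rule Bochner_Integration.integral_cong[OF refl])
      fix \<xi> assume x: "\<xi> \<in> space \<mu>"
      have "\<xi> ^ n * cnj (\<xi> ^ k) = \<xi> ^ (n - k) * (\<xi> * cnj \<xi>) ^ k"
        using k by (simp add: power_mult_distrib power_add[symmetric] mult.assoc[symmetric])
      also have "\<dots> = \<xi> ^ (n - k)" using inv[OF x] by simp
      finally show "?e (reflect_poly (\<phi> n)) \<xi> * cnj (\<xi> ^ k) = \<xi> ^ (n - k) * cnj (?e (\<phi> n) \<xi>)"
        unfolding r[OF x] by (metis mult.assoc mult.commute)
    qed
    also have "\<dots> = 0" by (rule *) (use k in auto)
    finally show ?thesis .
  qed
  have "(\<integral>\<xi>. ?e (reflect_poly (\<phi> n)) \<xi> * cnj (?e (reflect_poly (\<phi> n)) \<xi>) \<partial>\<mu>) = (\<integral>\<xi>. ?e (\<phi> n) \<xi> * cnj (?e (\<phi> n) \<xi>) \<partial>\<mu>)"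
  proof (rule Bochner_Integration.integral_cong[OF refl])
    fix \<xi> assume x: "\<xi> \<in> space \<mu>"
    have "\<xi> ^ n * cnj \<xi> ^ n = 1" using inv[OF x] by (metis power_mult_distrib power_one)
    moreover have "?e (reflect_poly (\<phi> n)) \<xi> * cnj (?e (reflect_poly (\<phi> n)) \<xi>) = (\<xi> ^ n * cnj \<xi> ^ n) * (?e (\<phi> n) \<xi> * cnj (?e (\<phi> n) \<xi>))"
      unfolding r[OF x] by simp
    ultimately show "?e (reflect_poly (\<phi> n)) \<xi> * cnj (?e (reflect_poly (\<phi> n)) \<xi>) = ?e (\<phi> n) \<xi> * cnj (?e (\<phi> n) \<xi>)" by simp
  qed
  then show "(\<integral>\<xi>. ?e (reflect_poly (\<phi> n)) \<xi> * cnj (?e (reflect_poly (\<phi> n)) \<xi>) \<partial>\<mu>) = 1"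
    by (simp add: o)
qed

section \<open>Exponentially accurate Szego asymptotics\<close>

text \<open>
  The function \<open>1 / D\<close> satisfies the orthogonality relations of the reversed polynomials, for every \<open>k \<ge> 1\<close>: multiplied by
  the weight it is \<open>D (1 / z)\<close> on the circle, which has only nonpositive frequencies.
\<close>

lemma szego_function_orthogonal:
  assumes S: "S > 1" and hol: "D holomorphic_on ball 0 S" and k: "k \<ge> 1"
    and D0: "\<And>z. D z \<noteq> 0" and DW: "\<And>z. norm z = 1 \<Longrightarrow> D z * D (1 / z) = W z"
  shows "integral {0..2*pi} (\<lambda>\<theta>. (1 / D (cis \<theta>) * cnj (cis \<theta> ^ k)) * W (cis \<theta>)) = 0"
proof -
  have "integral {0..2*pi} (\<lambda>\<theta>. (1 / D (cis \<theta>) * cnj (cis \<theta> ^ k)) * W (cis \<theta>)) =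
    integral {0..2*pi} (\<lambda>\<theta>. (1 / cis \<theta>) ^ k * D (1 / cis \<theta>))"
  proof (intro integral_cong)
    fix \<theta> :: real
    have "cnj (cis \<theta> ^ k) = (1 / cis \<theta>) ^ k" by (simp add: cis_cnj cis_divide[symmetric] flip: cis_inverse inverse_eq_divide)
    then show "(1 / D (cis \<theta>) * cnj (cis \<theta> ^ k)) * W (cis \<theta>) = (1 / cis \<theta>) ^ k * D (1 / cis \<theta>)"
      using DW[of "cis \<theta>"] D0[of "cis \<theta>"] by (simp flip: DW)
  qed
  also have "\<dots> = integral {0..2*pi} (\<lambda>\<theta>. cis \<theta> ^ k * D (cis \<theta>))"
    by (subst integral_reflect_2pi[symmetric]) (simp add: cis_reflect)
  also have "\<dots> = 0"
  proof -
    have "((\<lambda>u. u ^ (k - 1) * D u) has_contour_integral 0) (circlepath 0 1)"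
      by (rule Cauchy_theorem_disc_simple[where a=0 and e=S])
         (use S hol in \<open>auto intro!: holomorphic_intros\<close>)
    then have "contour_integral (circlepath 0 1) (\<lambda>u. u ^ (k - 1) * D u) = 0"
      by (rule contour_integral_unique)
    then have "integral {0..2*pi} (\<lambda>t. (of_real 1 * cis t) ^ (k - 1) * D (of_real 1 * cis t) * of_real 1 * \<i> * cis t) = 0"
      unfolding contour_integral_circle_eq .
    also have "(\<lambda>t. (of_real 1 * cis t) ^ (k - 1) * D (of_real 1 * cis t) * of_real 1 * \<i> * cis t) = (\<lambda>t. \<i> * (cis t ^ k * D (cis t)))"
    proof
      fix t :: real
      have "cis t ^ k = cis t ^ (k - 1) * cis t" using k by (metis Suc_diff_1 less_eq_Suc_le One_nat_def power_Suc2)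
      then show "(of_real 1 * cis t) ^ (k - 1) * D (of_real 1 * cis t) * of_real 1 * \<i> * cis t = \<i> * (cis t ^ k * D (cis t))"
        by (simp only: of_real_1 mult_1 mult_1_right mult_ac)
    qed
    finally show ?thesis by simp
  qed
  finally show ?thesis .
qed

text \<open>
  The multiple \<open>c\<close> is arbitrary because the speed of \<open>Q / P\<close>, for which this estimate is used, is invariant under a common
  factor of \<open>P\<close> and \<open>Q\<close>.
\<close>

abbreviation szego_close :: "real \<Rightarrow> (complex \<Rightarrow> complex) \<Rightarrow> real \<Rightarrow> complex \<Rightarrow> real poly \<Rightarrow> bool" where
  "szego_close R T e c Q \<equiv> \<forall>z\<in>ball 0 R. norm (c * poly (complexify (reflect_poly Q)) z - T z) \<le> e"

text \<open>
  Let \<open>E = T - c * ps\<close>, where \<open>ps\<close> is the reversed polynomial and \<open>c\<close> is the coefficient of the orthogonal projection of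
  \<open>T\<close> to it. Then \<open>E\<close> is orthogonal to \<open>ps\<close> and to \<open>z, \<dots>, z ^ n\<close>, hence to all polynomials of degree at
  most \<open>n\<close>, since \<open>ps\<close> has a nonzero constant term. In particular it is orthogonal to the
  difference \<open>G\<close> of \<open>c * ps\<close> and the Taylor polynomial of \<open>T\<close>. As \<open>E + G\<close> is the Taylor tail of \<open>T\<close>, Pythagoras
  bounds the norm of \<open>G\<close> by that of the tail, which is exponentially small. The coefficients of \<open>G\<close>
  inherit the bound \<open>r ^ n\<close>, and \<open>r R < 1\<close> makes it survive on the disc of radius \<open>R > 1\<close>.
\<close>

theorem szego_asymptotics:
  assumes sets: "sets \<mu> = sets borel_circle" and ps: "prob_space \<mu>" and sym: "conj_symmetric \<mu>"
    and ac: "absolutely_continuous arclength \<mu>" and hd: "has_nonvanishing_holomorphic_density \<mu>"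
  obtains R T C q where "R > 1" "0 < q" "q < 1" "C \<ge> 0" "T holomorphic_on ball 0 R" "\<And>z. T z \<noteq> 0"
    "\<And>\<phi> n. orthonormal_polys \<mu> \<phi> \<Longrightarrow> \<exists>c. szego_close R T (C * q ^ n) c (\<phi> n)"
proof -
  interpret P: prob_space \<mu> by fact
  have sp: "space \<mu> = sphere 0 1"
    using sets_eq_imp_space_eq[OF sets] by (simp add: borel_circle_def space_restrict_space)
  obtain R0 W where R0: "R0 > 1" "W holomorphic_on annulus R0"
    "\<And>z. z \<in> annulus R0 \<Longrightarrow> W (1 / z) = W z" "\<And>z. z \<in> annulus R0 \<Longrightarrow> Re (W z) > 0"
    and Wreal: "\<And>z. norm z = 1 \<Longrightarrow> Im (W z) = 0"
    and Wint: "\<And>F. continuous_on (sphere 0 1) F \<Longrightarrow> (\<integral>\<xi>. F \<xi> \<partial>\<mu>) = integral {0..2*pi} (\<lambda>\<theta>. F (cis \<theta>) * W (cis \<theta>))"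
    using symmetric_weight_on_annulus[OF assms] by blast
  obtain S D where S: "S > 1" and hD: "D holomorphic_on ball 0 S" and D0: "\<And>z. D z \<noteq> 0"
    and DW: "\<And>z. norm z = 1 \<Longrightarrow> D z * D (1 / z) = W z"
    using szego_function_exists[OF R0] by metis
  define T where "T z = 1 / D z" for z
  have hT: "T holomorphic_on ball 0 S" unfolding T_def using hD D0 by (intro holomorphic_intros) auto
  have T0: "T z \<noteq> 0" for z using D0 by (simp add: T_def)
  have cT: "continuous_on (sphere 0 1) T"
    by (rule continuous_on_subset[OF holomorphic_on_imp_continuous_on[OF hT]]) (use S in auto)
  define R2 where "R2 = (1 + S) / 2"
  have R2: "1 < R2" "R2 < S" using S by (auto simp: R2_def)
  define R where "R = (1 + R2) / 2"
  have R: "1 < R" "R < R2" using R2 by (auto simp: R_def)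
  define r where "r = 1 / R2"
  define q where "q = R / R2"
  have r: "0 < r" "r < 1" using R2 by (auto simp: r_def)
  have q: "0 < q" "q < 1" using R by (auto simp: q_def)
  have rR: "r * R = q" by (simp add: r_def q_def)
  have cW: "continuous_on (sphere 0 1) W"
    by (rule continuous_on_subset[OF holomorphic_on_imp_continuous_on[OF R0(2)]])
       (use sphere_in_annulus[OF R0(1)] in auto)
  obtain wmin where wmin: "wmin > 0" "\<And>z. norm z = 1 \<Longrightarrow> wmin \<le> Re (W z)"
  proof -
    have "continuous_on (sphere 0 1) (\<lambda>z. Re (W z))" using cW by (intro continuous_intros)
    then obtain x where "x \<in> sphere 0 1" "\<And>y. y \<in> sphere 0 1 \<Longrightarrow> Re (W x) \<le> Re (W y)"
      using continuous_attains_inf[of "sphere 0 (1::real)" "\<lambda>z. Re (W z)"] by (metis compact_sphere sphere_eq_empty not_one_less_zero)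
    then show thesis using that[of "Re (W x)"] R0(4) sphere_in_annulus[OF R0(1)] by auto
  qed
  obtain \<tau> B where B: "B \<ge> 0" and tail: "\<And>n z q. 0 \<le> q \<Longrightarrow> q < 1 \<Longrightarrow> norm z \<le> q * R2 \<Longrightarrow> norm (T z - (\<Sum>k\<le>n. \<tau> k * z ^ k)) \<le> B * q ^ Suc n / (1 - q)"
  proof -
    have "0 < R2" using R2 by simp
    show thesis by (rule power_series_tail_bound[OF hT \<open>0 < R2\<close> R2(2)]) (rule that)
  qed
  \<comment> \<open>On the unit circle the Taylor tail of \<open>T\<close> is at most \<open>C0 * r ^ n\<close>, and the
    coefficients of \<open>G\<close> turn out to be at most \<open>C1 * r ^ n\<close>.\<close>
  define C0 where "C0 = B * r / (1 - r)"
  have C0: "C0 \<ge> 0" using B r by (simp add: C0_def)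
  define C1 where "C1 = 1 / 2 + (C0\<^sup>2 / wmin) / (4 * pi)"
  have C1: "C1 \<ge> 0" using wmin by (simp add: C1_def)
  define C where "C = C1 * R / (R - 1) + B * q / (1 - q)"
  have C: "C \<ge> 0" using C1 R B q by (simp add: C_def)
  have Torth: "(\<integral>\<xi>. T \<xi> * cnj (\<xi> ^ k) \<partial>\<mu>) = 0" if k: "k \<ge> 1" for k
  proof -
    have "(\<integral>\<xi>. T \<xi> * cnj (\<xi> ^ k) \<partial>\<mu>) = integral {0..2*pi} (\<lambda>\<theta>. T (cis \<theta>) * cnj (cis \<theta> ^ k) * W (cis \<theta>))"
      by (rule Wint) (intro continuous_intros cT)
    also have "\<dots> = 0" unfolding T_def by (rule szego_function_orthogonal[OF S hD k D0 DW])
    finally show ?thesis .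
  qed
  have main: "\<exists>c. szego_close R T (C * q ^ n) c (\<phi> n)"
    if on: "orthonormal_polys \<mu> \<phi>" for \<phi> n
  proof -
    interpret toeplitz_orthonormal "circle_form \<mu>" \<phi> by (rule toeplitz_orthonormal_circle_form[OF sets ps on])
    define p where "p k = complex_of_real (coeff (reflect_poly (\<phi> n)) k)" for k
    define ps where "ps z = poly (complexify (reflect_poly (\<phi> n))) z" for z
    have degr: "degree (reflect_poly (\<phi> n)) \<le> n" using degree_reflect_poly_le[of "\<phi> n"] degree_\<phi>[of n] by simp
    have ps: "ps z = (\<Sum>k\<le>n. p k * z ^ k)" for z
      unfolding ps_def p_def by (rule poly_complexify_altdef[OF degr])
    have p0: "p 0 \<noteq> 0" using lead_\<phi>[of n] degree_\<phi>[of n] by (simp add: p_def)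
    note orth2 = reflected_orthogonal(2)[OF sets assms(2) on, where n=n, folded ps_def]
    note orth3 = reflected_orthogonal(3)[OF sets assms(2) on, where n=n, folded ps_def]
    have cps: "continuous_on A ps" for A unfolding ps_def by (intro continuous_intros)
    define c where "c = (\<integral>\<xi>. T \<xi> * cnj (ps \<xi>) \<partial>\<mu>)"
    define E where "E \<xi> = T \<xi> - c * ps \<xi>" for \<xi>
    define g where "g k = c * p k - \<tau> k" for k
    define G where "G \<xi> = (\<Sum>k\<le>n. g k * \<xi> ^ k)" for \<xi>
    have cE: "continuous_on (sphere 0 1) E" unfolding E_def by (intro continuous_intros cT cps)
    have cG: "continuous_on A G" for A unfolding G_def by (intro continuous_intros)
    note int = continuous_on_circle_integrable[OF sets assms(2)]
    have Ek: "(\<integral>\<xi>. E \<xi> * cnj (\<xi> ^ k) \<partial>\<mu>) = 0" if "1 \<le> k" "k \<le> n" for k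
    proof -
      have "(\<integral>\<xi>. E \<xi> * cnj (\<xi> ^ k) \<partial>\<mu>) = (\<integral>\<xi>. T \<xi> * cnj (\<xi> ^ k) - c * (ps \<xi> * cnj (\<xi> ^ k)) \<partial>\<mu>)"
        by (simp add: E_def left_diff_distrib mult.assoc)
      also have "\<dots> = (\<integral>\<xi>. T \<xi> * cnj (\<xi> ^ k) \<partial>\<mu>) - (\<integral>\<xi>. c * (ps \<xi> * cnj (\<xi> ^ k)) \<partial>\<mu>)"
        by (rule Bochner_Integration.integral_diff; rule int; intro continuous_intros cT cps)
      also have "\<dots> = 0" using Torth[OF that(1)] orth2[OF that] by (simp only: integral_mult_right_zero) simp
      finally show ?thesis .
    qed
    have Eps: "(\<integral>\<xi>. E \<xi> * cnj (ps \<xi>) \<partial>\<mu>) = 0"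
    proof -
      have "(\<integral>\<xi>. E \<xi> * cnj (ps \<xi>) \<partial>\<mu>) = (\<integral>\<xi>. T \<xi> * cnj (ps \<xi>) - c * (ps \<xi> * cnj (ps \<xi>)) \<partial>\<mu>)"
        by (simp add: E_def left_diff_distrib mult.assoc)
      also have "\<dots> = (\<integral>\<xi>. T \<xi> * cnj (ps \<xi>) \<partial>\<mu>) - (\<integral>\<xi>. c * (ps \<xi> * cnj (ps \<xi>)) \<partial>\<mu>)"
        by (rule Bochner_Integration.integral_diff; rule int; intro continuous_intros cT cps)
      also have "\<dots> = 0" using orth3 by (simp only: integral_mult_right_zero c_def) simp
      finally show ?thesis .
    qed
    have EG: "(\<integral>\<xi>. E \<xi> * cnj (G \<xi>) \<partial>\<mu>) = 0"
    proof -
      \<comment> \<open>Removing this multiple of \<open>ps\<close> from \<open>G\<close> kills the constant term; only the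
        frequencies \<open>1, \<dots>, n\<close> remain.\<close>
      define a where "a = g 0 / p 0"
      define h where "h k = g k - a * p k" for k
      have h0: "h 0 = 0" using p0 by (simp add: h_def a_def)
      have Gd: "G \<xi> = a * ps \<xi> + (\<Sum>k\<in>{1..n}. h k * \<xi> ^ k)" for \<xi>
      proof -
        have "(\<Sum>k\<in>{1..n}. h k * \<xi> ^ k) = (\<Sum>k\<le>n. h k * \<xi> ^ k)"
          by (rule sum.mono_neutral_left) (auto simp: h0 not_less_eq_eq le_Suc_eq)
        also have "\<dots> = G \<xi> - a * ps \<xi>"
          by (simp add: G_def ps h_def left_diff_distrib sum_subtractf sum_distrib_left mult.assoc)
        finally show ?thesis by simp
      qed
      have "(\<integral>\<xi>. E \<xi> * cnj (G \<xi>) \<partial>\<mu>) = (\<integral>\<xi>. cnj a * (E \<xi> * cnj (ps \<xi>)) + (\<Sum>k\<in>{1..n}. cnj (h k) * (E \<xi> * cnj (\<xi> ^ k))) \<partial>\<mu>)"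
        unfolding Gd by (simp add: distrib_left sum_distrib_left mult_ac)
      also have "\<dots> = (\<integral>\<xi>. cnj a * (E \<xi> * cnj (ps \<xi>)) \<partial>\<mu>) + (\<integral>\<xi>. (\<Sum>k\<in>{1..n}. cnj (h k) * (E \<xi> * cnj (\<xi> ^ k))) \<partial>\<mu>)"
        by (rule Bochner_Integration.integral_add; rule int; intro continuous_intros cE cps)
      also have "(\<integral>\<xi>. (\<Sum>k\<in>{1..n}. cnj (h k) * (E \<xi> * cnj (\<xi> ^ k))) \<partial>\<mu>) = (\<Sum>k\<in>{1..n}. (\<integral>\<xi>. cnj (h k) * (E \<xi> * cnj (\<xi> ^ k)) \<partial>\<mu>))"
        by (rule Bochner_Integration.integral_sum) (rule int, intro continuous_intros cE)
      also have "\<dots> = 0" by (rule sum.neutral) (use Ek in \<open>auto simp only: integral_mult_right_zero atLeastAtMost_iff mult_zero_right\<close>)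
      also have "(\<integral>\<xi>. cnj a * (E \<xi> * cnj (ps \<xi>)) \<partial>\<mu>) = 0" by (simp only: integral_mult_right_zero Eps mult_zero_right)
      finally show ?thesis by simp
    qed
    have tailc: "norm (E \<xi> + G \<xi>) \<le> C0 * r ^ n" if "\<xi> \<in> space \<mu>" for \<xi>
    proof -
      have "E \<xi> + G \<xi> = T \<xi> - (\<Sum>k\<le>n. \<tau> k * \<xi> ^ k)"
        by (simp add: E_def G_def g_def ps left_diff_distrib sum_subtractf sum_distrib_left mult.assoc)
      moreover have "norm \<xi> \<le> r * R2" using that R2 by (simp add: sp r_def)
      ultimately show ?thesis using tail[of r \<xi> n] r by (simp add: C0_def mult_ac)
    qed
    have normG: "(\<integral>\<xi>. (norm (G \<xi>))\<^sup>2 \<partial>\<mu>) \<le> C0\<^sup>2 * (r ^ n)\<^sup>2"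
    proof -
      have intr: "integrable \<mu> (\<lambda>\<xi>. (norm (f \<xi>))\<^sup>2)" if f: "continuous_on (sphere 0 1) f" for f :: "complex \<Rightarrow> complex"
      proof -
        have "integrable \<mu> (\<lambda>\<xi>. Re (complex_of_real ((norm (f \<xi>))\<^sup>2)))"
          by (rule integrable_Re, rule int) (intro continuous_intros f)
        then show ?thesis by simp
      qed
      have intEG: "integrable \<mu> (\<lambda>\<xi>. Re (E \<xi> * cnj (G \<xi>)))"
        by (rule integrable_Re, rule int) (intro continuous_intros cE cG)
      have cEG: "continuous_on (sphere 0 1) (\<lambda>\<xi>. E \<xi> + G \<xi>)" by (intro continuous_intros cE cG)
      have "(\<integral>\<xi>. (norm (G \<xi>))\<^sup>2 \<partial>\<mu>) \<le> (\<integral>\<xi>. (norm (E \<xi> + G \<xi>))\<^sup>2 - 2 * Re (E \<xi> * cnj (G \<xi>)) \<partial>\<mu>)"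
      proof (rule integral_mono)
        show "integrable \<mu> (\<lambda>\<xi>. (norm (E \<xi> + G \<xi>))\<^sup>2 - 2 * Re (E \<xi> * cnj (G \<xi>)))"
          by (intro Bochner_Integration.integrable_diff intr[OF cEG] integrable_mult_right intEG)
        fix \<xi>
        have "(norm (E \<xi> + G \<xi>))\<^sup>2 = (norm (E \<xi>))\<^sup>2 + (norm (G \<xi>))\<^sup>2 + 2 * Re (E \<xi> * cnj (G \<xi>))"
          by (simp add: cmod_power2) (simp add: power2_eq_square algebra_simps)
        then show "(norm (G \<xi>))\<^sup>2 \<le> (norm (E \<xi> + G \<xi>))\<^sup>2 - 2 * Re (E \<xi> * cnj (G \<xi>))" by simp
      qed (rule intr[OF cG])
      also have "\<dots> = (\<integral>\<xi>. (norm (E \<xi> + G \<xi>))\<^sup>2 \<partial>\<mu>) - (\<integral>\<xi>. 2 * Re (E \<xi> * cnj (G \<xi>)) \<partial>\<mu>)"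
        by (rule Bochner_Integration.integral_diff[OF intr[OF cEG] integrable_mult_right[OF intEG]])
      also have "(\<integral>\<xi>. 2 * Re (E \<xi> * cnj (G \<xi>)) \<partial>\<mu>) = 0"
      proof -
        have "(\<integral>\<xi>. Re (E \<xi> * cnj (G \<xi>)) \<partial>\<mu>) = Re (\<integral>\<xi>. E \<xi> * cnj (G \<xi>) \<partial>\<mu>)"
          by (rule integral_Re, rule int) (intro continuous_intros cE cG)
        then show ?thesis using EG by (simp only: integral_mult_right_zero) simp
      qed
      also have "(\<integral>\<xi>. (norm (E \<xi> + G \<xi>))\<^sup>2 \<partial>\<mu>) \<le> (\<integral>\<xi>. (C0 * r ^ n)\<^sup>2 \<partial>\<mu>)"
        by (rule integral_mono[OF intr[OF cEG]]) (use tailc in \<open>auto intro!: power_mono\<close>)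
      also have "\<dots> = C0\<^sup>2 * (r ^ n)\<^sup>2" by (simp add: P.prob_space power_mult_distrib)
      finally show ?thesis by simp
    qed
    have gk: "norm (g k) \<le> C1 * r ^ n" if k: "k \<le> n" for k
      unfolding C1_def
    proof (rule poly_coefficient_bound_circle[OF k])
      have cc: "continuous_on A (\<lambda>\<theta>. (norm (G (cis \<theta>)))\<^sup>2)" for A
        by (intro continuous_intros continuous_on_compose2[OF cG[of UNIV]]) auto
      have cWc: "continuous_on A (\<lambda>\<theta>. Re (W (cis \<theta>)))" for A
        by (intro continuous_intros continuous_on_compose2[OF cW]) auto
      have "wmin * integral {0..2*pi} (\<lambda>\<theta>. (norm (G (cis \<theta>)))\<^sup>2) = integral {0..2*pi} (\<lambda>\<theta>. wmin * (norm (G (cis \<theta>)))\<^sup>2)"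
        by simp
      also have "\<dots> \<le> integral {0..2*pi} (\<lambda>\<theta>. Re (W (cis \<theta>)) * (norm (G (cis \<theta>)))\<^sup>2)"
        by (rule integral_le)
           (use wmin in \<open>auto intro!: integrable_continuous_interval continuous_intros cc cWc mult_right_mono\<close>)
      also have "\<dots> = Re (integral {0..2*pi} (\<lambda>\<theta>. complex_of_real ((norm (G (cis \<theta>)))\<^sup>2) * W (cis \<theta>)))"
      proof -
        have "complex_of_real ((norm (G (cis \<theta>)))\<^sup>2) * W (cis \<theta>) = complex_of_real (Re (W (cis \<theta>)) * (norm (G (cis \<theta>)))\<^sup>2)" for \<theta>
          using Wreal[of "cis \<theta>"] by (simp add: complex_eq_iff del: of_real_power)
        then have e: "(\<lambda>\<theta>. complex_of_real ((norm (G (cis \<theta>)))\<^sup>2) * W (cis \<theta>)) = complex_of_real \<circ> (\<lambda>\<theta>. Re (W (cis \<theta>)) * (norm (G (cis \<theta>)))\<^sup>2)"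
          by (auto simp: fun_eq_iff)
        have "(\<lambda>\<theta>. Re (W (cis \<theta>)) * (norm (G (cis \<theta>)))\<^sup>2) integrable_on {0..2*pi}"
          by (intro integrable_continuous_interval continuous_intros cc cWc)
        then show ?thesis
          unfolding e by (subst integral_linear[OF _ bounded_linear_of_real]) simp_all
      qed
      also have "\<dots> = Re (\<integral>\<xi>. complex_of_real ((norm (G \<xi>))\<^sup>2) \<partial>\<mu>)"
        by (subst Wint) (auto intro!: continuous_intros cG)
      also have "\<dots> = (\<integral>\<xi>. (norm (G \<xi>))\<^sup>2 \<partial>\<mu>)" by (simp only: integral_complex_of_real Re_complex_of_real)
      finally have "wmin * integral {0..2*pi} (\<lambda>\<theta>. (norm (G (cis \<theta>)))\<^sup>2) \<le> C0\<^sup>2 * (r ^ n)\<^sup>2"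
        using normG by simp
      then show "integral {0..2*pi} (\<lambda>\<theta>. (norm (\<Sum>j\<le>n. g j * cis \<theta> ^ j))\<^sup>2) \<le> C0\<^sup>2 / wmin * (r ^ n)\<^sup>2"
        using wmin(1) by (simp add: G_def field_simps)
    qed (use r in simp)
    have "norm (c * ps z - T z) \<le> C * q ^ n" if z: "z \<in> ball 0 R" for z
    proof -
      have zR: "norm z \<le> R" using z by simp
      have "c * ps z - T z = G z - (T z - (\<Sum>k\<le>n. \<tau> k * z ^ k))"
        by (simp add: G_def g_def ps left_diff_distrib sum_subtractf sum_distrib_left mult.assoc)
      then have "norm (c * ps z - T z) \<le> norm (G z) + norm (T z - (\<Sum>k\<le>n. \<tau> k * z ^ k))"
        by (simp only: norm_triangle_ineq4)
      also have "norm (T z - (\<Sum>k\<le>n. \<tau> k * z ^ k)) \<le> B * q ^ Suc n / (1 - q)"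
        by (rule tail) (use q zR R2 R in \<open>auto simp: q_def\<close>)
      also have "norm (G z) \<le> C1 * R / (R - 1) * q ^ n"
      proof -
        have "norm (G z) \<le> (\<Sum>k\<le>n. C1 * r ^ n * R ^ k)"
          unfolding G_def
        proof (rule sum_norm_le)
          fix k assume k: "k \<in> {..n}"
          show "norm (g k * z ^ k) \<le> C1 * r ^ n * R ^ k"
            unfolding norm_mult norm_power
            by (intro mult_mono gk power_mono zR) (use k C1 r in auto)
        qed
        also have "\<dots> = C1 * r ^ n * (\<Sum>k<Suc n. R ^ k)" by (simp only: sum_distrib_left lessThan_Suc_atMost)
        also have "(\<Sum>k<Suc n. R ^ k) = (R ^ Suc n - 1) / (R - 1)" by (rule geometric_sum) (use R in auto)
        also have "C1 * r ^ n * ((R ^ Suc n - 1) / (R - 1)) \<le> C1 * r ^ n * (R ^ Suc n / (R - 1))"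
          by (intro mult_left_mono divide_right_mono) (use C1 r R in auto)
        also have "\<dots> = C1 * R / (R - 1) * q ^ n"
          by (simp add: rR[symmetric] power_mult_distrib)
        finally show ?thesis .
      qed
      finally show ?thesis by (simp add: C_def algebra_simps)
    qed
    then show ?thesis unfolding ps_def by blast
  qed
  have hTR: "T holomorphic_on ball 0 R" using hT R R2 by (auto intro: holomorphic_on_subset)
  show thesis by (rule that[of R q C T]) (fact R(1) q C hTR T0 main)+
qed

section \<open>Expansion of integrals with an analytic parameter\<close>

lemma power_le_exp: "x \<ge> 0 \<Longrightarrow> x ^ n \<le> fact n * exp (x::real)"
proof -
  assume x: "x \<ge> 0"
  have s: "(\<lambda>k. x ^ k / fact k) sums exp x" using exp_converges[of x] by (simp add: field_simps)
  have "(\<Sum>k\<in>{n}. x ^ k / fact k) \<le> exp x"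
    using s x by (metis (no_types, lifting) sum_le_suminf sums_iff finite.emptyI finite.insertI divide_nonneg_pos fact_gt_zero zero_le_power)
  then show ?thesis by (simp add: field_simps)
qed

lemma integrable_exp_poly_weight:
  "integrable lborel (\<lambda>t. indicator {0<..} t * (exp (- t) * (1 + t) ^ n :: real))"
proof (rule Bochner_Integration.integrable_bound)
  define K where "K = 2 ^ n * fact n * exp (1/2 :: real)"
  have K: "K \<ge> 0" by (simp add: K_def)
  have "(\<lambda>t. exp (- (1/2) * t)) integrable_on {0::real..}"
    by (rule integrable_on_exp_minus_to_infinity) simp
  then have "(\<lambda>t. exp (- (1/2) * t)) absolutely_integrable_on {0::real..}"
    by (rule nonnegative_absolutely_integrable_1) simp
  then have "integrable lebesgue (\<lambda>t. indicator {0..} t * exp (- (1/2) * t) :: real)"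
    by (simp add: set_integrable_def)
  then have "integrable lborel (\<lambda>t. indicator {0..} t * exp (- (1/2) * t) :: real)"
    by (subst (asm) integrable_completion) (auto intro!: borel_measurable_times borel_measurable_indicator)
  then show "integrable lborel (\<lambda>t. K * (indicator {0..} t * exp (- (1/2) * t) :: real))"
    by (rule integrable_mult_right)
  show "AE t in lborel. norm (indicator {0<..} t * (exp (- t) * (1 + t) ^ n :: real)) \<le> norm (K * (indicator {0..} t * exp (- (1/2) * t) :: real))"
  proof (rule AE_I2)
    fix t :: real
    show "norm (indicator {0<..} t * (exp (- t) * (1 + t) ^ n :: real)) \<le> norm (K * (indicator {0..} t * exp (- (1/2) * t) :: real))"
    proof (cases "t > 0")
      case True
      have "((1 + t) / 2) ^ n \<le> fact n * exp ((1 + t) / 2)" by (rule power_le_exp) (use True in simp)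
      then have "(1 + t) ^ n \<le> 2 ^ n * (fact n * exp ((1 + t) / 2))"
        by (simp add: power_divide field_simps)
      also have "\<dots> = K * exp (t / 2)" by (simp add: K_def add_divide_distrib exp_add)
      finally have "exp (- t) * (1 + t) ^ n \<le> exp (- t) * (K * exp (t / 2))" by (intro mult_left_mono) auto
      also have "\<dots> = K * exp (- (1/2) * t)" by (simp add: exp_add[symmetric])
      finally show ?thesis using True K by (simp add: abs_mult)
    qed simp
  qed
qed measurable

lemma power_scale: "(a * x / r) ^ p = (a / r) ^ p * (x::real) ^ p"
  by (metis power_mult_distrib times_divide_eq_left)

lemma taylor_coefficient_bound:
  assumes hol: "h holomorphic_on ball 0 \<rho>" and \<rho>: "\<rho> > 0" and bd: "\<And>z. z \<in> ball 0 \<rho> \<Longrightarrow> norm (h z) \<le> B"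
  shows "norm ((deriv ^^ p) h 0 / fact p) \<le> B * (2 / \<rho>) ^ p"
proof -
  have sub: "cball 0 (\<rho>/2) \<subseteq> ball (0::complex) \<rho>" using \<rho> by auto
  have "norm ((deriv ^^ p) h 0) \<le> fact p * B / (\<rho>/2) ^ p"
  proof (rule Cauchy_inequality[of h 0 "\<rho>/2" B p])
    show "h holomorphic_on ball 0 (\<rho>/2)" using hol sub holomorphic_on_subset ball_subset_cball by blast
    show "continuous_on (cball 0 (\<rho>/2)) h" using holomorphic_on_imp_continuous_on[OF hol] sub continuous_on_subset by blast
    show "norm (h x) \<le> B" if "norm (0 - x) = \<rho>/2" for x using bd that \<rho> by simp
  qed (use \<rho> in simp)
  then have "norm ((deriv ^^ p) h 0) / fact p \<le> (fact p * B / (\<rho>/2) ^ p) / fact p" by (rule divide_right_mono) simp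
  then show ?thesis using \<rho> by (simp add: norm_divide power_divide)
qed

text \<open>
  The bound holds on the whole disc, also near its boundary where the Taylor polynomial may be
  large: there \<open>4 * norm z / \<rho> > 1\<close>, and the right-hand side dominates every single term. A cruder
  constant is the price for not having to treat the two ranges separately later.
\<close>

lemma taylor_remainder_bound:
  assumes hol: "h holomorphic_on ball 0 \<rho>" and \<rho>: "\<rho> > 0" and bd: "\<And>z. z \<in> ball 0 \<rho> \<Longrightarrow> norm (h z) \<le> B"
    and z: "z \<in> ball 0 \<rho>"
  shows "norm (h z - (\<Sum>p<N. (deriv ^^ p) h 0 / fact p * z ^ p)) \<le> B * (real N + 2) * (4 * norm z / \<rho>) ^ N"
proof -
  define a where "a p = (deriv ^^ p) h 0 / fact p" for p
  have "norm (h 0) \<le> B" using bd \<rho> by simp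
  then have B: "B \<ge> 0" using norm_ge_zero[of "h 0"] by linarith
  define x where "x = 2 * norm z / \<rho>"
  have x0: "x \<ge> 0" using \<rho> by (simp add: x_def)
  have ab: "norm (a p * z ^ p) \<le> B * x ^ p" for p
  proof -
    have "norm (a p * z ^ p) \<le> (B * (2 / \<rho>) ^ p) * norm z ^ p"
      unfolding norm_mult norm_power a_def
      by (intro mult_right_mono taylor_coefficient_bound[OF hol \<rho> bd]) auto
    then show ?thesis by (simp add: x_def power_mult_distrib power_divide)
  qed
  have x4: "4 * norm z / \<rho> = 2 * x" by (simp add: x_def)
  have "norm (h z - (\<Sum>p<N. a p * z ^ p)) \<le> B * (real N + 2) * (2 * x) ^ N"
  proof (cases "x \<le> 1/2")
    case True
    have "(\<lambda>p. a p * z ^ p) sums h z" using holomorphic_power_series[OF hol z] by (simp add: a_def)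
    then have s1: "(\<lambda>p. a (p + N) * z ^ (p + N)) sums (h z - (\<Sum>p<N. a p * z ^ p))"
      by (rule sums_split_initial_segment)
    have s2: "(\<lambda>p. B * x ^ N * x ^ p) sums (B * x ^ N * (1 / (1 - x)))"
      by (intro sums_mult geometric_sums) (use True x0 in auto)
    have "norm (h z - (\<Sum>p<N. a p * z ^ p)) \<le> B * x ^ N * (1 / (1 - x))"
    proof (rule norm_sums_le[OF s1 s2])
      fix p show "norm (a (p + N) * z ^ (p + N)) \<le> B * x ^ N * x ^ p"
        using ab[of "p + N"] by (simp only: power_add[of x] mult_ac)
    qed
    also have "\<dots> \<le> B * x ^ N * 2" by (intro mult_left_mono) (use True B x0 in \<open>auto simp: field_simps\<close>)
    also have "\<dots> = B * 2 * x ^ N" by simp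
    also have "\<dots> \<le> B * (real N + 2) * (2 * x) ^ N"
      by (intro mult_mono power_mono) (use B x0 in auto)
    finally show ?thesis .
  next
    case False
    have pw: "x ^ p \<le> (2 * x) ^ N" if "p \<le> N" for p
    proof -
      have "x ^ p \<le> (2 * x) ^ p" by (intro power_mono) (use x0 in auto)
      also have "\<dots> \<le> (2 * x) ^ N" by (intro power_increasing that) (use False in auto)
      finally show ?thesis .
    qed
    have "norm (h z - (\<Sum>p<N. a p * z ^ p)) \<le> norm (h z) + norm (\<Sum>p<N. a p * z ^ p)" by (rule norm_triangle_ineq4)
    also have "norm (\<Sum>p<N. a p * z ^ p) \<le> (\<Sum>p<N. B * (2 * x) ^ N)"
      by (rule sum_norm_le, rule order_trans[OF ab]) (use B pw in \<open>auto intro!: mult_left_mono\<close>)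
    also have "norm (h z) \<le> B * (2 * x) ^ N"
      using bd[OF z] pw[of 0] B mult_left_mono[of 1 "(2*x)^N" B] by auto
    finally have "norm (h z - (\<Sum>p<N. a p * z ^ p)) \<le> B * (2 * x) ^ N + real N * (B * (2 * x) ^ N)" by simp
    also have "\<dots> \<le> B * (real N + 2) * (2 * x) ^ N"
    proof -
      have "0 \<le> B * (2 * x) ^ N" using B x0 by simp
      then show ?thesis by (simp add: algebra_simps)
    qed
    finally show ?thesis .
  qed
  then show ?thesis unfolding x4 a_def .
qed

text \<open>
  The integrand may be expanded in \<open>\<epsilon>\<close> although the discs of holomorphy shrink with \<open>t\<close>: a
  remainder of order \<open>N\<close> costs a factor \<open>(1 + t) ^ N\<close>, which the exponential decay pays for. The part
  \<open>t \<ge> \<delta> / \<epsilon>\<close> of the coefficient integrals obeys the same bound, because \<open>\<epsilon> (1 + t) / \<delta> \<ge> 1\<close> there.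
\<close>

theorem integral_asymptotic_expansion:
  fixes D :: "real \<Rightarrow> complex \<Rightarrow> complex"
  assumes \<delta>: "0 < \<delta>" "\<delta> < r" and C: "C \<ge> 0"
    and hol: "\<And>t. t > 0 \<Longrightarrow> D t holomorphic_on ball 0 (r / (1 + t))"
    and bd: "\<And>t z. t > 0 \<Longrightarrow> z \<in> ball 0 (r / (1 + t)) \<Longrightarrow> norm (D t z) \<le> C * exp (- t)"
    and meas: "\<And>\<epsilon>. 0 \<le> \<epsilon> \<Longrightarrow> (\<lambda>t. indicator {t. 0 < t \<and> \<epsilon> * (1 + t) < r} t *\<^sub>R D t (of_real \<epsilon>)) \<in> borel_measurable borel"
  shows "\<exists>K. \<forall>\<epsilon>. 0 < \<epsilon> \<longrightarrow> \<epsilon> < r - \<delta> \<longrightarrow>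
       norm ((\<integral>t. indicator {0<..<\<delta> / \<epsilon>} t *\<^sub>R D t (of_real \<epsilon>) \<partial>lborel) -
         (\<Sum>p<N. (\<integral>t. indicator {0<..} t *\<^sub>R ((deriv ^^ p) (D t) 0 / fact p) \<partial>lborel) * of_real \<epsilon> ^ p)) \<le> K * \<epsilon> ^ N"
proof -
  have r: "r > 0" using \<delta> by simp
  define d where "d p t = (deriv ^^ p) (D t) 0 / fact p" for p t
  have inball: "complex_of_real \<epsilon> \<in> ball 0 (r / (1 + t)) \<longleftrightarrow> \<epsilon> * (1 + t) < r" if "t > 0" "\<epsilon> \<ge> 0" for t \<epsilon>
    using that by (simp add: field_simps)
  have rt: "r / (1 + t) > 0" if "t > 0" for t using that r by simp
  have dbd: "norm (d p t) \<le> C * exp (- t) * (2 * (1 + t) / r) ^ p" if "t > 0" for p t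
    using taylor_coefficient_bound[OF hol[OF that] rt[OF that] bd[OF that], of p] by (simp add: d_def)
  have rem: "norm (D t (of_real \<epsilon>) - (\<Sum>p<N. d p t * of_real \<epsilon> ^ p)) \<le> C * exp (- t) * (real N + 2) * (4 * \<epsilon> * (1 + t) / r) ^ N"
    if "t > 0" "\<epsilon> \<ge> 0" "\<epsilon> * (1 + t) < r" for t \<epsilon> N
  proof -
    have "complex_of_real \<epsilon> \<in> ball 0 (r / (1 + t))" using inball that by simp
    from taylor_remainder_bound[OF hol[OF that(1)] rt[OF that(1)] bd[OF that(1)] this, of N]
    show ?thesis using that by (simp add: d_def)
  qed
  \<comment> \<open>The coefficients are limits of difference quotients along \<open>\<epsilon> = 1 / (k + 1)\<close>, so they
    inherit measurability from the integrand.\<close>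
  have dmeas: "(\<lambda>t. indicator {0<..} t *\<^sub>R d p t) \<in> borel_measurable borel" for p
  proof (induction p rule: less_induct)
    case (less p)
    define e where "e k = inverse (real (Suc k))" for k
    have e0: "e k > 0" for k by (simp add: e_def)
    have elim: "e \<longlonglongrightarrow> 0" unfolding e_def by (rule LIMSEQ_inverse_real_of_nat)
    define s where "s k t = (indicator {t. 0 < t \<and> e k * (1 + t) < r} t *\<^sub>R D t (of_real (e k)) -
        (\<Sum>j<p. (indicator {0<..} t *\<^sub>R d j t) * of_real (e k) ^ j)) / of_real (e k) ^ p" for k t
    show ?case
    proof (rule borel_measurable_LIMSEQ_metric)
      fix k
      have m1: "(\<lambda>t. indicator {t. 0 < t \<and> e k * (1 + t) < r} t *\<^sub>R D t (of_real (e k))) \<in> borel_measurable borel"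
        by (rule meas) (use e0[of k] in simp)
      have m2: "(\<lambda>t. \<Sum>j<p. (indicator {0<..} t *\<^sub>R d j t) * of_real (e k) ^ j) \<in> borel_measurable borel"
      proof (rule borel_measurable_sum)
        fix j assume "j \<in> {..<p}"
        then have "(\<lambda>t. indicator {0<..} t *\<^sub>R d j t) \<in> borel_measurable borel" using less by simp
        then show "(\<lambda>t. (indicator {0<..} t *\<^sub>R d j t) * of_real (e k) ^ j) \<in> borel_measurable borel"
          by (intro borel_measurable_times borel_measurable_const)
      qed
      show "s k \<in> borel_measurable borel"
        unfolding s_def by (intro borel_measurable_divide borel_measurable_diff m1 m2 borel_measurable_const)
    next
      fix t :: real
      show "(\<lambda>k. s k t) \<longlonglongrightarrow> indicator {0<..} t *\<^sub>R d p t"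
      proof (cases "t > 0")
        case False
        then have "s k t = 0" for k by (simp add: s_def)
        then show ?thesis using False by simp
      next
        case t: True
        define K where "K = C * exp (- t) * (real (Suc p) + 2) * (4 * (1 + t) / r) ^ Suc p"
        have "eventually (\<lambda>k. e k < r / (1 + t)) sequentially"
          using order_tendstoD(2)[OF elim rt[OF t]] .
        then have ev: "eventually (\<lambda>k. norm (s k t - d p t) \<le> K * e k) sequentially"
        proof eventually_elim
          case (elim k)
          then have ek: "e k * (1 + t) < r" using t by (simp add: field_simps)
          have "s k t - d p t = (D t (of_real (e k)) - (\<Sum>j<Suc p. d j t * of_real (e k) ^ j)) / of_real (e k) ^ p"
            using t ek e0[of k] by (simp add: s_def field_simps)
          then have "norm (s k t - d p t) = norm (D t (of_real (e k)) - (\<Sum>j<Suc p. d j t * of_real (e k) ^ j)) / e k ^ p"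
            using e0[of k] by (simp add: norm_divide norm_power)
          also have "\<dots> \<le> (C * exp (- t) * (real (Suc p) + 2) * (4 * e k * (1 + t) / r) ^ Suc p) / e k ^ p"
            by (intro divide_right_mono rem) (use t ek e0[of k] in auto)
          also have "(4 * e k * (1 + t) / r) ^ Suc p = (4 * (1 + t) / r) ^ Suc p * (e k * e k ^ p)"
          proof -
            have "4 * e k * (1 + t) / r = (4 * (1 + t) / r) * e k" by simp
            then show ?thesis by (simp only: power_mult_distrib power_Suc[of "e k"])
          qed
          also have "C * exp (- t) * (real (Suc p) + 2) * ((4 * (1 + t) / r) ^ Suc p * (e k * e k ^ p)) / e k ^ p = K * e k"
            using e0[of k] by (simp add: K_def)
          finally show ?case .
        qed
        have "(\<lambda>k. s k t - d p t) \<longlonglongrightarrow> 0"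
          by (rule Lim_null_comparison[OF ev]) (use tendsto_mult_right_zero[OF elim, of K] in simp)
        then show ?thesis using t by (simp add: LIM_zero_iff)
      qed
    qed
  qed
  let ?w = "\<lambda>n t. indicator {0<..} t * (exp (- t) * (1 + t) ^ n :: real)"
  have dint: "integrable lborel (\<lambda>t. indicator {0<..} t *\<^sub>R d p t)" for p
  proof (rule Bochner_Integration.integrable_bound[OF integrable_mult_right[OF integrable_exp_poly_weight[of p], of "C * (2 / r) ^ p"]])
    show "AE t in lborel. norm (indicator {0<..} t *\<^sub>R d p t) \<le> norm (C * (2 / r) ^ p * ?w p t)"
    proof (rule AE_I2)
      fix t :: real
      show "norm (indicator {0<..} t *\<^sub>R d p t) \<le> norm (C * (2 / r) ^ p * ?w p t)"
      proof (cases "t > 0")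
        case True
        have "norm (d p t) \<le> C * exp (- t) * (2 * (1 + t) / r) ^ p" by (rule dbd[OF True])
        also have "\<dots> = C * (2 / r) ^ p * (exp (- t) * (1 + t) ^ p)" unfolding power_scale by (simp only: mult_ac)
        finally show ?thesis using True C r by (simp add: abs_mult)
      qed simp
    qed
  qed (use dmeas in auto)
  define c where "c p = (\<integral>t. indicator {0<..} t *\<^sub>R d p t \<partial>lborel)" for p
  have "\<exists>K. \<forall>\<epsilon>. 0 < \<epsilon> \<longrightarrow> \<epsilon> < r - \<delta> \<longrightarrow>
       norm ((\<integral>t. indicator {0<..<\<delta> / \<epsilon>} t *\<^sub>R D t (of_real \<epsilon>) \<partial>lborel) - (\<Sum>p<N. c p * of_real \<epsilon> ^ p)) \<le> K * \<epsilon> ^ N"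
  proof -
    define K0 where "K0 = C * (real N + 2) * (4 / \<delta>) ^ N"
    have K0: "K0 \<ge> 0" using C \<delta> by (simp add: K0_def)
    define K where "K = K0 * (\<integral>t. ?w N t \<partial>lborel)"
    show "\<exists>K. \<forall>\<epsilon>. 0 < \<epsilon> \<longrightarrow> \<epsilon> < r - \<delta> \<longrightarrow>
       norm ((\<integral>t. indicator {0<..<\<delta> / \<epsilon>} t *\<^sub>R D t (of_real \<epsilon>) \<partial>lborel) - (\<Sum>p<N. c p * of_real \<epsilon> ^ p)) \<le> K * \<epsilon> ^ N"
    proof (rule exI[of _ K], intro allI impI)
      fix \<epsilon> :: real assume \<epsilon>: "0 < \<epsilon>" "\<epsilon> < r - \<delta>"
      have small: "\<epsilon> * (1 + t) < r" if "t < \<delta> / \<epsilon>" for t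
      proof -
        have "\<epsilon> * t < \<delta>" using that \<epsilon> by (simp add: field_simps)
        then show ?thesis using \<epsilon> by (simp add: algebra_simps)
      qed
      have DM: "(\<lambda>t. indicator {0<..<\<delta> / \<epsilon>} t *\<^sub>R D t (of_real \<epsilon>)) \<in> borel_measurable borel"
      proof -
        have eq: "(\<lambda>t. indicator {0<..<\<delta> / \<epsilon>} t *\<^sub>R D t (of_real \<epsilon>)) =
          (\<lambda>t. indicator {0<..<\<delta> / \<epsilon>} t *\<^sub>R (indicator {t. 0 < t \<and> \<epsilon> * (1 + t) < r} t *\<^sub>R D t (of_real \<epsilon>)))"
          using small by (auto simp: fun_eq_iff indicator_def)
        show ?thesis
          by (subst eq, intro borel_measurable_scaleR borel_measurable_indicator meas) (use \<epsilon> in auto)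
      qed
      have DI: "integrable lborel (\<lambda>t. indicator {0<..<\<delta> / \<epsilon>} t *\<^sub>R D t (of_real \<epsilon>))"
      proof (rule Bochner_Integration.integrable_bound[OF integrable_mult_right[OF integrable_exp_poly_weight[of 0], of C]])
        show "AE t in lborel. norm (indicator {0<..<\<delta> / \<epsilon>} t *\<^sub>R D t (of_real \<epsilon>)) \<le> norm (C * ?w 0 t)"
        proof (rule AE_I2)
          fix t :: real
          show "norm (indicator {0<..<\<delta> / \<epsilon>} t *\<^sub>R D t (of_real \<epsilon>)) \<le> norm (C * ?w 0 t)"
          proof (cases "0 < t \<and> t < \<delta> / \<epsilon>")
            case True
            then have "norm (D t (of_real \<epsilon>)) \<le> C * exp (- t)" by (intro bd) (use inball small \<epsilon> in auto)
            then show ?thesis using True C by (simp add: abs_mult)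
          qed auto
        qed
      qed (use DM in auto)
      have bound: "norm (indicator {0<..<\<delta> / \<epsilon>} t *\<^sub>R D t (of_real \<epsilon>) - (\<Sum>p<N. (indicator {0<..} t *\<^sub>R d p t) * of_real \<epsilon> ^ p)) \<le> K0 * \<epsilon> ^ N * ?w N t" for t
      proof -
        consider "t \<le> 0" | "0 < t" "t < \<delta> / \<epsilon>" | "0 < t" "\<delta> / \<epsilon> \<le> t" by linarith
        then show ?thesis
        proof cases
          case 1 then show ?thesis by simp
        next
          case 2
          have "norm (D t (of_real \<epsilon>) - (\<Sum>p<N. d p t * of_real \<epsilon> ^ p)) \<le> C * exp (- t) * (real N + 2) * (4 * \<epsilon> * (1 + t) / r) ^ N"
            by (rule rem) (use 2 \<epsilon> small in auto)
          also have "\<dots> \<le> C * exp (- t) * (real N + 2) * (4 * \<epsilon> * (1 + t) / \<delta>) ^ N"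
            by (intro mult_left_mono power_mono divide_left_mono) (use 2 \<epsilon> C \<delta> r in auto)
          also have "\<dots> = K0 * \<epsilon> ^ N * (exp (- t) * (1 + t) ^ N)"
            unfolding K0_def mult.assoc[of 4] power_scale power_mult_distrib[of \<epsilon>] by (simp only: mult_ac)
          finally show ?thesis using 2 by simp
        next
          case 3
          \<comment> \<open>Beyond \<open>\<delta> / \<epsilon>\<close> there is no integrand, and the Taylor terms alone have to
            be bounded.\<close>
          define y where "y = (1 + t) * \<epsilon> / \<delta>"
          have "\<delta> \<le> \<epsilon> * t" using 3 \<epsilon> by (simp add: field_simps)
          then have y: "y \<ge> 1" using 3 \<epsilon> \<delta> by (simp add: y_def field_simps)
          have tm: "norm (d p t * of_real \<epsilon> ^ p) \<le> C * exp (- t) * (4 * y) ^ N" if "p < N" for p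
          proof -
            have "norm (d p t * of_real \<epsilon> ^ p) \<le> (C * exp (- t) * (2 * (1 + t) / r) ^ p) * \<epsilon> ^ p"
              unfolding norm_mult norm_power by (intro mult_mono dbd) (use 3 \<epsilon> C r in auto)
            also have "\<dots> = C * exp (- t) * (2 * (1 + t) * \<epsilon> / r) ^ p"
              unfolding mult.assoc[of 2] power_scale power_mult_distrib[of "1 + t"] by (simp only: mult_ac)
            also have "\<dots> \<le> C * exp (- t) * (2 * (1 + t) * \<epsilon> / \<delta>) ^ p"
              by (intro mult_left_mono power_mono divide_left_mono) (use 3 \<epsilon> C \<delta> r in auto)
            also have "2 * (1 + t) * \<epsilon> / \<delta> = 2 * y" by (simp add: y_def)
            also have "C * exp (- t) * (2 * y) ^ p \<le> C * exp (- t) * (2 * y) ^ N"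
              by (intro mult_left_mono power_increasing) (use that y C in auto)
            also have "\<dots> \<le> C * exp (- t) * (4 * y) ^ N"
              by (intro mult_left_mono power_mono) (use y C in auto)
            finally show ?thesis .
          qed
          have "norm (\<Sum>p<N. d p t * of_real \<epsilon> ^ p) \<le> (\<Sum>p<N. C * exp (- t) * (4 * y) ^ N)"
            by (rule sum_norm_le) (use tm in auto)
          also have "\<dots> = real N * (C * exp (- t) * (4 * y) ^ N)" by simp
          also have "\<dots> \<le> (real N + 2) * (C * exp (- t) * (4 * y) ^ N)"
            by (intro mult_right_mono) (use C y in auto)
          also have "\<dots> = K0 * \<epsilon> ^ N * (exp (- t) * (1 + t) ^ N)"
          proof -
            have "4 * y = 4 * (\<epsilon> * (1 + t)) / \<delta>" by (simp add: y_def)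
            note eq = this
            show ?thesis unfolding K0_def eq power_scale power_mult_distrib[of \<epsilon>] by (simp only: mult_ac)
          qed
          finally show ?thesis using 3 by (simp add: norm_minus_commute)
        qed
      qed
      have I1: "(\<integral>t. indicator {0<..<\<delta> / \<epsilon>} t *\<^sub>R D t (of_real \<epsilon>) \<partial>lborel) - (\<Sum>p<N. c p * of_real \<epsilon> ^ p) =
        (\<integral>t. indicator {0<..<\<delta> / \<epsilon>} t *\<^sub>R D t (of_real \<epsilon>) - (\<Sum>p<N. (indicator {0<..} t *\<^sub>R d p t) * of_real \<epsilon> ^ p) \<partial>lborel)"
        unfolding c_def
        by (subst Bochner_Integration.integral_diff[OF DI Bochner_Integration.integrable_sum[OF integrable_mult_left[OF dint]]],
            subst Bochner_Integration.integral_sum[OF integrable_mult_left[OF dint]])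
           (simp only: integral_mult_left_zero)
      have "norm ((\<integral>t. indicator {0<..<\<delta> / \<epsilon>} t *\<^sub>R D t (of_real \<epsilon>) \<partial>lborel) - (\<Sum>p<N. c p * of_real \<epsilon> ^ p)) \<le> (\<integral>t. K0 * \<epsilon> ^ N * ?w N t \<partial>lborel)"
        unfolding I1
        by (rule Bochner_Integration.integral_norm_bound_integral[OF
              Bochner_Integration.integrable_diff[OF DI Bochner_Integration.integrable_sum[OF integrable_mult_left[OF dint]]]
              integrable_mult_right[OF integrable_exp_poly_weight[of N]]])
           (rule bound)
      also have "\<dots> = K * \<epsilon> ^ N" by (simp only: integral_mult_right_zero K_def) simp
      finally show "norm ((\<integral>t. indicator {0<..<\<delta> / \<epsilon>} t *\<^sub>R D t (of_real \<epsilon>) \<partial>lborel) - (\<Sum>p<N. c p * of_real \<epsilon> ^ p)) \<le> K * \<epsilon> ^ N" .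
    qed
  qed
  then show ?thesis by (simp only: c_def d_def)
qed

section \<open>The function z / sinh z\<close>

definition sinhc :: "complex \<Rightarrow> complex" where
  "sinhc z = (if z = 0 then 1 else sinh z / z)"

lemma sinhc_holomorphic: "sinhc holomorphic_on A"
proof -
  have "deriv sinh (0::complex) = 1" by (rule DERIV_imp_deriv) (auto intro!: derivative_eq_intros)
  moreover have "sinh holomorphic_on (UNIV :: complex set)"
    unfolding sinh_def by (intro holomorphic_intros) 
  moreover from this have "(\<lambda>z. if z = 0 then deriv sinh 0 else (sinh z - sinh 0) / (z - 0)) holomorphic_on (UNIV::complex set)"
    by (rule pole_lemma_open) simp
  moreover have "(\<lambda>z. if z = 0 then 1 else (sinh z - sinh 0) / (z - 0)) = sinhc"
    by (auto simp: fun_eq_iff sinhc_def)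
  ultimately have "sinhc holomorphic_on UNIV" by (simp only:)
  then show ?thesis by (rule holomorphic_on_subset) simp
qed

lemma norm_sinh_ge: "\<bar>sinh (Re z)\<bar> \<le> norm (sinh z)"
proof -
  have "norm (sinh z) ^ 2 = (sinh (Re z))\<^sup>2 + (sin (Im z))\<^sup>2"
  proof -
    have re: "Re (sinh z) = sinh (Re z) * cos (Im z)" and im: "Im (sinh z) = cosh (Re z) * sin (Im z)"
      by (simp_all add: sinh_def cosh_def Re_exp Im_exp algebra_simps)
    have "norm (sinh z) ^ 2 = (sinh (Re z))\<^sup>2 * (cos (Im z))\<^sup>2 + (cosh (Re z))\<^sup>2 * (sin (Im z))\<^sup>2"
      by (simp add: cmod_power2 re im power_mult_distrib)
    also have "\<dots> = (sinh (Re z))\<^sup>2 * ((cos (Im z))\<^sup>2 + (sin (Im z))\<^sup>2) + (sin (Im z))\<^sup>2"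
      by (simp add: cosh_square_eq cos_squared_eq algebra_simps)
    also have "(cos (Im z))\<^sup>2 + (sin (Im z))\<^sup>2 = 1" by simp
    finally show ?thesis by simp
  qed
  then have "(sinh (Re z))\<^sup>2 \<le> (norm (sinh z))\<^sup>2" by simp
  then show ?thesis using abs_le_square_iff[of "sinh (Re z)" "norm (sinh z)"] by simp
qed

lemma sinh_nonzero_Re: "Re z > 0 \<Longrightarrow> sinh z \<noteq> 0"
  using norm_sinh_ge[of z] by (auto simp: sinh_real_zero_iff)

lemma sinh_nonzero_ball: "z \<noteq> 0 \<Longrightarrow> norm z < 3 \<Longrightarrow> sinh (z::complex) \<noteq> 0"
proof
  assume z: "z \<noteq> 0" "norm z < 3" "sinh z = 0"
  then have "exp z = exp (- z)" by (simp add: sinh_def)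
  then have "exp (2 * z) = 1" by (simp only: mult_2 exp_add) (simp add: exp_minus field_simps)
  then obtain n :: int where n: "Re (2 * z) = 0" "Im (2 * z) = of_int (2 * n) * pi"
    using exp_eq_1[of "2 * z"] by auto
  then have im: "Re z = 0" "Im z = of_int n * pi" by auto
  then have "n \<noteq> 0" using z(1) by (auto simp: complex_eq_iff)
  then have "1 \<le> \<bar>real_of_int n\<bar>" by linarith
  then have "pi \<le> \<bar>Im z\<bar>" using im by (simp add: abs_mult)
  then show False using abs_Im_le_cmod[of z] z(2) pi_gt3 by linarith
qed

lemma sinhc_nonzero: "norm z < 3 \<or> Re z > 0 \<Longrightarrow> sinhc z \<noteq> 0"
  using sinh_nonzero_ball[of z] sinh_nonzero_Re[of z] by (auto simp: sinhc_def)

text \<open>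
  The function \<open>z\<^sup>2 csch\<^sup>2 z\<close> with its removable singularity at 0 filled.
\<close>

definition csch_sq :: "complex \<Rightarrow> complex" where
  "csch_sq z = 1 / (sinhc z)\<^sup>2"

text \<open>
  A connected neighbourhood of the half-line \<open>{0..}\<close> without zeros of \<open>sinhc\<close>: these are the nonzero multiples of
  \<open>\<i> * pi\<close>, and \<open>pi > 3\<close>.
\<close>

definition csch_region :: "complex set" where
  "csch_region = {z. norm z < 3 \<or> Re z > 0}"

lemma open_csch_region: "open csch_region"
  unfolding csch_region_def by (intro open_Collect_disj open_Collect_less continuous_intros)

lemma csch_sq_holomorphic: "csch_sq holomorphic_on csch_region"
  unfolding csch_sq_def csch_region_def using sinhc_nonzero
  by (intro holomorphic_intros sinhc_holomorphic) auto

lemma csch_sq_0: "csch_sq 0 = 1" by (simp add: csch_sq_def sinhc_def)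

lemma csch_sq_eq: "z \<noteq> 0 \<Longrightarrow> csch_sq z = z\<^sup>2 / (sinh z)\<^sup>2"
  by (simp add: csch_sq_def sinhc_def power_divide)

lemma csch_sq_minus: "csch_sq (- z) = csch_sq z"
  by (simp add: csch_sq_def sinhc_def)

text \<open>
  As \<open>csch_sq\<close> is even with value 1 at 0, the double zero of \<open>1 - csch_sq z\<close> at 0 can be divided out.
\<close>

lemma csch_sq_quotient_exists:
  obtains G where "G holomorphic_on csch_region" "\<And>z. csch_sq z = 1 - z\<^sup>2 * G z"
proof -
  have d0: "deriv csch_sq 0 = 0"
  proof -
    have "csch_sq field_differentiable at 0"
      using csch_sq_holomorphic open_csch_region by (auto simp: holomorphic_on_open field_differentiable_def csch_region_def)
    then have "(csch_sq has_field_derivative deriv csch_sq 0) (at 0)" by (simp add: DERIV_deriv_iff_field_differentiable)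
    moreover from this have "((\<lambda>z. csch_sq (- z)) has_field_derivative deriv csch_sq 0 * (-1)) (at 0)"
      by (intro DERIV_chain2[where f=csch_sq]) (auto intro!: derivative_eq_intros)
    then have "(csch_sq has_field_derivative - deriv csch_sq 0) (at 0)" by (simp add: csch_sq_minus)
    ultimately have "deriv csch_sq 0 = - deriv csch_sq 0" by (rule DERIV_unique)
    then show ?thesis by (simp add: eq_neg_iff_add_eq_0)
  qed
  define A where "A = (\<lambda>z. if z = 0 then deriv csch_sq 0 else (csch_sq z - csch_sq 0) / (z - 0))"
  have hA: "A holomorphic_on csch_region" unfolding A_def
    by (rule pole_lemma_open[OF csch_sq_holomorphic open_csch_region])
  define B where "B = (\<lambda>z. if z = 0 then deriv A 0 else (A z - A 0) / (z - 0))"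
  have hB: "B holomorphic_on csch_region" unfolding B_def
    by (rule pole_lemma_open[OF hA open_csch_region])
  have e: "csch_sq z = 1 - z\<^sup>2 * (- B z)" for z
  proof (cases "z = 0")
    case False
    have "z * A z = csch_sq z - 1" using False by (simp add: A_def csch_sq_0)
    moreover have "z * B z = A z" using False d0 by (simp add: B_def) (simp add: A_def)
    ultimately show ?thesis by (simp add: power2_eq_square algebra_simps)
  qed (simp add: csch_sq_0)
  show thesis by (rule that[of "\<lambda>z. - B z"]) (use hB e in \<open>auto intro!: holomorphic_intros\<close>)
qed

definition csch_quot :: "complex \<Rightarrow> complex" where
  "csch_quot = (SOME G. G holomorphic_on csch_region \<and> (\<forall>z. csch_sq z = 1 - z\<^sup>2 * G z))"

lemma csch_quot: "csch_quot holomorphic_on csch_region" "csch_sq z = 1 - z\<^sup>2 * csch_quot z"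
proof -
  have "\<exists>G. G holomorphic_on csch_region \<and> (\<forall>z. csch_sq z = 1 - z\<^sup>2 * G z)"
    using csch_sq_quotient_exists by metis
  then have "csch_quot holomorphic_on csch_region \<and> (\<forall>z. csch_sq z = 1 - z\<^sup>2 * csch_quot z)"
    unfolding csch_quot_def by (rule someI_ex)
  then show "csch_quot holomorphic_on csch_region" "csch_sq z = 1 - z\<^sup>2 * csch_quot z" by auto
qed

lemma sinh_ge_cubic: "x \<ge> 0 \<Longrightarrow> x + x ^ 3 / 6 \<le> sinh (x::real)"
proof -
  assume x: "x \<ge> 0"
  have "(\<lambda>n. if even n then 0 else x ^ n /\<^sub>R fact n) sums sinh x" by (rule sinh_converges)
  then have s: "(\<lambda>n. if even n then 0 else x ^ n / fact n) sums sinh x" by (simp add: divide_inverse mult.commute cong: if_cong)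
  have "(\<Sum>n<4. if even n then 0 else x ^ n / fact n) \<le> sinh x"
    unfolding sums_unique[OF s] by (rule sum_le_suminf) (use s x in \<open>auto simp: sums_iff\<close>)
  moreover have "{..<4::nat} = {0, 1, 2, 3}" by auto
  ultimately show ?thesis by (simp add: fact_numeral)
qed

lemma sinh_complex_of_real: "sinh (complex_of_real t) = of_real (sinh t)"
  by (simp add: sinh_def scaleR_conv_of_real flip: exp_of_real)

lemma csch_sq_real_bound:
  assumes "t > (0::real)"
  shows "csch_sq (of_real t) = of_real (t\<^sup>2 / (sinh t)\<^sup>2)" "t\<^sup>2 / (sinh t)\<^sup>2 \<le> 1 / (1 + t\<^sup>2 / 6)\<^sup>2"
proof -
  show "csch_sq (of_real t) = of_real (t\<^sup>2 / (sinh t)\<^sup>2)"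
    using assms by (simp add: csch_sq_eq sinh_complex_of_real)
  have "t * (1 + t\<^sup>2 / 6) \<le> sinh t" using sinh_ge_cubic[of t] assms by (simp add: power2_eq_square power3_eq_cube algebra_simps)
  then have "(t * (1 + t\<^sup>2 / 6))\<^sup>2 \<le> (sinh t)\<^sup>2" using assms by (intro power_mono) auto
  moreover have "6 + t\<^sup>2 \<noteq> 0" by (smt (verit) zero_le_power2)
  ultimately show "t\<^sup>2 / (sinh t)\<^sup>2 \<le> 1 / (1 + t\<^sup>2 / 6)\<^sup>2"
    using assms by (simp add: power_mult_distrib divide_simps sinh_real_zero_iff mult.commute add_pos_nonneg)
qed

text \<open>
  The positive lower bound keeps the square root of \<open>1 - csch_sq t\<close>, divided by \<open>t\<close>, holomorphic near \<open>t = 0\<close>.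
\<close>

lemma csch_quot_real_lower:
  assumes "0 \<le> t" "t \<le> (1::real)"
  shows "Re (csch_quot (of_real t)) \<ge> 1/9"
proof -
  have pos: "Re (csch_quot (of_real t)) \<ge> 1/9" if t: "0 < t" "t \<le> 1" for t
  proof -
    have "t\<^sup>2 * csch_quot (of_real t) = 1 - csch_sq (of_real t)" using csch_quot(2)[of "of_real t"] by simp
    also have "\<dots> = of_real (1 - t\<^sup>2 / (sinh t)\<^sup>2)" using csch_sq_real_bound(1)[OF t(1)] by simp
    finally have eq: "t\<^sup>2 * csch_quot (of_real t) = of_real (1 - t\<^sup>2 / (sinh t)\<^sup>2)" .
    have "t\<^sup>2 * Re (csch_quot (of_real t)) = 1 - t\<^sup>2 / (sinh t)\<^sup>2"
    proof -
      from eq have "Re (of_real (t\<^sup>2) * csch_quot (of_real t)) = 1 - t\<^sup>2 / (sinh t)\<^sup>2"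
        by (simp only: Re_complex_of_real)
      then show ?thesis by simp
    qed
    moreover have "1 / (1 + t\<^sup>2 / 6)\<^sup>2 \<le> 1 - t\<^sup>2 / 9"
    proof -
      define u where "u = t\<^sup>2"
      have u: "0 < u" "u \<le> 1" using t by (auto simp: u_def power_le_one)
      have "u * u \<le> u * 1" using u by (intro mult_left_mono) auto
      moreover have "u * u * u \<le> u * u * 1" using u by (intro mult_left_mono) auto
      moreover have "(1 - u / 9) * (1 + u / 6)\<^sup>2 = 1 + 2 * u / 9 - u * u / 108 - u * u * u / 324"
        by (simp add: power2_eq_square field_simps)
      ultimately have "1 \<le> (1 - u / 9) * (1 + u / 6)\<^sup>2"
        using u by linarith
      moreover have "(1 + u / 6)\<^sup>2 > 0" using u by (simp add: add_pos_pos)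
      ultimately show ?thesis unfolding u_def[symmetric] by (simp add: divide_le_eq)
    qed
    ultimately have "t\<^sup>2 * (1/9) \<le> t\<^sup>2 * Re (csch_quot (of_real t))"
      using csch_sq_real_bound(2)[OF t(1)] by simp
    then show ?thesis using t by (simp add: mult_le_cancel_left)
  qed
  show ?thesis
  proof (cases "t = 0")
    case False
    then show ?thesis using pos assms by auto
  next
    case True
    have "isCont csch_quot 0"
      using csch_quot(1) open_csch_region
      by (metis continuous_on_eq_continuous_at holomorphic_on_imp_continuous_on csch_region_def mem_Collect_eq norm_zero zero_less_numeral)
    then have lim: "(\<lambda>n. Re (csch_quot (of_real (inverse (real (Suc n)))))) \<longlonglongrightarrow> Re (csch_quot 0)"
    proof (intro tendsto_Re isCont_tendsto_compose[of _ csch_quot])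
      show "(\<lambda>n. complex_of_real (inverse (real (Suc n)))) \<longlonglongrightarrow> 0"
        using tendsto_of_real[OF LIMSEQ_inverse_real_of_nat, where 'a=complex] by (simp only: of_real_0)
    qed
    have "Re (csch_quot 0) \<ge> 1/9"
    proof (rule LIMSEQ_le_const[OF lim], intro exI allI impI)
      fix n :: nat
      show "1/9 \<le> Re (csch_quot (of_real (inverse (real (Suc n)))))"
        by (rule pos) (auto simp: inverse_le_1_iff)
    qed
    then show ?thesis using True by simp
  qed
qed

section \<open>The rescaled integrand\<close>

text \<open>
  With \<open>m = 1 / \<epsilon>\<close> and \<open>s = \<epsilon> t\<close>, this is \<open>csch\<^sup>2 s - ((m - a - s\<^sup>2 h) / sinh (m s - s a))\<^sup>2\<close>, divided by \<open>m\<^sup>2\<close>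
  (see \<open>rescaled_radicand_eq\<close>). In that form both terms have a double pole at \<open>t = 0\<close>; here the poles have been cancelled
  by hand with the help of \<open>csch_quot\<close>, so that holomorphy in \<open>\<epsilon>\<close> is visible uniformly in small \<open>t\<close>.
\<close>

definition rescaled_radicand :: "complex \<Rightarrow> complex \<Rightarrow> real \<Rightarrow> complex \<Rightarrow> complex" where
  "rescaled_radicand a h t \<epsilon> =
     \<epsilon> ^ 3 * h * (2 - \<epsilon> * (\<epsilon> * of_real t)\<^sup>2 * h / (1 - \<epsilon> * a)) / (1 - \<epsilon> * a)
     - \<epsilon>\<^sup>2 * csch_quot (\<epsilon> * of_real t)
     + (1 - \<epsilon> * (a + (\<epsilon> * of_real t)\<^sup>2 * h))\<^sup>2 * csch_quot (of_real t * (1 - \<epsilon> * a))"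

text \<open>
  The second term is \<open>\<epsilon> / sinh (\<epsilon> t)\<close>, which carries the nonintegrable tail \<open>1 / t\<close>. It is subtracted for \<open>t > 1\<close>
  only, since it is not integrable near \<open>t = 0\<close> either.
\<close>

definition rescaled_integrand :: "complex \<Rightarrow> complex \<Rightarrow> real \<Rightarrow> complex \<Rightarrow> complex" where
  "rescaled_integrand a h t \<epsilon> = csqrt (rescaled_radicand a h t \<epsilon>) - (if t > 1 then csqrt (csch_sq (\<epsilon> * of_real t)) / of_real t else 0)"

lemma rescaled_radicand_eq:
  assumes "\<epsilon> * a \<noteq> 1"
  shows "of_real t ^ 2 * rescaled_radicand a h t \<epsilon> = csch_sq (\<epsilon> * of_real t)
     - (1 - \<epsilon> * (\<epsilon> * of_real t)\<^sup>2 * h / (1 - \<epsilon> * a))\<^sup>2 * csch_sq (of_real t * (1 - \<epsilon> * a))"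
proof -
  define b where "b = 1 - \<epsilon> * a"
  have b: "b \<noteq> 0" using assms by (simp add: b_def)
  define T where "T = complex_of_real t"
  define u where "u = \<epsilon> * (\<epsilon> * T)\<^sup>2 * h / b"
  have ub: "u * b = \<epsilon> * (\<epsilon> * T)\<^sup>2 * h" using b by (simp add: u_def)
  have 1: "1 - \<epsilon> * (a + (\<epsilon> * T)\<^sup>2 * h) = (1 - u) * b" 
    using ub by (simp add: b_def algebra_simps)
  have 2: "T\<^sup>2 * (\<epsilon> ^ 3 * h * (2 - u) / b) = u * (2 - u)"
    using b by (simp add: u_def power2_eq_square power3_eq_cube)
  have "T\<^sup>2 * rescaled_radicand a h t \<epsilon> = T\<^sup>2 * (\<epsilon> ^ 3 * h * (2 - u) / b) - (\<epsilon> * T)\<^sup>2 * csch_quot (\<epsilon> * T) + (1 - u)\<^sup>2 * ((T * b)\<^sup>2 * csch_quot (T * b))"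
    unfolding rescaled_radicand_def T_def[symmetric] b_def[symmetric] u_def[symmetric] 1
    by (simp add: power2_eq_square algebra_simps)
  also have "\<dots> = csch_sq (\<epsilon> * T) - (1 - u)\<^sup>2 * csch_sq (T * b)"
    unfolding csch_quot(2) 2 by (simp add: power2_eq_square algebra_simps)
  finally show ?thesis unfolding T_def b_def u_def .
qed

lemma csch_quot_near_unit_interval:
  obtains \<eta> M where "0 < \<eta>" "\<eta> \<le> 1/100" "M \<ge> 0"
    "\<And>t y. 0 \<le> t \<Longrightarrow> t \<le> 1 \<Longrightarrow> norm (y - of_real t) \<le> \<eta> \<Longrightarrow> Re (csch_quot y) \<ge> 1/18"
    "\<And>y. norm y \<le> 2 \<Longrightarrow> norm (csch_quot y) \<le> M"
    "\<And>y. norm y \<le> \<eta> \<Longrightarrow> norm (csch_sq y - 1) \<le> 1/100"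
proof -
  have cq: "continuous_on csch_region csch_quot" using csch_quot(1) by (rule holomorphic_on_imp_continuous_on)
  have cs: "continuous_on csch_region csch_sq" using csch_sq_holomorphic by (rule holomorphic_on_imp_continuous_on)
  define V where "V = csch_region \<inter> (\<lambda>z. Re (csch_quot z)) -` {1/18<..}"
  have opV: "open V"
  proof -
    have "openin (top_of_set csch_region) V" unfolding V_def
      by (rule continuous_openin_preimage_gen) (use cq in \<open>auto intro!: continuous_intros\<close>)
    then show ?thesis using open_csch_region openin_open_trans by blast
  qed
  have "compact (complex_of_real ` {0..1})" by (intro compact_continuous_image continuous_intros) auto
  moreover have "complex_of_real ` {0..1} \<subseteq> V"
    using csch_quot_real_lower by (fastforce simp: V_def csch_region_def)
  ultimately obtain e where e: "e > 0" "(\<Union>x\<in>complex_of_real ` {0..1}. ball x e) \<subseteq> V"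
    using compact_subset_open_imp_ball_epsilon_subset opV by metis
  have sub2: "cball 0 2 \<subseteq> csch_region" by (auto simp: csch_region_def)
  have cq2: "continuous_on (cball 0 2) csch_quot" using cq sub2 continuous_on_subset by blast
  obtain M where M: "\<And>y. y \<in> cball 0 2 \<Longrightarrow> norm (csch_quot y) \<le> M"
    using compact_imp_bounded[OF compact_continuous_image[OF cq2 compact_cball]] unfolding bounded_iff by blast
  have "norm (csch_quot 0) \<le> M" by (rule M) simp
  then have M0: "M \<ge> 0" using norm_ge_zero[of "csch_quot 0"] by linarith
  have "0 \<in> csch_region" by (simp add: csch_region_def)
  then have "isCont csch_sq 0" using cs open_csch_region continuous_on_eq_continuous_at by blast
  then obtain d where d: "d > 0" "\<And>y. dist y 0 < d \<Longrightarrow> dist (csch_sq y) (csch_sq 0) < 1/100"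
    unfolding continuous_at_eps_delta by (metis divide_pos_pos zero_less_numeral zero_less_one)
  define \<eta> where "\<eta> = min (1/100) (min (e/2) (d/2))"
  have \<eta>: "0 < \<eta>" "\<eta> \<le> 1/100" "\<eta> < e" "\<eta> < d" using e(1) d(1) by (auto simp: \<eta>_def)
  show thesis
  proof (rule that[OF \<eta>(1,2) M0])
    fix t :: real and y :: complex assume t: "0 \<le> t" "t \<le> 1" "norm (y - of_real t) \<le> \<eta>"
    then have "y \<in> ball (of_real t) e" using \<eta> by (simp add: dist_norm norm_minus_commute)
    moreover have "complex_of_real t \<in> complex_of_real ` {0..1}" using t by auto
    ultimately have "y \<in> V" using e(2) by blast
    then show "Re (csch_quot y) \<ge> 1/18" by (simp add: V_def)
  next
    fix y :: complex assume "norm y \<le> 2" then show "norm (csch_quot y) \<le> M" using M by simp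
  next
    fix y :: complex assume "norm y \<le> \<eta>"
    then have "dist (csch_sq y) (csch_sq 0) < 1/100" by (intro d) (use \<eta> in simp)
    then show "norm (csch_sq y - 1) \<le> 1/100" by (simp add: csch_sq_0 dist_norm)
  qed
qed

text \<open>
  The constant 78/100 leaves room for the relative error 103/100 in the factor of \<open>csch_sq\<close> in the
  radicand: their product is below the lower bound 99/100 for the first term.
\<close>

lemma csch_sq_bound_far:
  assumes t: "t \<ge> 1" and y: "norm (y - of_real t) \<le> 1/100"
  shows "Re y > 0" "norm (csch_sq y) \<le> 78/100" "norm (csch_sq y) \<le> 256 * exp (- t)"
proof -
  define x where "x = t - 1/100"
  have x: "x \<ge> 99/100" using t by (simp add: x_def)
  have Re: "Re y \<ge> x" using abs_Re_le_cmod[of "y - of_real t"] y by (simp add: x_def)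
  then show Rp: "Re y > 0" using x by linarith
  have "norm y \<le> norm (y - of_real t) + norm (complex_of_real t)" using norm_triangle_sub[of y "of_real t"] by simp
  then have ny: "norm y \<le> x + 2/100" using y t by (simp add: x_def)
  have y0: "y \<noteq> 0" using Rp by auto
  have sh: "sinh x \<le> norm (sinh y)"
  proof -
    have "sinh x \<le> sinh (Re y)" using Re by (simp add: sinh_real_le_iff)
    also have "\<dots> \<le> norm (sinh y)" using norm_sinh_ge[of y] by linarith
    finally show ?thesis .
  qed
  have shp: "sinh x > 0" using x by (simp add: sinh_real_pos_iff)
  have nF: "norm (csch_sq y) \<le> ((x + 2/100) / sinh x)\<^sup>2"
  proof -
    have "norm y / norm (sinh y) \<le> (x + 2/100) / sinh x"
      by (rule frac_le) (use ny sh shp x in auto)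
    then have "(norm y / norm (sinh y))\<^sup>2 \<le> ((x + 2/100) / sinh x)\<^sup>2" by (intro power_mono) auto
    then show ?thesis by (simp add: csch_sq_eq[OF y0] norm_divide norm_power power_divide)
  qed
  have "x * x \<ge> 98/100" using mult_mono[of "99/100" x "99/100" x] x by simp
  then have "x * (x * x) \<ge> x * (98/100)" using x by (intro mult_left_mono) auto
  then have "x ^ 3 \<ge> x * (98/100)" by (simp only: power3_eq_cube mult.assoc)
  then have "x + 2/100 \<le> 88/100 * (x + x ^ 3 / 6)" using x by simp
  also have "\<dots> \<le> 88/100 * sinh x" using sinh_ge_cubic[of x] x by simp
  finally have "(x + 2/100) / sinh x \<le> 88/100" using shp by (simp add: divide_le_eq)
  then have "((x + 2/100) / sinh x)\<^sup>2 \<le> (88/100)\<^sup>2" using shp x by (intro power_mono) auto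
  then show "norm (csch_sq y) \<le> 78/100" using nF by (simp add: power2_eq_square)
  have "exp x / 4 \<le> sinh x"
  proof -
    have "1 + 2 * x \<le> exp (2 * x)" by (rule exp_ge_add_one_self)
    then have "2 \<le> exp (2 * x)" using x by linarith
    then have "2 * exp (- x) \<le> exp (2 * x) * exp (- x)" by (intro mult_right_mono) auto
    also have "\<dots> = exp x" by (simp flip: exp_add)
    finally show ?thesis by (simp add: sinh_def)
  qed
  then have "(x + 2/100) / sinh x \<le> (2 * t) / (exp x / 4)"
    by (intro frac_le) (use x t in \<open>auto simp: x_def\<close>)
  also have "\<dots> = 8 * t * exp (- x)" by (simp add: exp_minus field_simps)
  finally have "((x + 2/100) / sinh x)\<^sup>2 \<le> (8 * t * exp (- x))\<^sup>2" using shp x by (intro power_mono) auto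
  also have "\<dots> = 64 * t\<^sup>2 * exp (- 2 * x)" by (simp add: power_mult_distrib power2_eq_square mult_exp_exp)
  also have "\<dots> \<le> 64 * (2 * exp t) * exp (- 2 * x)"
    using power_le_exp[of t 2] t by (intro mult_right_mono mult_left_mono) (auto simp: fact_numeral)
  also have "\<dots> = 128 * (exp (- t) * exp (2/100))" by (simp add: x_def mult_exp_exp)
  also have "\<dots> \<le> 128 * (exp (- t) * 2)"
  proof -
    have "exp (2/100 :: real) \<le> 1 + 2/100 + (2/100)\<^sup>2" by (rule exp_bound) auto
    also have "\<dots> \<le> 2" by (simp add: power2_eq_square)
    finally show ?thesis by (intro mult_left_mono) auto
  qed
  finally show "norm (csch_sq y) \<le> 256 * exp (- t)" using nF by simp
qed

lemma csqrt_near_one: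
  assumes "norm (w - 1) \<le> 1/100" shows "Re (csqrt w) \<ge> 1/2" "Re w > 0"
proof -
  have Rw: "Re w \<ge> 99/100" using abs_Re_le_cmod[of "w - 1"] assms by (simp add: abs_if split: if_splits)
  then show "Re w > 0" by linarith
  have "norm w \<ge> 99/100" using complex_Re_le_cmod[of w] Rw by linarith
  then have "(1/2)\<^sup>2 \<le> (norm w + Re w) / 2" using Rw by (simp add: power2_eq_square)
  then have "1/2 \<le> sqrt ((norm w + Re w) / 2)" by (rule real_le_rsqrt)
  then show "Re (csqrt w) \<ge> 1/2" by simp
qed

text \<open>
  For \<open>t \<le> 1\<close> the radicand is a small perturbation of \<open>csch_quot (t * (1 - \<epsilon> a))\<close>, whose real part is bounded
  below. For \<open>t > 1\<close> it is the difference of a term near 1 and a term below it of size \<open>exp (- t)\<close>,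
  divided by \<open>t\<^sup>2\<close>; rationalizing the difference of the square roots shows the decay. The restriction on \<open>\<epsilon>\<close>
  keeps both \<open>\<epsilon>\<close> and \<open>\<epsilon> t\<close> small.
\<close>

theorem rescaled_integrand_bound:
  assumes B: "B \<ge> 0"
  obtains r C where "0 < r" "r \<le> 1" "C \<ge> 0"
    "\<And>a h t \<epsilon>. norm a \<le> B \<Longrightarrow> norm h \<le> B \<Longrightarrow> 0 < t \<Longrightarrow> norm \<epsilon> * (1 + t) < r \<Longrightarrow>
       \<epsilon> * a \<noteq> 1 \<and> \<epsilon> * of_real t \<in> csch_region \<and> of_real t * (1 - \<epsilon> * a) \<in> csch_region \<and> Re (csch_sq (\<epsilon> * of_real t)) > 0 \<and>
       Re (rescaled_radicand a h t \<epsilon>) > 0 \<and> norm (rescaled_integrand a h t \<epsilon>) \<le> C * exp (- t)"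
proof -
  obtain \<eta> M where \<eta>: "0 < \<eta>" "\<eta> \<le> 1/100" "M \<ge> 0"
    and Q1: "\<And>t y. 0 \<le> t \<Longrightarrow> t \<le> 1 \<Longrightarrow> norm (y - of_real t) \<le> \<eta> \<Longrightarrow> Re (csch_quot y) \<ge> 1/18"
    and Q2: "\<And>y. norm y \<le> 2 \<Longrightarrow> norm (csch_quot y) \<le> M"
    and F1: "\<And>y. norm y \<le> \<eta> \<Longrightarrow> norm (csch_sq y - 1) \<le> 1/100"
    by (rule csch_quot_near_unit_interval) (rule that)
  \<comment> \<open>The terms \<open>4 B\<close>, \<open>M\<close> and \<open>6 B M\<close> bound the three perturbations
    \<open>w1\<close>, \<open>w2\<close>, \<open>w3\<close> of the radicand below.\<close>
  define K where "K = 6 * B * M + 4 * B + M + B + 1"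
  have K: "K \<ge> 1" "K \<ge> B" using B \<eta>(3) by (auto simp: K_def)
  define r where "r = \<eta> / (36 * K)"
  have r0: "r > 0" using \<eta> K by (simp add: r_def)
  have rK: "36 * (K * r) = \<eta>" using K by (simp add: r_def)
  have rK': "r * (6 * B * M + 4 * B + M) < 1/18"
  proof -
    have "r * (6 * B * M + 4 * B + M) \<le> r * K" using r0 B by (intro mult_left_mono) (auto simp: K_def)
    then show ?thesis using rK \<eta> by (simp add: mult.commute)
  qed
  have r1: "r * 1 \<le> r * K" using r0 K by (intro mult_left_mono) auto
  then have "r \<le> K * r" by (simp add: mult.commute)
  moreover have "0 \<le> K * r" using K r0 by simp
  ultimately have r\<eta>: "r \<le> \<eta>" using rK by linarith
  have rle: "r \<le> 1" using r\<eta> \<eta> by linarith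
  have rB: "B * r \<le> \<eta>"
  proof -
    have "B * r \<le> K * r" using K r0 by (intro mult_right_mono) auto
    moreover have "0 \<le> K * r" using K r0 by simp
    ultimately show ?thesis using rK by linarith
  qed
  \<comment> \<open>The first summand serves \<open>t \<le> 1\<close>, where \<open>exp (1 - t) \<ge> 1\<close>; the second one
    serves \<open>t > 1\<close>, since \<open>2 * (103/100) * 256 \<le> 768\<close>.\<close>
  define C where "C = (M + 1) * exp 1 + 768"
  have C: "C \<ge> 0" using \<eta>(3) by (simp add: C_def)
  show thesis
  proof (rule that[OF r0 rle C])
    fix a h \<epsilon> :: complex and t :: real
    assume a: "norm a \<le> B" and h: "norm h \<le> B" and t: "0 < t" and et: "norm \<epsilon> * (1 + t) < r"
    define s where "s = \<epsilon> * of_real t"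
    have ns: "norm s = norm \<epsilon> * t" using t by (simp add: s_def norm_mult)
    have e: "norm \<epsilon> \<le> r" "norm s \<le> r"
    proof -
      have "norm \<epsilon> + norm \<epsilon> * t < r" using et by (simp add: distrib_left)
      moreover have "0 \<le> norm \<epsilon> * t" using t by simp
      ultimately show "norm \<epsilon> \<le> r" "norm s \<le> r" unfolding ns using norm_ge_zero[of \<epsilon>] by linarith+
    qed
    have s1: "norm s \<le> 1" and e1: "norm \<epsilon> \<le> 1" using e rle by auto
    define b where "b = 1 - \<epsilon> * a"
    have ea: "norm (\<epsilon> * a) \<le> 1/100"
    proof -
      have "norm \<epsilon> * norm a \<le> r * B" by (intro mult_mono e a) (use r0 in auto)
      then show ?thesis using rB \<eta>(2) by (simp add: norm_mult mult.commute)
    qed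
    then have ea1: "\<epsilon> * a \<noteq> 1" by auto
    have nb: "norm b \<ge> 99/100" using norm_triangle_ineq2[of 1 "\<epsilon> * a"] ea by (simp add: b_def)
    define Y where "Y = of_real t * b"
    have Yt: "norm (Y - of_real t) \<le> \<eta>"
    proof -
      have "Y - of_real t = - (s * a)" by (simp add: Y_def b_def s_def algebra_simps)
      then have "norm (Y - of_real t) = norm s * norm a" by (simp add: norm_mult)
      also have "\<dots> \<le> r * B" by (intro mult_mono e a) (use r0 in auto)
      finally show ?thesis using rB by (simp add: mult.commute)
    qed
    define u where "u = \<epsilon> * s\<^sup>2 * h"
    have s2: "norm (s\<^sup>2) \<le> 1" using s1 by (simp add: norm_power power_le_one)
    have nu: "norm u \<le> r * B"
    proof -
      have "norm u = norm \<epsilon> * norm (s\<^sup>2) * norm h" by (simp add: u_def norm_mult)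
      also have "\<dots> \<le> r * 1 * B" by (intro mult_mono e s2 h) (use r0 in auto)
      finally show ?thesis by simp
    qed
    then have nu': "norm u \<le> 1/100" using rB \<eta>(2) by (simp add: mult.commute)
    define q where "q = 1 - u / b"
    have ub: "norm (u / b) \<le> 1/99"
    proof -
      have "norm u / norm b \<le> (1/100) / (99/100)" by (intro frac_le nu' nb) auto
      then show ?thesis by (simp add: norm_divide)
    qed
    have nq: "norm (q\<^sup>2) \<le> 103/100"
    proof -
      have "norm q \<le> 1 + 1/99" using norm_triangle_ineq4[of 1 "u / b"] ub by (simp add: q_def)
      then have "norm q ^ 2 \<le> (1 + 1/99)\<^sup>2" by (intro power_mono) auto
      then show ?thesis by (simp add: norm_mult power2_eq_square)
    qed
    have req: "of_real t ^ 2 * rescaled_radicand a h t \<epsilon> = csch_sq s - q\<^sup>2 * csch_sq Y"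
      using rescaled_radicand_eq[OF ea1, of t h] by (simp add: s_def q_def u_def Y_def b_def)
    have Fs: "norm (csch_sq s - 1) \<le> 1/100" by (rule F1) (use e r\<eta> in linarith)
    have sreg: "s \<in> csch_region" using s1 by (simp add: csch_region_def)
    have cp: "Re (csch_sq s) > 0" by (rule csqrt_near_one(2)[OF Fs])
    have main: "Y \<in> csch_region \<and> Re (rescaled_radicand a h t \<epsilon>) > 0 \<and> norm (rescaled_integrand a h t \<epsilon>) \<le> C * exp (- t)"
    proof (cases "t \<le> 1")
      case True
      have nY: "norm Y \<le> 2"
        using norm_triangle_sub[of Y "of_real t"] Yt \<eta>(2) True t by simp
      have QY: "Re (csch_quot Y) \<ge> 1/18" "norm (csch_quot Y) \<le> M" "norm (csch_quot s) \<le> M"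
        using Q1[OF _ True Yt] Q2[OF nY] Q2[of s] t s1 by auto
      define v where "v = \<epsilon> * (a + s\<^sup>2 * h)"
      have nv: "norm v \<le> r * (2 * B)"
      proof -
        have "norm (s\<^sup>2 * h) \<le> 1 * B" unfolding norm_mult by (intro mult_mono s2 h) auto
        then have "norm (a + s\<^sup>2 * h) \<le> 2 * B" using norm_triangle_ineq[of a "s\<^sup>2 * h"] a by linarith
        then show ?thesis unfolding v_def norm_mult by (intro mult_mono e) (use r0 in auto)
      qed
      have "r * (2 * B) = 2 * (B * r)" by simp
      then have nv1: "norm v \<le> 1" using nv rB \<eta>(2) by linarith
      define w1 where "w1 = \<epsilon> ^ 3 * h * (2 - u / b) / b"
      have nw1: "norm w1 \<le> r * (4 * B)"
      proof -
        have "norm (\<epsilon> ^ 3) \<le> r"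
        proof -
          have "norm (\<epsilon> ^ 3) = norm \<epsilon> * (norm \<epsilon>)\<^sup>2" by (simp add: norm_mult power3_eq_cube power2_eq_square)
          also have "\<dots> \<le> r * 1" by (intro mult_mono e) (use e1 r0 in \<open>auto simp: power_le_one\<close>)
          finally show ?thesis by simp
        qed
        moreover have "norm (2 - u / b) \<le> 3" using norm_triangle_ineq4[of 2 "u / b"] ub by simp
        ultimately have "norm (\<epsilon> ^ 3 * h * (2 - u / b)) \<le> r * B * 3"
          unfolding norm_mult by (intro mult_mono h) (use r0 B in auto)
        then have "norm (\<epsilon> ^ 3 * h * (2 - u / b)) / norm b \<le> (r * B * 3) / (99/100)"
          by (intro frac_le nb) (use r0 B in auto)
        also have "\<dots> \<le> r * (4 * B)" using r0 B by (simp add: field_simps)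
        finally show ?thesis by (simp add: w1_def norm_divide)
      qed
      define w2 where "w2 = \<epsilon>\<^sup>2 * csch_quot s"
      have nw2: "norm w2 \<le> r * M"
      proof -
        have "norm (\<epsilon>\<^sup>2) \<le> r * 1" unfolding power2_eq_square norm_mult by (intro mult_mono e e1) (use r0 in auto)
        then show ?thesis unfolding w2_def norm_mult by (intro mult_mono QY) (use r0 in auto)
      qed
      define w3 where "w3 = (v\<^sup>2 - 2 * v) * csch_quot Y"
      have nw3: "norm w3 \<le> r * (6 * B * M)"
      proof -
        have "v\<^sup>2 - 2 * v = v * (v - 2)" by (simp add: power2_eq_square algebra_simps)
        then have "norm (v\<^sup>2 - 2 * v) = norm v * norm (v - 2)" by (simp add: norm_mult)
        also have "\<dots> \<le> (r * (2 * B)) * 3"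
          by (intro mult_mono nv) (use norm_triangle_ineq4[of v 2] nv1 r0 B in auto)
        finally have "norm (v\<^sup>2 - 2 * v) * norm (csch_quot Y) \<le> (r * (2 * B)) * 3 * M"
          by (intro mult_mono QY) (use r0 B in auto)
        then show ?thesis by (simp add: w3_def norm_mult mult_ac)
      qed
      have Xeq: "rescaled_radicand a h t \<epsilon> = csch_quot Y + (w1 - w2 + w3)"
        unfolding rescaled_radicand_def s_def[symmetric] b_def[symmetric] Y_def[symmetric] u_def[symmetric] v_def[symmetric] w1_def w2_def w3_def
        by (simp add: power2_eq_square algebra_simps)
      have "norm (w1 - w2 + w3) \<le> norm w1 + norm w2 + norm w3"
        using norm_triangle_ineq[of "w1 - w2" w3] norm_triangle_ineq4[of w1 w2] by linarith
      also have "\<dots> \<le> r * (6 * B * M + 4 * B + M)" using nw1 nw2 nw3 by (simp add: algebra_simps)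
      finally have nw: "norm (w1 - w2 + w3) < 1/18" using rK' by linarith
      have pos: "Re (rescaled_radicand a h t \<epsilon>) > 0"
        using abs_Re_le_cmod[of "w1 - w2 + w3"] nw QY(1) unfolding Xeq by simp
      have "norm (rescaled_radicand a h t \<epsilon>) \<le> M + 1"
        unfolding Xeq using norm_triangle_ineq[of "csch_quot Y" "w1 - w2 + w3"] nw QY(2) by linarith
      then have "sqrt (norm (rescaled_radicand a h t \<epsilon>)) \<le> sqrt (M + 1)" by simp
      also have "\<dots> \<le> M + 1"
      proof (rule real_le_lsqrt)
        show "M + 1 \<le> (M + 1)\<^sup>2" using \<eta>(3) by (simp add: power2_eq_square algebra_simps)
      qed (use \<eta>(3) in auto)
      finally have "norm (rescaled_integrand a h t \<epsilon>) \<le> M + 1" using True by (simp add: rescaled_integrand_def)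
      also have "\<dots> \<le> (M + 1) * (exp 1 * exp (- t))"
      proof -
        have "1 \<le> exp (1 - t)" using True by simp
        then have "1 \<le> exp 1 * exp (- t)" by (simp add: mult_exp_exp)
        then show ?thesis using \<eta>(3) mult_left_mono[of 1 "exp 1 * exp (- t)" "M + 1"] by simp
      qed
      also have "\<dots> \<le> C * exp (- t)" by (simp add: C_def algebra_simps)
      finally have "norm (rescaled_integrand a h t \<epsilon>) \<le> C * exp (- t)" .
      then show ?thesis using pos nY by (simp add: csch_region_def)
    next
      case False
      then have t1: "t \<ge> 1" "t > 1" by auto
      have Yt': "norm (Y - of_real t) \<le> 1/100" using Yt \<eta>(2) by linarith
      note far = csch_sq_bound_far[OF t1(1) Yt']
      have qF: "norm (q\<^sup>2 * csch_sq Y) \<le> 103/100 * (78/100)"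
        unfolding norm_mult by (intro mult_mono nq far) auto
      have "Re (csch_sq s) \<ge> 99/100" using abs_Re_le_cmod[of "csch_sq s - 1"] Fs by (simp add: abs_if split: if_splits)
      then have "Re (csch_sq s - q\<^sup>2 * csch_sq Y) > 0"
        using abs_Re_le_cmod[of "q\<^sup>2 * csch_sq Y"] qF by simp
      then have "Re (of_real (t\<^sup>2) * rescaled_radicand a h t \<epsilon>) > 0" using req by simp
      then have "t\<^sup>2 * Re (rescaled_radicand a h t \<epsilon>) > 0" by (simp only: Re_complex_of_real times_complex.sel Im_complex_of_real)
      then have pos: "Re (rescaled_radicand a h t \<epsilon>) > 0" using t1 by (simp add: zero_less_mult_iff)
      define A where "A = csqrt (rescaled_radicand a h t \<epsilon>)"
      define E where "E = csqrt (csch_sq s) / of_real t"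
      have A2: "A\<^sup>2 = rescaled_radicand a h t \<epsilon>" and E2: "E\<^sup>2 = csch_sq s / of_real t ^ 2"
        by (simp_all add: A_def E_def power_divide)
      have "A\<^sup>2 - E\<^sup>2 = - (q\<^sup>2 * csch_sq Y) / of_real t ^ 2"
      proof -
        have "rescaled_radicand a h t \<epsilon> = (csch_sq s - q\<^sup>2 * csch_sq Y) / of_real t ^ 2"
          using req t1 by (simp add: nonzero_eq_divide_eq mult.commute)
        then show ?thesis unfolding A2 E2 by (simp add: diff_divide_distrib)
      qed
      \<comment> \<open>The sum of the square roots is bounded below by the second one, as both lie in the right
        half-plane.\<close>
      then have "(A - E) * (A + E) = - (q\<^sup>2 * csch_sq Y) / of_real t ^ 2" by (simp add: power2_eq_square algebra_simps)
      then have "norm (A - E) * norm (A + E) = norm (q\<^sup>2 * csch_sq Y) / t\<^sup>2"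
        by (metis norm_mult norm_divide norm_minus_cancel norm_power norm_of_real power2_abs)
      moreover have "norm (A + E) \<ge> (1/2) / t"
      proof -
        have "Re A \<ge> 0"
          using csqrt_principal[of "rescaled_radicand a h t \<epsilon>"] by (auto simp: A_def simp del: csqrt.sel)
        moreover have "Re E \<ge> (1/2) / t"
        proof -
          have "(1/2) / t \<le> Re (csqrt (csch_sq s)) / t"
            by (intro divide_right_mono csqrt_near_one(1)[OF Fs]) (use t1 in simp)
          then show ?thesis unfolding E_def by (simp only: Re_divide_of_real)
        qed
        ultimately have "Re (A + E) \<ge> (1/2) / t" by simp
        then show ?thesis using complex_Re_le_cmod[of "A + E"] by linarith
      qed
      ultimately have "norm (A - E) * ((1/2) / t) \<le> norm (q\<^sup>2 * csch_sq Y) / t\<^sup>2"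
        by (metis mult_left_mono norm_ge_zero)
      then have "norm (A - E) * t \<le> 2 * norm (q\<^sup>2 * csch_sq Y)" using t1 by (simp add: field_simps power2_eq_square)
      moreover have "norm (A - E) * 1 \<le> norm (A - E) * t" using t1 by (intro mult_left_mono) auto
      ultimately have "norm (A - E) \<le> 2 * norm (q\<^sup>2 * csch_sq Y)" by simp
      also have "norm (q\<^sup>2 * csch_sq Y) \<le> 103/100 * (256 * exp (- t))"
        unfolding norm_mult by (intro mult_mono nq far) auto
      finally have "norm (A - E) \<le> 2 * (103/100 * (256 * exp (- t)))" by simp
      then have "norm (A - E) \<le> 768 * exp (- t)" using exp_gt_zero[of "- t"] by linarith
      also have "\<dots> \<le> C * exp (- t)" using \<eta>(3) by (simp add: C_def)
      finally have "norm (rescaled_integrand a h t \<epsilon>) \<le> C * exp (- t)" using t1 by (simp add: rescaled_integrand_def A_def E_def s_def)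
      then show ?thesis using pos far(1) by (simp add: csch_region_def)
    qed
    show "\<epsilon> * a \<noteq> 1 \<and> \<epsilon> * of_real t \<in> csch_region \<and> of_real t * (1 - \<epsilon> * a) \<in> csch_region \<and> Re (csch_sq (\<epsilon> * of_real t)) > 0 \<and>
       Re (rescaled_radicand a h t \<epsilon>) > 0 \<and> norm (rescaled_integrand a h t \<epsilon>) \<le> C * exp (- t)"
      using main ea1 sreg cp unfolding s_def Y_def b_def by blast
  qed
qed

section \<open>Expansion of the rescaled integral\<close>

text \<open>
  The conditions under which all square roots in the integrand are taken in the right half-plane, where
  \<open>csqrt\<close> is holomorphic.
\<close>

definition regular_at :: "complex \<Rightarrow> complex \<Rightarrow> real \<Rightarrow> complex \<Rightarrow> bool" where
  "regular_at a h t \<epsilon> \<longleftrightarrow> \<epsilon> * a \<noteq> 1 \<and> \<epsilon> * of_real t \<in> csch_region \<and> of_real t * (1 - \<epsilon> * a) \<in> csch_region \<and>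
     Re (csch_sq (\<epsilon> * of_real t)) > 0 \<and> Re (rescaled_radicand a h t \<epsilon>) > 0"

lemma rescaled_integrand_holomorphic:
  assumes A: "A holomorphic_on S" "H holomorphic_on S" "E holomorphic_on S"
    and reg: "\<And>z. z \<in> S \<Longrightarrow> regular_at (A z) (H z) t (E z)"
  shows "(\<lambda>z. rescaled_integrand (A z) (H z) t (E z)) holomorphic_on S"
proof -
  have cq: "(\<lambda>z. csch_quot (g z)) holomorphic_on S" if "g holomorphic_on S" "\<And>z. z \<in> S \<Longrightarrow> g z \<in> csch_region" for g
    using holomorphic_on_compose_gen[OF that(1) csch_quot(1)] that(2) by (auto simp: o_def)
  have cs: "(\<lambda>z. csch_sq (g z)) holomorphic_on S" if "g holomorphic_on S" "\<And>z. z \<in> S \<Longrightarrow> g z \<in> csch_region" for g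
    using holomorphic_on_compose_gen[OF that(1) csch_sq_holomorphic] that(2) by (auto simp: o_def)
  have rad: "(\<lambda>z. rescaled_radicand (A z) (H z) t (E z)) holomorphic_on S"
    unfolding rescaled_radicand_def
    by (intro holomorphic_intros A cq) (use reg in \<open>auto simp: regular_at_def\<close>)
  have h1: "(\<lambda>z. csqrt (rescaled_radicand (A z) (H z) t (E z))) holomorphic_on S"
    by (rule holomorphic_on_csqrt'[OF rad]) (use reg in \<open>fastforce simp: regular_at_def complex_nonpos_Reals_iff\<close>)
  have h2: "(\<lambda>z. csqrt (csch_sq (E z * of_real t))) holomorphic_on S"
    by (rule holomorphic_on_csqrt', rule cs) (use reg A in \<open>fastforce simp: regular_at_def complex_nonpos_Reals_iff intro!: holomorphic_intros\<close>)+
  show ?thesis unfolding rescaled_integrand_def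
  proof (cases "t > 1")
    case True
    then show "(\<lambda>z. csqrt (rescaled_radicand (A z) (H z) t (E z)) - (if t > 1 then csqrt (csch_sq (E z * of_real t)) / of_real t else 0)) holomorphic_on S"
      by (simp only: if_True) (intro holomorphic_on_diff holomorphic_on_divide holomorphic_on_const h1 h2, auto)
  next
    case False
    then show "(\<lambda>z. csqrt (rescaled_radicand (A z) (H z) t (E z)) - (if t > 1 then csqrt (csch_sq (E z * of_real t)) / of_real t else 0)) holomorphic_on S"
      using h1 by simp
  qed
qed

text \<open>
  Continuity in \<open>t\<close> serves to show measurability, so the jump of the integrand at \<open>t = 1\<close> is avoided by
  treating the two sides separately.
\<close>

lemma rescaled_integrand_continuous:
  assumes A: "continuous_on T A" "continuous_on T H" and T: "T \<subseteq> {..1} \<or> T \<subseteq> {1<..}"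
    and reg: "\<And>t. t \<in> T \<Longrightarrow> regular_at (A t) (H t) t \<epsilon>"
  shows "continuous_on T (\<lambda>t. rescaled_integrand (A t) (H t) t \<epsilon>)"
proof -
  have cq: "continuous_on T (\<lambda>z. csch_quot (g z))" if "continuous_on T g" "\<And>z. z \<in> T \<Longrightarrow> g z \<in> csch_region" for g
    by (rule continuous_on_compose2[OF holomorphic_on_imp_continuous_on[OF csch_quot(1)] that(1)]) (use that(2) in auto)
  have cs: "continuous_on T (\<lambda>z. csch_sq (g z))" if "continuous_on T g" "\<And>z. z \<in> T \<Longrightarrow> g z \<in> csch_region" for g
    by (rule continuous_on_compose2[OF holomorphic_on_imp_continuous_on[OF csch_sq_holomorphic] that(1)]) (use that(2) in auto)
  have "csqrt holomorphic_on {z. Re z > 0}"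
    by (rule holomorphic_on_csqrt'[OF holomorphic_on_ident]) (auto simp: complex_nonpos_Reals_iff)
  then have csq: "continuous_on {z. Re z > 0} csqrt" by (rule holomorphic_on_imp_continuous_on)
  have sq: "continuous_on T (\<lambda>z. csqrt (g z))" if "continuous_on T g" "\<And>z. z \<in> T \<Longrightarrow> Re (g z) > 0" for g
    by (rule continuous_on_compose2[OF csq that(1)]) (use that(2) in auto)
  have rad: "continuous_on T (\<lambda>t. rescaled_radicand (A t) (H t) t \<epsilon>)"
    unfolding rescaled_radicand_def
    by (intro continuous_intros A cq) (use reg in \<open>auto simp: regular_at_def\<close>)
  have h1: "continuous_on T (\<lambda>t. csqrt (rescaled_radicand (A t) (H t) t \<epsilon>))"
    by (rule sq[OF rad]) (use reg in \<open>auto simp: regular_at_def\<close>)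
  have h2: "continuous_on T (\<lambda>t. csqrt (csch_sq (\<epsilon> * of_real t)))"
    by (rule sq, rule cs) (use reg in \<open>auto simp: regular_at_def intro!: continuous_intros\<close>)
  show ?thesis using T
  proof
    assume "T \<subseteq> {..1}"
    then have "rescaled_integrand (A t) (H t) t \<epsilon> = csqrt (rescaled_radicand (A t) (H t) t \<epsilon>)" if "t \<in> T" for t
      using that by (auto simp: rescaled_integrand_def)
    then show ?thesis using h1 by (simp cong: continuous_on_cong)
  next
    assume T: "T \<subseteq> {1<..}"
    then have "rescaled_integrand (A t) (H t) t \<epsilon> = csqrt (rescaled_radicand (A t) (H t) t \<epsilon>) - csqrt (csch_sq (\<epsilon> * of_real t)) / of_real t" if "t \<in> T" for t
      using that by (auto simp: rescaled_integrand_def)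
    moreover have "continuous_on T (\<lambda>t. csqrt (rescaled_radicand (A t) (H t) t \<epsilon>) - csqrt (csch_sq (\<epsilon> * of_real t)) / of_real t)"
      by (intro continuous_intros h1 h2) (use T in auto)
    ultimately show ?thesis by (simp cong: continuous_on_cong)
  qed
qed

text \<open>
  The parameters \<open>a\<close> and \<open>h\<close> are values of fixed holomorphic functions of \<open>s = \<epsilon> t\<close>. The last but one conclusion compares
  with slightly perturbed parameters: on the complex line through both parameter
  values the integrand is holomorphic and bounded in the unit disc, so its variation at
  distance \<open>\<kappa>\<close> is \<open>O (\<kappa>)\<close>.
\<close>

theorem rescaled_integrand_expansion:
  assumes \<delta>0: "\<delta>0 > 0" and GH: "G holomorphic_on ball 0 \<delta>0" "H holomorphic_on ball 0 \<delta>0"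
    and B: "\<And>z. z \<in> ball 0 \<delta>0 \<Longrightarrow> norm (G z) \<le> B" "\<And>z. z \<in> ball 0 \<delta>0 \<Longrightarrow> norm (H z) \<le> B"
  obtains r K c where "0 < r" "r \<le> \<delta>0" "r \<le> 1" "K \<ge> 0"
    "c 0 = (\<integral>t. indicator {0<..} t *\<^sub>R rescaled_integrand (G 0) (H 0) t 0 \<partial>lborel)"
    "\<And>N \<delta>. 0 < \<delta> \<Longrightarrow> \<delta> < r \<Longrightarrow> \<exists>C. \<forall>\<epsilon>. 0 < \<epsilon> \<longrightarrow> \<epsilon> < r - \<delta> \<longrightarrow>
       norm ((\<integral>t. indicator {0<..<\<delta> / \<epsilon>} t *\<^sub>R rescaled_integrand (G (\<epsilon> * of_real t)) (H (\<epsilon> * of_real t)) t (of_real \<epsilon>) \<partial>lborel) - (\<Sum>p<N. c p * of_real \<epsilon> ^ p)) \<le> C * \<epsilon> ^ N"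
    "\<And>\<epsilon> t a h \<kappa>. 0 < t \<Longrightarrow> 0 < \<epsilon> \<Longrightarrow> \<epsilon> * (1 + t) < r \<Longrightarrow> 0 \<le> \<kappa> \<Longrightarrow> \<kappa> \<le> 1 / 2 \<Longrightarrow>
       norm (a - G (\<epsilon> * of_real t)) \<le> \<kappa> * B \<Longrightarrow> norm (h - H (\<epsilon> * of_real t)) \<le> \<kappa> * B \<Longrightarrow>
       regular_at a h t (of_real \<epsilon>) \<and>
       norm (rescaled_integrand a h t (of_real \<epsilon>) - rescaled_integrand (G (\<epsilon> * of_real t)) (H (\<epsilon> * of_real t)) t (of_real \<epsilon>)) \<le> K * exp (- t) * \<kappa>"
    "\<And>\<epsilon> \<delta>. 0 < \<delta> \<Longrightarrow> \<delta> < r \<Longrightarrow> 0 < \<epsilon> \<Longrightarrow> \<epsilon> < r - \<delta> \<Longrightarrow> integrable lborel (\<lambda>t. indicator {0<..<\<delta> / \<epsilon>} t *\<^sub>R rescaled_integrand (G (\<epsilon> * of_real t)) (H (\<epsilon> * of_real t)) t (of_real \<epsilon>))"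
proof -
  have "norm (G 0) \<le> B" using B \<delta>0 by simp
  then have B0: "B \<ge> 0" using norm_ge_zero[of "G 0"] by linarith
  have B2: "2 * B \<ge> 0" using B0 by simp
  obtain r0 C where r0: "0 < r0" "r0 \<le> 1" "C \<ge> 0" and bound:
    "\<And>a h t \<epsilon>. norm a \<le> 2 * B \<Longrightarrow> norm h \<le> 2 * B \<Longrightarrow> 0 < t \<Longrightarrow> norm \<epsilon> * (1 + t) < r0 \<Longrightarrow>
       \<epsilon> * a \<noteq> 1 \<and> \<epsilon> * of_real t \<in> csch_region \<and> of_real t * (1 - \<epsilon> * a) \<in> csch_region \<and> Re (csch_sq (\<epsilon> * of_real t)) > 0 \<and>
       Re (rescaled_radicand a h t \<epsilon>) > 0 \<and> norm (rescaled_integrand a h t \<epsilon>) \<le> C * exp (- t)"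
    by (rule rescaled_integrand_bound[OF B2]) (rule that)
  have reg: "regular_at a h t \<epsilon>" and bd: "norm (rescaled_integrand a h t \<epsilon>) \<le> C * exp (- t)"
    if "norm a \<le> 2 * B" "norm h \<le> 2 * B" "0 < t" "norm \<epsilon> * (1 + t) < r0" for a h t \<epsilon>
    using bound[OF that] by (auto simp: regular_at_def)
  define r where "r = min r0 \<delta>0"
  have r: "0 < r" "r \<le> r0" "r \<le> \<delta>0" "r \<le> 1" using r0 \<delta>0 by (auto simp: r_def)
  have in\<delta>: "\<epsilon> * of_real t \<in> ball 0 \<delta>0" if "0 < t" "norm \<epsilon> * (1 + t) < r" for \<epsilon> :: complex and t :: real
  proof -
    have "norm \<epsilon> * t \<le> norm \<epsilon> * (1 + t)" by (intro mult_left_mono) auto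
    then show ?thesis using that r by (simp add: norm_mult)
  qed
  have G2: "norm (G (\<epsilon> * of_real t)) \<le> 2 * B" "norm (H (\<epsilon> * of_real t)) \<le> 2 * B"
    if "0 < t" "norm \<epsilon> * (1 + t) < r" for \<epsilon> :: complex and t :: real
    using B[OF in\<delta>[OF that]] B0 by auto
  define D where "D t \<epsilon> = rescaled_integrand (G (\<epsilon> * of_real t)) (H (\<epsilon> * of_real t)) t \<epsilon>" for t \<epsilon>
  have nb: "norm z * (1 + t) < r" if "z \<in> ball 0 (r / (1 + t))" "0 < t" for z :: complex and t
    using that by (simp add: field_simps)
  have Dreg: "regular_at (G (\<epsilon> * of_real t)) (H (\<epsilon> * of_real t)) t \<epsilon>" if "0 < t" "norm \<epsilon> * (1 + t) < r" for \<epsilon> t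
    by (rule reg[OF G2[OF that]]) (use that r in auto)
  have Dbd: "norm (D t \<epsilon>) \<le> C * exp (- t)" if "0 < t" "norm \<epsilon> * (1 + t) < r" for \<epsilon> t
    unfolding D_def by (rule bd[OF G2[OF that]]) (use that r in auto)
  have Dhol: "D t holomorphic_on ball 0 (r / (1 + t))" if t: "0 < t" for t
    unfolding D_def
  proof (rule rescaled_integrand_holomorphic)
    have l: "(\<lambda>z. z * complex_of_real t) holomorphic_on ball 0 (r / (1 + t))" by (intro holomorphic_intros)
    have im: "(\<lambda>z. z * complex_of_real t) ` ball 0 (r / (1 + t)) \<subseteq> ball 0 \<delta>0"
      using in\<delta>[OF t nb[OF _ t]] by blast
    show "(\<lambda>z. G (z * complex_of_real t)) holomorphic_on ball 0 (r / (1 + t))"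
      using holomorphic_on_compose_gen[OF l GH(1) im] by (simp add: o_def)
    show "(\<lambda>z. H (z * complex_of_real t)) holomorphic_on ball 0 (r / (1 + t))"
      using holomorphic_on_compose_gen[OF l GH(2) im] by (simp add: o_def)
    show "(\<lambda>z. z) holomorphic_on ball 0 (r / (1 + t))" by (intro holomorphic_intros)
    fix z :: complex assume "z \<in> ball 0 (r / (1 + t))"
    then show "regular_at (G (z * complex_of_real t)) (H (z * complex_of_real t)) t z"
      by (intro Dreg t nb)
  qed
  have Dmeas: "(\<lambda>t. indicator {t. 0 < t \<and> \<epsilon> * (1 + t) < r} t *\<^sub>R D t (of_real \<epsilon>)) \<in> borel_measurable borel"
    if \<epsilon>: "0 \<le> \<epsilon>" for \<epsilon>
  proof -
    define T where "T = {t. 0 < t \<and> \<epsilon> * (1 + t) < r}"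
    have Tb: "T \<in> sets borel" unfolding T_def by measurable
    have cont: "continuous_on S (\<lambda>t. D t (of_real \<epsilon>))" if S: "S \<subseteq> T" "S \<subseteq> {..1} \<or> S \<subseteq> {1<..}" for S
      unfolding D_def
    proof (rule rescaled_integrand_continuous)
      have tT: "0 < t" "norm (complex_of_real \<epsilon>) * (1 + t) < r" if "t \<in> S" for t using that S \<epsilon> by (auto simp: T_def)
      have im: "(\<lambda>t. of_real \<epsilon> * complex_of_real t) ` S \<subseteq> ball 0 \<delta>0" using in\<delta>[OF tT] by blast
      show "continuous_on S (\<lambda>t. G (of_real \<epsilon> * complex_of_real t))"
        by (rule continuous_on_compose2[OF holomorphic_on_imp_continuous_on[OF GH(1)] _ im]) (intro continuous_intros)
      show "continuous_on S (\<lambda>t. H (of_real \<epsilon> * complex_of_real t))"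
        by (rule continuous_on_compose2[OF holomorphic_on_imp_continuous_on[OF GH(2)] _ im]) (intro continuous_intros)
      show "S \<subseteq> {..1} \<or> S \<subseteq> {1<..}" by (rule S)
      fix t assume "t \<in> S"
      then show "regular_at (G (of_real \<epsilon> * complex_of_real t)) (H (of_real \<epsilon> * complex_of_real t)) t (of_real \<epsilon>)"
        by (intro Dreg tT)
    qed
    have "(\<lambda>t. indicator (T \<inter> {..1}) t *\<^sub>R D t (of_real \<epsilon>)) \<in> borel_measurable borel"
      by (rule borel_measurable_continuous_on_indicator) (use Tb in \<open>auto intro: cont\<close>)
    moreover have "(\<lambda>t. indicator (T \<inter> {1<..}) t *\<^sub>R D t (of_real \<epsilon>)) \<in> borel_measurable borel"
      by (rule borel_measurable_continuous_on_indicator) (use Tb in \<open>auto intro: cont\<close>)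
    ultimately have "(\<lambda>t. indicator (T \<inter> {..1}) t *\<^sub>R D t (of_real \<epsilon>) + indicator (T \<inter> {1<..}) t *\<^sub>R D t (of_real \<epsilon>)) \<in> borel_measurable borel"
      by (rule borel_measurable_add)
    moreover have "(\<lambda>t. indicator (T \<inter> {..1}) t *\<^sub>R D t (of_real \<epsilon>) + indicator (T \<inter> {1<..}) t *\<^sub>R D t (of_real \<epsilon>)) = (\<lambda>t. indicator T t *\<^sub>R D t (of_real \<epsilon>))"
      by (auto simp: fun_eq_iff indicator_def)
    ultimately show ?thesis by (simp add: T_def)
  qed
  define K where "K = 12 * C"
  have K: "K \<ge> 0" using r0 by (simp add: K_def)
  define c where "c p = (\<integral>t. indicator {0<..} t *\<^sub>R ((deriv ^^ p) (D t) 0 / fact p) \<partial>lborel)" for p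
  have expn: "\<exists>C'. \<forall>\<epsilon>. 0 < \<epsilon> \<longrightarrow> \<epsilon> < r - \<delta> \<longrightarrow>
       norm ((\<integral>t. indicator {0<..<\<delta> / \<epsilon>} t *\<^sub>R D t (of_real \<epsilon>) \<partial>lborel) - (\<Sum>p<N. c p * of_real \<epsilon> ^ p)) \<le> C' * \<epsilon> ^ N"
    if "0 < \<delta>" "\<delta> < r" for \<delta> N
    unfolding c_def by (rule integral_asymptotic_expansion[OF that r0(3) Dhol Dbd Dmeas]) (use nb in auto)
  show thesis
  proof (rule that[of r K c])
    show "c 0 = (\<integral>t. indicator {0<..} t *\<^sub>R rescaled_integrand (G 0) (H 0) t 0 \<partial>lborel)"
      by (simp add: c_def D_def)
    show "\<exists>C. \<forall>\<epsilon>. 0 < \<epsilon> \<longrightarrow> \<epsilon> < r - \<delta> \<longrightarrow>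
       norm ((\<integral>t. indicator {0<..<\<delta> / \<epsilon>} t *\<^sub>R rescaled_integrand (G (\<epsilon> * of_real t)) (H (\<epsilon> * of_real t)) t (of_real \<epsilon>) \<partial>lborel) - (\<Sum>p<N. c p * of_real \<epsilon> ^ p)) \<le> C * \<epsilon> ^ N"
      if "0 < \<delta>" "\<delta> < r" for N \<delta>
      using expn[OF that, of N] by (simp add: D_def)
  next
    fix \<epsilon> t \<kappa> :: real and a h :: complex
    assume t: "0 < t" and \<epsilon>: "0 < \<epsilon>" "\<epsilon> * (1 + t) < r" and \<kappa>: "0 \<le> \<kappa>" "\<kappa> \<le> 1/2"
      and a: "norm (a - G (\<epsilon> * of_real t)) \<le> \<kappa> * B" and h: "norm (h - H (\<epsilon> * of_real t)) \<le> \<kappa> * B"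
    have e: "norm (complex_of_real \<epsilon>) * (1 + t) < r" using \<epsilon> by simp
    have e0: "norm (complex_of_real \<epsilon>) * (1 + t) < r0" using e r by simp
    define a0 h0 where "a0 = G (\<epsilon> * of_real t)" and "h0 = H (\<epsilon> * of_real t)"
    have a0: "norm a0 \<le> B" "norm h0 \<le> B" using B[OF in\<delta>[OF t e]] by (auto simp: a0_def h0_def)
    obtain a' where a': "norm a' \<le> B" "a = a0 + of_real \<kappa> * a'"
    proof (cases "\<kappa> = 0")
      case True then show thesis using a that[of 0] B0 by (simp add: a0_def)
    next
      case False
      then have "norm ((a - a0) / of_real \<kappa>) \<le> B" using a \<kappa> by (simp add: a0_def norm_divide divide_le_eq mult.commute)
      then show thesis using that[of "(a - a0) / of_real \<kappa>"] False by simp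
    qed
    obtain h' where h': "norm h' \<le> B" "h = h0 + of_real \<kappa> * h'"
    proof (cases "\<kappa> = 0")
      case True then show thesis using h that[of 0] B0 by (simp add: h0_def)
    next
      case False
      then have "norm ((h - h0) / of_real \<kappa>) \<le> B" using h \<kappa> by (simp add: h0_def norm_divide divide_le_eq mult.commute)
      then show thesis using that[of "(h - h0) / of_real \<kappa>"] False by simp
    qed
    \<comment> \<open>The line through the two parameter values; at \<open>z = \<kappa>\<close> it meets \<open>(a, h)\<close>,
      and in the unit disc its parameters are bounded by \<open>2 B\<close>.\<close>
    define f where "f z = rescaled_integrand (a0 + z * a') (h0 + z * h') t (of_real \<epsilon>)" for z
    have nz: "norm (a0 + z * a') \<le> 2 * B" "norm (h0 + z * h') \<le> 2 * B" if "z \<in> ball 0 1" for z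
    proof -
      have "norm (z * a') \<le> 1 * B" "norm (z * h') \<le> 1 * B" unfolding norm_mult
        by (intro mult_mono a' h'; use that in simp)+
      then show "norm (a0 + z * a') \<le> 2 * B" "norm (h0 + z * h') \<le> 2 * B"
        using norm_triangle_ineq[of a0 "z * a'"] norm_triangle_ineq[of h0 "z * h'"] a0 by linarith+
    qed
    have fhol: "f holomorphic_on ball 0 1" unfolding f_def
      by (rule rescaled_integrand_holomorphic) (use reg[OF nz t e0] in \<open>auto intro!: holomorphic_intros\<close>)
    have fbd: "norm (f z) \<le> C * exp (- t)" if "z \<in> ball 0 1" for z
      unfolding f_def by (rule bd[OF nz[OF that] t e0])
    have kb: "complex_of_real \<kappa> \<in> ball 0 1" using \<kappa> by simp
    have "norm (f (of_real \<kappa>) - (\<Sum>p<1. (deriv ^^ p) f 0 / fact p * of_real \<kappa> ^ p)) \<le> (C * exp (- t)) * (real 1 + 2) * (4 * norm (complex_of_real \<kappa>) / 1) ^ 1"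
      by (rule taylor_remainder_bound[OF fhol _ fbd kb]) auto
    then have "norm (f (of_real \<kappa>) - f 0) \<le> K * exp (- t) * \<kappa>" using \<kappa> by (simp add: K_def mult_ac)
    moreover have "f (of_real \<kappa>) = rescaled_integrand a h t (of_real \<epsilon>)" "f 0 = rescaled_integrand a0 h0 t (of_real \<epsilon>)"
      by (simp_all add: f_def a' h')
    moreover have "regular_at a h t (of_real \<epsilon>)" unfolding a'(2) h'(2) by (rule reg[OF nz[OF kb] t e0])
    ultimately show "regular_at a h t (of_real \<epsilon>) \<and>
       norm (rescaled_integrand a h t (of_real \<epsilon>) - rescaled_integrand (G (\<epsilon> * of_real t)) (H (\<epsilon> * of_real t)) t (of_real \<epsilon>)) \<le> K * exp (- t) * \<kappa>"
      by (simp add: a0_def h0_def)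
  next
    fix \<epsilon> \<delta> :: real assume \<delta>: "0 < \<delta>" "\<delta> < r" and \<epsilon>: "0 < \<epsilon>" "\<epsilon> < r - \<delta>"
    have small: "\<epsilon> * (1 + t) < r" if "t < \<delta> / \<epsilon>" for t
    proof -
      have "\<epsilon> * t < \<delta>" using that \<epsilon> by (simp add: field_simps)
      then show ?thesis using \<epsilon> by (simp add: algebra_simps)
    qed
    have "integrable lborel (\<lambda>t. indicator {0<..<\<delta> / \<epsilon>} t *\<^sub>R D t (of_real \<epsilon>))"
    proof (rule Bochner_Integration.integrable_bound[OF integrable_mult_right[OF integrable_exp_poly_weight[of 0], of C]])
      have eq: "(\<lambda>t. indicator {0<..<\<delta> / \<epsilon>} t *\<^sub>R D t (of_real \<epsilon>)) =
          (\<lambda>t. indicator {0<..<\<delta> / \<epsilon>} t *\<^sub>R (indicator {t. 0 < t \<and> \<epsilon> * (1 + t) < r} t *\<^sub>R D t (of_real \<epsilon>)))"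
        using small by (auto simp: fun_eq_iff indicator_def)
      have "(\<lambda>t. indicator {0<..<\<delta> / \<epsilon>} t *\<^sub>R D t (of_real \<epsilon>)) \<in> borel_measurable borel"
        by (subst eq, intro borel_measurable_scaleR borel_measurable_indicator Dmeas) (use \<epsilon> in auto)
      then show "(\<lambda>t. indicator {0<..<\<delta> / \<epsilon>} t *\<^sub>R D t (of_real \<epsilon>)) \<in> borel_measurable lborel" by simp
      show "AE t in lborel. norm (indicator {0<..<\<delta> / \<epsilon>} t *\<^sub>R D t (of_real \<epsilon>)) \<le> norm (C * (indicator {0<..} t * (exp (- t) * (1 + t) ^ 0)))"
      proof (rule AE_I2)
        fix t :: real
        show "norm (indicator {0<..<\<delta> / \<epsilon>} t *\<^sub>R D t (of_real \<epsilon>)) \<le> norm (C * (indicator {0<..} t * (exp (- t) * (1 + t) ^ 0)))"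
        proof (cases "0 < t \<and> t < \<delta> / \<epsilon>")
          case True
          then have "norm (D t (of_real \<epsilon>)) \<le> C * exp (- t)" by (intro Dbd) (use small \<epsilon> in auto)
          then show ?thesis using True r0 by (simp add: abs_mult)
        qed auto
      qed
    qed
    then show "integrable lborel (\<lambda>t. indicator {0<..<\<delta> / \<epsilon>} t *\<^sub>R rescaled_integrand (G (\<epsilon> * of_real t)) (H (\<epsilon> * of_real t)) t (of_real \<epsilon>))"
      by (simp add: D_def)
  qed (use r K in auto)
qed

section \<open>Expected zeros as a defect of hyperbolic speed\<close>

text \<open>
  For \<open>b = Q / reflect_poly Q\<close> this is \<open>2 x b' / (1 - b\<^sup>2)\<close>: up to sign, the hyperbolic speed of \<open>b\<close> along
  \<open>x = \<plusminus> exp (- s)\<close> as a function of \<open>s\<close>.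
\<close>

definition blaschke_speed :: "real poly \<Rightarrow> real \<Rightarrow> real" where
  "blaschke_speed Q x = 2 * x * (poly (reflect_poly Q) x * poly (pderiv Q) x - poly (pderiv (reflect_poly Q)) x * poly Q x) /
     ((poly (reflect_poly Q) x)\<^sup>2 - (poly Q x)\<^sup>2)"

text \<open>
  Inversion \<open>x \<mapsto> 1 / x\<close> exchanges \<open>Q\<close> and its reversal up to the factor \<open>x ^ m\<close>, which cancels in the
  speed.
\<close>

lemma blaschke_speed_inverse:
  fixes Q :: "real poly"
  assumes x: "x \<noteq> 0"
  shows "blaschke_speed Q (1 / x) = - blaschke_speed Q x"
proof -
  define m where "m = degree Q"
  define P where "P = reflect_poly Q"
  have refl: "y ^ m * poly Q (1 / y) = poly P y" if "y \<noteq> 0" for y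
    using poly_reflect_poly_nz[of y Q] that by (simp add: P_def m_def inverse_eq_divide)
  have refl': "y ^ m * poly P (1 / y) = poly Q y" if "y \<noteq> 0" for y
    using refl[of "1 / y"] that by (simp add: power_divide field_simps)
  have dinv: "((\<lambda>y. 1 / y) has_real_derivative - 1 / x\<^sup>2) (at x)"
    using x by (auto intro!: derivative_eq_intros simp: power2_eq_square)
  have d1: "real m * x ^ (m - 1) * poly A (1 / x) + x ^ m * (poly (pderiv A) (1 / x) * (- 1 / x\<^sup>2)) = poly (pderiv B) x"
    if AB: "\<And>y. y \<noteq> 0 \<Longrightarrow> y ^ m * poly A (1 / y) = poly B y" for A B
  proof (rule DERIV_unique)
    have c: "((\<lambda>y. poly A (1 / y)) has_real_derivative poly (pderiv A) (1 / x) * (- 1 / x\<^sup>2)) (at x)"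
      by (rule DERIV_chain2[OF poly_DERIV dinv])
    show "((\<lambda>y. y ^ m * poly A (1 / y)) has_real_derivative
        real m * x ^ (m - 1) * poly A (1 / x) + x ^ m * (poly (pderiv A) (1 / x) * (- 1 / x\<^sup>2))) (at x)"
      by (rule derivative_eq_intros c refl | simp)+
    have "((\<lambda>y. poly B y) has_real_derivative poly (pderiv B) x) (at x)" by (rule poly_DERIV)
    then show "((\<lambda>y. y ^ m * poly A (1 / y)) has_real_derivative poly (pderiv B) x) (at x)"
      by (rule has_field_derivative_transform_within_open[where S="- {0}"]) (use x AB in auto)
  qed
  define p q p' q' where pq: "p = poly P (1 / x)" "q = poly Q (1 / x)" "p' = poly (pderiv P) (1 / x)" "q' = poly (pderiv Q) (1 / x)"
  define X where "X = x ^ m"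
  have X: "X \<noteq> 0" using x by (simp add: X_def)
  define k where "k = real m * x ^ (m - 1)"
  have eP: "poly P x = X * q" "poly Q x = X * p" using refl[OF x] refl'[OF x] by (simp_all add: X_def pq)
  have dP: "poly (pderiv P) x = k * q - X * q' / x\<^sup>2" "poly (pderiv Q) x = k * p - X * p' / x\<^sup>2"
    using d1[OF refl] d1[OF refl'] by (simp_all add: X_def k_def pq)
  have n: "poly P x * poly (pderiv Q) x - poly (pderiv P) x * poly Q x = X\<^sup>2 / x\<^sup>2 * (p * q' - p' * q)"
    unfolding eP dP using x by (simp add: field_simps power2_eq_square)
  have dn: "(poly P x)\<^sup>2 - (poly Q x)\<^sup>2 = - (X\<^sup>2 * (p\<^sup>2 - q\<^sup>2))"
    unfolding eP by (simp add: power_mult_distrib algebra_simps)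
  have "blaschke_speed Q x = 2 * x * (X\<^sup>2 / x\<^sup>2 * (p * q' - p' * q)) / (- (X\<^sup>2 * (p\<^sup>2 - q\<^sup>2)))"
    unfolding blaschke_speed_def P_def[symmetric] n dn ..
  also have "\<dots> = - (2 * (1 / x) * (p * q' - p' * q) / (p\<^sup>2 - q\<^sup>2))"
  proof (cases "p\<^sup>2 - q\<^sup>2 = 0")
    case False
    then show ?thesis using x X by (simp add: field_simps power2_eq_square)
  qed simp
  also have "\<dots> = - blaschke_speed Q (1 / x)"
    unfolding blaschke_speed_def P_def[symmetric] pq by simp
  finally show ?thesis by simp
qed

lemma nn_integral_exp_substitution:
  fixes f :: "real \<Rightarrow> real"
  assumes f: "f \<in> borel_measurable borel" "\<And>x. 0 \<le> f x" and s: "\<sigma> = 1 \<or> \<sigma> = -1"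
  shows "(\<integral>\<^sup>+s. ennreal (exp (- s) * f (\<sigma> * exp (- s))) \<partial>lborel) = (\<integral>\<^sup>+x. ennreal (f x) * indicator {x. 0 < \<sigma> * x} x \<partial>lborel)"
proof -
  have img: "(\<lambda>s. \<sigma> * exp (- s)) ` UNIV = {x. 0 < \<sigma> * x}"
  proof (intro equalityI subsetI)
    fix x assume "x \<in> {x. 0 < \<sigma> * x}"
    then have "x = \<sigma> * exp (- (- ln (\<sigma> * x)))" using s by auto
    then show "x \<in> (\<lambda>s. \<sigma> * exp (- s)) ` UNIV" by blast
  qed (use s in auto)
  have Sb: "{x. 0 < \<sigma> * x} \<in> sets borel" by measurable
  have "(\<integral>\<^sup>+s. ennreal (\<bar>- \<sigma> * exp (- s)\<bar> * f (\<sigma> * exp (- s))) * indicator UNIV s \<partial>lborel) =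
      (\<integral>\<^sup>+x. ennreal (f x) * indicator ((\<lambda>s. \<sigma> * exp (- s)) ` UNIV) x \<partial>lborel)"
  proof (rule nn_integral_change_of_variables_real)
    show "inj_on (\<lambda>s. \<sigma> * exp (- s)) UNIV" using s by (auto simp: inj_on_def)
    show "((\<lambda>s. \<sigma> * exp (- s)) has_real_derivative - \<sigma> * exp (- x)) (at x within UNIV)" for x
      by (auto intro!: derivative_eq_intros)
    show "(\<lambda>s. \<sigma> * exp (- s)) ` UNIV \<in> sets borel" unfolding img by (rule Sb)
  qed (use f in auto)
  moreover have "\<bar>- \<sigma> * exp (- s)\<bar> = exp (- s)" for s using s by (auto simp: abs_mult)
  ultimately show ?thesis unfolding img by simp
qed

text \<open>
  The diagonal Christoffel-Darboux identities turn the Kac-Rice density at \<open>x = \<plusminus> exp (- s)\<close>, times the Jacobian, into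
  \<open>sqrt (csch\<^sup>2 s - v\<^sup>2) / (2 pi)\<close>. This is even in \<open>s\<close>, so the half-line \<open>s > 0\<close> is counted twice.
\<close>

theorem expected_real_zeros_hyperbolic:
  assumes sets: "sets \<mu> = sets borel_circle" and ps: "prob_space \<mu>" and on: "orthonormal_polys \<mu> \<phi>"
    and iid: "iid_std_normal M \<eta>"
  shows "ennreal (pi * expected_real_zeros M \<phi> \<eta> n) =
     (\<integral>\<^sup>+s. ennreal (sqrt ((1 / sinh s)\<^sup>2 - (blaschke_speed (\<phi> (Suc n)) (exp (- s)))\<^sup>2)) * indicator {0<..} s \<partial>lborel) +
     (\<integral>\<^sup>+s. ennreal (sqrt ((1 / sinh s)\<^sup>2 - (blaschke_speed (\<phi> (Suc n)) (- exp (- s)))\<^sup>2)) * indicator {0<..} s \<partial>lborel)"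
    and "0 < s \<Longrightarrow> \<sigma> = 1 \<or> \<sigma> = -1 \<Longrightarrow> (blaschke_speed (\<phi> (Suc n)) (\<sigma> * exp (- s)))\<^sup>2 \<le> (1 / sinh s)\<^sup>2"
proof -
  interpret toeplitz_orthonormal "circle_form \<mu>" \<phi> by (rule toeplitz_orthonormal_circle_form[OF sets ps on])
  let ?Q = "\<phi> (Suc n)"
  let ?P = "reflect_poly ?Q"
  obtain k0 where k0: "\<phi> 0 = [:k0:]" using degree_\<phi>[of 0] degree_eq_zeroE by blast
  have k0n: "k0 \<noteq> 0" using lead_\<phi>[of 0] k0 by simp
  define K0 K1 K2 where K: "K0 = kernel0 \<phi> n" "K1 = kernel1 \<phi> n" "K2 = kernel2 \<phi> n"
  note diag = christoffel_darboux_diagonal[where n=n and \<phi>=\<phi> and P="?P" and Q="?Q", OF christoffel_darboux]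
  have cd1: "(1 - x\<^sup>2) * K0 x = (poly ?P x)\<^sup>2 - (poly ?Q x)\<^sup>2" for x
    using diag(1)[of x] by (simp add: K kernel0_def)
  define w where "w x = poly ?P x * poly (pderiv ?Q) x - poly (pderiv ?P) x * poly ?Q x" for x
  have cd2: "(1 - x\<^sup>2)\<^sup>2 * (K0 x * K2 x - (K1 x)\<^sup>2) = (K0 x)\<^sup>2 - (w x)\<^sup>2" for x
    using diag(2)[of x] by (simp add: K kernel0_def kernel1_def kernel2_def w_def)
  have K0pos: "K0 x > 0" for x
  proof -
    have "(poly (\<phi> 0) x)\<^sup>2 \<le> (\<Sum>i\<le>n. (poly (\<phi> i) x)\<^sup>2)" by (rule member_le_sum) auto
    moreover have "(poly (\<phi> 0) x)\<^sup>2 > 0" using k0n by (simp add: k0)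
    ultimately show ?thesis unfolding K kernel0_def by linarith
  qed
  have CS: "(K1 x)\<^sup>2 \<le> K0 x * K2 x" for x
    using Cauchy_Schwarz_ineq_sum[of "\<lambda>i. poly (\<phi> i) x" "\<lambda>i. poly (pderiv (\<phi> i)) x" "{..n}"]
    by (simp add: K kernel0_def kernel1_def kernel2_def)
  define \<kappa> where "\<kappa> x = sqrt (K0 x * K2 x - (K1 x)\<^sup>2) / K0 x" for x
  have \<kappa>0: "\<kappa> x \<ge> 0" for x using K0pos[of x] CS[of x] by (simp add: \<kappa>_def)
  have [measurable]: "poly p \<in> borel_measurable borel" for p :: "real poly"
    by (auto intro!: borel_measurable_continuous_onI continuous_intros)
  have \<kappa>m[measurable]: "\<kappa> \<in> borel_measurable borel"
    unfolding \<kappa>_def K kernel0_def kernel1_def kernel2_def by measurable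
  have \<kappa>2: "(2 * exp (- s) * \<kappa> (\<sigma> * exp (- s)))\<^sup>2 = (1 / sinh s)\<^sup>2 - (blaschke_speed ?Q (\<sigma> * exp (- s)))\<^sup>2"
    if s: "s \<noteq> 0" and \<sigma>: "\<sigma> = 1 \<or> \<sigma> = -1" for s \<sigma>
  proof -
    define x where "x = \<sigma> * exp (- s)"
    have x2: "x\<^sup>2 = (exp (- s))\<^sup>2" using \<sigma> by (auto simp: x_def)
    have u: "1 - x\<^sup>2 \<noteq> 0"
    proof
      assume "1 - x\<^sup>2 = 0"
      then have "exp (- s) ^ 2 = 1" using x2 by simp
      then have "exp (- 2 * s) = 1" by (simp add: power2_eq_square mult_exp_exp)
      then show False using s by simp
    qed
    have "(2 * exp (- s) * \<kappa> x)\<^sup>2 = 4 * x\<^sup>2 * ((K0 x * K2 x - (K1 x)\<^sup>2) / (K0 x)\<^sup>2)"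
      unfolding \<kappa>_def x2 using CS[of x] by (simp add: power_mult_distrib power_divide)
    also have "K0 x * K2 x - (K1 x)\<^sup>2 = ((K0 x)\<^sup>2 - (w x)\<^sup>2) / (1 - x\<^sup>2)\<^sup>2"
      using cd2[of x] u by (simp add: field_simps)
    also have "4 * x\<^sup>2 * (((K0 x)\<^sup>2 - (w x)\<^sup>2) / (1 - x\<^sup>2)\<^sup>2 / (K0 x)\<^sup>2) = (2 * x / (1 - x\<^sup>2))\<^sup>2 - (2 * x * w x / ((1 - x\<^sup>2) * K0 x))\<^sup>2"
      using u K0pos[of x] by (simp add: power_mult_distrib power_divide diff_divide_distrib right_diff_distrib)
    also have "2 * x * w x / ((1 - x\<^sup>2) * K0 x) = blaschke_speed ?Q x"
      unfolding cd1 by (simp add: blaschke_speed_def w_def)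
    also have "(2 * x / (1 - x\<^sup>2))\<^sup>2 = (1 / sinh s)\<^sup>2"
    proof -
      have "exp s * exp (- s) = 1" by (simp add: mult_exp_exp)
      then have "sinh s * (2 * exp (- s)) = 1 - (exp (- s))\<^sup>2"
        by (simp add: sinh_def power2_eq_square algebra_simps)
      then have e: "1 - x\<^sup>2 = sinh s * (2 * exp (- s))" using x2 by simp
      have "(2 * x / (1 - x\<^sup>2))\<^sup>2 = 4 * x\<^sup>2 / (1 - x\<^sup>2)\<^sup>2" by (simp add: power_mult_distrib power_divide)
      also have "\<dots> = 4 * (exp (- s))\<^sup>2 / (sinh s * (2 * exp (- s)))\<^sup>2" unfolding x2[symmetric] e[symmetric] ..
      also have "\<dots> = (1 / sinh s)\<^sup>2" by (simp add: power_mult_distrib power_divide)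
      finally show ?thesis .
    qed
    finally show ?thesis by (simp add: x_def)
  qed
  show "(blaschke_speed ?Q (\<sigma> * exp (- s)))\<^sup>2 \<le> (1 / sinh s)\<^sup>2" if "0 < s" "\<sigma> = 1 \<or> \<sigma> = -1"
    using \<kappa>2[of s \<sigma>] that zero_le_power2[of "2 * exp (- s) * \<kappa> (\<sigma> * exp (- s))"] by linarith
  have half: "(\<integral>\<^sup>+x. ennreal (\<kappa> x) * indicator {x. 0 < \<sigma> * x} x \<partial>lborel) =
     (\<integral>\<^sup>+s. ennreal (sqrt ((1 / sinh s)\<^sup>2 - (blaschke_speed ?Q (\<sigma> * exp (- s)))\<^sup>2)) * indicator {0<..} s \<partial>lborel)"
    if \<sigma>: "\<sigma> = 1 \<or> \<sigma> = -1" for \<sigma>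
  proof -
    define h where "h s = exp (- s) * \<kappa> (\<sigma> * exp (- s))" for s
    have h0: "h s \<ge> 0" for s using \<kappa>0 by (simp add: h_def)
    have hm[measurable]: "h \<in> borel_measurable borel" unfolding h_def by measurable
    have h2: "2 * h s = sqrt ((1 / sinh s)\<^sup>2 - (blaschke_speed ?Q (\<sigma> * exp (- s)))\<^sup>2)" if "s \<noteq> 0" for s
    proof -
      have "2 * h s = sqrt ((2 * h s)\<^sup>2)" by (subst real_sqrt_abs) (use h0[of s] in simp)
      then show ?thesis using \<kappa>2[OF that \<sigma>] by (simp add: h_def mult.assoc)
    qed
    \<comment> \<open>The zeros inside and outside the unit interval have the same density in \<open>s\<close>.\<close>
    have heven: "h (- s) = h s" if "s \<noteq> 0" for s
    proof -
      have "blaschke_speed ?Q (\<sigma> * exp (- (- s))) = - blaschke_speed ?Q (\<sigma> * exp (- s))"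
      proof -
        have "\<sigma> * exp (- (- s)) = 1 / (\<sigma> * exp (- s))" using \<sigma> by (auto simp: exp_minus field_simps)
        then show ?thesis using blaschke_speed_inverse[of "\<sigma> * exp (- s)" ?Q] \<sigma> by auto
      qed
      then have "2 * h (- s) = 2 * h s" using h2[of s] h2[of "- s"] that by simp
      then show ?thesis by simp
    qed
    have "(\<integral>\<^sup>+x. ennreal (\<kappa> x) * indicator {x. 0 < \<sigma> * x} x \<partial>lborel) = (\<integral>\<^sup>+s. ennreal (h s) \<partial>lborel)"
      unfolding h_def by (rule nn_integral_exp_substitution[OF \<kappa>m \<kappa>0 \<sigma>, symmetric])
    also have "\<dots> = (\<integral>\<^sup>+s. ennreal (h s) * indicator {0<..} s + ennreal (h s) * indicator {..<0} s \<partial>lborel)"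
    proof (rule nn_integral_cong_AE)
      have "AE s in lborel. s \<noteq> (0::real)" by (rule AE_lborel_singleton)
      then show "AE s in lborel. ennreal (h s) = ennreal (h s) * indicator {0<..} s + ennreal (h s) * indicator {..<0} s"
        by eventually_elim (auto simp: indicator_def)
    qed
    also have "\<dots> = (\<integral>\<^sup>+s. ennreal (h s) * indicator {0<..} s \<partial>lborel) + (\<integral>\<^sup>+s. ennreal (h s) * indicator {..<0} s \<partial>lborel)"
      by (rule nn_integral_add) measurable
    also have "(\<integral>\<^sup>+s. ennreal (h s) * indicator {..<0} s \<partial>lborel) = (\<integral>\<^sup>+s. ennreal (h s) * indicator {0<..} s \<partial>lborel)"
    proof -
      have "(\<integral>\<^sup>+s. ennreal (h s) * indicator {..<0} s \<partial>lborel) = ennreal \<bar>- 1\<bar> * (\<integral>\<^sup>+s. ennreal (h (0 + - 1 * s)) * indicator {..<0} (0 + - 1 * s) \<partial>lborel)"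
        by (rule nn_integral_real_affine) auto
      also have "\<dots> = (\<integral>\<^sup>+s. ennreal (h (- s)) * indicator {..<0} (- s) \<partial>lborel)" by simp
      also have "\<dots> = (\<integral>\<^sup>+s. ennreal (h s) * indicator {0<..} s \<partial>lborel)"
        by (intro nn_integral_cong) (auto simp: indicator_def heven)
      finally show ?thesis .
    qed
    also have "(\<integral>\<^sup>+s. ennreal (h s) * indicator {0<..} s \<partial>lborel) + (\<integral>\<^sup>+s. ennreal (h s) * indicator {0<..} s \<partial>lborel)
       = (\<integral>\<^sup>+s. ennreal (h s) * indicator {0<..} s + ennreal (h s) * indicator {0<..} s \<partial>lborel)"
      by (rule nn_integral_add[symmetric]) measurable
    also have "\<dots> = (\<integral>\<^sup>+s. ennreal (sqrt ((1 / sinh s)\<^sup>2 - (blaschke_speed ?Q (\<sigma> * exp (- s)))\<^sup>2)) * indicator {0<..} s \<partial>lborel)"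
    proof (rule nn_integral_cong)
      fix s :: real
      show "ennreal (h s) * indicator {0<..} s + ennreal (h s) * indicator {0<..} s = ennreal (sqrt ((1 / sinh s)\<^sup>2 - (blaschke_speed ?Q (\<sigma> * exp (- s)))\<^sup>2)) * indicator {0<..} s"
      proof (cases "s > 0")
        case True
        then show ?thesis using h2[of s] h0[of s] by (simp flip: ennreal_plus)
      qed simp
    qed
    finally show ?thesis .
  qed
  have "ennreal (pi * expected_real_zeros M \<phi> \<eta> n) = ennreal pi * (\<integral>\<^sup>+x. ennreal (\<kappa> x / pi) \<partial>lborel)"
    using kac_rice[where \<phi>=\<phi> and M=M and \<eta>=\<eta> and n=n, OF iid k0 k0n] by (simp add: ennreal_mult' \<kappa>_def K mult.commute)
  also have "\<dots> = (\<integral>\<^sup>+x. ennreal pi * ennreal (\<kappa> x / pi) \<partial>lborel)"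
    by (rule nn_integral_cmult[symmetric]) measurable
  also have "\<dots> = (\<integral>\<^sup>+x. ennreal (\<kappa> x) * indicator {x. 0 < 1 * x} x + ennreal (\<kappa> x) * indicator {x. 0 < - 1 * x} x \<partial>lborel)"
  proof (rule nn_integral_cong_AE)
    have "AE x in lborel. x \<noteq> (0::real)" by (rule AE_lborel_singleton)
    then show "AE x in lborel. ennreal pi * ennreal (\<kappa> x / pi) = ennreal (\<kappa> x) * indicator {x. 0 < 1 * x} x + ennreal (\<kappa> x) * indicator {x. 0 < - 1 * x} x"
    proof eventually_elim
      case (elim x)
      have "ennreal pi * ennreal (\<kappa> x / pi) = ennreal (\<kappa> x)" by (simp flip: ennreal_mult')
      then show ?case using elim by (auto simp: indicator_def)
    qed
  qed
  also have "\<dots> = (\<integral>\<^sup>+x. ennreal (\<kappa> x) * indicator {x. 0 < 1 * x} x \<partial>lborel) + (\<integral>\<^sup>+x. ennreal (\<kappa> x) * indicator {x. 0 < - 1 * x} x \<partial>lborel)"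
    by (rule nn_integral_add) measurable
  finally show "ennreal (pi * expected_real_zeros M \<phi> \<eta> n) =
     (\<integral>\<^sup>+s. ennreal (sqrt ((1 / sinh s)\<^sup>2 - (blaschke_speed ?Q (exp (- s)))\<^sup>2)) * indicator {0<..} s \<partial>lborel) +
     (\<integral>\<^sup>+s. ennreal (sqrt ((1 / sinh s)\<^sup>2 - (blaschke_speed ?Q (- exp (- s)))\<^sup>2)) * indicator {0<..} s \<partial>lborel)"
    using half[of 1] half[of "-1"] by simp
qed

definition endpoint_integrand :: "real poly \<Rightarrow> real \<Rightarrow> real \<Rightarrow> real" where
  "endpoint_integrand Q \<sigma> = (\<lambda>s. indicator {0<..} s * sqrt ((1 / sinh s)\<^sup>2 - (blaschke_speed Q (\<sigma> * exp (- s)))\<^sup>2))"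

text \<open>
  The expectation is finite by definition, which makes both endpoint integrals finite and allows passing from extended nonnegative to
  ordinary integrals.
\<close>

lemma expected_real_zeros_endpoints:
  assumes sets: "sets \<mu> = sets borel_circle" and ps: "prob_space \<mu>" and on: "orthonormal_polys \<mu> \<phi>"
    and iid: "iid_std_normal M \<eta>"
  shows "integrable lborel (endpoint_integrand (\<phi> (Suc n)) 1)" "integrable lborel (endpoint_integrand (\<phi> (Suc n)) (-1))"
    and "pi * expected_real_zeros M \<phi> \<eta> n =
      (\<integral>s. endpoint_integrand (\<phi> (Suc n)) 1 s \<partial>lborel) + (\<integral>s. endpoint_integrand (\<phi> (Suc n)) (-1) s \<partial>lborel)"
proof -
  note hyp = expected_real_zeros_hyperbolic[OF assms]
  define F where "F = endpoint_integrand (\<phi> (Suc n))"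
  have nn: "0 \<le> F \<sigma> s" if "\<sigma> = 1 \<or> \<sigma> = -1" for \<sigma> s
    using hyp(2)[of s \<sigma> n] that by (cases "0 < s") (auto simp: F_def endpoint_integrand_def)
  have meas: "F \<sigma> \<in> borel_measurable lborel" for \<sigma>
  proof -
    have p: "(\<lambda>s. poly p (\<sigma> * exp (- s))) \<in> borel_measurable borel" for p :: "real poly"
      by (intro borel_measurable_continuous_onI continuous_intros)
    have sh: "(\<lambda>s::real. 1 / sinh s) \<in> borel_measurable borel"
      by (intro borel_measurable_divide borel_measurable_const borel_measurable_continuous_onI continuous_intros)
    have ex: "(\<lambda>s. \<sigma> * exp (- s)) \<in> borel_measurable borel"
      by (intro borel_measurable_continuous_onI continuous_intros)
    note [measurable] = p sh ex
    have "F \<sigma> \<in> borel_measurable borel"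
      unfolding F_def endpoint_integrand_def blaschke_speed_def by measurable
    then show ?thesis by simp
  qed
  have eq: "(\<integral>\<^sup>+s. ennreal (sqrt ((1 / sinh s)\<^sup>2 - (blaschke_speed (\<phi> (Suc n)) (\<sigma> * exp (- s)))\<^sup>2)) * indicator {0<..} s \<partial>lborel)
      = (\<integral>\<^sup>+s. ennreal (F \<sigma> s) \<partial>lborel)" for \<sigma>
    by (intro nn_integral_cong) (auto simp: F_def endpoint_integrand_def indicator_def)
  have sum: "ennreal (pi * expected_real_zeros M \<phi> \<eta> n) = (\<integral>\<^sup>+s. ennreal (F 1 s) \<partial>lborel) + (\<integral>\<^sup>+s. ennreal (F (-1) s) \<partial>lborel)"
    using hyp(1)[of n] eq[of 1] eq[of "-1"] by simp
  then have fin: "(\<integral>\<^sup>+s. ennreal (F 1 s) \<partial>lborel) < \<infinity>" "(\<integral>\<^sup>+s. ennreal (F (-1) s) \<partial>lborel) < \<infinity>"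
    by (metis ennreal_less_top ennreal_add_less_top infinity_ennreal_def)+
  have int: "integrable lborel (F 1)" "integrable lborel (F (-1))"
    by (rule integrableI_nonneg[OF meas AE_I2 fin(1)], simp add: nn, rule integrableI_nonneg[OF meas AE_I2 fin(2)], simp add: nn)
  then show "integrable lborel (endpoint_integrand (\<phi> (Suc n)) 1)" "integrable lborel (endpoint_integrand (\<phi> (Suc n)) (-1))"
    by (simp_all add: F_def)
  have I0: "0 \<le> (\<integral>s. F 1 s \<partial>lborel)" "0 \<le> (\<integral>s. F (-1) s \<partial>lborel)"
    by (simp_all add: Bochner_Integration.integral_nonneg nn)
  have E0: "0 \<le> expected_real_zeros M \<phi> \<eta> n"
    unfolding expected_real_zeros_def by (simp add: Bochner_Integration.integral_nonneg)
  have "ennreal (pi * expected_real_zeros M \<phi> \<eta> n) = ennreal ((\<integral>s. F 1 s \<partial>lborel) + (\<integral>s. F (-1) s \<partial>lborel))"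
    unfolding sum using nn_integral_eq_integral[OF int(1)] nn_integral_eq_integral[OF int(2)] nn I0 by simp
  then show "pi * expected_real_zeros M \<phi> \<eta> n =
      (\<integral>s. endpoint_integrand (\<phi> (Suc n)) 1 s \<partial>lborel) + (\<integral>s. endpoint_integrand (\<phi> (Suc n)) (-1) s \<partial>lborel)"
    using I0 E0 by (simp add: F_def flip: ennreal_plus)
qed

section \<open>Logarithmic form of the speed\<close>

lemma bound_from_sphere:
  assumes "f holomorphic_on ball 0 \<delta>" "0 < \<rho>" "\<rho> < \<delta>" "\<And>z. norm z = \<rho> \<Longrightarrow> norm (f z) \<le> B" "norm z \<le> \<rho>"
  shows "norm (f z) \<le> B"
proof (rule maximum_modulus_frontier[of f "cball 0 \<rho>"])
  have sub: "cball 0 \<rho> \<subseteq> ball (0::complex) \<delta>" using assms by auto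
  show "f holomorphic_on interior (cball 0 \<rho>)"
    using holomorphic_on_subset[OF assms(1) sub] holomorphic_on_subset interior_subset by blast
  show "continuous_on (closure (cball 0 \<rho>)) f"
    using holomorphic_on_imp_continuous_on[OF holomorphic_on_subset[OF assms(1) sub]] by simp
qed (use assms in auto)

lemma deriv_bound_ball:
  assumes hol: "f holomorphic_on ball 0 \<delta>" and \<rho>: "0 < \<rho>'" "\<rho>' < \<rho>" "\<rho> < \<delta>"
    and B: "\<And>z. norm z \<le> \<rho> \<Longrightarrow> norm (f z) \<le> B" and z: "norm z \<le> \<rho>'"
  shows "norm (deriv f z) \<le> B / (\<rho> - \<rho>')"
proof -
  have sub: "cball z (\<rho> - \<rho>') \<subseteq> ball 0 \<delta>"
  proof
    fix y assume "y \<in> cball z (\<rho> - \<rho>')"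
    then show "y \<in> ball 0 \<delta>" using norm_triangle_sub[of y z] z \<rho> by (simp add: dist_norm norm_minus_commute)
  qed
  have "norm ((deriv ^^ 1) f z) \<le> fact 1 * B / (\<rho> - \<rho>') ^ 1"
  proof (rule Cauchy_inequality[of f z "\<rho> - \<rho>'" B 1])
    show "f holomorphic_on ball z (\<rho> - \<rho>')" using holomorphic_on_subset[OF hol] sub ball_subset_cball by blast
    show "continuous_on (cball z (\<rho> - \<rho>')) f" using continuous_on_subset[OF holomorphic_on_imp_continuous_on[OF hol] sub] .
    show "norm (f x) \<le> B" if "norm (z - x) = \<rho> - \<rho>'" for x
      using B[of x] norm_triangle_sub[of x z] that z by (simp add: norm_minus_commute)
  qed (use \<rho> in simp)
  then show ?thesis by simp
qed

text \<open>
  The bound for the quotient is obtained on the circle of radius \<open>\<rho>\<close> and extended inwards by the maximum principle;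
  dividing by \<open>z\<close> at small \<open>z\<close> would lose it.
\<close>

lemma quotient_by_identity:
  assumes hol: "f holomorphic_on ball 0 \<delta>" and f0: "f 0 = 0"
    and \<rho>: "0 < \<rho>" "\<rho> < \<delta>" and B: "\<And>z. norm z \<le> \<rho> \<Longrightarrow> norm (f z) \<le> B"
  obtains F where "F holomorphic_on ball 0 \<delta>" "\<And>z. f z = z * F z" "\<And>z. norm z \<le> \<rho> \<Longrightarrow> norm (F z) \<le> B / \<rho>"
proof -
  define F where "F = (\<lambda>z. if z = 0 then deriv f 0 else (f z - f 0) / (z - 0))"
  have hF: "F holomorphic_on ball 0 \<delta>" unfolding F_def by (rule pole_lemma_open[OF hol]) simp
  have eq: "f z = z * F z" for z by (simp add: F_def f0)
  have sb: "norm (F z) \<le> B / \<rho>" if "norm z = \<rho>" for z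
  proof -
    have "z \<noteq> 0" using that \<rho> by auto
    then have "norm (F z) = norm (f z) / \<rho>" using that by (simp add: F_def f0 norm_divide)
    then show ?thesis using B[of z] that \<rho> by (simp add: divide_right_mono)
  qed
  show thesis by (rule that[OF hF eq]) (rule bound_from_sphere[OF hF \<rho> sb])
qed

text \<open>
  For odd \<open>g\<close>, the quotient \<open>G = g / z\<close> is even, so its derivative vanishes at 0 and \<open>g' = G + z G' = G + z\<^sup>2 H\<close>. The
  constant \<open>K\<close> is chosen before \<open>g\<close>, so the decomposition of an exponentially small function is
  exponentially small.
\<close>

lemma odd_holomorphic_decomposition:
  assumes \<delta>: "\<delta> > 0"
  obtains K where "K \<ge> 0" "\<forall>g B. g holomorphic_on ball 0 \<delta> \<longrightarrow> (\<forall>z. g (- z) = - g z) \<longrightarrow> (\<forall>z\<in>ball 0 \<delta>. norm (g z) \<le> B) \<longrightarrow>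
     (\<exists>G H. G holomorphic_on ball 0 (\<delta>/4) \<and> H holomorphic_on ball 0 (\<delta>/4) \<and> (\<forall>z. g z = z * G z) \<and>
       (\<forall>z\<in>ball 0 (\<delta>/4). deriv g z = G z + z\<^sup>2 * H z \<and> norm (G z) \<le> K * B \<and> norm (H z) \<le> K * B))"
proof -
  \<comment> \<open>Three divisions lose a fixed factor each: by \<open>z\<close> on radius \<open>3 \<delta> / 4\<close>, by the
    gap to \<open>\<delta> / 2\<close> for the derivative, and by \<open>z\<close> on radius \<open>\<delta> / 2\<close>.\<close>
  define K1 where "K1 = 1 / (3 * \<delta> / 4)"
  define K2 where "K2 = K1 / (3 * \<delta> / 4 - \<delta> / 2) / (\<delta> / 2)"
  define K where "K = K1 + K2"
  have K: "K1 \<ge> 0" "K2 \<ge> 0" "K \<ge> 0" using \<delta> by (auto simp: K_def K1_def K2_def)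
  show thesis
  proof (rule that[OF K(3)], intro allI impI)
    fix g :: "complex \<Rightarrow> complex" and B
    assume hg: "g holomorphic_on ball 0 \<delta>" and odd': "\<forall>z. g (- z) = - g z" and B': "\<forall>z\<in>ball 0 \<delta>. norm (g z) \<le> B"
    note odd = odd'[rule_format] and B = B'[rule_format]
    have "norm (g 0) \<le> B" using B \<delta> by simp
    then have B0: "B \<ge> 0" using norm_ge_zero[of "g 0"] by linarith
    have g0: "g 0 = 0" using odd[of 0] by simp
    obtain G where G: "G holomorphic_on ball 0 \<delta>" "\<And>z. g z = z * G z" "\<And>z. norm z \<le> 3 * \<delta> / 4 \<Longrightarrow> norm (G z) \<le> B / (3 * \<delta> / 4)"
      by (rule quotient_by_identity[OF hg g0, of "3 * \<delta> / 4" B]) (use B \<delta> in auto)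
    have Geven: "G (- z) = G z" for z
    proof (cases "z = 0")
      case False
      then show ?thesis using odd[of z] by (simp add: G(2))
    qed simp
    define G' where "G' = deriv G"
    have hG': "G' holomorphic_on ball 0 \<delta>" unfolding G'_def by (rule holomorphic_deriv[OF G(1)]) simp
    have dG: "(G has_field_derivative G' z) (at z)" if "z \<in> ball 0 \<delta>" for z
      unfolding G'_def by (rule holomorphic_derivI[OF G(1) _ that]) simp
    have G'0: "G' 0 = 0"
    proof -
      have "(G has_field_derivative G' 0) (at 0)" using dG \<delta> by simp
      moreover from this have "((\<lambda>z. G (- z)) has_field_derivative G' 0 * (-1)) (at 0)"
        by (intro DERIV_chain2[where f=G]) (auto intro!: derivative_eq_intros)
      then have "(G has_field_derivative - G' 0) (at 0)" by (simp add: Geven)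
      ultimately have "G' 0 = - G' 0" by (rule DERIV_unique)
      then show ?thesis by (simp add: eq_neg_iff_add_eq_0)
    qed
    have G'b: "norm (G' z) \<le> (B / (3 * \<delta> / 4)) / (3 * \<delta> / 4 - \<delta> / 2)" if "norm z \<le> \<delta> / 2" for z
      unfolding G'_def by (rule deriv_bound_ball[OF G(1) _ _ _ G(3) that]) (use \<delta> in auto)
    obtain H where H: "H holomorphic_on ball 0 \<delta>" "\<And>z. G' z = z * H z"
      "\<And>z. norm z \<le> \<delta> / 2 \<Longrightarrow> norm (H z) \<le> ((B / (3 * \<delta> / 4)) / (3 * \<delta> / 4 - \<delta> / 2)) / (\<delta> / 2)"
      by (rule quotient_by_identity[OF hG' G'0, of "\<delta> / 2"]) (use G'b \<delta> in auto)
    have sub: "ball 0 (\<delta>/4) \<subseteq> ball (0::complex) \<delta>" using \<delta> by auto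
    have main: "deriv g z = G z + z\<^sup>2 * H z \<and> norm (G z) \<le> K * B \<and> norm (H z) \<le> K * B" if z: "z \<in> ball 0 (\<delta>/4)" for z
    proof (intro conjI)
      have "g = (\<lambda>z. z * G z)" using G(2) by auto
      moreover have "((\<lambda>z. z * G z) has_field_derivative G z + z * G' z) (at z)"
        using dG[of z] z sub by (auto intro!: derivative_eq_intros)
      ultimately show "deriv g z = G z + z\<^sup>2 * H z" using H(2)[of z] by (auto intro!: DERIV_imp_deriv simp: power2_eq_square mult.assoc)
      have "norm (G z) \<le> B / (3 * \<delta> / 4)" by (rule G(3)) (use z \<delta> in simp)
      also have "\<dots> = K1 * B" by (simp add: K1_def)
      also have "\<dots> \<le> K * B" using K B0 by (intro mult_right_mono) (auto simp: K_def)
      finally show "norm (G z) \<le> K * B" .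
      have "norm (H z) \<le> ((B / (3 * \<delta> / 4)) / (3 * \<delta> / 4 - \<delta> / 2)) / (\<delta> / 2)" by (rule H(3)) (use z \<delta> in simp)
      also have "\<dots> = K2 * B" by (simp add: K2_def K1_def)
      also have "\<dots> \<le> K * B" using K B0 by (intro mult_right_mono) (auto simp: K_def)
      finally show "norm (H z) \<le> K * B" .
    qed
    show "\<exists>G H. G holomorphic_on ball 0 (\<delta>/4) \<and> H holomorphic_on ball 0 (\<delta>/4) \<and> (\<forall>z. g z = z * G z) \<and>
       (\<forall>z\<in>ball 0 (\<delta>/4). deriv g z = G z + z\<^sup>2 * H z \<and> norm (G z) \<le> K * B \<and> norm (H z) \<le> K * B)"
      by (rule exI[of _ G], rule exI[of _ H])
         (use main G(2) holomorphic_on_subset[OF G(1) sub] holomorphic_on_subset[OF H(1) sub] in blast)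
  qed
qed

lemma poly_complexify_of_real: "poly (complexify p) (of_real x) = of_real (poly p x)"
  by (induction p) (auto simp: map_poly_pCons)

lemma pderiv_complexify: "pderiv (complexify p) = complexify (pderiv p)"
  by (rule poly_eqI) (simp add: coeff_pderiv coeff_map_poly)

lemma reflect_poly_complexify: "reflect_poly (complexify p) = complexify (reflect_poly p)"
  by (rule poly_eqI) (auto simp: coeff_reflect_poly coeff_map_poly degree_map_poly)

text \<open>
  With \<open>Y = m s - g s\<close>, the Blaschke quotient at \<open>\<sigma> exp (- s)\<close> equals \<open>\<sigma> ^ m exp (- Y)\<close>, and \<open>2 y' / (1 - y\<^sup>2)\<close> for
  \<open>y = exp (- Y)\<close> is \<open>- Y' / sinh Y\<close>. Squaring removes the sign \<open>\<sigma> ^ m\<close>.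
\<close>

lemma blaschke_speed_logarithmic:
  fixes Q :: "real poly" and g :: "complex \<Rightarrow> complex"
  assumes m: "degree Q = m" "m > 0" and \<sigma>: "\<sigma> = 1 \<or> \<sigma> = (-1::real)" and \<delta>: "\<delta> > 0"
    and hg: "g holomorphic_on ball 0 \<delta>"
    and nz: "\<And>z. z \<in> ball 0 \<delta> \<Longrightarrow> poly (complexify (reflect_poly Q)) (of_real \<sigma> * exp z) \<noteq> 0"
    and eg: "\<And>z. z \<in> ball 0 \<delta> \<Longrightarrow> exp (g z) = poly (complexify (reflect_poly Q)) (of_real \<sigma> * exp z) /
        poly (complexify (reflect_poly Q)) (of_real \<sigma> * exp (- z))"
    and s: "0 < s" "s < \<delta>" and Y: "sinh (of_nat m * of_real s - g (of_real s)) \<noteq> 0"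
  shows "complex_of_real ((blaschke_speed Q (\<sigma> * exp (- s)))\<^sup>2) =
     ((of_nat m - deriv g (of_real s)) / sinh (of_nat m * of_real s - g (of_real s)))\<^sup>2"
proof -
  define Pc where "Pc = complexify (reflect_poly Q)"
  define Qc where "Qc = complexify Q"
  have PQ: "Pc = reflect_poly Qc" by (simp add: Pc_def Qc_def reflect_poly_complexify)
  have dQ: "degree Qc = m" using m by (simp add: Qc_def degree_map_poly)
  have QP: "poly Qc x = x ^ m * poly Pc (1 / x)" if "x \<noteq> 0" for x
  proof -
    have "poly Pc (1 / x) = (1 / x) ^ m * poly Qc (inverse (1 / x))"
      unfolding PQ using poly_reflect_poly_nz[of "1 / x" Qc] that dQ by simp
    then show ?thesis using that by (simp add: power_divide)
  qed
  define \<tau> where "\<tau> = complex_of_real \<sigma>"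
  have \<tau>: "\<tau> * \<tau> = 1" "\<tau> \<noteq> 0" "1 / \<tau> = \<tau>" using \<sigma> by (auto simp: \<tau>_def)
  define Y where "Y z = of_nat m * z - g z" for z
  define \<beta> where "\<beta> z = poly Qc (\<tau> * exp (- z)) / poly Pc (\<tau> * exp (- z))" for z
  have \<beta>eq: "\<beta> z = \<tau> ^ m * exp (- Y z)" if z: "z \<in> ball 0 \<delta>" for z
  proof -
    have "poly Qc (\<tau> * exp (- z)) = (\<tau> * exp (- z)) ^ m * poly Pc (1 / (\<tau> * exp (- z)))" by (rule QP) (use \<tau> in simp)
    also have "1 / (\<tau> * exp (- z)) = (1 / \<tau>) * exp z" by (simp add: exp_minus divide_inverse)
    also have "(1 / \<tau>) * exp z = \<tau> * exp z" by (simp only: \<tau>(3))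
    finally have "\<beta> z = \<tau> ^ m * exp (- z) ^ m * exp (g z)" using eg[OF z] by (simp add: \<beta>_def Pc_def \<tau>_def power_mult_distrib)
    also have "exp (- z) ^ m = exp (- (of_nat m * z))" by (simp add: exp_of_nat_mult[symmetric])
    also have "\<tau> ^ m * exp (- (of_nat m * z)) * exp (g z) = \<tau> ^ m * exp (- Y z)" by (simp add: Y_def exp_add exp_minus exp_diff field_simps)
    finally show ?thesis .
  qed
  define S where "S = complex_of_real s"
  have S: "S \<in> ball 0 \<delta>" "- S \<in> ball 0 \<delta>" using s by (auto simp: S_def)
  define x where "x = \<tau> * exp (- S)"
  have xr: "x = of_real (\<sigma> * exp (- s))" by (simp add: x_def S_def \<tau>_def exp_of_real flip: of_real_minus)
  define p q p' q' where pq: "p = poly Pc x" "q = poly Qc x" "p' = poly (pderiv Pc) x" "q' = poly (pderiv Qc) x"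
  have p0: "p \<noteq> 0" using nz[OF S(2)] by (simp add: pq Pc_def x_def \<tau>_def)
  have dx: "((\<lambda>z. \<tau> * exp (- z)) has_field_derivative - x) (at S)"
    unfolding x_def by (auto intro!: derivative_eq_intros)
  have dPx: "((\<lambda>z. poly A (\<tau> * exp (- z))) has_field_derivative poly (pderiv A) x * (- x)) (at S)" for A
    using DERIV_chain2[OF poly_DERIV dx, of A] by (simp add: x_def)
  have d\<beta>1: "(\<beta> has_field_derivative ((q' * (- x)) * p - q * (p' * (- x))) / (p * p)) (at S)"
    unfolding \<beta>_def using DERIV_divide[OF dPx[of Qc] dPx[of Pc]] p0 by (simp add: pq x_def)
  have dg: "(g has_field_derivative deriv g S) (at S)" by (rule holomorphic_derivI[OF hg _ S(1)]) simp
  define Y' where "Y' = of_nat m - deriv g S"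
  have dY: "((\<lambda>z. \<tau> ^ m * exp (- Y z)) has_field_derivative - Y' * (\<tau> ^ m * exp (- Y S))) (at S)"
    unfolding Y_def Y'_def by (auto intro!: derivative_eq_intros dg simp: algebra_simps)
  have d\<beta>2: "(\<beta> has_field_derivative - Y' * \<beta> S) (at S)"
    unfolding \<beta>eq[OF S(1)]
    by (rule has_field_derivative_transform_within_open[OF dY, of "ball 0 \<delta>"]) (use S \<beta>eq in auto)
  have eq: "((q' * (- x)) * p - q * (p' * (- x))) / (p * p) = - Y' * \<beta> S" by (rule DERIV_unique[OF d\<beta>1 d\<beta>2])
  have \<beta>S: "\<beta> S = q / p" by (simp add: \<beta>_def pq x_def)
  \<comment> \<open>Compare the two expressions for the derivative of the Blaschke quotient.\<close>
  have num: "x * (p * q' - p' * q) = Y' * q * p"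
  proof -
    have "((q' * (- x)) * p - q * (p' * (- x))) = - Y' * (q / p) * (p * p)" using eq p0 unfolding \<beta>S by (simp add: divide_eq_eq)
    then show ?thesis using p0 by (simp add: algebra_simps)
  qed
  define E where "E = exp (- Y S)"
  have qE: "q = \<tau> ^ m * E * p" using \<beta>eq[OF S(1)] p0 unfolding \<beta>S E_def by (simp add: divide_eq_eq)
  have tm: "(\<tau> ^ m)\<^sup>2 = 1" using \<tau>(1) by (metis power2_eq_square power_mult_distrib power_one)
  have shY: "sinh (Y S) = (1 / E - E) / 2" unfolding E_def by (simp add: sinh_def exp_minus field_simps scaleR_conv_of_real)
  have E0: "E \<noteq> 0" by (simp add: E_def)
  have sh0: "sinh (Y S) \<noteq> 0" using Y by (simp add: Y_def S_def)
  have 1: "1 - E\<^sup>2 = 2 * E * sinh (Y S)" unfolding shY using E0 by (simp add: field_simps power2_eq_square)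
  have den: "p\<^sup>2 - q\<^sup>2 = p\<^sup>2 * (2 * E * sinh (Y S))"
    unfolding 1[symmetric] qE by (simp add: power_mult_distrib tm algebra_simps)
  have "complex_of_real (blaschke_speed Q (\<sigma> * exp (- s))) = 2 * x * (p * q' - p' * q) / (p\<^sup>2 - q\<^sup>2)"
    unfolding blaschke_speed_def pq xr Pc_def Qc_def pderiv_complexify poly_complexify_of_real by simp
  also have "\<dots> = 2 * (Y' * (\<tau> ^ m * E * p) * p) / (p\<^sup>2 * (2 * E * sinh (Y S)))"
    unfolding den using num qE by (simp add: mult.assoc)
  also have "\<dots> = \<tau> ^ m * (Y' / sinh (Y S))" using p0 E0 sh0 by (simp add: field_simps power2_eq_square)
  finally have "complex_of_real ((blaschke_speed Q (\<sigma> * exp (- s)))\<^sup>2) = (\<tau> ^ m * (Y' / sinh (Y S)))\<^sup>2" by simp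
  also have "\<dots> = (Y' / sinh (Y S))\<^sup>2" by (simp only: power_mult_distrib tm mult_1)
  finally show ?thesis by (simp add: Y_def Y'_def S_def)
qed

lemma rescaled_radicand_of_speed:
  assumes m: "m > 0" and t: "t > 0" and V: "complex_of_real V2 = ((of_nat m - (a + of_real s ^ 2 * h)) / sinh (of_nat m * of_real s - of_real s * a))\<^sup>2"
    and s: "s = t / real m" and le: "V2 \<le> (1 / sinh s)\<^sup>2" and ea: "of_real (1 / real m) * a \<noteq> 1"
  shows "csqrt (rescaled_radicand a h t (of_real (1 / real m))) = of_real (sqrt ((1 / sinh s)\<^sup>2 - V2) / real m)"
proof -
  define \<epsilon> where "\<epsilon> = complex_of_real (1 / real m)"
  define M where "M = complex_of_nat m"
  have M: "M \<noteq> 0" "\<epsilon> = 1 / M" using m by (auto simp: M_def \<epsilon>_def)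
  define T where "T = complex_of_real t"
  have T0: "T \<noteq> 0" using t by (simp add: T_def)
  define S where "S = complex_of_real s"
  have S: "S = T / M" by (simp add: S_def s T_def M_def)
  have S0: "S \<noteq> 0" using S T0 M by simp
  define b where "b = 1 - \<epsilon> * a"
  have b0: "b \<noteq> 0" using ea by (simp add: b_def \<epsilon>_def)
  have Yb: "M * S - S * a = T * b" unfolding S b_def M(2) using M(1) by (simp add: field_simps)
  have Tb: "T * b \<noteq> 0" using T0 b0 by simp
  have eT: "\<epsilon> * T = S" unfolding S M(2) by simp
  have ea': "\<epsilon> * a \<noteq> 1" using ea by (simp add: \<epsilon>_def)
  define Y' where "Y' = M - (a + S\<^sup>2 * h)"
  have q: "1 - \<epsilon> * S\<^sup>2 * h / b = Y' / (M * b)"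
  proof -
    have "(1 - \<epsilon> * S\<^sup>2 * h / b) * (M * b) = M * b - \<epsilon> * M * S\<^sup>2 * h" using b0 by (simp add: field_simps)
    also have "\<dots> = Y'" unfolding b_def Y'_def M(2) using M(1) by (simp add: field_simps)
    finally show ?thesis using b0 M(1) by (simp add: b_def[symmetric] eq_divide_eq)
  qed
  have "T\<^sup>2 * rescaled_radicand a h t \<epsilon> = csch_sq S - (Y' / (M * b))\<^sup>2 * csch_sq (T * b)"
    using rescaled_radicand_eq[OF ea', of t h] unfolding T_def[symmetric] b_def[symmetric] eT q .
  also have "csch_sq S = S\<^sup>2 / (sinh S)\<^sup>2" by (rule csch_sq_eq[OF S0])
  also have "csch_sq (T * b) = (T * b)\<^sup>2 / (sinh (T * b))\<^sup>2" by (rule csch_sq_eq[OF Tb])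
  also have "S\<^sup>2 / (sinh S)\<^sup>2 - (Y' / (M * b))\<^sup>2 * ((T * b)\<^sup>2 / (sinh (T * b))\<^sup>2) =
     T\<^sup>2 * (((1 / sinh S)\<^sup>2 - (Y' / sinh (T * b))\<^sup>2) / M\<^sup>2)"
    unfolding S using b0 M(1) by (simp add: power_divide power_mult_distrib diff_divide_distrib right_diff_distrib mult_ac)
  finally have "T\<^sup>2 * rescaled_radicand a h t \<epsilon> = T\<^sup>2 * (((1 / sinh S)\<^sup>2 - (Y' / sinh (T * b))\<^sup>2) / M\<^sup>2)" .
  then have "rescaled_radicand a h t \<epsilon> = ((1 / sinh S)\<^sup>2 - (Y' / sinh (T * b))\<^sup>2) / M\<^sup>2"
    by (rule mult_left_cancel[THEN iffD1, rotated]) (use T0 in simp)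
  also have "(Y' / sinh (T * b))\<^sup>2 = of_real V2" unfolding V Y'_def Yb[symmetric] M_def S_def by simp
  also have "((1 / sinh S)\<^sup>2 - of_real V2) / M\<^sup>2 = of_real (((1 / sinh s)\<^sup>2 - V2) / (real m)\<^sup>2)"
    by (simp add: S_def M_def sinh_complex_of_real)
  finally have r: "rescaled_radicand a h t \<epsilon> = of_real (((1 / sinh s)\<^sup>2 - V2) / (real m)\<^sup>2)" .
  have "csqrt (rescaled_radicand a h t \<epsilon>) = of_real (sqrt (((1 / sinh s)\<^sup>2 - V2) / (real m)\<^sup>2))"
    unfolding r by (subst csqrt_of_real_nonneg) (use le in auto)
  also have "sqrt (((1 / sinh s)\<^sup>2 - V2) / (real m)\<^sup>2) = sqrt ((1 / sinh s)\<^sup>2 - V2) / real m"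
    by (simp add: real_sqrt_divide)
  finally show ?thesis unfolding \<epsilon>_def .
qed

section \<open>The speed near and away from the endpoints\<close>

text \<open>
  On a circle of radius \<open>r1 < 1\<close> the polynomial \<open>Q\<close> is \<open>z ^ m\<close> times the bounded values of its reversal at \<open>1 / z\<close>,
  hence \<open>O (r1 ^ m)\<close>, and so is its derivative on a smaller disc. The reversal is bounded and bounded
  away from 0.
\<close>

lemma blaschke_speed_tail:
  assumes R: "R > 1" and hT: "T holomorphic_on ball 0 R" and T0: "\<And>z. T z \<noteq> 0"
    and q: "0 < q" "q < 1" and C: "C \<ge> 0" and \<delta>: "\<delta> > 0"
  obtains K \<rho> m0 where "K \<ge> 0" "0 < \<rho>" "\<rho> < 1"
    "\<forall>Q m c x. degree Q = m \<longrightarrow> m \<ge> m0 \<longrightarrow>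
       szego_close R T (C * q ^ m) c Q \<longrightarrow>
       \<bar>x\<bar> \<le> exp (- \<delta>) \<longrightarrow> \<bar>blaschke_speed Q x\<bar> \<le> K * \<bar>x\<bar> * \<rho> ^ m"
proof -
  define R' where "R' = (1 + R) / 2"
  have R': "1 < R'" "R' < R" using R by (auto simp: R'_def)
  have cT: "continuous_on (cball 0 R') T"
    by (rule continuous_on_subset[OF holomorphic_on_imp_continuous_on[OF hT]]) (use R' in auto)
  obtain M0 where M0: "\<And>z. z \<in> cball 0 R' \<Longrightarrow> norm (T z) \<le> M0"
    using compact_imp_bounded[OF compact_continuous_image[OF cT compact_cball]] unfolding bounded_iff by blast
  obtain z0 where z0: "z0 \<in> cball 0 R'" "\<And>z. z \<in> cball 0 R' \<Longrightarrow> norm (T z0) \<le> norm (T z)"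
    using continuous_attains_inf[OF compact_cball _ continuous_on_norm[OF cT]] R' by auto
  define l where "l = norm (T z0)"
  have l: "l > 0" "\<And>z. norm z \<le> R' \<Longrightarrow> l \<le> norm (T z)" using z0 T0 by (auto simp: l_def)
  have "norm (T 0) \<le> M0" by (rule M0) (use R' in simp)
  then have M0n: "M0 \<ge> 0" using norm_ge_zero[of "T 0"] by linarith
  define M where "M = M0 + C"
  have M: "M \<ge> 0" using M0n C by (simp add: M_def)
  define r2 where "r2 = exp (- \<delta>)"
  have r2: "0 < r2" "r2 < 1" using \<delta> by (auto simp: r2_def)
  \<comment> \<open>Large enough that \<open>1 / z\<close> remains in the disc of radius \<open>R'\<close> when \<open>z\<close>
    has norm \<open>r1\<close>.\<close>
  define r1 where "r1 = (1 + max r2 (1 / R')) / 2"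
  have "1 / R' < 1" using R' by simp
  then have r1: "r2 < r1" "1 / R' < r1" "r1 < 1" "0 < r1" using r2 by (auto simp: r1_def max_def)
  have r1R: "1 / r1 \<le> R'"
  proof -
    have "1 < r1 * R'" using r1(2) R' by (simp add: field_simps)
    then show ?thesis using r1 by (simp add: field_simps)
  qed
  have "(\<lambda>m. C * q ^ m) \<longlonglongrightarrow> C * 0" by (intro tendsto_mult tendsto_const LIMSEQ_power_zero) (use q in simp)
  then have "eventually (\<lambda>m. C * q ^ m < l / 2) sequentially" by (rule order_tendstoD(2)) (use l in simp)
  moreover have "(\<lambda>m. M * r1 ^ m) \<longlonglongrightarrow> M * 0" by (intro tendsto_mult tendsto_const LIMSEQ_power_zero) (use r1 in simp)
  then have "eventually (\<lambda>m. M * r1 ^ m < l / 4) sequentially" by (rule order_tendstoD(2)) (use l in simp)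
  ultimately have "eventually (\<lambda>m. C * q ^ m < l / 2 \<and> M * r1 ^ m < l / 4) sequentially" by (rule eventually_conj)
  then obtain m0 where m0: "\<And>m. m \<ge> m0 \<Longrightarrow> C * q ^ m < l / 2 \<and> M * r1 ^ m < l / 4"
    unfolding eventually_sequentially by blast
  define K where "K = 2 * (2 * M * M / (r1 - r2)) / (l\<^sup>2 / 8)"
  have K: "K \<ge> 0" using M r1 by (simp add: K_def)
  show thesis
  proof (rule that[OF K r1(4,3)], intro allI impI)
    fix Q :: "real poly" and m and c :: complex and x :: real
    assume dQ: "degree Q = m" and m: "m \<ge> m0"
      and ap0: "szego_close R T (C * q ^ m) c Q"
      and x: "\<bar>x\<bar> \<le> exp (- \<delta>)"
    note ap = ap0[rule_format]
    define Pc where "Pc = complexify (reflect_poly Q)"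
    define Qc where "Qc = complexify Q"
    have PQ: "Pc = reflect_poly Qc" by (simp add: Pc_def Qc_def reflect_poly_complexify)
    have dQc: "degree Qc = m" using dQ by (simp add: Qc_def degree_map_poly)
    have QP: "poly Qc y = y ^ m * poly Pc (1 / y)" if "y \<noteq> 0" for y
    proof -
      have "poly Pc (1 / y) = (1 / y) ^ m * poly Qc (inverse (1 / y))"
        unfolding PQ using poly_reflect_poly_nz[of "1 / y" Qc] that dQc by simp
      then show ?thesis using that by (simp add: power_divide)
    qed
    define Ph where "Ph z = c * poly Pc z" for z
    define Qh where "Qh z = c * poly Qc z" for z
    have hP: "Ph holomorphic_on A" "Qh holomorphic_on A" for A unfolding Ph_def Qh_def by (intro holomorphic_intros)+
    have ap': "norm (Ph z - T z) \<le> C * q ^ m" if "norm z \<le> R'" for z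
      unfolding Ph_def Pc_def by (rule ap) (use that R' in simp)
    have qm: "C * q ^ m \<le> C" using C q mult_left_mono[of "q ^ m" 1 C] by (simp add: power_le_one)
    have Pu: "norm (Ph z) \<le> M" if "norm z \<le> R'" for z
      using norm_triangle_sub[of "Ph z" "T z"] ap'[OF that] M0[of z] that qm by (simp add: M_def)
    have Pl: "l / 2 \<le> norm (Ph z)" if "norm z \<le> R'" for z
    proof -
      have "norm (T z) - norm (Ph z) \<le> norm (T z - Ph z)" by (rule norm_triangle_ineq2)
      then show ?thesis using ap'[OF that] l(2)[OF that] m0[OF m] by (simp add: norm_minus_commute)
    qed
    have Qs: "norm (Qh z) \<le> M * r1 ^ m" if "norm z = r1" for z
    proof -
      have z: "z \<noteq> 0" using that r1 by auto
      have "Qh z = z ^ m * Ph (1 / z)" using QP[OF z] by (simp add: Qh_def Ph_def)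
      then have "norm (Qh z) = r1 ^ m * norm (Ph (1 / z))" using that by (simp add: norm_mult norm_power)
      also have "\<dots> \<le> r1 ^ m * M" by (intro mult_left_mono Pu) (use that r1 r1R in \<open>auto simp: norm_divide\<close>)
      finally show ?thesis by (simp add: mult.commute)
    qed
    have Qb: "norm (Qh z) \<le> M * r1 ^ m" if "norm z \<le> r1" for z
      by (rule bound_from_sphere[OF hP(2) r1(4,3) Qs that])
    define X where "X = complex_of_real x"
    have X: "norm X \<le> r2" using x by (simp add: X_def r2_def)
    have dQ': "norm (deriv Qh X) \<le> M * r1 ^ m / (r1 - r2)"
      by (rule deriv_bound_ball[OF hP(2) r2(1) r1(1,3) Qb X])
    have dP': "norm (deriv Ph X) \<le> M / (r1 - r2)"
      by (rule deriv_bound_ball[OF hP(1) r2(1) r1(1,3) _ X], rule Pu) (use r1 R' in simp)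
    have derivs: "deriv Ph X = c * poly (pderiv Pc) X" "deriv Qh X = c * poly (pderiv Qc) X"
      unfolding Ph_def Qh_def by (intro DERIV_imp_deriv DERIV_cmult poly_DERIV)+
    have XR: "norm X \<le> R'" "norm X \<le> r1" using X r1 R' r2 by auto
    have c0: "c \<noteq> 0" using Pl[OF XR(1)] l by (auto simp: Ph_def)
    have "complex_of_real (blaschke_speed Q x) = 2 * X * (poly Pc X * poly (pderiv Qc) X - poly (pderiv Pc) X * poly Qc X) / ((poly Pc X)\<^sup>2 - (poly Qc X)\<^sup>2)"
      unfolding blaschke_speed_def X_def Pc_def Qc_def pderiv_complexify poly_complexify_of_real by simp
    also have "\<dots> = 2 * X * (Ph X * deriv Qh X - deriv Ph X * Qh X) / ((Ph X)\<^sup>2 - (Qh X)\<^sup>2)"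
    proof -
      have "2 * X * (Ph X * deriv Qh X - deriv Ph X * Qh X) = c\<^sup>2 * (2 * X * (poly Pc X * poly (pderiv Qc) X - poly (pderiv Pc) X * poly Qc X))"
        unfolding derivs Ph_def Qh_def by (simp add: power2_eq_square algebra_simps)
      moreover have "(Ph X)\<^sup>2 - (Qh X)\<^sup>2 = c\<^sup>2 * ((poly Pc X)\<^sup>2 - (poly Qc X)\<^sup>2)"
        unfolding Ph_def Qh_def by (simp add: power_mult_distrib algebra_simps)
      ultimately show ?thesis using c0 by (metis mult_divide_mult_cancel_left power_not_zero)
    qed
    finally have eq: "\<bar>blaschke_speed Q x\<bar> = 2 * \<bar>x\<bar> * norm (Ph X * deriv Qh X - deriv Ph X * Qh X) / norm ((Ph X)\<^sup>2 - (Qh X)\<^sup>2)"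
      by (metis (no_types, opaque_lifting) X_def norm_divide norm_mult norm_numeral norm_of_real)
    have num: "norm (Ph X * deriv Qh X - deriv Ph X * Qh X) \<le> 2 * M * M / (r1 - r2) * r1 ^ m"
    proof -
      have "norm (Ph X * deriv Qh X - deriv Ph X * Qh X) \<le> norm (Ph X) * norm (deriv Qh X) + norm (deriv Ph X) * norm (Qh X)"
        using norm_triangle_ineq4[of "Ph X * deriv Qh X" "deriv Ph X * Qh X"] by (simp add: norm_mult)
      also have "\<dots> \<le> M * (M * r1 ^ m / (r1 - r2)) + M / (r1 - r2) * (M * r1 ^ m)"
        by (intro add_mono mult_mono Pu dQ' dP' Qb XR) (use M r1 in auto)
      also have "\<dots> = 2 * M * M / (r1 - r2) * r1 ^ m" by simp
      finally show ?thesis .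
    qed
    have den: "l\<^sup>2 / 8 \<le> norm ((Ph X)\<^sup>2 - (Qh X)\<^sup>2)"
    proof -
      have "(l / 2)\<^sup>2 \<le> (norm (Ph X))\<^sup>2" by (rule power_mono[OF Pl[OF XR(1)]]) (use l in simp)
      moreover have "(norm (Qh X))\<^sup>2 \<le> (l / 4)\<^sup>2"
        by (rule power_mono) (use Qb[OF XR(2)] m0[OF m] in auto)
      moreover have "norm ((Ph X)\<^sup>2) - norm ((Qh X)\<^sup>2) \<le> norm ((Ph X)\<^sup>2 - (Qh X)\<^sup>2)" by (rule norm_triangle_ineq2)
      moreover have "l\<^sup>2 \<ge> 0" by simp
      moreover have "(l / 2)\<^sup>2 = l\<^sup>2 / 4" "(l / 4)\<^sup>2 = l\<^sup>2 / 16" by (simp_all add: power2_eq_square)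
      ultimately show ?thesis unfolding norm_power by linarith
    qed
    have "\<bar>blaschke_speed Q x\<bar> \<le> 2 * \<bar>x\<bar> * (2 * M * M / (r1 - r2) * r1 ^ m) / (l\<^sup>2 / 8)"
      unfolding eq by (intro frac_le mult_left_mono num den) (use M r1 l in auto)
    also have "\<dots> = K * \<bar>x\<bar> * r1 ^ m" by (simp add: K_def)
    finally show "\<bar>blaschke_speed Q x\<bar> \<le> K * \<bar>x\<bar> * r1 ^ m" .
  qed
qed

text \<open>
  The logarithm of \<open>P (\<sigma> exp z) / P (\<sigma> exp (- z))\<close> is the sum of the corresponding logarithm \<open>g\<close> for \<open>T\<close> and a
  correction \<open>k = O (q ^ m)\<close>. Both are odd in \<open>z\<close>, so both decompose; \<open>G\<close> and \<open>H\<close> come from \<open>g\<close> and are independent of \<open>Q\<close>.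
\<close>

lemma blaschke_speed_near_endpoint:
  assumes R: "R > 1" and hT: "T holomorphic_on ball 0 R" and T0: "\<And>z. T z \<noteq> 0"
    and q: "0 < q" "q < 1" and C: "C \<ge> 0" and \<sigma>: "\<sigma> = 1 \<or> \<sigma> = (-1::real)"
  obtains \<delta> G H B m0 where "\<delta> > 0" "G holomorphic_on ball 0 \<delta>" "H holomorphic_on ball 0 \<delta>"
    "\<And>z. z \<in> ball 0 \<delta> \<Longrightarrow> norm (G z) \<le> B" "\<And>z. z \<in> ball 0 \<delta> \<Longrightarrow> norm (H z) \<le> B"
    "\<forall>Q m c. degree Q = m \<longrightarrow> m \<ge> m0 \<longrightarrow>
       szego_close R T (C * q ^ m) c Q \<longrightarrow>
       (\<exists>a h. \<forall>s. 0 < s \<longrightarrow> s < \<delta> \<longrightarrow>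
          norm (a s - G (of_real s)) \<le> q ^ m * B \<and> norm (h s - H (of_real s)) \<le> q ^ m * B \<and>
          (sinh (of_nat m * of_real s - of_real s * a s) \<noteq> 0 \<longrightarrow>
            complex_of_real ((blaschke_speed Q (\<sigma> * exp (- s)))\<^sup>2) =
            ((of_nat m - (a s + of_real s ^ 2 * h s)) / sinh (of_nat m * of_real s - of_real s * a s))\<^sup>2))"
proof -
  define R' where "R' = (1 + R) / 2"
  have R': "1 < R'" "R' < R" using R by (auto simp: R'_def)
  \<comment> \<open>The exponential of a disc of radius \<open>d1\<close> stays within the disc of radius
    \<open>R'\<close>.\<close>
  define d1 where "d1 = ln R'"
  have d1: "d1 > 0" using R' by (simp add: d1_def)
  have nE: "norm (of_real \<sigma> * exp z) < R'" if "z \<in> ball 0 d1" for z :: complex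
  proof -
    have "Re z < d1" using complex_Re_le_cmod[of z] that by simp
    then have "exp (Re z) < R'" using R' by (simp add: d1_def ln_ge_iff[symmetric] flip: exp_less_cancel_iff[of _ "ln R'"])
    then show ?thesis using \<sigma> by (auto simp: norm_mult norm_exp_eq_Re)
  qed
  have cT: "continuous_on (cball 0 R') T"
    by (rule continuous_on_subset[OF holomorphic_on_imp_continuous_on[OF hT]]) (use R' in auto)
  obtain z0 where z0: "z0 \<in> cball 0 R'" "\<And>z. z \<in> cball 0 R' \<Longrightarrow> norm (T z0) \<le> norm (T z)"
    using continuous_attains_inf[OF compact_cball _ continuous_on_norm[OF cT]] R' by auto
  define l where "l = norm (T z0)"
  have l: "l > 0" "\<And>z. norm z \<le> R' \<Longrightarrow> l \<le> norm (T z)" using z0 T0 by (auto simp: l_def)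
  define E where "E z = of_real \<sigma> * exp z" for z :: complex
  have hE: "E holomorphic_on A" for A unfolding E_def by (intro holomorphic_intros)
  have ER: "E z \<in> ball 0 R" "norm (E z) \<le> R'" if "z \<in> ball 0 d1" for z using nE[OF that] R' by (auto simp: E_def)
  have hTE: "(\<lambda>z. T (E z)) holomorphic_on ball 0 d1"
  proof -
    have "E ` ball 0 d1 \<subseteq> ball 0 R" using ER(1) by blast
    then show ?thesis using holomorphic_on_compose_gen[OF hE hT, of "ball 0 d1"] by (simp add: o_def)
  qed
  obtain L where L: "L holomorphic_on ball 0 d1" "\<And>z. z \<in> ball 0 d1 \<Longrightarrow> exp (L z) = T (E z)"
    by (rule holomorphic_logarithm_exists[OF convex_ball open_ball hTE, of 0]) (use T0 d1 in auto)
  define d2 where "d2 = d1 / 2"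
  have d2: "0 < d2" "d2 < d1" using d1 by (auto simp: d2_def)
  have odd_hol: "(\<lambda>z. f z - f (- z)) holomorphic_on ball 0 d2" if "f holomorphic_on ball 0 d2" for f :: "complex \<Rightarrow> complex"
  proof -
    have "(\<lambda>z. f (- z)) holomorphic_on ball 0 d2"
    proof -
      have "(\<lambda>z. - z) ` ball (0::complex) d2 \<subseteq> ball 0 d2" by (rule image_subsetI) simp
      then show ?thesis
        using holomorphic_on_compose_gen[OF holomorphic_on_minus[OF holomorphic_on_ident] that, of "ball 0 d2"] by (simp add: o_def)
    qed
    then show ?thesis using that by (intro holomorphic_intros)
  qed
  have L2: "L holomorphic_on ball 0 d2" by (rule holomorphic_on_subset[OF L(1)]) (use d2 in auto)
  have cL: "continuous_on (cball 0 d2) L"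
    by (rule continuous_on_subset[OF holomorphic_on_imp_continuous_on[OF L(1)]]) (use d2 in auto)
  obtain BL where BL: "\<And>z. z \<in> cball 0 d2 \<Longrightarrow> norm (L z) \<le> BL"
    using compact_imp_bounded[OF compact_continuous_image[OF cL compact_cball]] unfolding bounded_iff by blast
  define g where "g z = L z - L (- z)" for z
  have hg: "g holomorphic_on ball 0 d2" unfolding g_def by (rule odd_hol[OF L2])
  have gB: "norm (g z) \<le> 2 * BL" if "z \<in> ball 0 d2" for z
    unfolding g_def using norm_triangle_ineq4[of "L z" "L (- z)"] BL[of z] BL[of "- z"] that by simp
  have "norm (L 0) \<le> BL" using BL[of 0] d2 by simp
  then have BL0: "BL \<ge> 0" using norm_ge_zero[of "L 0"] by linarith
  obtain K where K: "K \<ge> 0" and dec0: "\<forall>g B. g holomorphic_on ball 0 d2 \<longrightarrow> (\<forall>z. g (- z) = - g z) \<longrightarrow> (\<forall>z\<in>ball 0 d2. norm (g z) \<le> B) \<longrightarrow>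
     (\<exists>G H. G holomorphic_on ball 0 (d2/4) \<and> H holomorphic_on ball 0 (d2/4) \<and> (\<forall>z. g z = z * G z) \<and>
       (\<forall>z\<in>ball 0 (d2/4). deriv g z = G z + z\<^sup>2 * H z \<and> norm (G z) \<le> K * B \<and> norm (H z) \<le> K * B))"
    by (rule odd_holomorphic_decomposition[OF d2(1)]) (rule that)
  note dec = dec0[rule_format]
  have godd: "g (- z) = - g z" for z by (simp add: g_def)
  obtain G H where GH: "G holomorphic_on ball 0 (d2/4)" "H holomorphic_on ball 0 (d2/4)" "\<forall>z. g z = z * G z"
    "\<forall>z\<in>ball 0 (d2/4). deriv g z = G z + z\<^sup>2 * H z \<and> norm (G z) \<le> K * (2 * BL) \<and> norm (H z) \<le> K * (2 * BL)"
    using dec[OF hg godd gB] by blast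
  define B where "B = K * (2 * BL) + K * (4 * C / l)"
  have B1: "K * (2 * BL) \<le> B" "K * (4 * C / l) \<le> B" using K C l BL0 by (auto simp: B_def)
  have "(\<lambda>m. C * q ^ m) \<longlonglongrightarrow> C * 0" by (intro tendsto_mult tendsto_const LIMSEQ_power_zero) (use q in simp)
  then have "eventually (\<lambda>m. C * q ^ m < l / 2) sequentially" by (rule order_tendstoD(2)) (use l in simp)
  then obtain m0 where m0: "\<And>m. m \<ge> m0 \<Longrightarrow> C * q ^ m < l / 2"
    unfolding eventually_sequentially by blast
  have d4: "d2 / 4 > 0" using d2 by simp
  show thesis
  proof (rule that[OF d4 GH(1,2), of B "Suc m0"])
    show "norm (G z) \<le> B" "norm (H z) \<le> B" if "z \<in> ball 0 (d2/4)" for z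
      using GH(4) that B1(1) by (auto intro: order_trans)
  next
    show "\<forall>Q m c. degree Q = m \<longrightarrow> m \<ge> Suc m0 \<longrightarrow>
       szego_close R T (C * q ^ m) c Q \<longrightarrow>
       (\<exists>a h. \<forall>s. 0 < s \<longrightarrow> s < d2 / 4 \<longrightarrow>
          norm (a s - G (of_real s)) \<le> q ^ m * B \<and> norm (h s - H (of_real s)) \<le> q ^ m * B \<and>
          (sinh (of_nat m * of_real s - of_real s * a s) \<noteq> 0 \<longrightarrow>
            complex_of_real ((blaschke_speed Q (\<sigma> * exp (- s)))\<^sup>2) =
            ((of_nat m - (a s + of_real s ^ 2 * h s)) / sinh (of_nat m * of_real s - of_real s * a s))\<^sup>2))"
    proof (intro allI impI)
    fix Q :: "real poly" and m and c :: complex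
    assume dQ: "degree Q = m" and m: "m \<ge> Suc m0"
      and ap0: "szego_close R T (C * q ^ m) c Q"
    note ap = ap0[rule_format]
    define Pc where "Pc = complexify (reflect_poly Q)"
    \<comment> \<open>The relative error of the approximation by \<open>T\<close>.\<close>
    define u where "u z = c * poly Pc (E z) / T (E z) - 1" for z
    have ub: "norm (u z) \<le> C * q ^ m / l" "norm (u z) < 1 / 2" if "z \<in> ball 0 d1" for z
    proof -
      have "u z = (c * poly Pc (E z) - T (E z)) / T (E z)" using T0 by (simp add: u_def diff_divide_distrib)
      then have "norm (u z) = norm (c * poly Pc (E z) - T (E z)) / norm (T (E z))" by (simp add: norm_divide)
      also have "\<dots> \<le> C * q ^ m / l"
        by (rule frac_le) (use ap[OF ER(1)[OF that]] l(2)[OF ER(2)[OF that]] l(1) C q in \<open>auto simp: Pc_def\<close>)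
      finally show 1: "norm (u z) \<le> C * q ^ m / l" .
      have "C * q ^ m / l < 1 / 2" using m0[of m] m l(1) by (simp add: field_simps)
      then show "norm (u z) < 1 / 2" using 1 by linarith
    qed
    have u1: "1 + u z \<noteq> 0" if "z \<in> ball 0 d1" for z
    proof
      assume "1 + u z = 0"
      then have "u z = - 1" by (simp add: eq_neg_iff_add_eq_0 add.commute)
      then show False using ub(2)[OF that] by simp
    qed
    have cP: "c * poly Pc (E z) = T (E z) * (1 + u z)" for z using T0 by (simp add: u_def)
    have Pn: "poly Pc (E z) \<noteq> 0" "c \<noteq> 0" if "z \<in> ball 0 d1" for z
      using cP[of z] u1[OF that] T0[of "E z"] by auto
    have hu: "u holomorphic_on ball 0 d2"
    proof -
      have "(\<lambda>z. T (E z)) holomorphic_on ball 0 d2" by (rule holomorphic_on_subset[OF hTE]) (use d2 in auto)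
      moreover have "(\<lambda>z. poly Pc (E z)) holomorphic_on ball 0 d2"
        by (intro poly_holomorphic_on hE)
      ultimately show ?thesis unfolding u_def
        by (intro holomorphic_on_diff holomorphic_on_divide holomorphic_on_mult holomorphic_on_const) (use T0 in auto)
    qed
    define k where "k z = Ln (1 + u z) - Ln (1 + u (- z))" for z
    have sub21: "z \<in> ball 0 d1" "- z \<in> ball 0 d1" if "z \<in> ball (0::complex) d2" for z using that d2 by auto
    have hk: "k holomorphic_on ball 0 d2" unfolding k_def
    proof (rule odd_hol, rule holomorphic_on_Ln')
      show "(\<lambda>z. 1 + u z) holomorphic_on ball 0 d2" by (intro holomorphic_intros hu)
      fix z assume "z \<in> ball (0::complex) d2"
      then have "norm (u z) < 1 / 2" using ub(2) sub21 by blast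
      then have "Re (1 + u z) > 0" using abs_Re_le_cmod[of "u z"] by simp
      then show "1 + u z \<notin> \<real>\<^sub>\<le>\<^sub>0" by (auto simp: complex_nonpos_Reals_iff)
    qed
    have kb: "norm (k z) \<le> 4 * C / l * q ^ m" if "z \<in> ball 0 d2" for z
    proof -
      have "norm (Ln (1 + u z)) \<le> 2 * (C * q ^ m / l)" "norm (Ln (1 + u (- z))) \<le> 2 * (C * q ^ m / l)"
        using norm_Ln_le[OF ub(2)[OF sub21(1)[OF that]]] ub(1)[OF sub21(1)[OF that]]
          norm_Ln_le[OF ub(2)[OF sub21(2)[OF that]]] ub(1)[OF sub21(2)[OF that]] by linarith+
      then have "norm (k z) \<le> 2 * (C * q ^ m / l) + 2 * (C * q ^ m / l)"
        unfolding k_def using norm_triangle_ineq4[of "Ln (1 + u z)" "Ln (1 + u (- z))"] by linarith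
      then show ?thesis by simp
    qed
    have kodd: "k (- z) = - k z" for z by (simp add: k_def)
    obtain Gk Hk where GHk: "Gk holomorphic_on ball 0 (d2/4)" "Hk holomorphic_on ball 0 (d2/4)" "\<forall>z. k z = z * Gk z"
      "\<forall>z\<in>ball 0 (d2/4). deriv k z = Gk z + z\<^sup>2 * Hk z \<and> norm (Gk z) \<le> K * (4 * C / l * q ^ m) \<and> norm (Hk z) \<le> K * (4 * C / l * q ^ m)"
      using dec[OF hk kodd kb] by blast
    define f where "f z = g z + k z" for z
    have sub42: "z \<in> ball 0 d2" if "z \<in> ball (0::complex) (d2/4)" for z using that d2 by auto
    have hf: "f holomorphic_on ball 0 (d2/4)" unfolding f_def
      by (intro holomorphic_intros; rule holomorphic_on_subset[of _ "ball 0 d2"]) (use hg hk sub42 in auto)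
    have expf: "exp (f z) = poly Pc (E z) / poly Pc (E (- z))" if "z \<in> ball 0 (d2/4)" for z
    proof -
      note z = sub21[OF sub42[OF that]]
      have "exp (f z) = exp (L z) / exp (L (- z)) * (exp (Ln (1 + u z)) / exp (Ln (1 + u (- z))))"
        by (simp add: f_def g_def k_def exp_add exp_diff)
      also have "\<dots> = (T (E z) * (1 + u z)) / (T (E (- z)) * (1 + u (- z)))"
        using L(2)[OF z(1)] L(2)[OF z(2)] u1[OF z(1)] u1[OF z(2)] by simp
      also have "\<dots> = poly Pc (E z) / poly Pc (E (- z))" unfolding cP[symmetric] using Pn[OF z(1)] by simp
      finally show ?thesis .
    qed
    define a where "a s = G (of_real s) + Gk (of_real s)" for s
    define h where "h s = H (of_real s) + Hk (of_real s)" for s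
    have fin: "norm (a s - G (of_real s)) \<le> q ^ m * B \<and> norm (h s - H (of_real s)) \<le> q ^ m * B \<and>
          (sinh (of_nat m * of_real s - of_real s * a s) \<noteq> 0 \<longrightarrow>
            complex_of_real ((blaschke_speed Q (\<sigma> * exp (- s)))\<^sup>2) =
            ((of_nat m - (a s + of_real s ^ 2 * h s)) / sinh (of_nat m * of_real s - of_real s * a s))\<^sup>2)"
      if s: "0 < s" "s < d2 / 4" for s
    proof -
      have sb: "complex_of_real s \<in> ball 0 (d2/4)" using s by simp
      have kq: "K * (4 * C / l * q ^ m) \<le> q ^ m * B"
        using mult_left_mono[OF B1(2), of "q ^ m"] q by (simp add: mult_ac)
      have fs: "f (of_real s) = of_real s * a s" using GH(3) GHk(3) by (simp add: f_def a_def distrib_left)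
      have "deriv f (of_real s) = deriv g (of_real s) + deriv k (of_real s)"
        unfolding f_def
        by (rule deriv_add) (use hg hk sub42[OF sb] in \<open>auto intro: holomorphic_on_imp_differentiable_at\<close>)
      then have df: "deriv f (of_real s) = a s + of_real s ^ 2 * h s"
        using GH(4) GHk(4) sb by (simp add: a_def h_def distrib_left)
      have "complex_of_real ((blaschke_speed Q (\<sigma> * exp (- s)))\<^sup>2) =
            ((of_nat m - deriv f (of_real s)) / sinh (of_nat m * of_real s - f (of_real s)))\<^sup>2"
        if "sinh (of_nat m * of_real s - f (of_real s)) \<noteq> 0"
        by (rule blaschke_speed_logarithmic[OF dQ _ \<sigma> d4 hf _ _ s that])
           (use m Pn sub21 sub42 expf in \<open>auto simp: E_def Pc_def\<close>)
      then show ?thesis unfolding fs df using GHk(4) sb kq by (auto simp: a_def h_def intro: order_trans)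
    qed
    then show "\<exists>a h. \<forall>s. 0 < s \<longrightarrow> s < d2 / 4 \<longrightarrow>
          norm (a s - G (of_real s)) \<le> q ^ m * B \<and> norm (h s - H (of_real s)) \<le> q ^ m * B \<and>
          (sinh (of_nat m * of_real s - of_real s * a s) \<noteq> 0 \<longrightarrow>
            complex_of_real ((blaschke_speed Q (\<sigma> * exp (- s)))\<^sup>2) =
            ((of_nat m - (a s + of_real s ^ 2 * h s)) / sinh (of_nat m * of_real s - of_real s * a s))\<^sup>2)"
      by blast
    qed
  qed
qed

text \<open>
  The antiderivative \<open>ln (tanh (s / 2))\<close> tends to 0 at infinity.
\<close>

lemma csch_integral:
  assumes a: "a > (0::real)"
  shows "integrable lborel (\<lambda>s. indicator {a..} s * (1 / sinh s))"
    and "(\<integral>s. indicator {a..} s * (1 / sinh s) \<partial>lborel) = - ln (tanh (a / 2))"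
proof -
  have m: "(\<lambda>s::real. 1 / sinh s) \<in> borel_measurable borel"
    by (intro borel_measurable_divide borel_measurable_const borel_measurable_continuous_onI continuous_intros)
  have d: "((\<lambda>s. ln (tanh (s / 2))) has_real_derivative 1 / sinh x) (at x)" if "x > 0" for x :: real
  proof -
    have t: "tanh (x / 2) > 0" using that by simp
    have "((\<lambda>s. ln (tanh (s / 2))) has_real_derivative (1 / tanh (x / 2)) * ((1 - tanh (x / 2) ^ 2) * (1 / 2))) (at x)"
      using t by (auto intro!: derivative_eq_intros simp: divide_simps)
    also have "(1 / tanh (x / 2)) * ((1 - tanh (x / 2) ^ 2) * (1 / 2)) = 1 / sinh x"
    proof -
      define S where "S = sinh (x / 2)"
      define D where "D = cosh (x / 2)"
      have D: "D > 0" "S > 0" using that by (auto simp: S_def D_def)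
      have DS: "D\<^sup>2 = S\<^sup>2 + 1" unfolding S_def D_def by (rule cosh_square_eq)
      have sx: "sinh x = 2 * S * D" using sinh_double[of "x / 2"] by (simp add: S_def D_def)
      have "1 - (S / D)\<^sup>2 = (D\<^sup>2 - S\<^sup>2) / D\<^sup>2" using D by (simp add: power_divide diff_divide_distrib)
      also have "D\<^sup>2 - S\<^sup>2 = 1" using DS by simp
      finally have "1 - (S / D)\<^sup>2 = 1 / D\<^sup>2" .
      then show ?thesis unfolding sx tanh_def S_def[symmetric] D_def[symmetric] using D by (simp add: power2_eq_square)
    qed
    finally show ?thesis .
  qed
  have lim: "((\<lambda>s::real. ln (tanh (s / 2))) \<longlongrightarrow> 0) at_top"
  proof -
    have "((\<lambda>s::real. tanh (s / 2)) \<longlongrightarrow> 1) at_top"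
    proof -
      have "filterlim (\<lambda>s::real. 1 / 2 * s) at_top at_top"
        by (rule filterlim_tendsto_pos_mult_at_top[OF tendsto_const _ filterlim_ident]) simp
      from filterlim_compose[OF tanh_real_at_top this] show ?thesis by simp
    qed
    then have "((\<lambda>s::real. ln (tanh (s / 2))) \<longlongrightarrow> ln 1) at_top" by (intro tendsto_ln) auto
    then show ?thesis by simp
  qed
  have ftc: "(\<integral>\<^sup>+s. ennreal (1 / sinh s) * indicator {a..} s \<partial>lborel) = ennreal (0 - ln (tanh (a / 2)))"
    by (rule nn_integral_FTC_atLeast[OF m _ _ lim]) (use d a in auto)
  have nn: "(\<integral>\<^sup>+s. ennreal (indicator {a..} s * (1 / sinh s)) \<partial>lborel) = ennreal (- ln (tanh (a / 2)))"
  proof -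
    have e: "ennreal (indicator {a..} s * (1 / sinh s)) = ennreal (1 / sinh s) * indicator {a..} s" for s
      by (auto simp: indicator_def)
    show ?thesis unfolding e using ftc by simp
  qed
  have pos: "0 \<le> indicator {a..} s * (1 / sinh s)" for s using a by (auto simp: indicator_def)
  have m2: "(\<lambda>s. indicator {a..} s * (1 / sinh s)) \<in> borel_measurable lborel"
    using m by (intro borel_measurable_times borel_measurable_indicator) auto
  show int: "integrable lborel (\<lambda>s. indicator {a..} s * (1 / sinh s))"
    by (rule integrableI_nonneg[OF m2]) (use pos nn in auto)
  have "tanh (a / 2) \<le> 1" by (rule less_imp_le[OF tanh_real_lt_1])
  then have "- ln (tanh (a / 2)) \<ge> 0" using a by (simp add: ln_le_zero_iff)
  then show "(\<integral>s. indicator {a..} s * (1 / sinh s) \<partial>lborel) = - ln (tanh (a / 2))"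
    using nn nn_integral_eq_integral[OF int] pos by (simp add: integral_nonneg)
qed

section \<open>The contribution of one endpoint\<close>

lemma power_decay_bound:
  assumes "0 < q" "q < (1::real)"
  obtains K where "K \<ge> 0" "\<And>m. m > 0 \<Longrightarrow> q ^ m \<le> K * (1 / real m) ^ N"
proof -
  define \<eta> where "\<eta> = - ln q / 2"
  have \<eta>: "\<eta> > 0" using assms by (simp add: \<eta>_def)
  define K where "K = fact N / \<eta> ^ N"
  have K: "K \<ge> 0" using \<eta> by (simp add: K_def)
  show thesis
  proof (rule that[OF K])
    fix m :: nat assume m: "m > 0"
    have "(\<eta> * real m) ^ N \<le> fact N * exp (\<eta> * real m)" by (rule power_le_exp) (use \<eta> in simp)
    then have mN: "real m ^ N \<le> K * exp (\<eta> * real m)"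
      using \<eta> by (simp add: K_def power_mult_distrib field_simps)
    have "q ^ m = exp (ln q * real m)" using assms by (simp add: exp_of_nat2_mult)
    also have "ln q * real m = - (2 * (\<eta> * real m))" by (simp add: \<eta>_def)
    finally have qm: "q ^ m = exp (- (2 * (\<eta> * real m)))" .
    have "q ^ m * real m ^ N \<le> q ^ m * (K * exp (\<eta> * real m))" using mN assms by (intro mult_left_mono) auto
    also have "\<dots> = K * exp (- (\<eta> * real m))" unfolding qm by (simp add: mult_exp_exp)
    also have "\<dots> \<le> K * 1" using K \<eta> by (intro mult_left_mono) auto
    finally show "q ^ m \<le> K * (1 / real m) ^ N"
      using m by (simp add: power_divide pos_le_divide_eq)
  qed
qed

lemma sqrt_diff_bound:
  assumes "A > 0" "0 \<le> v" "v \<le> A\<^sup>2"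
  shows "\<bar>sqrt (A\<^sup>2 - v) - A\<bar> \<le> v / (A::real)"
proof -
  define S where "S = sqrt (A\<^sup>2 - v)"
  have S: "0 \<le> S" "S\<^sup>2 = A\<^sup>2 - v" using assms by (auto simp: S_def)
  have SA: "S \<le> A" using assms unfolding S_def by (intro real_le_lsqrt) auto
  have "(A - S) * A \<le> (A - S) * (A + S)" using S SA by (intro mult_left_mono) auto
  also have "\<dots> = v" using S by (simp add: power2_eq_square algebra_simps)
  finally have "A - S \<le> v / A" using assms by (simp add: pos_le_divide_eq)
  then show ?thesis using SA by (simp add: S_def[symmetric])
qed

lemma sinh_nonzero_region: "z \<in> csch_region \<Longrightarrow> z \<noteq> 0 \<Longrightarrow> sinh z \<noteq> 0"
  using sinhc_nonzero[of z] by (auto simp: csch_region_def sinhc_def)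

lemma csqrt_csch_sq_real:
  assumes "s > (0::real)" shows "csqrt (csch_sq (of_real s)) = of_real (s / sinh s)"
proof -
  have "csch_sq (of_real s) = of_real ((s / sinh s)\<^sup>2)"
    using csch_sq_real_bound(1)[OF assms] by (simp add: power_divide)
  also have "csqrt \<dots> = of_real (sqrt ((s / sinh s)\<^sup>2))" by (subst csqrt_of_real_nonneg) auto
  also have "sqrt ((s / sinh s)\<^sup>2) = s / sinh s" using assms by simp
  finally show ?thesis .
qed

text \<open>
  In the limit \<open>\<epsilon> \<rightarrow> 0\<close> the parameters \<open>a\<close> and \<open>h\<close> drop out, which makes the constant term universal.
\<close>

lemma rescaled_integrand_at_zero:
  assumes t: "t > 0"
  shows "rescaled_integrand a h t 0 = of_real ((kac_f t - (if t > 1 then 1 else 0)) / t)"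
proof -
  have le: "t\<^sup>2 / (sinh t)\<^sup>2 \<le> 1"
  proof -
    have "1 \<le> (1 + t\<^sup>2 / 6)\<^sup>2" by (rule one_le_power) simp
    then have "1 / (1 + t\<^sup>2 / 6)\<^sup>2 \<le> 1" using frac_le[of 1 1 1 "(1 + t\<^sup>2 / 6)\<^sup>2"] by simp
    then show ?thesis using csch_sq_real_bound(2)[OF t] by linarith
  qed
  have "of_real (t\<^sup>2) * rescaled_radicand a h t 0 = of_real (1 - t\<^sup>2 / (sinh t)\<^sup>2)"
    using rescaled_radicand_eq[of 0 a t h] csch_sq_real_bound(1)[OF t] by (simp add: csch_sq_0)
  then have "rescaled_radicand a h t 0 = of_real ((1 - t\<^sup>2 / (sinh t)\<^sup>2) / t\<^sup>2)"
    using t by (simp add: eq_divide_eq mult.commute)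
  then have "csqrt (rescaled_radicand a h t 0) = of_real (sqrt ((1 - t\<^sup>2 / (sinh t)\<^sup>2) / t\<^sup>2))"
    by (simp only:) (subst csqrt_of_real_nonneg, use le in auto)
  also have "sqrt ((1 - t\<^sup>2 / (sinh t)\<^sup>2) / t\<^sup>2) = kac_f t / t"
    using t by (simp add: real_sqrt_divide kac_f_def csch_def power_divide)
  finally show ?thesis by (simp add: rescaled_integrand_def csch_sq_0 diff_divide_distrib)
qed

lemma kac_f_measurable: "kac_f \<in> borel_measurable borel"
proof -
  have [measurable]: "(sinh :: real \<Rightarrow> real) \<in> borel_measurable borel"
    by (intro borel_measurable_continuous_onI continuous_intros)
  show ?thesis unfolding kac_f_def csch_def by measurable
qed

lemma borel_measurable_complex_of_real:
  "f \<in> borel_measurable M \<Longrightarrow> (\<lambda>x. complex_of_real (f x)) \<in> borel_measurable M"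
  by (rule borel_measurable_continuous_on[OF continuous_on_of_real[OF continuous_on_id]])

text \<open>
  The domination by \<open>exp (- t)\<close> is the case \<open>\<epsilon> = 0\<close> of the bound for the rescaled integrand.
\<close>

lemma integrable_kac_f_parts:
  "set_integrable lborel {0..1} (\<lambda>t. kac_f t / t)" "set_integrable lborel {1..} (\<lambda>t. (kac_f t - 1) / t)"
proof -
  obtain r C where "0 < r" "C \<ge> 0" and bd: "\<And>a h t \<epsilon>. norm a \<le> 0 \<Longrightarrow> norm h \<le> 0 \<Longrightarrow> 0 < t \<Longrightarrow> norm \<epsilon> * (1 + t) < r \<Longrightarrow>
       norm (rescaled_integrand a h t \<epsilon>) \<le> C * exp (- t)"
    by (rule rescaled_integrand_bound[of 0]) auto
  have b: "\<bar>(kac_f t - (if t > 1 then 1 else 0)) / t\<bar> \<le> C * exp (- t)" if "t > 0" for t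
    using bd[of 0 0 t 0] that \<open>0 < r\<close> unfolding rescaled_integrand_at_zero[OF that] norm_of_real by simp
  note fm = kac_f_measurable
  note w = integrable_mult_right[OF integrable_exp_poly_weight[of 0], of C]
  show "set_integrable lborel {0..1} (\<lambda>t. kac_f t / t)"
    unfolding set_integrable_def
  proof (rule Bochner_Integration.integrable_bound[OF w])
    show "AE t in lborel. norm (indicator {0..1} t *\<^sub>R (kac_f t / t)) \<le> norm (C * (indicator {0<..} t * (exp (- t) * (1 + t) ^ 0)))"
    proof (rule AE_I2)
      fix t :: real
      show "norm (indicator {0..1} t *\<^sub>R (kac_f t / t)) \<le> norm (C * (indicator {0<..} t * (exp (- t) * (1 + t) ^ 0)))"
      proof (cases "0 < t \<and> t \<le> 1")
        case True
        then show ?thesis using b[of t] \<open>C \<ge> 0\<close> by (simp add: abs_mult)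
      qed (auto simp: indicator_def)
    qed
  qed (use fm in \<open>auto intro!: borel_measurable_scaleR borel_measurable_indicator borel_measurable_divide\<close>)
  show "set_integrable lborel {1..} (\<lambda>t. (kac_f t - 1) / t)"
    unfolding set_integrable_def
  proof (rule Bochner_Integration.integrable_bound[OF w])
    have ne: "AE t in lborel. t \<noteq> (1::real)" by (rule AE_lborel_singleton)
    then show "AE t in lborel. norm (indicator {1..} t *\<^sub>R ((kac_f t - 1) / t)) \<le> norm (C * (indicator {0<..} t * (exp (- t) * (1 + t) ^ 0)))"
    proof eventually_elim
      case (elim t)
      show ?case
      proof (cases "1 < t")
        case True
        then show ?thesis using b[of t] \<open>C \<ge> 0\<close> by (simp add: abs_mult)
      qed (use elim in \<open>auto simp: indicator_def\<close>)
    qed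
  qed (use fm in \<open>auto intro!: borel_measurable_scaleR borel_measurable_indicator borel_measurable_divide borel_measurable_diff\<close>)
qed

text \<open>
  The constant term contributed by one endpoint; it is independent of \<open>\<mu>\<close>.
\<close>

definition kac_constant :: real where
  "kac_constant = (LBINT t:{0..1}. kac_f t / t) + (LBINT t:{1..}. (kac_f t - 1) / t)"

lemma integral_rescaled_integrand_at_zero:
  "(\<integral>t. indicator {0<..} t *\<^sub>R rescaled_integrand a h t 0 \<partial>lborel) = of_real kac_constant"
proof -
  have "(\<integral>t. indicator {0<..} t *\<^sub>R rescaled_integrand a h t 0 \<partial>lborel) =
    (\<integral>t. complex_of_real (indicator {0..1} t *\<^sub>R (kac_f t / t) + indicator {1..} t *\<^sub>R ((kac_f t - 1) / t)) \<partial>lborel)"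
  proof (rule integral_cong_AE)
    have "AE t in lborel. t \<noteq> (1::real)" "AE t in lborel. t \<noteq> (0::real)" by (rule AE_lborel_singleton)+
    then show "AE t in lborel. indicator {0<..} t *\<^sub>R rescaled_integrand a h t 0 =
        complex_of_real (indicator {0..1} t *\<^sub>R (kac_f t / t) + indicator {1..} t *\<^sub>R ((kac_f t - 1) / t))"
      by eventually_elim (auto simp: indicator_def rescaled_integrand_at_zero)
    have m: "(\<lambda>t. indicator {0..1} t *\<^sub>R (kac_f t / t) + indicator {1..} t *\<^sub>R ((kac_f t - 1) / t)) \<in> borel_measurable lborel"
      using integrable_kac_f_parts unfolding set_integrable_def by (intro borel_measurable_add borel_measurable_integrable)
    then show "(\<lambda>t. complex_of_real (indicator {0..1} t *\<^sub>R (kac_f t / t) + indicator {1..} t *\<^sub>R ((kac_f t - 1) / t))) \<in> borel_measurable lborel"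
      by (rule borel_measurable_complex_of_real)
    note fm = kac_f_measurable
    have eq: "(\<lambda>t. indicator {0<..} t *\<^sub>R rescaled_integrand a h t 0) = (\<lambda>t. indicator {0<..} t *\<^sub>R complex_of_real ((kac_f t - indicator {1<..} t) / t))"
      by (auto simp: fun_eq_iff indicator_def rescaled_integrand_at_zero)
    show "(\<lambda>t. indicator {0<..} t *\<^sub>R rescaled_integrand a h t 0) \<in> borel_measurable lborel"
      unfolding eq using fm
      by (auto intro!: borel_measurable_scaleR borel_measurable_indicator borel_measurable_complex_of_real borel_measurable_divide borel_measurable_diff)
  qed
  also have "\<dots> = of_real (\<integral>t. indicator {0..1} t *\<^sub>R (kac_f t / t) + indicator {1..} t *\<^sub>R ((kac_f t - 1) / t) \<partial>lborel)"
    by (rule integral_complex_of_real)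
  also have "(\<integral>t. indicator {0..1} t *\<^sub>R (kac_f t / t) + indicator {1..} t *\<^sub>R ((kac_f t - 1) / t) \<partial>lborel) = kac_constant"
    unfolding kac_constant_def set_lebesgue_integral_def
    by (rule Bochner_Integration.integral_add) (use integrable_kac_f_parts in \<open>auto simp: set_integrable_def\<close>)
  finally show ?thesis .
qed

text \<open>
  The term \<open>ln (tanh (1 / (2 m)))\<close> compensates the integral of \<open>1 / sinh s\<close> over \<open>s > 1 / m\<close>. On \<open>s \<ge> \<delta>\<close> the integrand differs from
  \<open>1 / sinh s\<close> by an exponentially small amount. On \<open>s < \<delta>\<close> the substitution \<open>s = t / m\<close> leads to the rescaled integrand
  with parameters that are exponentially close to the limit functions \<open>G\<close> and \<open>H\<close>; so the
  expansion holds with coefficients \<open>c\<close> that do not depend on \<open>Q\<close>.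
\<close>

theorem endpoint_expansion:
  assumes R: "R > 1" and hT: "T holomorphic_on ball 0 R" and T0: "\<And>z. T z \<noteq> 0"
    and q: "0 < q" "q < 1" and C: "C \<ge> 0" and \<sigma>: "\<sigma> = 1 \<or> \<sigma> = (-1::real)"
  obtains c :: "nat \<Rightarrow> complex" where "c 0 = complex_of_real kac_constant"
    "\<And>N. \<exists>K n0. \<forall>m\<ge>n0. \<forall>Q b. degree Q = m \<longrightarrow>
       szego_close R T (C * q ^ m) b Q \<longrightarrow>
       (\<forall>s>0. (blaschke_speed Q (\<sigma> * exp (- s)))\<^sup>2 \<le> (1 / sinh s)\<^sup>2) \<longrightarrow>
       integrable lborel (endpoint_integrand Q \<sigma>) \<longrightarrow>
       norm (complex_of_real ((\<integral>s. endpoint_integrand Q \<sigma> s \<partial>lborel) + ln (tanh ((1 / real m) / 2)))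
          - (\<Sum>p<N. c p * of_real (1 / real m) ^ p)) \<le> K * (1 / real m) ^ N"
proof -
  obtain \<delta>0 G H B m1 where \<delta>0: "\<delta>0 > 0" and GH: "G holomorphic_on ball 0 \<delta>0" "H holomorphic_on ball 0 \<delta>0"
    and B: "\<And>z. z \<in> ball 0 \<delta>0 \<Longrightarrow> norm (G z) \<le> B" "\<And>z. z \<in> ball 0 \<delta>0 \<Longrightarrow> norm (H z) \<le> B"
    and fam0: "\<forall>Q m c. degree Q = m \<longrightarrow> m \<ge> m1 \<longrightarrow>
       szego_close R T (C * q ^ m) c Q \<longrightarrow>
       (\<exists>a h. \<forall>s. 0 < s \<longrightarrow> s < \<delta>0 \<longrightarrow>
          norm (a s - G (of_real s)) \<le> q ^ m * B \<and> norm (h s - H (of_real s)) \<le> q ^ m * B \<and>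
          (sinh (of_nat m * of_real s - of_real s * a s) \<noteq> 0 \<longrightarrow>
            complex_of_real ((blaschke_speed Q (\<sigma> * exp (- s)))\<^sup>2) =
            ((of_nat m - (a s + of_real s ^ 2 * h s)) / sinh (of_nat m * of_real s - of_real s * a s))\<^sup>2))"
    by (rule blaschke_speed_near_endpoint[OF R hT T0 q C \<sigma>]) (rule that)
  obtain r K c where r: "0 < r" "r \<le> \<delta>0" "r \<le> 1" and K: "K \<ge> 0"
    and c0: "c 0 = (\<integral>t. indicator {0<..} t *\<^sub>R rescaled_integrand (G 0) (H 0) t 0 \<partial>lborel)"
    and expn: "\<And>N \<delta>. 0 < \<delta> \<Longrightarrow> \<delta> < r \<Longrightarrow> \<exists>C. \<forall>\<epsilon>. 0 < \<epsilon> \<longrightarrow> \<epsilon> < r - \<delta> \<longrightarrow>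
       norm ((\<integral>t. indicator {0<..<\<delta> / \<epsilon>} t *\<^sub>R rescaled_integrand (G (\<epsilon> * of_real t)) (H (\<epsilon> * of_real t)) t (of_real \<epsilon>) \<partial>lborel) - (\<Sum>p<N. c p * of_real \<epsilon> ^ p)) \<le> C * \<epsilon> ^ N"
    and comp: "\<And>\<epsilon> t a h \<kappa>. 0 < t \<Longrightarrow> 0 < \<epsilon> \<Longrightarrow> \<epsilon> * (1 + t) < r \<Longrightarrow> 0 \<le> \<kappa> \<Longrightarrow> \<kappa> \<le> 1 / 2 \<Longrightarrow>
       norm (a - G (\<epsilon> * of_real t)) \<le> \<kappa> * B \<Longrightarrow> norm (h - H (\<epsilon> * of_real t)) \<le> \<kappa> * B \<Longrightarrow>
       regular_at a h t (of_real \<epsilon>) \<and>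
       norm (rescaled_integrand a h t (of_real \<epsilon>) - rescaled_integrand (G (\<epsilon> * of_real t)) (H (\<epsilon> * of_real t)) t (of_real \<epsilon>)) \<le> K * exp (- t) * \<kappa>"
    and intD: "\<And>\<epsilon> \<delta>. 0 < \<delta> \<Longrightarrow> \<delta> < r \<Longrightarrow> 0 < \<epsilon> \<Longrightarrow> \<epsilon> < r - \<delta> \<Longrightarrow> integrable lborel (\<lambda>t. indicator {0<..<\<delta> / \<epsilon>} t *\<^sub>R rescaled_integrand (G (\<epsilon> * of_real t)) (H (\<epsilon> * of_real t)) t (of_real \<epsilon>))"
    by (rule rescaled_integrand_expansion[OF \<delta>0 GH, of B], erule B(1), erule B(2)) (rule that)
  \<comment> \<open>This choice makes \<open>r - \<delta> = \<delta>\<close>, so one number bounds \<open>s\<close> and the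
    admissible \<open>\<epsilon>\<close>.\<close>
  define \<delta> where "\<delta> = r / 2"
  have \<delta>: "0 < \<delta>" "\<delta> < r" "r - \<delta> = \<delta>" using r by (auto simp: \<delta>_def)
  obtain KV \<rho> m2 where KV: "KV \<ge> 0" and \<rho>: "0 < \<rho>" "\<rho> < 1"
    and tail: "\<forall>Q m c x. degree Q = m \<longrightarrow> m \<ge> m2 \<longrightarrow>
       szego_close R T (C * q ^ m) c Q \<longrightarrow>
       \<bar>x\<bar> \<le> exp (- \<delta>) \<longrightarrow> \<bar>blaschke_speed Q x\<bar> \<le> KV * \<bar>x\<bar> * \<rho> ^ m"
    by (rule blaschke_speed_tail[OF R hT T0 q C \<delta>(1)]) (rule that)
  define W where "W = (\<integral>t. indicator {0<..} t * (exp (- t) * (1 + t) ^ 0 :: real) \<partial>lborel)"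
  have "(\<lambda>m. q ^ m) \<longlonglongrightarrow> 0" by (rule LIMSEQ_power_zero) (use q in simp)
  then have "eventually (\<lambda>m. q ^ m < 1 / 2) sequentially" by (rule order_tendstoD(2)) simp
  then obtain m3 where m3: "\<And>m. m \<ge> m3 \<Longrightarrow> q ^ m < 1 / 2" unfolding eventually_sequentially by blast
  obtain m4 :: nat where m4: "1 / \<delta> < real m4" using reals_Archimedean2 by blast
  show thesis
  proof (rule that[of c])
    show "c 0 = of_real kac_constant" unfolding c0 by (rule integral_rescaled_integrand_at_zero)
    fix N
    obtain KE where KE: "\<And>\<epsilon>. 0 < \<epsilon> \<Longrightarrow> \<epsilon> < \<delta> \<Longrightarrow>
       norm ((\<integral>t. indicator {0<..<\<delta> / \<epsilon>} t *\<^sub>R rescaled_integrand (G (\<epsilon> * of_real t)) (H (\<epsilon> * of_real t)) t (of_real \<epsilon>) \<partial>lborel) - (\<Sum>p<N. c p * of_real \<epsilon> ^ p)) \<le> KE * \<epsilon> ^ N"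
      using expn[OF \<delta>(1,2), of N] unfolding \<delta>(3) by blast
    obtain Kq where Kq: "Kq \<ge> 0" "\<And>m. m > 0 \<Longrightarrow> q ^ m \<le> Kq * (1 / real m) ^ N"
      by (rule power_decay_bound[OF q]) (rule that)
    obtain K\<rho> where K\<rho>: "K\<rho> \<ge> 0" "\<And>m. m > 0 \<Longrightarrow> \<rho> ^ m \<le> K\<rho> * (1 / real m) ^ N"
      by (rule power_decay_bound[OF \<rho>]) (rule that)
    define KK where "KK = KE + K * W * Kq + KV\<^sup>2 * W * K\<rho>"
    have W0: "W \<ge> 0" unfolding W_def by (rule Bochner_Integration.integral_nonneg) (auto simp: indicator_def)
    show "\<exists>K n0. \<forall>m\<ge>n0. \<forall>Q b. degree Q = m \<longrightarrow>
       szego_close R T (C * q ^ m) b Q \<longrightarrow>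
       (\<forall>s>0. (blaschke_speed Q (\<sigma> * exp (- s)))\<^sup>2 \<le> (1 / sinh s)\<^sup>2) \<longrightarrow>
       integrable lborel (endpoint_integrand Q \<sigma>) \<longrightarrow>
       norm (complex_of_real ((\<integral>s. endpoint_integrand Q \<sigma> s \<partial>lborel) + ln (tanh ((1 / real m) / 2)))
          - (\<Sum>p<N. c p * of_real (1 / real m) ^ p)) \<le> K * (1 / real m) ^ N"
    proof (rule exI[of _ KK], rule exI[of _ "Suc (m1 + m2 + m3 + m4)"], intro allI impI)
      fix m Q b
      assume m: "Suc (m1 + m2 + m3 + m4) \<le> m" and dQ: "degree Q = m"
        and ap: "szego_close R T (C * q ^ m) b Q"
        and le: "\<forall>s>0. (blaschke_speed Q (\<sigma> * exp (- s)))\<^sup>2 \<le> (1 / sinh s)\<^sup>2"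
        and int: "integrable lborel (endpoint_integrand Q \<sigma>)"
      define \<Phi> where "\<Phi> s = sqrt ((1 / sinh s)\<^sup>2 - (blaschke_speed Q (\<sigma> * exp (- s)))\<^sup>2)" for s
      define \<epsilon> where "\<epsilon> = 1 / real m"
      have mpos: "m > 0" using m by simp
      have \<epsilon>: "0 < \<epsilon>" "\<epsilon> < \<delta>"
      proof -
        have "1 / \<delta> < real m" using m4 m by linarith
        then show "0 < \<epsilon>" "\<epsilon> < \<delta>" using mpos \<delta>(1) by (auto simp: \<epsilon>_def field_simps)
      qed
      have qm: "0 \<le> q ^ m" "q ^ m \<le> 1 / 2" using m3[of m] m q by auto
      obtain a h where ah: "\<And>s. 0 < s \<Longrightarrow> s < \<delta>0 \<Longrightarrow>
          norm (a s - G (of_real s)) \<le> q ^ m * B \<and> norm (h s - H (of_real s)) \<le> q ^ m * B \<and>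
          (sinh (of_nat m * of_real s - of_real s * a s) \<noteq> 0 \<longrightarrow>
            complex_of_real ((blaschke_speed Q (\<sigma> * exp (- s)))\<^sup>2) =
            ((of_nat m - (a s + of_real s ^ 2 * h s)) / sinh (of_nat m * of_real s - of_real s * a s))\<^sup>2)"
        proof -
        have "m \<ge> m1" using m by simp
        with fam0 dQ ap have "\<exists>a h. \<forall>s. 0 < s \<longrightarrow> s < \<delta>0 \<longrightarrow>
          norm (a s - G (of_real s)) \<le> q ^ m * B \<and> norm (h s - H (of_real s)) \<le> q ^ m * B \<and>
          (sinh (of_nat m * of_real s - of_real s * a s) \<noteq> 0 \<longrightarrow>
            complex_of_real ((blaschke_speed Q (\<sigma> * exp (- s)))\<^sup>2) =
            ((of_nat m - (a s + of_real s ^ 2 * h s)) / sinh (of_nat m * of_real s - of_real s * a s))\<^sup>2)"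
          by blast
        then show thesis using that by blast
      qed
      have inr: "\<epsilon> * (1 + t) < r" "0 < \<epsilon> * t" "\<epsilon> * t < \<delta>" if "0 < t" "t < \<delta> / \<epsilon>" for t
      proof -
        show 1: "\<epsilon> * t < \<delta>" using that \<epsilon> by (simp add: field_simps)
        then show "\<epsilon> * (1 + t) < r" using \<epsilon> \<delta> by (simp add: distrib_left)
        show "0 < \<epsilon> * t" using that \<epsilon> by simp
      qed
      define D where "D t = rescaled_integrand (G (\<epsilon> * of_real t)) (H (\<epsilon> * of_real t)) t (of_real \<epsilon>)" for t
      \<comment> \<open>The integrand in the variable \<open>t\<close>, with the subtraction for \<open>t > 1\<close>, that is,
        for \<open>s > \<epsilon>\<close>.\<close>
      define \<psi> where "\<psi> t = \<epsilon> * \<Phi> (\<epsilon> * t) - (if t > 1 then \<epsilon> / sinh (\<epsilon> * t) else 0)" for t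
      have point: "norm (of_real (\<psi> t) - D t) \<le> K * exp (- t) * q ^ m" if t: "0 < t" "t < \<delta> / \<epsilon>" for t
      proof -
        define s where "s = \<epsilon> * t"
        have s: "0 < s" "s < \<delta>0" using inr[OF t] \<delta> r by (auto simp: s_def)
        have sc: "complex_of_real s = \<epsilon> * of_real t" by (simp add: s_def)
        note as = ah[OF s]
        have cmp: "regular_at (a s) (h s) t (of_real \<epsilon>) \<and>
          norm (rescaled_integrand (a s) (h s) t (of_real \<epsilon>) - rescaled_integrand (G (\<epsilon> * of_real t)) (H (\<epsilon> * of_real t)) t (of_real \<epsilon>)) \<le> K * exp (- t) * q ^ m"
          by (rule comp[OF t(1) \<epsilon>(1) inr(1)[OF t] qm]) (use as in \<open>simp_all only: sc\<close>)
        then have ra: "of_real \<epsilon> * a s \<noteq> 1" "of_real t * (1 - of_real \<epsilon> * a s) \<in> csch_region" by (auto simp: regular_at_def)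
        have Y: "of_nat m * of_real s - of_real s * a s = of_real t * (1 - of_real \<epsilon> * a s)"
        proof -
          have "complex_of_nat m * of_real s = of_real (real m * s)" by simp
          also have "real m * s = t" using mpos by (simp add: s_def \<epsilon>_def)
          finally show ?thesis by (simp add: s_def algebra_simps)
        qed
        have "sinh (of_nat m * of_real s - of_real s * a s) \<noteq> 0"
          unfolding Y by (rule sinh_nonzero_region[OF ra(2)]) (use t ra(1) in auto)
        then have V: "complex_of_real ((blaschke_speed Q (\<sigma> * exp (- s)))\<^sup>2) =
            ((of_nat m - (a s + of_real s ^ 2 * h s)) / sinh (of_nat m * of_real s - of_real s * a s))\<^sup>2"
          using as by blast
        have "csqrt (rescaled_radicand (a s) (h s) t (of_real (1 / real m))) = of_real (sqrt ((1 / sinh s)\<^sup>2 - (blaschke_speed Q (\<sigma> * exp (- s)))\<^sup>2) / real m)"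
          by (rule rescaled_radicand_of_speed[OF mpos t(1) V]) (use le s ra(1) in \<open>auto simp: s_def \<epsilon>_def\<close>)
        then have e1: "csqrt (rescaled_radicand (a s) (h s) t (of_real \<epsilon>)) = of_real (\<epsilon> * \<Phi> s)" by (simp add: \<epsilon>_def \<Phi>_def)
        have e2: "csqrt (csch_sq (of_real \<epsilon> * of_real t)) / of_real t = of_real (\<epsilon> / sinh s)"
        proof -
          have "csqrt (csch_sq (of_real \<epsilon> * of_real t)) = of_real (s / sinh s)"
            using csqrt_csch_sq_real[OF s(1)] by (simp add: s_def)
          then show ?thesis using t by (simp add: s_def)
        qed
        have "rescaled_integrand (a s) (h s) t (of_real \<epsilon>) = of_real (\<psi> t)"
          unfolding rescaled_integrand_def e1 e2 by (simp add: \<psi>_def s_def)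
        then show ?thesis using cmp by (simp add: D_def)
      qed
      have int\<Phi>: "integrable lborel (\<lambda>s. indicator {0<..} s * \<Phi> s)" using int by (simp add: \<Phi>_def endpoint_integrand_def)
      have int1: "integrable lborel (\<lambda>s. indicator {0<..<\<delta>} s * \<Phi> s)"
      proof -
        have "(\<lambda>s. indicator {0<..<\<delta>} s * \<Phi> s) = (\<lambda>s. indicator {..<\<delta>} s *\<^sub>R (indicator {0<..} s * \<Phi> s))"
          by (auto simp: fun_eq_iff indicator_def)
        then show ?thesis using integrable_mult_indicator[OF _ int\<Phi>, of "{..<\<delta>}"] by simp
      qed
      have int2: "integrable lborel (\<lambda>s. indicator {\<delta>..} s * \<Phi> s)"
      proof -
        have "(\<lambda>s. indicator {\<delta>..} s * \<Phi> s) = (\<lambda>s. indicator {\<delta>..} s *\<^sub>R (indicator {0<..} s * \<Phi> s))"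
          using \<delta> by (auto simp: fun_eq_iff indicator_def)
        then show ?thesis using integrable_mult_indicator[OF _ int\<Phi>, of "{\<delta>..}"] by simp
      qed
      define I where "I = (\<integral>s. indicator {0<..} s * \<Phi> s \<partial>lborel)"
      define I1 where "I1 = (\<integral>s. indicator {0<..<\<delta>} s * \<Phi> s \<partial>lborel)"
      define I2 where "I2 = (\<integral>s. indicator {\<delta>..} s * \<Phi> s \<partial>lborel)"
      have I12: "I = I1 + I2"
      proof -
        have "I = (\<integral>s. indicator {0<..<\<delta>} s * \<Phi> s + indicator {\<delta>..} s * \<Phi> s \<partial>lborel)"
          unfolding I_def using \<delta> by (intro Bochner_Integration.integral_cong) (auto simp: indicator_def)
        then show ?thesis unfolding I1_def I2_def using int1 int2 by simp
      qed
      have tailb: "\<bar>I2 + ln (tanh (\<delta> / 2))\<bar> \<le> KV\<^sup>2 * \<rho> ^ m * W"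
      proof -
        have pt: "\<bar>indicator {\<delta>..} s * \<Phi> s - indicator {\<delta>..} s * (1 / sinh s)\<bar> \<le> KV\<^sup>2 * \<rho> ^ m * (indicator {0<..} s * (exp (- s) * (1 + s) ^ 0))" for s
        proof (cases "\<delta> \<le> s")
          case True
          then have s: "s > 0" using \<delta> by simp
          have sh: "sinh s > 0" using s by (simp add: sinh_real_pos_iff)
          have sinh_le_exp: "sinh s \<le> exp s"
            using sinh_plus_cosh[of s] cosh_real_nonneg[of s] by linarith
          define v where "v = blaschke_speed Q (\<sigma> * exp (- s))"
          have "\<bar>v\<bar> \<le> KV * \<bar>\<sigma> * exp (- s)\<bar> * \<rho> ^ m" unfolding v_def
            by (rule tail[rule_format, of Q m b]) (use m dQ ap \<sigma> True in auto)
          also have "\<bar>\<sigma> * exp (- s)\<bar> = exp (- s)" using \<sigma> by auto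
          finally have "\<bar>v\<bar> \<le> KV * exp (- s) * \<rho> ^ m" .
          then have "\<bar>v\<bar> ^ 2 \<le> (KV * exp (- s) * \<rho> ^ m)\<^sup>2" by (intro power_mono) auto
          then have v2: "v\<^sup>2 \<le> KV\<^sup>2 * (exp (- s))\<^sup>2 * (\<rho> ^ m)\<^sup>2" by (simp add: power_mult_distrib)
          have "\<bar>\<Phi> s - 1 / sinh s\<bar> \<le> v\<^sup>2 / (1 / sinh s)"
            unfolding \<Phi>_def v_def[symmetric] by (rule sqrt_diff_bound) (use sh le s in \<open>auto simp: v_def\<close>)
          also have "\<dots> = v\<^sup>2 * sinh s" by simp
          also have "\<dots> \<le> (KV\<^sup>2 * (exp (- s))\<^sup>2 * (\<rho> ^ m)\<^sup>2) * exp s"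
            by (intro mult_mono v2) (use sh sinh_le_exp in auto)
          also have "\<dots> = KV\<^sup>2 * (\<rho> ^ m * \<rho> ^ m) * exp (- s)"
          proof -
            have "(exp (- s))\<^sup>2 * exp s = exp (- s)" by (simp add: power2_eq_square mult_exp_exp)
            then show ?thesis by (simp add: power2_eq_square mult_ac) 
          qed
          also have "\<dots> \<le> KV\<^sup>2 * (\<rho> ^ m * 1) * exp (- s)"
            by (intro mult_left_mono mult_right_mono) (use \<rho> in \<open>auto simp: power_le_one\<close>)
          finally show ?thesis using True s by simp
        next
          case False
          then show ?thesis using \<rho> by (simp add: indicator_def)
        qed
        have "I2 + ln (tanh (\<delta> / 2)) = (\<integral>s. indicator {\<delta>..} s * \<Phi> s - indicator {\<delta>..} s * (1 / sinh s) \<partial>lborel)"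
          using Bochner_Integration.integral_diff[OF int2 csch_integral(1)[OF \<delta>(1)]] csch_integral(2)[OF \<delta>(1)] by (simp add: I2_def)
        also have "\<bar>\<dots>\<bar> \<le> (\<integral>s. KV\<^sup>2 * \<rho> ^ m * (indicator {0<..} s * (exp (- s) * (1 + s) ^ 0)) \<partial>lborel)"
          using Bochner_Integration.integral_norm_bound_integral[OF Bochner_Integration.integrable_diff[OF int2 csch_integral(1)[OF \<delta>(1)]]
            integrable_mult_right[OF integrable_exp_poly_weight[of 0], of "KV\<^sup>2 * \<rho> ^ m"]] pt by (simp only: real_norm_def)
        also have "\<dots> = KV\<^sup>2 * \<rho> ^ m * W" unfolding W_def by (rule integral_mult_right_zero)
        finally show ?thesis .
      qed
      have cs: "integrable lborel (\<lambda>s. indicator {\<epsilon><..<\<delta>} s * (1 / sinh s))" "(\<integral>s. indicator {\<epsilon><..<\<delta>} s * (1 / sinh s) \<partial>lborel) = ln (tanh (\<delta> / 2)) - ln (tanh (\<epsilon> / 2))"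
      proof -
        have i1: "integrable lborel (\<lambda>s. indicator {\<epsilon>..} s * (1 / sinh s) - indicator {\<delta>..} s * (1 / sinh s))"
          by (intro Bochner_Integration.integrable_diff csch_integral \<epsilon> \<delta>)
        have ae: "AE s in lborel. indicator {\<epsilon>..} s * (1 / sinh s) - indicator {\<delta>..} s * (1 / sinh s) = indicator {\<epsilon><..<\<delta>} s * (1 / sinh s)"
        proof -
          have "AE s in lborel. s \<noteq> \<epsilon>" by (rule AE_lborel_singleton)
          then show ?thesis by eventually_elim (use \<epsilon> in \<open>auto simp: indicator_def\<close>)
        qed
        have m': "(\<lambda>s. indicator {\<epsilon><..<\<delta>} s * (1 / sinh s)) \<in> borel_measurable lborel"
        proof -
          have "(\<lambda>s::real. 1 / sinh s) \<in> borel_measurable borel"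
            by (intro borel_measurable_divide borel_measurable_const borel_measurable_continuous_onI continuous_intros)
          then show ?thesis by (intro borel_measurable_times borel_measurable_indicator) auto
        qed
        show "integrable lborel (\<lambda>s. indicator {\<epsilon><..<\<delta>} s * (1 / sinh s))"
          by (rule integrable_cong_AE_imp[OF i1 m']) (use ae in \<open>auto elim: eventually_mono\<close>)
        have "(\<integral>s. indicator {\<epsilon><..<\<delta>} s * (1 / sinh s) \<partial>lborel) = (\<integral>s. indicator {\<epsilon>..} s * (1 / sinh s) - indicator {\<delta>..} s * (1 / sinh s) \<partial>lborel)"
          by (rule integral_cong_AE[OF m' borel_measurable_integrable[OF i1]]) (use ae in \<open>auto elim: eventually_mono\<close>)
        also have "\<dots> = ln (tanh (\<delta> / 2)) - ln (tanh (\<epsilon> / 2))"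
          using Bochner_Integration.integral_diff[OF csch_integral(1)[OF \<epsilon>(1)] csch_integral(1)[OF \<delta>(1)]]
            csch_integral(2)[OF \<epsilon>(1)] csch_integral(2)[OF \<delta>(1)] by simp
        finally show "(\<integral>s. indicator {\<epsilon><..<\<delta>} s * (1 / sinh s) \<partial>lborel) = ln (tanh (\<delta> / 2)) - ln (tanh (\<epsilon> / 2))" .
      qed
      define u where "u s = indicator {0<..<\<delta>} s * \<Phi> s - indicator {\<epsilon><..<\<delta>} s * (1 / sinh s)" for s
      have intu: "integrable lborel u" unfolding u_def by (intro Bochner_Integration.integrable_diff int1 cs)
      have Iu: "(\<integral>s. u s \<partial>lborel) = I1 - (ln (tanh (\<delta> / 2)) - ln (tanh (\<epsilon> / 2)))"
        unfolding u_def I1_def using Bochner_Integration.integral_diff[OF int1 cs(1)] cs(2) by simp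
      have u\<psi>: "\<epsilon> * u (\<epsilon> * t) = indicator {0<..<\<delta> / \<epsilon>} t * \<psi> t" for t
      proof -
        have "0 < \<epsilon> * t \<longleftrightarrow> 0 < t" "\<epsilon> * t < \<delta> \<longleftrightarrow> t < \<delta> / \<epsilon>" "\<epsilon> < \<epsilon> * t \<longleftrightarrow> 1 < t"
          using \<epsilon> by (auto simp: field_simps zero_less_mult_iff)
        then show ?thesis by (auto simp: u_def \<psi>_def indicator_def algebra_simps)
      qed
      have intu': "integrable lborel (\<lambda>t. \<epsilon> * u (\<epsilon> * t))"
        using lborel_integrable_real_affine[OF intu, of \<epsilon> 0] \<epsilon> by (simp add: integrable_mult_right)
      have Iu': "(\<integral>t. \<epsilon> * u (\<epsilon> * t) \<partial>lborel) = (\<integral>s. u s \<partial>lborel)"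
        using lborel_integral_real_affine[of \<epsilon> u 0] \<epsilon> by simp
      have near: "norm (of_real (I1 - (ln (tanh (\<delta> / 2)) - ln (tanh (\<epsilon> / 2)))) - (\<integral>t. indicator {0<..<\<delta> / \<epsilon>} t *\<^sub>R D t \<partial>lborel)) \<le> K * q ^ m * W"
      proof -
        have iD: "integrable lborel (\<lambda>t. indicator {0<..<\<delta> / \<epsilon>} t *\<^sub>R D t)"
          unfolding D_def by (rule intD) (use \<delta> \<epsilon> in auto)
        have ic: "integrable lborel (\<lambda>t. complex_of_real (\<epsilon> * u (\<epsilon> * t)))" using intu' by (rule integrable_of_real)
        have "of_real (I1 - (ln (tanh (\<delta> / 2)) - ln (tanh (\<epsilon> / 2)))) - (\<integral>t. indicator {0<..<\<delta> / \<epsilon>} t *\<^sub>R D t \<partial>lborel)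
          = (\<integral>t. complex_of_real (\<epsilon> * u (\<epsilon> * t)) - indicator {0<..<\<delta> / \<epsilon>} t *\<^sub>R D t \<partial>lborel)"
          unfolding Bochner_Integration.integral_diff[OF ic iD] integral_complex_of_real Iu' Iu ..
        also have "norm \<dots> \<le> (\<integral>t. K * q ^ m * (indicator {0<..} t * (exp (- t) * (1 + t) ^ 0)) \<partial>lborel)"
        proof (rule Bochner_Integration.integral_norm_bound_integral[OF Bochner_Integration.integrable_diff[OF ic iD]
            integrable_mult_right[OF integrable_exp_poly_weight[of 0], of "K * q ^ m"]])
          fix t :: real
          show "norm (complex_of_real (\<epsilon> * u (\<epsilon> * t)) - indicator {0<..<\<delta> / \<epsilon>} t *\<^sub>R D t) \<le> K * q ^ m * (indicator {0<..} t * (exp (- t) * (1 + t) ^ 0))"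
          proof (cases "0 < t \<and> t < \<delta> / \<epsilon>")
            case True
            then show ?thesis using point[of t] unfolding u\<psi> by (simp add: mult_ac)
          next
            case False
            then show ?thesis unfolding u\<psi> using K qm by (auto simp: indicator_def)
          qed
        qed
        also have "\<dots> = K * q ^ m * W" unfolding W_def by (rule integral_mult_right_zero)
        finally show ?thesis .
      qed
      have KEb: "norm ((\<integral>t. indicator {0<..<\<delta> / \<epsilon>} t *\<^sub>R D t \<partial>lborel) - (\<Sum>p<N. c p * of_real \<epsilon> ^ p)) \<le> KE * \<epsilon> ^ N"
        unfolding D_def by (rule KE[OF \<epsilon>])
      have split: "complex_of_real (I + ln (tanh (\<epsilon> / 2))) - (\<Sum>p<N. c p * of_real \<epsilon> ^ p) =
        (of_real (I1 - (ln (tanh (\<delta> / 2)) - ln (tanh (\<epsilon> / 2)))) - (\<integral>t. indicator {0<..<\<delta> / \<epsilon>} t *\<^sub>R D t \<partial>lborel))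
        + ((\<integral>t. indicator {0<..<\<delta> / \<epsilon>} t *\<^sub>R D t \<partial>lborel) - (\<Sum>p<N. c p * of_real \<epsilon> ^ p))
        + of_real (I2 + ln (tanh (\<delta> / 2)))"
        unfolding I12 by simp
      have "norm (complex_of_real (I + ln (tanh (\<epsilon> / 2))) - (\<Sum>p<N. c p * of_real \<epsilon> ^ p)) \<le> K * q ^ m * W + KE * \<epsilon> ^ N + KV\<^sup>2 * \<rho> ^ m * W"
        unfolding split
        by (intro norm_triangle_mono near KEb) (use tailb in \<open>simp only: norm_of_real\<close>)
      also have "\<dots> \<le> K * (Kq * \<epsilon> ^ N) * W + KE * \<epsilon> ^ N + KV\<^sup>2 * (K\<rho> * \<epsilon> ^ N) * W"
        unfolding \<epsilon>_def by (intro add_mono mult_right_mono mult_left_mono Kq K\<rho> mpos order_refl) (use K W0 in auto)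
      also have "\<dots> = KK * \<epsilon> ^ N" by (simp add: KK_def algebra_simps)
      finally show "norm (complex_of_real ((\<integral>s. endpoint_integrand Q \<sigma> s \<partial>lborel) + ln (tanh ((1 / real m) / 2)))
          - (\<Sum>p<N. c p * of_real (1 / real m) ^ p)) \<le> KK * (1 / real m) ^ N"
        unfolding I_def \<Phi>_def \<epsilon>_def endpoint_integrand_def .
    qed
  qed
qed

section \<open>The full expansion\<close>

text \<open>
  For positive \<open>\<epsilon>\<close> the expression equals \<open>Ln (cosh (\<epsilon> / 2) / sinhc (\<epsilon> / 2))\<close>, which is holomorphic near 0.
\<close>

lemma log_tanh_expansion:
  obtains a :: "nat \<Rightarrow> complex" and \<rho> :: real where "a 0 = 0" "\<rho> > 0"
    "\<And>N. \<exists>K. \<forall>\<epsilon>. 0 < \<epsilon> \<longrightarrow> \<epsilon> < \<rho> \<longrightarrow>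
       norm (complex_of_real (ln \<epsilon> - ln 2 - ln (tanh (\<epsilon> / 2))) - (\<Sum>p<N. a p * of_real \<epsilon> ^ p)) \<le> K * \<epsilon> ^ N"
proof -
  define f where "f z = cosh (z / 2) / sinhc (z / 2)" for z :: complex
  have hs: "(\<lambda>z. sinhc (z / 2)) holomorphic_on ball 0 3"
    using holomorphic_on_compose_gen[of "\<lambda>z. z / 2" "ball 0 3" sinhc UNIV, OF _ sinhc_holomorphic]
    by (simp add: o_def holomorphic_intros)
  have hf: "f holomorphic_on ball 0 3" unfolding f_def cosh_def
    by (intro holomorphic_intros hs) (auto intro!: sinhc_nonzero)
  have f0: "f 0 = 1" by (simp add: f_def sinhc_def)
  have "isCont f 0"
    using holomorphic_on_imp_continuous_on[OF hf] by (simp add: continuous_on_eq_continuous_at)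
  then obtain \<rho>0 where \<rho>0: "\<rho>0 > 0" "\<And>z. dist z 0 < \<rho>0 \<Longrightarrow> dist (f z) (f 0) < 1 / 2"
    unfolding continuous_at_eps_delta by (metis half_gt_zero_iff zero_less_one)
  define \<rho> where "\<rho> = min \<rho>0 3"
  have \<rho>: "\<rho> > 0" using \<rho>0 by (simp add: \<rho>_def)
  have fn: "norm (f z - 1) < 1 / 2" if "z \<in> ball 0 \<rho>" for z
    using \<rho>0(2)[of z] that f0 by (simp add: \<rho>_def dist_norm)
  define L where "L z = Ln (f z)" for z
  have hL: "L holomorphic_on ball 0 \<rho>" unfolding L_def
  proof (rule holomorphic_on_Ln')
    show "f holomorphic_on ball 0 \<rho>" by (rule holomorphic_on_subset[OF hf]) (auto simp: \<rho>_def)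
    fix z assume "z \<in> ball (0::complex) \<rho>"
    then have "Re (f z) > 0" using fn[of z] abs_Re_le_cmod[of "f z - 1"] by simp
    then show "f z \<notin> \<real>\<^sub>\<le>\<^sub>0" by (auto simp: complex_nonpos_Reals_iff)
  qed
  have bL: "norm (L z) \<le> 1" if "z \<in> ball 0 \<rho>" for z
    using norm_Ln_le[of "f z - 1"] fn[OF that] by (simp add: L_def)
  have L_real: "L (of_real \<epsilon>) = of_real (ln \<epsilon> - ln 2 - ln (tanh (\<epsilon> / 2)))" if \<epsilon>: "0 < \<epsilon>" for \<epsilon>
  proof -
    have th: "tanh (\<epsilon> / 2) > 0" using \<epsilon> by (simp add: tanh_real_pos_iff)
    have ch: "cosh (complex_of_real x) = of_real (cosh x)" for x
      by (simp add: cosh_def scaleR_conv_of_real flip: exp_of_real)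
    have "f (of_real \<epsilon>) = cosh (complex_of_real (\<epsilon> / 2)) / (sinh (complex_of_real (\<epsilon> / 2)) / of_real (\<epsilon> / 2))"
      using \<epsilon> by (simp add: f_def sinhc_def)
    also have "\<dots> = of_real ((\<epsilon> / 2) / tanh (\<epsilon> / 2))"
      unfolding ch sinh_complex_of_real by (simp add: tanh_def mult_ac)
    finally have "L (of_real \<epsilon>) = of_real (ln ((\<epsilon> / 2) / tanh (\<epsilon> / 2)))"
      using \<epsilon> th by (simp add: L_def Ln_of_real del: of_real_divide)
    also have "ln ((\<epsilon> / 2) / tanh (\<epsilon> / 2)) = ln \<epsilon> - ln 2 - ln (tanh (\<epsilon> / 2))"
      using \<epsilon> th by (simp add: ln_div del: divide_divide_eq_left)
    finally show ?thesis .
  qed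
  show thesis
  proof (rule that[of "\<lambda>p. (deriv ^^ p) L 0 / fact p", OF _ \<rho>])
    show "(deriv ^^ 0) L 0 / fact 0 = 0" by (simp add: L_def f0)
    fix N
    show "\<exists>K. \<forall>\<epsilon>. 0 < \<epsilon> \<longrightarrow> \<epsilon> < \<rho> \<longrightarrow>
       norm (complex_of_real (ln \<epsilon> - ln 2 - ln (tanh (\<epsilon> / 2))) - (\<Sum>p<N. (deriv ^^ p) L 0 / fact p * of_real \<epsilon> ^ p)) \<le> K * \<epsilon> ^ N"
    proof (intro exI[of _ "1 * (real N + 2) * (4 / \<rho>) ^ N"] allI impI)
      fix \<epsilon> :: real assume \<epsilon>: "0 < \<epsilon>" "\<epsilon> < \<rho>"
      have "norm (L (of_real \<epsilon>) - (\<Sum>p<N. (deriv ^^ p) L 0 / fact p * of_real \<epsilon> ^ p)) \<le> 1 * (real N + 2) * (4 * norm (complex_of_real \<epsilon>) / \<rho>) ^ N"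
        by (rule taylor_remainder_bound[OF hL \<rho> bL]) (use \<epsilon> in auto)
      also have "\<dots> = 1 * (real N + 2) * (4 / \<rho>) ^ N * \<epsilon> ^ N"
        using \<epsilon> by (simp add: power_mult_distrib power_divide)
      finally show "norm (complex_of_real (ln \<epsilon> - ln 2 - ln (tanh (\<epsilon> / 2))) - (\<Sum>p<N. (deriv ^^ p) L 0 / fact p * of_real \<epsilon> ^ p))
          \<le> 1 * (real N + 2) * (4 / \<rho>) ^ N * \<epsilon> ^ N"
        unfolding L_real[OF \<epsilon>(1)] .
    qed
  qed
qed

theorem theorem1:
  fixes \<mu> :: "complex measure"
  assumes "sets \<mu> = sets borel_circle"
    and "prob_space \<mu>"
    and "conj_symmetric \<mu>"
    and "absolutely_continuous arclength \<mu>"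
    and "has_nonvanishing_holomorphic_density \<mu>"
  shows "\<exists>A :: nat \<Rightarrow> real. \<forall>N::int. \<exists>(C::real) (n0::nat). \<forall>n\<ge>n0.
           \<forall>(M :: 'a measure) \<phi> \<eta>. orthonormal_polys \<mu> \<phi> \<longrightarrow> iid_std_normal M \<eta> \<longrightarrow>
             \<bar>expected_real_zeros M \<phi> \<eta> n -
               (2 / pi * ln (real (n + 1)) + kac_A0 +
                 (\<Sum>p = 1..<nat N. A p * real (n + 1) powi (- int p)))\<bar>
             \<le> C * real (n + 1) powi (- N)"
proof -
  obtain R T C q where R: "R > 1" and q: "0 < q" "q < 1" and C: "C \<ge> 0"
    and T: "T holomorphic_on ball 0 R" "\<And>z. T z \<noteq> 0"
    and approx: "\<And>\<phi> n. orthonormal_polys \<mu> \<phi> \<Longrightarrow> \<exists>c. szego_close R T (C * q ^ n) c (\<phi> n)"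
    using szego_asymptotics[OF assms] by metis
  \<comment> \<open>The properties of \<open>\<phi> m\<close> that the endpoint expansions use; no reference to the probability
    space or to \<open>\<phi>\<close> is left, so that the constants are uniform in both.\<close>
  define near where "near Q m \<longleftrightarrow> degree Q = m \<and>
      (\<exists>b. szego_close R T (C * q ^ m) b Q) \<and>
      (\<forall>\<sigma> s. (\<sigma> = 1 \<or> \<sigma> = -1) \<longrightarrow> 0 < s \<longrightarrow> (blaschke_speed Q (\<sigma> * exp (- s)))\<^sup>2 \<le> (1 / sinh s)\<^sup>2) \<and>
      integrable lborel (endpoint_integrand Q 1) \<and> integrable lborel (endpoint_integrand Q (-1))" for Q m
  have ends: "\<exists>c :: nat \<Rightarrow> complex. c 0 = complex_of_real kac_constant \<and>
      (\<forall>N. \<exists>K n0. \<forall>m\<ge>n0. \<forall>Q. near Q m \<longrightarrow>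
        norm (complex_of_real ((\<integral>s. endpoint_integrand Q \<sigma> s \<partial>lborel) + ln (tanh ((1 / real m) / 2)))
          - (\<Sum>p<N. c p * of_real (1 / real m) ^ p)) \<le> K * (1 / real m) ^ N)"
    if \<sigma>: "\<sigma> = 1 \<or> \<sigma> = -1" for \<sigma>
  proof -
    obtain c :: "nat \<Rightarrow> complex" where c: "c 0 = complex_of_real kac_constant"
      "\<And>N. \<exists>K n0. \<forall>m\<ge>n0. \<forall>Q b. degree Q = m \<longrightarrow>
       szego_close R T (C * q ^ m) b Q \<longrightarrow>
       (\<forall>s>0. (blaschke_speed Q (\<sigma> * exp (- s)))\<^sup>2 \<le> (1 / sinh s)\<^sup>2) \<longrightarrow>
       integrable lborel (endpoint_integrand Q \<sigma>) \<longrightarrow>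
       norm (complex_of_real ((\<integral>s. endpoint_integrand Q \<sigma> s \<partial>lborel) + ln (tanh ((1 / real m) / 2)))
          - (\<Sum>p<N. c p * of_real (1 / real m) ^ p)) \<le> K * (1 / real m) ^ N"
      by (rule endpoint_expansion[OF R T q C \<sigma>]) (rule that)
    have c2: "\<exists>K n0. \<forall>m\<ge>n0. \<forall>Q. near Q m \<longrightarrow>
        norm (complex_of_real ((\<integral>s. endpoint_integrand Q \<sigma> s \<partial>lborel) + ln (tanh ((1 / real m) / 2)))
          - (\<Sum>p<N. c p * of_real (1 / real m) ^ p)) \<le> K * (1 / real m) ^ N" for N
    proof -
      obtain K n0 where K: "\<And>m Q b. m \<ge> n0 \<Longrightarrow> degree Q = m \<Longrightarrow>
       szego_close R T (C * q ^ m) b Q \<Longrightarrow>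
       (\<forall>s>0. (blaschke_speed Q (\<sigma> * exp (- s)))\<^sup>2 \<le> (1 / sinh s)\<^sup>2) \<Longrightarrow>
       integrable lborel (endpoint_integrand Q \<sigma>) \<Longrightarrow>
       norm (complex_of_real ((\<integral>s. endpoint_integrand Q \<sigma> s \<partial>lborel) + ln (tanh ((1 / real m) / 2)))
          - (\<Sum>p<N. c p * of_real (1 / real m) ^ p)) \<le> K * (1 / real m) ^ N"
        using c(2)[of N] by blast
      have "norm (complex_of_real ((\<integral>s. endpoint_integrand Q \<sigma> s \<partial>lborel) + ln (tanh ((1 / real m) / 2)))
          - (\<Sum>p<N. c p * of_real (1 / real m) ^ p)) \<le> K * (1 / real m) ^ N" if mQ: "m \<ge> n0" "near Q m" for m Q
      proof -
        obtain b where b: "szego_close R T (C * q ^ m) b Q"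
          using mQ(2) unfolding near_def by blast
        show ?thesis by (rule K[OF mQ(1) _ b]) (use mQ(2) \<sigma> in \<open>auto simp: near_def\<close>)
      qed
      then show ?thesis by blast
    qed
    show ?thesis using c(1) c2 by blast
  qed
  obtain c1 :: "nat \<Rightarrow> complex" where c1: "c1 0 = complex_of_real kac_constant"
      "\<And>N. \<exists>K n0. \<forall>m\<ge>n0. \<forall>Q. near Q m \<longrightarrow>
        norm (complex_of_real ((\<integral>s. endpoint_integrand Q 1 s \<partial>lborel) + ln (tanh ((1 / real m) / 2)))
          - (\<Sum>p<N. c1 p * of_real (1 / real m) ^ p)) \<le> K * (1 / real m) ^ N"
    using ends[of 1] by blast
  obtain c2 :: "nat \<Rightarrow> complex" where c2: "c2 0 = complex_of_real kac_constant"
      "\<And>N. \<exists>K n0. \<forall>m\<ge>n0. \<forall>Q. near Q m \<longrightarrow>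
        norm (complex_of_real ((\<integral>s. endpoint_integrand Q (-1) s \<partial>lborel) + ln (tanh ((1 / real m) / 2)))
          - (\<Sum>p<N. c2 p * of_real (1 / real m) ^ p)) \<le> K * (1 / real m) ^ N"
    using ends[of "-1"] by blast
  obtain a :: "nat \<Rightarrow> complex" and \<rho> :: real where a: "a 0 = 0" "\<rho> > 0"
    "\<And>N. \<exists>K. \<forall>\<epsilon>. 0 < \<epsilon> \<longrightarrow> \<epsilon> < \<rho> \<longrightarrow>
       norm (complex_of_real (ln \<epsilon> - ln 2 - ln (tanh (\<epsilon> / 2))) - (\<Sum>p<N. a p * of_real \<epsilon> ^ p)) \<le> K * \<epsilon> ^ N"
    by (rule log_tanh_expansion) (rule that)
  \<comment> \<open>The logarithm enters once for each endpoint, hence the factor 2.\<close>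
  define A where "A p = Re (c1 p + c2 p + 2 * a p) / pi" for p
  have main: "\<exists>K n0. K \<ge> 0 \<and> (\<forall>n\<ge>n0. \<forall>(M :: 'a measure) \<phi> \<eta>. orthonormal_polys \<mu> \<phi> \<longrightarrow> iid_std_normal M \<eta> \<longrightarrow>
      \<bar>expected_real_zeros M \<phi> \<eta> n - (2 / pi * ln (real (n + 1)) + kac_A0 + (\<Sum>p = 1..<N. A p * (1 / real (n + 1)) ^ p))\<bar>
        \<le> K * (1 / real (n + 1)) ^ N)" if N: "N \<ge> 1" for N
  proof -
    obtain K1 n1 where K1: "\<And>m Q. m \<ge> n1 \<Longrightarrow> near Q m \<Longrightarrow>
        norm (complex_of_real ((\<integral>s. endpoint_integrand Q 1 s \<partial>lborel) + ln (tanh ((1 / real m) / 2)))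
          - (\<Sum>p<N. c1 p * of_real (1 / real m) ^ p)) \<le> K1 * (1 / real m) ^ N"
      using c1(2)[of N] by blast
    obtain K2 n2 where K2: "\<And>m Q. m \<ge> n2 \<Longrightarrow> near Q m \<Longrightarrow>
        norm (complex_of_real ((\<integral>s. endpoint_integrand Q (-1) s \<partial>lborel) + ln (tanh ((1 / real m) / 2)))
          - (\<Sum>p<N. c2 p * of_real (1 / real m) ^ p)) \<le> K2 * (1 / real m) ^ N"
      using c2(2)[of N] by blast
    obtain K3 where K3: "\<And>\<epsilon>. 0 < \<epsilon> \<Longrightarrow> \<epsilon> < \<rho> \<Longrightarrow>
       norm (complex_of_real (ln \<epsilon> - ln 2 - ln (tanh (\<epsilon> / 2))) - (\<Sum>p<N. a p * of_real \<epsilon> ^ p)) \<le> K3 * \<epsilon> ^ N"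
      using a(3)[of N] by blast
    obtain n3 :: nat where n3: "1 / \<rho> < real n3" using reals_Archimedean2 by blast
    define KK where "KK = K1 + K2 + 2 * K3"
    have bound: "\<bar>expected_real_zeros M \<phi> \<eta> n - (2 / pi * ln (real (n + 1)) + kac_A0 + (\<Sum>p = 1..<N. A p * (1 / real (n + 1)) ^ p))\<bar>
        \<le> \<bar>KK\<bar> / pi * (1 / real (n + 1)) ^ N"
      if n: "n \<ge> n1 + n2 + n3" and on: "orthonormal_polys \<mu> \<phi>" and iid: "iid_std_normal M \<eta>"
      for n \<phi> \<eta> and M :: "'a measure"
    proof -
      define m where "m = Suc n"
      define \<epsilon> where "\<epsilon> = 1 / real m"
      define Q where "Q = \<phi> m"
      note hyp = expected_real_zeros_endpoints[OF assms(1,2) on iid, of n, folded m_def, folded Q_def]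
      have \<epsilon>: "0 < \<epsilon>" "\<epsilon> < \<rho>"
      proof -
        have "1 / \<rho> < real m" using n3 n by (simp add: m_def)
        moreover have "real m > 0" by (simp add: m_def)
        ultimately show "0 < \<epsilon>" "\<epsilon> < \<rho>" using a(2) by (auto simp: \<epsilon>_def field_simps)
      qed
      have nQ: "near Q m"
        unfolding near_def
        using on approx[OF on, of m] hyp(1,2) expected_real_zeros_hyperbolic(2)[OF assms(1,2) on iid, of _ _ n]
        by (auto simp: Q_def m_def orthonormal_polys_def)
      define J1 where "J1 = (\<integral>s. endpoint_integrand Q 1 s \<partial>lborel) + ln (tanh (\<epsilon> / 2))"
      define J2 where "J2 = (\<integral>s. endpoint_integrand Q (-1) s \<partial>lborel) + ln (tanh (\<epsilon> / 2))"
      define L where "L = ln \<epsilon> - ln 2 - ln (tanh (\<epsilon> / 2))"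
      define S where "S = (\<Sum>p<N. (c1 p + c2 p + 2 * a p) * of_real \<epsilon> ^ p)"
      have b1: "norm (complex_of_real J1 - (\<Sum>p<N. c1 p * of_real \<epsilon> ^ p)) \<le> K1 * \<epsilon> ^ N"
        using K1[OF _ nQ] n by (simp add: J1_def \<epsilon>_def m_def)
      have b2: "norm (complex_of_real J2 - (\<Sum>p<N. c2 p * of_real \<epsilon> ^ p)) \<le> K2 * \<epsilon> ^ N"
        using K2[OF _ nQ] n by (simp add: J2_def \<epsilon>_def m_def)
      have b3: "norm (2 * (complex_of_real L - (\<Sum>p<N. a p * of_real \<epsilon> ^ p))) \<le> 2 * (K3 * \<epsilon> ^ N)"
        using K3[OF \<epsilon>] by (simp only: norm_mult L_def) simp
      have split: "complex_of_real (J1 + J2 + 2 * L) - S =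
          (complex_of_real J1 - (\<Sum>p<N. c1 p * of_real \<epsilon> ^ p)) + (complex_of_real J2 - (\<Sum>p<N. c2 p * of_real \<epsilon> ^ p))
          + 2 * (complex_of_real L - (\<Sum>p<N. a p * of_real \<epsilon> ^ p))"
        by (simp add: S_def distrib_right sum.distrib sum_distrib_left algebra_simps)
      have "norm (complex_of_real (J1 + J2 + 2 * L) - S) \<le> K1 * \<epsilon> ^ N + K2 * \<epsilon> ^ N + 2 * (K3 * \<epsilon> ^ N)"
        unfolding split by (intro norm_triangle_mono b1 b2 b3)
      also have "\<dots> = KK * \<epsilon> ^ N" by (simp add: KK_def algebra_simps)
      finally have "\<bar>Re (complex_of_real (J1 + J2 + 2 * L) - S)\<bar> \<le> KK * \<epsilon> ^ N"
        using abs_Re_le_cmod order_trans by blast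
      moreover have "Re S = pi * (\<Sum>p<N. A p * \<epsilon> ^ p)"
      proof -
        have Rep: "Re ((c1 p + c2 p + 2 * a p) * of_real \<epsilon> ^ p) = pi * (A p * \<epsilon> ^ p)" for p
          by (simp add: A_def flip: of_real_power)
        show ?thesis unfolding S_def Re_sum sum_distrib_left by (intro sum.cong refl Rep)
      qed
      moreover have "(\<Sum>p<N. A p * \<epsilon> ^ p) = 2 * kac_constant / pi + (\<Sum>p = 1..<N. A p * \<epsilon> ^ p)"
      proof -
        have "{..<N} = insert 0 {1..<N}" using N by auto
        then show ?thesis by (simp add: A_def c1 c2 a)
      qed
      moreover have "J1 + J2 + 2 * L = pi * expected_real_zeros M \<phi> \<eta> n - 2 * ln (real m) - 2 * ln 2"
      proof -
        have "ln \<epsilon> = - ln (real m)" by (simp add: \<epsilon>_def m_def ln_div)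
        then show ?thesis unfolding hyp(3) J1_def J2_def L_def by simp
      qed
      ultimately have "\<bar>pi * expected_real_zeros M \<phi> \<eta> n - 2 * ln (real m) - 2 * ln 2 - pi * (2 * kac_constant / pi + (\<Sum>p = 1..<N. A p * \<epsilon> ^ p))\<bar> \<le> KK * \<epsilon> ^ N"
        by simp
      also have "pi * expected_real_zeros M \<phi> \<eta> n - 2 * ln (real m) - 2 * ln 2 - pi * (2 * kac_constant / pi + (\<Sum>p = 1..<N. A p * \<epsilon> ^ p)) =
        pi * (expected_real_zeros M \<phi> \<eta> n - (2 / pi * ln (real m) + kac_A0 + (\<Sum>p = 1..<N. A p * \<epsilon> ^ p)))"
        by (simp add: kac_A0_def kac_constant_def field_simps)
      also have "\<bar>\<dots>\<bar> = pi * \<bar>expected_real_zeros M \<phi> \<eta> n - (2 / pi * ln (real m) + kac_A0 + (\<Sum>p = 1..<N. A p * \<epsilon> ^ p))\<bar>"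
        by (simp add: abs_mult)
      also have "KK * \<epsilon> ^ N \<le> \<bar>KK\<bar> * \<epsilon> ^ N" using \<epsilon> by (intro mult_right_mono) auto
      finally show ?thesis by (simp add: \<epsilon>_def m_def pos_le_divide_eq mult.commute)
    qed
    show ?thesis
      by (rule exI[of _ "\<bar>KK\<bar> / pi"], rule exI[of _ "n1 + n2 + n3"]) (use bound in auto)
  qed
  have "\<exists>(C::real) (n0::nat). \<forall>n\<ge>n0.
           \<forall>(M :: 'a measure) \<phi> \<eta>. orthonormal_polys \<mu> \<phi> \<longrightarrow> iid_std_normal M \<eta> \<longrightarrow>
             \<bar>expected_real_zeros M \<phi> \<eta> n -
               (2 / pi * ln (real (n + 1)) + kac_A0 +
                 (\<Sum>p = 1..<nat N. A p * real (n + 1) powi (- int p)))\<bar>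
             \<le> C * real (n + 1) powi (- N)" for N :: int
  proof -
    \<comment> \<open>For \<open>N \<le> 0\<close> the claim is weaker than the one for \<open>N = 1\<close>: the sum is empty in
      both cases.\<close>
    define N' where "N' = max 1 (nat N)"
    have "N' \<ge> 1" by (simp add: N'_def)
    from main[OF this] obtain K n0 where K: "K \<ge> 0" and bd: "\<And>n (M :: 'a measure) \<phi> \<eta>. n \<ge> n0 \<Longrightarrow> orthonormal_polys \<mu> \<phi> \<Longrightarrow> iid_std_normal M \<eta> \<Longrightarrow>
      \<bar>expected_real_zeros M \<phi> \<eta> n - (2 / pi * ln (real (n + 1)) + kac_A0 + (\<Sum>p = 1..<N'. A p * (1 / real (n + 1)) ^ p))\<bar>
        \<le> K * (1 / real (n + 1)) ^ N'"
      by blast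
    have sums: "(\<Sum>p = 1..<N'. A p * (1 / real (n + 1)) ^ p) = (\<Sum>p = 1..<nat N. A p * real (n + 1) powi (- int p))" for n
    proof -
      have "{1..<N'} = {1..<nat N}" by (auto simp: N'_def)
      then show ?thesis by (simp add: power_int_minus power_divide inverse_eq_divide)
    qed
    have pw: "(1 / real (n + 1)) ^ N' \<le> real (n + 1) powi (- N)" for n
    proof (cases "N \<ge> 1")
      case True
      then obtain k where k: "N = int k" using zero_le_imp_eq_int[of N] by auto
      have "N' = k" using True by (simp add: N'_def k)
      then show ?thesis by (simp add: k power_int_minus power_divide inverse_eq_divide)
    next
      case False
      then obtain k where k: "- N = int k" using zero_le_imp_eq_int[of "- N"] by auto
      have "N' = 1" using False by (simp add: N'_def)
      then have "(1 / real (n + 1)) ^ N' \<le> 1" by simp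
      also have "1 \<le> real (n + 1) ^ k" by (rule one_le_power) simp
      finally show ?thesis unfolding k by simp
    qed
    show ?thesis
    proof (rule exI[of _ K], rule exI[of _ n0], intro allI impI)
      fix n and M :: "'a measure" and \<phi> \<eta>
      assume "n0 \<le> n" "orthonormal_polys \<mu> \<phi>" "iid_std_normal M \<eta>"
      note bd[OF this]
      also have "K * (1 / real (n + 1)) ^ N' \<le> K * real (n + 1) powi (- N)" by (rule mult_left_mono[OF pw K])
      finally show "\<bar>expected_real_zeros M \<phi> \<eta> n -
               (2 / pi * ln (real (n + 1)) + kac_A0 +
                 (\<Sum>p = 1..<nat N. A p * real (n + 1) powi (- int p)))\<bar>
             \<le> K * real (n + 1) powi (- N)" unfolding sums .
    qed
  qed
  then show ?thesis by blast
qed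

end
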